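(* Let $M_1$ and $M_2$ be two compact, smooth, strongly pseudoconvex CR 3-manifolds. If $f:M_1\to M_2$ is a homeomorphism such that, for a constant $K\ge1$ and any curve family $\Gamma$ which forms a smooth contact fibration of an open set in $M_1$, $$\mathrm{Mod}_{M_1}(\Gamma)\le K^2\,\mathrm{Mod}_{M_2}(f(\Gamma)),$$ where $f(\Gamma)=\{f(\gamma):\gamma\in\Gamma\}$, then $f$ is ACL.
   Context: A CR 3-manifold $M$ is a smooth 3-manifold with a smooth, oriented, non-integrable (contact) distribution $HM\subset TM$ of tangent planes, the kernel of a smooth global contact form, and a complex structure $J:HM\to HM$, $J^2=-1$. A regular curve is Legendrian if it is tangent to $HM$. A smooth contact fibration of an open set $U$ is a smooth fibration of $U$ by regular Legendrian curves. A subfamily of fibers has measure zero if the intersection of its fibers with any transversal regular surface has measure zero on that surface. A map is ACL (absolutely continuous on lines) if for any open set with a smooth contact fibration it is absolutely continuous along all fibers except a subfamily of measure zero. Modulus. Equip each $HM$ ($M=M_1,M_2$) with a smooth Hermitian metric with respect to its CR structure $J$, with norm $|\cdot|$. Let $\omega$ be the oriented area form on $HM$ of this metric, $\eta$ the unique contact form with $\ker\eta=HM$ and $d\eta|_{HM}=\omega$, and $dv=d\eta\wedge\eta$. A curve $\gamma:I_\gamma\to M$ ($I_\gamma\subset\mathbb R$ an interval) is locally rectifiable if it is absolutely continuous and $\gamma'(t)\in HM$ for almost all $t$. For such $\gamma$ and a Borel function $\sigma\ge0$, $\int_\gamma\sigma=\int_{I_\gamma}\sigma(\gamma(t))|\gamma'(t)|\,dt$.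 For a family $\Gamma$ of curves, $A(\Gamma)$ is the set of Borel functions $\sigma\ge 0$ on $M$ with $\int_\gamma\sigma\ge1$ for all locally rectifiable $\gamma\in\Gamma$, and $\mathrm{Mod}_M(\Gamma)=\inf_{\sigma\in A(\Gamma)}\int_M\sigma^4\,dv$. This value does not depend on the choice of Hermitian metric. *)

theory Defs
  imports "HOL-Analysis.Analysis"
begin

section \<open>Smooth maps between Euclidean spaces\<close>

text \<open>\<open>C_upto k S f\<close>: on the open set \<open>S\<close>, \<open>f\<close> is k times continuously differentiable.\<close>

primrec C_upto ::
  "nat \<Rightarrow> 'a::euclidean_space set \<Rightarrow> ('a \<Rightarrow> 'b::real_normed_vector) \<Rightarrow> bool" where
  "C_upto 0 = (\<lambda>S f. continuous_on S f)"
| "C_upto (Suc k) = (\<lambda>S f. (\<forall>x\<in>S. f differentiable (at x)) \<and>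
      (\<forall>v. C_upto k S (\<lambda>x. frechet_derivative f (at x) v)))"

definition smooth_on :: "'a::euclidean_space set \<Rightarrow> ('a \<Rightarrow> 'b::real_normed_vector) \<Rightarrow> bool" where
  "smooth_on S f \<longleftrightarrow> (\<forall>k. C_upto k S f)"


section \<open>Smooth 3-manifolds with a CR structure\<close>

text \<open>
  The underlying topological space is a whole type \<open>'a\<close>.  A chart is a pair of a domain and a
  coordinate map (whose values outside of the domain are irrelevant).  A tangent vector at \<open>p\<close> is
  the family of its coordinate vectors in all charts around \<open>p\<close>; these are related by the
  differentials of the coordinate changes.  The family is 0 at all other charts, so that tangent
  vectors are uniquely represented.

  \<open>hplane M p\<close> is the plane $H_pM$, \<open>pos_basis M p v w\<close> says that (v, w) is a positively oriented
  basis of it, and \<open>cplx M p\<close> is the complex structure J on it.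
\<close>

type_synonym 'a chart = "'a set \<times> ('a \<Rightarrow> real^3)"
type_synonym 'a tvec = "'a chart \<Rightarrow> real^3"

record 'a cr_struct =
  charts :: "'a chart set"
  hplane :: "'a \<Rightarrow> 'a tvec set"
  pos_basis :: "'a \<Rightarrow> 'a tvec \<Rightarrow> 'a tvec \<Rightarrow> bool"
  cplx :: "'a \<Rightarrow> 'a tvec \<Rightarrow> 'a tvec"

definition chart_inv :: "'a chart \<Rightarrow> real^3 \<Rightarrow> 'a" where
  "chart_inv c = inv_into (fst c) (snd c)"

definition charts_at :: "'a cr_struct \<Rightarrow> 'a \<Rightarrow> 'a chart set" where
  "charts_at M p = {c \<in> charts M. p \<in> fst c}"

definition smooth_atlas :: "'a::{t2_space,second_countable_topology} chart set \<Rightarrow> bool" where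
  "smooth_atlas A \<longleftrightarrow>
     (\<Union>c\<in>A. fst c) = UNIV \<and>
     (\<forall>c\<in>A. open (fst c) \<and> open (snd c ` fst c) \<and>
        homeomorphism (fst c) (snd c ` fst c) (snd c) (chart_inv c)) \<and>
     (\<forall>c\<in>A. \<forall>c'\<in>A. smooth_on (snd c ` (fst c \<inter> fst c')) (snd c' \<circ> chart_inv c))"

text \<open>The tangent vector at \<open>p\<close> whose coordinate vector in the chart \<open>c\<close> is \<open>v\<close>.\<close>

definition tangent_vec :: "'a cr_struct \<Rightarrow> 'a \<Rightarrow> 'a chart \<Rightarrow> real^3 \<Rightarrow> 'a tvec" where
  "tangent_vec M p c v =
     (\<lambda>c'. if c' \<in> charts_at M p
           then frechet_derivative (snd c' \<circ> chart_inv c) (at (snd c p)) v else 0)"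

definition tangent_space :: "'a cr_struct \<Rightarrow> 'a \<Rightarrow> 'a tvec set" where
  "tangent_space M p = {tangent_vec M p c v | c v. c \<in> charts_at M p}"

definition zero_vec :: "'a tvec" where
  "zero_vec = (\<lambda>c. 0)"

definition lin_comb :: "real \<Rightarrow> 'a tvec \<Rightarrow> real \<Rightarrow> 'a tvec \<Rightarrow> 'a tvec" where
  "lin_comb a v b w = (\<lambda>c. a *\<^sub>R v c + b *\<^sub>R w c)"

definition smooth_fun :: "'a cr_struct \<Rightarrow> 'a set \<Rightarrow> ('a \<Rightarrow> real) \<Rightarrow> bool" where
  "smooth_fun M W h \<longleftrightarrow> (\<forall>c\<in>charts M. smooth_on (snd c ` (W \<inter> fst c)) (h \<circ> chart_inv c))"

definition smooth_field :: "'a cr_struct \<Rightarrow> 'a set \<Rightarrow> ('a \<Rightarrow> 'a tvec) \<Rightarrow> bool" where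
  "smooth_field M W X \<longleftrightarrow>
     (\<forall>p\<in>W. X p \<in> tangent_space M p) \<and>
     (\<forall>c\<in>charts M. smooth_on (snd c ` (W \<inter> fst c)) (\<lambda>x. X (chart_inv c x) c))"

definition horizontal_field ::
  "'a cr_struct \<Rightarrow> 'a set \<Rightarrow> ('a \<Rightarrow> 'a tvec) \<Rightarrow> bool" where
  "horizontal_field M W X \<longleftrightarrow> smooth_field M W X \<and> (\<forall>p\<in>W. X p \<in> hplane M p)"

text \<open>
  Around every point there is a smooth frame (X, Y) of the distribution, in which a pair of
  vectors is positively oriented iff the determinant of its coefficients is positive.
\<close>

definition smooth_oriented_planes :: "'a::topological_space cr_struct \<Rightarrow> bool" where
  "smooth_oriented_planes M \<longleftrightarrow>
     (\<forall>p v w. pos_basis M p v w \<longrightarrow> v \<in> hplane M p \<and> w \<in> hplane M p) \<and>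
     (\<forall>p. \<exists>W X Y. open W \<and> p \<in> W \<and> smooth_field M W X \<and> smooth_field M W Y \<and>
        (\<forall>q\<in>W.
           (\<forall>a b. lin_comb a (X q) b (Y q) = zero_vec \<longrightarrow> a = 0 \<and> b = 0) \<and>
           hplane M q = {lin_comb a (X q) b (Y q) | a b. True} \<and>
           (\<forall>a b a' b'. pos_basis M q (lin_comb a (X q) b (Y q)) (lin_comb a' (X q) b' (Y q))
              \<longleftrightarrow> a * b' - b * a' > 0)))"

definition smooth_complex_structure :: "'a::topological_space cr_struct \<Rightarrow> bool" where
  "smooth_complex_structure M \<longleftrightarrow>
     (\<forall>p. \<forall>v\<in>hplane M p. cplx M p v \<in> hplane M p \<and>
        cplx M p (cplx M p v) = lin_comb (-1) v 0 v) \<and>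
     (\<forall>p a b. \<forall>v\<in>hplane M p. \<forall>w\<in>hplane M p.
        cplx M p (lin_comb a v b w) = lin_comb a (cplx M p v) b (cplx M p w)) \<and>
     (\<forall>W X. open W \<and> horizontal_field M W X \<longrightarrow> smooth_field M W (\<lambda>p. cplx M p (X p)))"


section \<open>Contact forms\<close>

text \<open>
  \<open>form_coord M \<eta> c x v\<close> is \<open>\<eta>\<close> applied to the vector with coordinates \<open>v\<close> at the point with
  coordinates \<open>x\<close>, with respect to the chart \<open>c\<close>.
\<close>

definition form_coord ::
  "'a cr_struct \<Rightarrow> ('a \<Rightarrow> 'a tvec \<Rightarrow> real) \<Rightarrow> 'a chart \<Rightarrow> real^3 \<Rightarrow> real^3 \<Rightarrow> real" where
  "form_coord M \<eta> c x v = \<eta> (chart_inv c x) (tangent_vec M (chart_inv c x) c v)"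

text \<open>A 1-form is normalised to vanish on everything that is not a tangent vector at \<open>p\<close>, so that
  a 1-form is determined by its values on tangent vectors.\<close>

definition smooth_one_form :: "'a cr_struct \<Rightarrow> ('a \<Rightarrow> 'a tvec \<Rightarrow> real) \<Rightarrow> bool" where
  "smooth_one_form M \<eta> \<longleftrightarrow>
     (\<forall>p v. v \<notin> tangent_space M p \<longrightarrow> \<eta> p v = 0) \<and>
     (\<forall>p a b. \<forall>v\<in>tangent_space M p. \<forall>w\<in>tangent_space M p.
        \<eta> p (lin_comb a v b w) = a * \<eta> p v + b * \<eta> p w) \<and>
     (\<forall>c\<in>charts M. \<forall>v. smooth_on (snd c ` fst c) (\<lambda>x. form_coord M \<eta> c x v))"

text \<open>The exterior derivative in the chart \<open>c\<close>, applied to constant coordinate fields, with the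
  convention $d\eta(X,Y) = X\eta(Y) - Y\eta(X) - \eta([X,Y])$.\<close>

definition ext_deriv ::
  "'a cr_struct \<Rightarrow> ('a \<Rightarrow> 'a tvec \<Rightarrow> real) \<Rightarrow> 'a chart \<Rightarrow> real^3 \<Rightarrow> real^3 \<Rightarrow> real^3 \<Rightarrow> real" where
  "ext_deriv M \<eta> c x v w =
     frechet_derivative (\<lambda>y. form_coord M \<eta> c y w) (at x) v -
     frechet_derivative (\<lambda>y. form_coord M \<eta> c y v) (at x) w"

text \<open>The coefficient of $d\eta\wedge\eta$ with respect to $dx_1\wedge dx_2\wedge dx_3$.\<close>

definition vol_coeff ::
  "'a cr_struct \<Rightarrow> ('a \<Rightarrow> 'a tvec \<Rightarrow> real) \<Rightarrow> 'a chart \<Rightarrow> real^3 \<Rightarrow> real" where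
  "vol_coeff M \<eta> c x =
     ext_deriv M \<eta> c x (axis 1 1) (axis 2 1) * form_coord M \<eta> c x (axis 3 1) +
     ext_deriv M \<eta> c x (axis 2 1) (axis 3 1) * form_coord M \<eta> c x (axis 1 1) +
     ext_deriv M \<eta> c x (axis 3 1) (axis 1 1) * form_coord M \<eta> c x (axis 2 1)"

text \<open>Contact forms of the distribution: their kernel is the given plane field.\<close>

definition contact_form :: "'a cr_struct \<Rightarrow> ('a \<Rightarrow> 'a tvec \<Rightarrow> real) \<Rightarrow> bool" where
  "contact_form M \<eta> \<longleftrightarrow>
     smooth_one_form M \<eta> \<and>
     (\<forall>c\<in>charts M. \<forall>x\<in>snd c ` fst c. vol_coeff M \<eta> c x \<noteq> 0) \<and>
     (\<forall>p. hplane M p = {v \<in> tangent_space M p. \<eta> p v = 0})"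

definition cr_manifold :: "'a::{t2_space,second_countable_topology} cr_struct \<Rightarrow> bool" where
  "cr_manifold M \<longleftrightarrow>
     smooth_atlas (charts M) \<and>
     smooth_oriented_planes M \<and>
     smooth_complex_structure M \<and>
     (\<exists>\<theta>. contact_form M \<theta>)"

text \<open>Positive definiteness of the Levi form $d\theta(\cdot,J\cdot)$ of some contact form.\<close>

definition strongly_pseudoconvex :: "'a cr_struct \<Rightarrow> bool" where
  "strongly_pseudoconvex M \<longleftrightarrow>
     (\<exists>\<theta>. contact_form M \<theta> \<and>
        (\<forall>p. \<forall>c\<in>charts_at M p. \<forall>v\<in>hplane M p. v \<noteq> zero_vec \<longrightarrow>
           ext_deriv M \<theta> c (snd c p) (v c) (cplx M p v c) > 0))"


section \<open>Hermitian metrics and the associated volume\<close>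

definition hermitian_metric ::
  "'a::topological_space cr_struct \<Rightarrow> ('a \<Rightarrow> 'a tvec \<Rightarrow> 'a tvec \<Rightarrow> real) \<Rightarrow> bool" where
  "hermitian_metric M g \<longleftrightarrow>
     (\<forall>p. \<forall>v\<in>hplane M p. \<forall>w\<in>hplane M p.
        g p v w = g p w v \<and>
        g p (cplx M p v) (cplx M p w) = g p v w \<and>
        (v \<noteq> zero_vec \<longrightarrow> g p v v > 0) \<and>
        (\<forall>a b. \<forall>u\<in>hplane M p. g p (lin_comb a v b w) u = a * g p v u + b * g p w u)) \<and>
     (\<forall>W X Y. open W \<and> horizontal_field M W X \<and> horizontal_field M W Y \<longrightarrow>
        smooth_fun M W (\<lambda>p. g p (X p) (Y p)))"

definition hnorm :: "('a \<Rightarrow> 'a tvec \<Rightarrow> 'a tvec \<Rightarrow> real) \<Rightarrow> 'a \<Rightarrow> 'a tvec \<Rightarrow> real" where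
  "hnorm g p v = sqrt (g p v v)"

definition area_form ::
  "'a cr_struct \<Rightarrow> ('a \<Rightarrow> 'a tvec \<Rightarrow> 'a tvec \<Rightarrow> real) \<Rightarrow> 'a \<Rightarrow> 'a tvec \<Rightarrow> 'a tvec \<Rightarrow> real" where
  "area_form M g p v w =
     (if pos_basis M p v w then 1 else - 1) * sqrt (g p v v * g p w w - (g p v w)\<^sup>2)"

definition metric_contact_form ::
  "'a cr_struct \<Rightarrow> ('a \<Rightarrow> 'a tvec \<Rightarrow> 'a tvec \<Rightarrow> real) \<Rightarrow> 'a \<Rightarrow> 'a tvec \<Rightarrow> real" where
  "metric_contact_form M g =
     (THE \<eta>. contact_form M \<eta> \<and>
        (\<forall>p. \<forall>c\<in>charts_at M p. \<forall>v\<in>hplane M p. \<forall>w\<in>hplane M p.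
           ext_deriv M \<eta> c (snd c p) (v c) (w c) = area_form M g p v w))"

text \<open>
  The measure given by $dv = d\eta\wedge\eta$, where \<open>M\<close> carries the orientation for which this
  3-form is positive (hence the absolute value, since charts need not be compatible with it).
\<close>

definition volume ::
  "'a::topological_space cr_struct \<Rightarrow> ('a \<Rightarrow> 'a tvec \<Rightarrow> 'a tvec \<Rightarrow> real) \<Rightarrow> 'a measure" where
  "volume M g =
     (THE \<mu>. sets \<mu> = sets borel \<and>
        (\<forall>c\<in>charts M. \<forall>B\<in>sets borel. B \<subseteq> fst c \<longrightarrow>
           emeasure \<mu> B =
             (\<integral>\<^sup>+x\<in>snd c ` B. ennreal \<bar>vol_coeff M (metric_contact_form M g) c x\<bar> \<partial>lborel)))"


section \<open>Curves and the modulus\<close>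

text \<open>A curve is a pair of its parameter interval and its parametrisation.\<close>

type_synonym 'a curve = "real set \<times> (real \<Rightarrow> 'a)"

definition velocity :: "'a cr_struct \<Rightarrow> 'a curve \<Rightarrow> real \<Rightarrow> 'a tvec" where
  "velocity M = (\<lambda>(I, \<gamma>) t c.
     if c \<in> charts_at M (\<gamma> t) then vector_derivative (snd c \<circ> \<gamma>) (at t within I) else 0)"

definition abs_cont_on :: "real set \<Rightarrow> (real \<Rightarrow> 'b::metric_space) \<Rightarrow> bool" where
  "abs_cont_on S h \<longleftrightarrow>
     (\<forall>\<epsilon>>0. \<exists>\<delta>>0. \<forall>(n::nat) a b.
        (\<forall>i<n. a i \<le> b i \<and> {a i..b i} \<subseteq> S) \<and>
        (\<forall>i<n. \<forall>j<n. i \<noteq> j \<longrightarrow> {a i<..<b i} \<inter> {a j<..<b j} = {}) \<and>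
        (\<Sum>i<n. b i - a i) < \<delta> \<longrightarrow>
        (\<Sum>i<n. dist (h (a i)) (h (b i))) < \<epsilon>)"

text \<open>
  Absolute continuity of a curve in a manifold is read in charts, locally around each parameter;
  on a compact parameter interval this is the usual notion, on other intervals it is absolute
  continuity on compact subintervals.
\<close>

definition abs_cont_curve :: "'a cr_struct \<Rightarrow> 'a curve \<Rightarrow> bool" where
  "abs_cont_curve M = (\<lambda>(I, \<gamma>). \<forall>t\<in>I. \<exists>c\<in>charts M. \<exists>r>0.
     \<gamma> ` (I \<inter> {t-r..t+r}) \<subseteq> fst c \<and> abs_cont_on (I \<inter> {t-r..t+r}) (snd c \<circ> \<gamma>))"

definition locally_rectifiable :: "'a cr_struct \<Rightarrow> 'a curve \<Rightarrow> bool" where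
  "locally_rectifiable M = (\<lambda>(I, \<gamma>).
     is_interval I \<and> interior I \<noteq> {} \<and> abs_cont_curve M (I, \<gamma>) \<and>
     (AE t in lebesgue. t \<in> I \<longrightarrow>
        (\<forall>c\<in>charts_at M (\<gamma> t). (snd c \<circ> \<gamma>) differentiable (at t within I)) \<and>
        velocity M (I, \<gamma>) t \<in> hplane M (\<gamma> t)))"

definition line_integral ::
  "'a cr_struct \<Rightarrow> ('a \<Rightarrow> 'a tvec \<Rightarrow> 'a tvec \<Rightarrow> real) \<Rightarrow> 'a curve \<Rightarrow> ('a \<Rightarrow> real) \<Rightarrow> ennreal" where
  "line_integral M g = (\<lambda>(I, \<gamma>) \<sigma>.
     \<integral>\<^sup>+t\<in>I. ennreal (\<sigma> (\<gamma> t) * hnorm g (\<gamma> t) (velocity M (I, \<gamma>) t)) \<partial>lebesgue)"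

definition admissible ::
  "'a::topological_space cr_struct \<Rightarrow> ('a \<Rightarrow> 'a tvec \<Rightarrow> 'a tvec \<Rightarrow> real) \<Rightarrow> 'a curve set
     \<Rightarrow> ('a \<Rightarrow> real) set" where
  "admissible M g \<Gamma> =
     {\<sigma> \<in> borel_measurable borel. (\<forall>p. \<sigma> p \<ge> 0) \<and>
        (\<forall>\<gamma>\<in>\<Gamma>. locally_rectifiable M \<gamma> \<longrightarrow> line_integral M g \<gamma> \<sigma> \<ge> 1)}"

definition modulus ::
  "'a::topological_space cr_struct \<Rightarrow> ('a \<Rightarrow> 'a tvec \<Rightarrow> 'a tvec \<Rightarrow> real) \<Rightarrow> 'a curve set
     \<Rightarrow> ennreal" where
  "modulus M g \<Gamma> = (INF \<sigma>\<in>admissible M g \<Gamma>. \<integral>\<^sup>+p. ennreal (\<sigma> p ^ 4) \<partial>volume M g)"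

definition image_family :: "('a \<Rightarrow> 'b) \<Rightarrow> 'a curve set \<Rightarrow> 'b curve set" where
  "image_family f \<Gamma> = (\<lambda>(I, \<gamma>). (I, f \<circ> \<gamma>)) ` \<Gamma>"


section \<open>Contact fibrations and the ACL property\<close>

definition smooth_map ::
  "'a::topological_space cr_struct \<Rightarrow> 'e::euclidean_space set \<Rightarrow> ('e \<Rightarrow> 'a) \<Rightarrow> bool" where
  "smooth_map M D F \<longleftrightarrow>
     continuous_on D F \<and> (\<forall>c\<in>charts M. smooth_on (D \<inter> F -` fst c) (snd c \<circ> F))"

text \<open>At an end point belonging to the parameter interval, smoothness means the existence of a
  smooth extension.\<close>

definition regular_legendrian :: "'a::topological_space cr_struct \<Rightarrow> 'a curve \<Rightarrow> bool" where
  "regular_legendrian M = (\<lambda>(I, \<gamma>).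
     is_interval I \<and> interior I \<noteq> {} \<and>
     (\<exists>S \<gamma>'. open S \<and> I \<subseteq> S \<and> smooth_map M S \<gamma>' \<and> (\<forall>t\<in>I. \<gamma>' t = \<gamma> t)) \<and>
     (\<forall>t\<in>I. velocity M (I, \<gamma>) t \<noteq> zero_vec \<and> velocity M (I, \<gamma>) t \<in> hplane M (\<gamma> t)))"

definition curve_trace :: "'a curve \<Rightarrow> 'a set" where
  "curve_trace = (\<lambda>(I, \<gamma>). \<gamma> ` I)"

text \<open>
  A smooth fibre bundle structure on the open set \<open>U\<close> with 1-dimensional connected fibres, given by
  the set \<open>\<F>\<close> of its fibres.  The base is the set \<open>\<F>\<close> itself with the quotient topology, required to
  be Hausdorff.  A local trivialisation over an open set \<open>D\<close> of the plane is a smooth map \<open>\<Psi>\<close> on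
  \<open>D \<times> UNIV\<close> with bijective differentials that induces an injection of \<open>D\<close> times the
  model fibre.  The model fibre is the line modulo \<open>P\<close>: the line itself if \<open>P = {0}\<close>, the circle
  if \<open>P = \<int>\<close>.
\<close>

definition smooth_fibration ::
  "'a::topological_space cr_struct \<Rightarrow> 'a set \<Rightarrow> 'a set set \<Rightarrow> bool" where
  "smooth_fibration M U \<F> \<longleftrightarrow>
     open U \<and> \<Union>\<F> = U \<and> {} \<notin> \<F> \<and> disjoint \<F> \<and>
     (\<forall>L1\<in>\<F>. \<forall>L2\<in>\<F>. L1 \<noteq> L2 \<longrightarrow>
        (\<exists>\<F>1 \<F>2. \<F>1 \<subseteq> \<F> \<and> \<F>2 \<subseteq> \<F> \<and> L1 \<in> \<F>1 \<and> L2 \<in> \<F>2 \<and> \<F>1 \<inter> \<F>2 = {} \<and>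
           open (\<Union>\<F>1) \<and> open (\<Union>\<F>2))) \<and>
     (\<forall>L\<in>\<F>. \<exists>(D :: (real^2) set) (\<Psi> :: (real^2) \<times> real \<Rightarrow> 'a) (P :: real set).
        open D \<and> (P = {0} \<or> P = \<int>) \<and>
        smooth_map M (D \<times> UNIV) \<Psi> \<and>
        (\<forall>z\<in>D \<times> UNIV. \<forall>c\<in>charts_at M (\<Psi> z). bij (frechet_derivative (snd c \<circ> \<Psi>) (at z))) \<and>
        (\<forall>z\<in>D \<times> UNIV. \<forall>z'\<in>D \<times> UNIV.
           \<Psi> z = \<Psi> z' \<longleftrightarrow> fst z = fst z' \<and> snd z - snd z' \<in> P) \<and>
        (\<forall>d\<in>D. \<Psi> ` ({d} \<times> UNIV) \<in> \<F>) \<and>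
        (\<exists>d\<in>D. \<Psi> ` ({d} \<times> UNIV) = L))"

text \<open>
  A family of parametrised curves forms a contact fibration of \<open>U\<close> if the curves are regular
  Legendrian parametrisations, running through each fibre once, of the fibres of a smooth
  fibration.  Injectivity is only required in the interior of the parameter interval, so that a
  circle can be parametrised by a closed curve.
\<close>

definition contact_fibration ::
  "'a::topological_space cr_struct \<Rightarrow> 'a set \<Rightarrow> 'a curve set \<Rightarrow> bool" where
  "contact_fibration M U \<Gamma> \<longleftrightarrow>
     (\<forall>(I, \<gamma>)\<in>\<Gamma>. regular_legendrian M (I, \<gamma>) \<and> inj_on \<gamma> (interior I)) \<and>
     inj_on curve_trace \<Gamma> \<and>
     smooth_fibration M U (curve_trace ` \<Gamma>)"

text \<open>
  A patch, i.e. the image of an open set of the plane under a smooth embedding, of a regular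
  surface in \<open>U\<close> which is transversal to the curves of \<open>\<Gamma>\<close>.
\<close>

definition transversal_patch ::
  "'a::topological_space cr_struct \<Rightarrow> 'a set \<Rightarrow> 'a curve set \<Rightarrow> (real^2) set \<Rightarrow> (real^2 \<Rightarrow> 'a) \<Rightarrow> bool"
where
  "transversal_patch M U \<Gamma> D s \<longleftrightarrow>
     open D \<and> s ` D \<subseteq> U \<and> smooth_map M D s \<and> (\<exists>r. homeomorphism D (s ` D) s r) \<and>
     (\<forall>x\<in>D. \<forall>c\<in>charts_at M (s x).
        inj (frechet_derivative (snd c \<circ> s) (at x)) \<and>
        (\<forall>(I, \<gamma>)\<in>\<Gamma>. \<forall>t\<in>I. \<gamma> t = s x \<longrightarrow>
           velocity M (I, \<gamma>) t c \<notin> range (frechet_derivative (snd c \<circ> s) (at x))))"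

text \<open>A subset of a surface has measure zero iff its preimages under all patches are Lebesgue null
  sets.\<close>

definition null_subfamily ::
  "'a::topological_space cr_struct \<Rightarrow> 'a set \<Rightarrow> 'a curve set \<Rightarrow> 'a curve set \<Rightarrow> bool" where
  "null_subfamily M U \<Gamma> N \<longleftrightarrow>
     N \<subseteq> \<Gamma> \<and>
     (\<forall>D s. transversal_patch M U \<Gamma> D s \<longrightarrow> negligible {x \<in> D. s x \<in> \<Union>(curve_trace ` N)})"

definition ACL ::
  "'a::topological_space cr_struct \<Rightarrow> 'b cr_struct \<Rightarrow> ('a \<Rightarrow> 'b) \<Rightarrow> bool" where
  "ACL M1 M2 f \<longleftrightarrow>
     (\<forall>U \<Gamma>. contact_fibration M1 U \<Gamma> \<longrightarrow>
        (\<exists>N. null_subfamily M1 U \<Gamma> N \<and> (\<forall>(I, \<gamma>)\<in>\<Gamma> - N. abs_cont_curve M2 (I, f \<circ> \<gamma>))))"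

end

theory Submission
  imports Defs
begin

text \<open>
  The proof is the length-volume argument of Gehring and Vaisala, carried out in flow boxes.
  Let \<open>\<Psi>\<close> be a local trivialisation of a contact fibration of $M_1$, so that the vertical lines
  \<open>\<tau> \<mapsto> \<Psi> (d, \<tau>)\<close> run through the fibres, with \<open>d\<close> in a plane domain.  For a disc \<open>B\<close> and a short
  interval $(u,v)$ the fibre segments over \<open>B\<close> form themselves a contact fibration
  (\<open>fibre_segments_contact_fibration\<close> below), so the hypothesis on \<open>f\<close> applies to them.  Their modulus and
  the modulus of their image are estimated in opposite directions:

  \<^item> Every admissible function has integral at least 1 along each segment.  By Young's inequality
    its fourth power has integral at least $c/(v-u)^3$ along the segment, and by Fubini's theorem
    in the flow box the modulus is at least $c\,|B|/(v-u)^3$ (\<open>modulus_lower_bound\<close>).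

  \<^item> If the ends of all image segments have distance at least $\delta$ in a chart, then the constant
    $C/\delta$ on the tube $V = f(\Psi(B\times(u,v)))$ is admissible for the image family, because
    metric length of rectifiable horizontal curves dominates coordinate length.  So the modulus
    of the image is at most $(C/\delta)^4$ times the volume of \<open>V\<close> (\<open>modulus_upper_bound\<close>).

  Together, $\delta^4 \le Q\,(v-u)^3\,\mathrm{vol}(V)/|B|$ (\<open>box_estimate\<close>).  The volumes of the images of
  full tubes define a finite measure on the plane domain, whose upper density is finite at almost
  every point \<open>d\<close> by a covering argument (\<open>density_bounded_ae\<close>).  Let \<open>B\<close> shrink to such a point.
  For disjoint intervals of lengths $l_i$ in the fibre over \<open>d\<close>, the displacements $\delta_i$ of the image
  satisfy $\delta_i^4 \le Q\,l_i^3\,w_i$ where $\sum w_i$ is bounded by the density, since the tubes over disjoint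
  intervals are disjoint.  Hoelder's inequality with the exponents 4/3 and 4 makes $\sum\delta_i$ small
  together with $\sum l_i$, which is the absolute continuity of \<open>f\<close> on that fibre (\<open>fibre_abs_cont\<close>).

  The exceptional points \<open>d\<close> of one flow box are a null set.  On a transversal surface, the map that
  sends a point to the label \<open>d\<close> of its fibre has injective differentials, so the exceptional fibres
  meet the surface in a null set (\<open>null_on_patch\<close>).  By Lindelof's theorem countably many boxes
  suffice (\<open>image_ACL\<close>).

  The volume measure and its contact form are given by definite descriptions.  The estimates depend
  on their existence and uniqueness, which are the theorems \<open>metric_contact_form_well_defined\<close>
  and \<open>volume_well_defined\<close>.
\<close>


section \<open>Calculus of smooth maps\<close>

lemma frechet_derivative_worksI:
  "f differentiable F \<Longrightarrow> (f has_derivative frechet_derivative f F) F"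
  by (simp add: frechet_derivative_works[symmetric])

lemma C_upto_subset: "C_upto k S f \<Longrightarrow> T \<subseteq> S \<Longrightarrow> C_upto k T f"
  by (induction k arbitrary: f) (auto intro: continuous_on_subset)

lemma C_upto_cong:
  assumes "open S" "\<And>x. x \<in> S \<Longrightarrow> f x = g x" "C_upto k S f"
  shows "C_upto k S g"
  using assms(2,3)
proof (induction k arbitrary: f g)
  case 0
  then show ?case using continuous_on_cong[of S S f g] by simp
next
  case (Suc k)
  have ev: "eventually (\<lambda>y. f y = g y) (nhds x)" if "x \<in> S" for x
    using Suc.prems(1) assms(1) eventually_nhds that by blast
  have der: "(g has_derivative D) (at x) \<longleftrightarrow> (f has_derivative D) (at x)" if "x \<in> S" for x D
    using assms(1) that Suc.prems(1)
    by (metis (no_types, lifting) has_derivative_transform_within_open)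
  have fd: "frechet_derivative f (at x) = frechet_derivative g (at x)" if "x \<in> S" for x
    using der[OF that] unfolding frechet_derivative_def by simp
  have "C_upto k S (\<lambda>x. frechet_derivative g (at x) v)" for v
    by (rule Suc.IH[of "\<lambda>x. frechet_derivative f (at x) v"]) (use Suc.prems fd in auto)
  moreover have "g differentiable (at x)" if "x \<in> S" for x
  proof -
    have "f differentiable (at x)" using Suc.prems(2) that by simp
    then show ?thesis using der[OF that] unfolding differentiable_def by blast
  qed
  ultimately show ?case by simp
qed

lemma C_upto_continuous_on:
  assumes "C_upto k S f" shows "continuous_on S f"
proof (cases k)
  case (Suc n)
  then have "f differentiable (at x)" if "x \<in> S" for x using assms that by simp
  then show ?thesis
    by (meson differentiable_imp_continuous_within continuous_at_imp_continuous_on)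
qed (use assms in simp)

lemma C_upto_SucD: "C_upto (Suc k) S f \<Longrightarrow> C_upto k S f"
proof (induction k arbitrary: f)
  case 0
  then show ?case using C_upto_continuous_on[of "Suc 0" S f] by simp
next
  case (Suc k)
  have "C_upto k S (\<lambda>x. frechet_derivative f (at x) v)" for v
    using Suc by simp
  then show ?case using Suc.prems by simp
qed

text \<open>
  Differentiability to any order is a local property.  It reduces smoothness of global objects to
  formulas in local frames.
\<close>

lemma C_upto_local:
  assumes "\<And>x. x \<in> S \<Longrightarrow> \<exists>T. open T \<and> x \<in> T \<and> C_upto k T f"
  shows "C_upto k S f"
  using assms
proof (induction k arbitrary: f)
  case 0
  then show ?case
    by (metis C_upto.simps(1) continuous_at_imp_continuous_on continuous_on_eq_continuous_at)
next
  case (Suc k)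
  have "f differentiable (at x)" if "x \<in> S" for x
    using Suc.prems[OF that] by auto
  moreover have "C_upto k S (\<lambda>x. frechet_derivative f (at x) v)" for v
    by (rule Suc.IH) (use Suc.prems in force)
  ultimately show ?case by simp
qed

lemma smooth_on_local:
  assumes "\<And>x. x \<in> S \<Longrightarrow> \<exists>T. open T \<and> x \<in> T \<and> smooth_on T f"
  shows "smooth_on S f"
  unfolding smooth_on_def
proof
  show "C_upto k S f" for k
    by (rule C_upto_local) (use assms in \<open>force simp: smooth_on_def\<close>)
qed

lemma C_upto_const: "C_upto k S (\<lambda>x. c)"
  by (induction k arbitrary: c) auto

lemma C_upto_bounded_linear:
  assumes "bounded_linear f" shows "C_upto k S f"
proof (cases k)
  case 0
  then show ?thesis using assms by (simp add: linear_continuous_on)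
next
  case (Suc n)
  have "frechet_derivative f (at x) = f" for x
    using assms by (metis bounded_linear_imp_has_derivative frechet_derivative_at)
  then show ?thesis
    using assms Suc bounded_linear_imp_differentiable by (auto simp: C_upto_const)
qed

lemma C_upto_linear_comp:
  assumes "bounded_linear L" "open S" "C_upto k S f"
  shows "C_upto k S (\<lambda>x. L (f x))"
  using assms(3)
proof (induction k arbitrary: f)
  case 0
  then show ?case using bounded_linear.continuous_on[OF assms(1)] by auto
next
  case (Suc k)
  have der: "((\<lambda>x. L (f x)) has_derivative (\<lambda>v. L (frechet_derivative f (at x) v))) (at x)" if "x \<in> S" for x
    using Suc.prems that
    by (intro bounded_linear.has_derivative[OF assms(1)]) (simp add: frechet_derivative_worksI)
  have "C_upto k S (\<lambda>x. frechet_derivative (\<lambda>x. L (f x)) (at x) v)" for v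
  proof (rule C_upto_cong[OF assms(2)])
    show "C_upto k S (\<lambda>x. L (frechet_derivative f (at x) v))"
      using Suc by simp
    show "L (frechet_derivative f (at x) v) = frechet_derivative (\<lambda>x. L (f x)) (at x) v" if "x \<in> S" for x
      using fun_cong[OF frechet_derivative_at[OF der[OF that]], of v] by simp
  qed
  then show ?case using der unfolding C_upto.simps differentiable_def by blast
qed

lemma C_upto_add:
  assumes "open S" "C_upto k S f" "C_upto k S g"
  shows "C_upto k S (\<lambda>x. f x + g x)"
  using assms(2,3)
proof (induction k arbitrary: f g)
  case 0
  then show ?case by (simp add: continuous_on_add)
next
  case (Suc k)
  have der: "((\<lambda>x. f x + g x) has_derivative
      (\<lambda>v. frechet_derivative f (at x) v + frechet_derivative g (at x) v)) (at x)" if "x \<in> S" for x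
    using Suc.prems that
    by (intro has_derivative_add) (simp_all add: frechet_derivative_worksI)
  have "C_upto k S (\<lambda>x. frechet_derivative (\<lambda>x. f x + g x) (at x) v)" for v
  proof (rule C_upto_cong[OF assms(1)])
    show "C_upto k S (\<lambda>x. frechet_derivative f (at x) v + frechet_derivative g (at x) v)"
      using Suc by simp
    show "frechet_derivative f (at x) v + frechet_derivative g (at x) v = frechet_derivative (\<lambda>x. f x + g x) (at x) v"
      if "x \<in> S" for x
      using fun_cong[OF frechet_derivative_at[OF der[OF that]], of v] by simp
  qed
  then show ?case using der unfolding C_upto.simps differentiable_def by blast
qed

lemma C_upto_sum:
  assumes "open S" "\<And>i. i \<in> I \<Longrightarrow> C_upto k S (f i)"
  shows "C_upto k S (\<lambda>x. \<Sum>i\<in>I. f i x)"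
  using assms(2)
  by (induction I rule: infinite_finite_induct) (auto simp: C_upto_const intro: C_upto_add[OF assms(1)])

text \<open>
  The product rule expresses the derivative by products of the same kind, and both factors of each
  of them are of class k.
\<close>

lemma (in bounded_bilinear) C_upto:
  assumes "open S" "C_upto k S f" "C_upto k S g"
  shows "C_upto k S (\<lambda>x. prod (f x) (g x))"
  using assms(2,3)
proof (induction k arbitrary: f g)
  case 0
  then show ?case by (simp add: continuous_on)
next
  case (Suc k)
  have der: "((\<lambda>x. prod (f x) (g x)) has_derivative
      (\<lambda>v. prod (f x) (frechet_derivative g (at x) v) + prod (frechet_derivative f (at x) v) (g x))) (at x)"
    if "x \<in> S" for x
    using Suc.prems that
    by (intro FDERIV) (simp_all add: frechet_derivative_worksI)
  have "C_upto k S (\<lambda>x. frechet_derivative (\<lambda>x. prod (f x) (g x)) (at x) v)" for v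
  proof (rule C_upto_cong[OF assms(1)])
    show "C_upto k S (\<lambda>x. prod (f x) (frechet_derivative g (at x) v) + prod (frechet_derivative f (at x) v) (g x))"
      using Suc.prems C_upto_SucD[OF Suc.prems(1)] C_upto_SucD[OF Suc.prems(2)]
      by (intro C_upto_add assms Suc.IH) auto
    show "prod (f x) (frechet_derivative g (at x) v) + prod (frechet_derivative f (at x) v) (g x)
       = frechet_derivative (\<lambda>x. prod (f x) (g x)) (at x) v" if "x \<in> S" for x
      using fun_cong[OF frechet_derivative_at[OF der[OF that]], of v] by simp
  qed
  then show ?case using der unfolding C_upto.simps differentiable_def by blast
qed

text \<open>
  The induction is over the order with the outer function generalised.  The chain rule in
  coordinates, a sum over basis vectors, keeps every term a product of a derivative of the inner
  function and a composition with a derivative of the outer one.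
\<close>

lemma C_upto_comp:
  fixes f :: "'a::euclidean_space \<Rightarrow> 'b::euclidean_space" and g :: "'b \<Rightarrow> 'c::real_normed_vector"
  assumes "open S" "open T" "f ` S \<subseteq> T" "C_upto k S f" "C_upto k T g"
  shows "C_upto k S (g \<circ> f)"
  using assms(4,5)
proof (induction k arbitrary: g)
  case 0
  then show ?case
    using continuous_on_compose[of S f g] continuous_on_subset[of T g "f ` S"] assms(3) by simp
next
  case (Suc k)
  let ?D = "\<lambda>x v. \<Sum>b\<in>Basis. (frechet_derivative f (at x) v \<bullet> b) *\<^sub>R frechet_derivative g (at (f x)) b"
  have der: "((g \<circ> f) has_derivative ?D x) (at x)" if "x \<in> S" for x
  proof -
    have g: "(g has_derivative frechet_derivative g (at (f x))) (at (f x))"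
      using Suc.prems(2) assms(3) that by (intro frechet_derivative_worksI) auto
    have f: "(f has_derivative frechet_derivative f (at x)) (at x)"
      using Suc.prems(1) that by (intro frechet_derivative_worksI) auto
    have lin: "frechet_derivative g (at (f x)) w = (\<Sum>b\<in>Basis. (w \<bullet> b) *\<^sub>R frechet_derivative g (at (f x)) b)" for w
    proof -
      interpret g: linear "frechet_derivative g (at (f x))" using has_derivative_linear[OF g] .
      have "frechet_derivative g (at (f x)) (\<Sum>b\<in>Basis. (w \<bullet> b) *\<^sub>R b)
          = (\<Sum>b\<in>Basis. (w \<bullet> b) *\<^sub>R frechet_derivative g (at (f x)) b)"
        by (simp add: g.sum g.scale)
      then show ?thesis by (simp add: euclidean_representation)
    qed
    have "?D x = frechet_derivative g (at (f x)) \<circ> frechet_derivative f (at x)"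
      by (rule ext) (metis lin o_apply)
    then show ?thesis using diff_chain_at[OF f g] by simp
  qed
  have "C_upto k S (\<lambda>x. frechet_derivative (g \<circ> f) (at x) v)" for v
  proof (rule C_upto_cong[OF assms(1)])
    show "C_upto k S (\<lambda>x. ?D x v)"
    proof (intro C_upto_sum assms bounded_bilinear.C_upto[OF bounded_bilinear_scaleR])
      show "C_upto k S (\<lambda>x. frechet_derivative f (at x) v \<bullet> b)" for b
        using Suc.prems(1)
        by (intro C_upto_linear_comp[OF bounded_linear_inner_left] assms) auto
      show "C_upto k S (\<lambda>x. frechet_derivative g (at (f x)) b)" for b
        using Suc.IH[of "\<lambda>y. frechet_derivative g (at y) b"] Suc.prems C_upto_SucD[OF Suc.prems(1)]
        by (simp add: o_def)
    qed
    show "?D x v = frechet_derivative (g \<circ> f) (at x) v" if "x \<in> S" for x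
      using fun_cong[OF frechet_derivative_at[OF der[OF that]], of v] by simp
  qed
  then show ?case using der unfolding C_upto.simps differentiable_def by blast
qed

lemma smooth_on_subset: "smooth_on S f \<Longrightarrow> T \<subseteq> S \<Longrightarrow> smooth_on T f"
  unfolding smooth_on_def using C_upto_subset by blast
lemma smooth_on_cong: "open S \<Longrightarrow> (\<And>x. x \<in> S \<Longrightarrow> f x = g x) \<Longrightarrow> smooth_on S f \<Longrightarrow> smooth_on S g"
  using C_upto_cong[of S f g] unfolding smooth_on_def by auto
lemma smooth_on_continuous_on: "smooth_on S f \<Longrightarrow> continuous_on S f"
  unfolding smooth_on_def using C_upto_continuous_on by blast
lemma smooth_on_const: "smooth_on S (\<lambda>x. c)"
  unfolding smooth_on_def by (simp add: C_upto_const)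
lemma smooth_on_bounded_linear: "bounded_linear f \<Longrightarrow> smooth_on S f"
  unfolding smooth_on_def by (simp add: C_upto_bounded_linear)
lemma smooth_on_linear_comp: "bounded_linear L \<Longrightarrow> open S \<Longrightarrow> smooth_on S f \<Longrightarrow> smooth_on S (\<lambda>x. L (f x))"
  unfolding smooth_on_def by (simp add: C_upto_linear_comp)
lemma smooth_on_add: "open S \<Longrightarrow> smooth_on S f \<Longrightarrow> smooth_on S g \<Longrightarrow> smooth_on S (\<lambda>x. f x + g x)"
  unfolding smooth_on_def by (simp add: C_upto_add)
lemma smooth_on_minus: "open S \<Longrightarrow> smooth_on S f \<Longrightarrow> smooth_on S (\<lambda>x. - f x)"
  using smooth_on_linear_comp[OF bounded_linear_minus[OF bounded_linear_ident]] .
lemma smooth_on_diff: "open S \<Longrightarrow> smooth_on S f \<Longrightarrow> smooth_on S g \<Longrightarrow> smooth_on S (\<lambda>x. f x - g x)"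
  using smooth_on_add[of S f "\<lambda>x. - g x"] smooth_on_minus[of S g] by simp
lemma smooth_on_bilinear:
  "bounded_bilinear pr \<Longrightarrow> open S \<Longrightarrow> smooth_on S f \<Longrightarrow> smooth_on S g \<Longrightarrow> smooth_on S (\<lambda>x. pr (f x) (g x))"
  unfolding smooth_on_def by (simp add: bounded_bilinear.C_upto)
lemmas smooth_on_mult = smooth_on_bilinear[OF bounded_bilinear_mult]
lemma smooth_on_comp:
  fixes f :: "'a::euclidean_space \<Rightarrow> 'b::euclidean_space" and g :: "'b \<Rightarrow> 'c::real_normed_vector"
  assumes "smooth_on S f" "smooth_on T g" "open S" "open T" "f ` S \<subseteq> T"
  shows "smooth_on S (g \<circ> f)"
  unfolding smooth_on_def
proof
  show "C_upto k S (g \<circ> f)" for k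
    by (rule C_upto_comp[OF assms(3-5)]) (use assms(1,2) in \<open>auto simp: smooth_on_def\<close>)
qed

lemma smooth_on_differentiable: "smooth_on S f \<Longrightarrow> x \<in> S \<Longrightarrow> f differentiable (at x)"
  unfolding smooth_on_def by (drule spec[of _ "Suc 0"]) simp

lemma smooth_on_has_derivative:
  "smooth_on S f \<Longrightarrow> x \<in> S \<Longrightarrow> (f has_derivative frechet_derivative f (at x)) (at x)"
  by (simp add: frechet_derivative_worksI smooth_on_differentiable)

lemma smooth_on_frechet_derivative:
  "smooth_on S f \<Longrightarrow> smooth_on S (\<lambda>x. frechet_derivative f (at x) v)"
  unfolding smooth_on_def
proof
  fix k assume "\<forall>k. C_upto k S f"
  then have "C_upto (Suc k) S f" by blast
  then show "C_upto k S (\<lambda>x. frechet_derivative f (at x) v)" by simp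
qed

text \<open>
  Bootstrapping: if the derivative is an expression in the function that inherits its order of
  differentiability, then one order is gained at each step.  This covers the inverse, the square
  root and the arctangent.
\<close>

lemma smooth_on_of_derivative_expression:
  fixes f :: "real \<Rightarrow> real"
  assumes "open S" "\<And>x. x \<in> S \<Longrightarrow> (f has_real_derivative f' x) (at x)"
    and "\<And>k. C_upto k S f \<Longrightarrow> C_upto k S f'"
  shows "smooth_on S f"
proof -
  have der: "frechet_derivative f (at x) v = f' x * v" if "x \<in> S" for x v
    using fun_cong[OF frechet_derivative_at[OF assms(2)[OF that, unfolded has_field_derivative_def]], of v] by simp
  have "C_upto k S f" for k
  proof (induction k)
    case 0
    then show ?case
      using assms(2) DERIV_isCont continuous_at_imp_continuous_on by (metis C_upto.simps(1))
  next
    case (Suc k)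
    have "C_upto k S (\<lambda>x. frechet_derivative f (at x) v)" for v
    proof (rule C_upto_cong[OF assms(1)])
      show "C_upto k S (\<lambda>x. v * f' x)"
        by (intro C_upto_linear_comp[OF bounded_linear_mult_right] assms Suc)
    qed (simp add: der)
    moreover have "f differentiable (at x)" if "x \<in> S" for x
      using assms(2)[OF that] by (auto simp: has_field_derivative_def differentiable_def)
    ultimately show ?case by simp
  qed
  then show ?thesis unfolding smooth_on_def by blast
qed

lemma smooth_on_inverse_real: "smooth_on (- {0::real}) inverse"
proof (rule smooth_on_of_derivative_expression)
  show "(inverse has_real_derivative - (inverse x * inverse x)) (at x)" if "x \<in> - {0}" for x :: real
    using that DERIV_inverse[of x] by (simp add: power2_eq_square)
  show "C_upto k (-{0}) (\<lambda>x::real. - (inverse x * inverse x))" if "C_upto k (-{0}) (inverse :: real \<Rightarrow> real)" for k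
    using that
    by (intro C_upto_linear_comp[OF bounded_linear_minus[OF bounded_linear_ident]]
        bounded_bilinear.C_upto[OF bounded_bilinear_mult]) auto
qed auto

lemma smooth_on_inverse:
  fixes f :: "'a::euclidean_space \<Rightarrow> real"
  assumes "smooth_on S f" "open S" "\<And>x. x \<in> S \<Longrightarrow> f x \<noteq> 0"
  shows "smooth_on S (\<lambda>x. inverse (f x))"
proof -
  have "smooth_on S (inverse \<circ> f)"
    by (rule smooth_on_comp[OF assms(1) smooth_on_inverse_real assms(2)]) (use assms(3) in auto)
  then show ?thesis by (simp add: o_def)
qed

lemma smooth_on_sqrt_real: "smooth_on {0<..} sqrt"
proof (rule smooth_on_of_derivative_expression)
  show "(sqrt has_real_derivative inverse (sqrt x) / 2) (at x)" if "x \<in> {0<..}" for x :: real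
    using that DERIV_real_sqrt[of x] by simp
  show "C_upto k {0<..} (\<lambda>x. inverse (sqrt x) / 2)" if "C_upto k {0<..} sqrt" for k
  proof -
    have "C_upto k {0<..} (inverse \<circ> sqrt)"
      by (rule C_upto_comp[of _ "-{0}"]) (use that smooth_on_inverse_real in \<open>auto simp: smooth_on_def\<close>)
    then show ?thesis
      using C_upto_linear_comp[OF bounded_linear_divide[of 2], of "{0<..}" k "inverse \<circ> sqrt"] by (simp add: o_def)
  qed
qed auto

lemma smooth_on_sqrt:
  fixes f :: "'a::euclidean_space \<Rightarrow> real"
  assumes "smooth_on S f" "open S" "\<And>x. x \<in> S \<Longrightarrow> f x > 0"
  shows "smooth_on S (\<lambda>x. sqrt (f x))"
proof -
  have "smooth_on S (sqrt \<circ> f)"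
    by (rule smooth_on_comp[OF assms(1) smooth_on_sqrt_real assms(2)]) (use assms(3) in auto)
  then show ?thesis by (simp add: o_def)
qed

lemma smooth_on_arctan: "smooth_on UNIV arctan"
proof (rule smooth_on_of_derivative_expression)
  show "(arctan has_real_derivative inverse (1 + x\<^sup>2)) (at x)" for x
    by (rule DERIV_arctan)
  have "smooth_on UNIV (\<lambda>x::real. 1 + x\<^sup>2)"
    unfolding power2_eq_square
    by (intro smooth_on_add smooth_on_mult smooth_on_const smooth_on_bounded_linear bounded_linear_ident) auto
  then have "smooth_on UNIV (\<lambda>x::real. inverse (1 + x\<^sup>2))"
    by (rule smooth_on_inverse) (auto simp: add_nonneg_eq_0_iff)
  then show "C_upto k UNIV (\<lambda>x::real. inverse (1 + x\<^sup>2))" for k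
    by (simp add: smooth_on_def)
qed auto

lemma smooth_on_Pair:
  assumes "open S" "smooth_on S f" "smooth_on S g"
  shows "smooth_on S (\<lambda>x. (f x, g x))"
proof -
  have "smooth_on S (\<lambda>x. (f x, 0) + (0, g x))"
    by (intro smooth_on_add assms smooth_on_linear_comp[of "\<lambda>y. (y, 0)" S f] smooth_on_linear_comp[of "\<lambda>y. (0, y)" S g]
        bounded_linear_Pair bounded_linear_ident bounded_linear_zero)
  then show ?thesis by simp
qed

section \<open>Symmetry of second derivatives\<close>

text \<open>
  The mean value theorem is applied once in direction \<open>w\<close> and once in direction \<open>v\<close> to the second
  difference.  That difference is symmetric in \<open>v\<close> and \<open>w\<close>, which is where the symmetry of the second
  derivative comes from.
\<close>

lemma second_difference_mvt:
  fixes f :: "'a::euclidean_space \<Rightarrow> real"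
  assumes S: "C_upto 2 S f" and h: "h > 0"
    and sub: "\<And>s t. 0 \<le> s \<Longrightarrow> s \<le> h \<Longrightarrow> 0 \<le> t \<Longrightarrow> t \<le> h \<Longrightarrow> x + s *\<^sub>R v + t *\<^sub>R w \<in> S"
  shows "\<exists>s t. 0 < s \<and> s < h \<and> 0 < t \<and> t < h \<and>
     f (x + h *\<^sub>R v + h *\<^sub>R w) - f (x + h *\<^sub>R v) - f (x + h *\<^sub>R w) + f x
       = h * (h * frechet_derivative (\<lambda>y. frechet_derivative f (at y) w) (at (x + s *\<^sub>R v + t *\<^sub>R w)) v)"
proof -
  let ?Dw = "\<lambda>y. frechet_derivative f (at y) w"
  have d1: "(f has_derivative frechet_derivative f (at y)) (at y)" if "y \<in> S" for y
    using S that by (auto simp: numeral_2_eq_2 intro: frechet_derivative_worksI)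
  have d2: "(?Dw has_derivative frechet_derivative ?Dw (at y)) (at y)" if "y \<in> S" for y
    using S that by (auto simp: numeral_2_eq_2 intro: frechet_derivative_worksI)
  have dt: "((\<lambda>t. f (x + s *\<^sub>R v + t *\<^sub>R w)) has_real_derivative ?Dw (x + s *\<^sub>R v + t *\<^sub>R w)) (at t)"
    if "0 \<le> s" "s \<le> h" "0 \<le> t" "t \<le> h" for s t
  proof -
    have *: "x + s *\<^sub>R v + t *\<^sub>R w \<in> S" using sub that by auto
    have "((\<lambda>t. f (x + s *\<^sub>R v + t *\<^sub>R w)) has_derivative
       (\<lambda>r. frechet_derivative f (at (x + s *\<^sub>R v + t *\<^sub>R w)) (r *\<^sub>R w))) (at t)"
      by (rule has_derivative_compose[where g=f and f="\<lambda>t. x + s *\<^sub>R v + t *\<^sub>R w" and x=t, OF _ d1[OF *]]) (auto intro!: derivative_eq_intros)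
    then show ?thesis unfolding has_field_derivative_def
      using linear_scale[OF has_derivative_linear[OF d1[OF *]]] by (simp add: mult.commute[of _ "?Dw _"])
  qed
  have ds: "((\<lambda>s. ?Dw (x + s *\<^sub>R v + t *\<^sub>R w)) has_real_derivative frechet_derivative ?Dw (at (x + s *\<^sub>R v + t *\<^sub>R w)) v) (at s)"
    if "0 \<le> s" "s \<le> h" "0 \<le> t" "t \<le> h" for s t
  proof -
    have *: "x + s *\<^sub>R v + t *\<^sub>R w \<in> S" using sub that by auto
    have "((\<lambda>s. ?Dw (x + s *\<^sub>R v + t *\<^sub>R w)) has_derivative
       (\<lambda>r. frechet_derivative ?Dw (at (x + s *\<^sub>R v + t *\<^sub>R w)) (r *\<^sub>R v))) (at s)"
      by (rule has_derivative_compose[where g="?Dw" and f="\<lambda>s. x + s *\<^sub>R v + t *\<^sub>R w" and x=s, OF _ d2[OF *]]) (auto intro!: derivative_eq_intros)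
    then show ?thesis unfolding has_field_derivative_def
      using linear_scale[OF has_derivative_linear[OF d2[OF *]]]
      by (simp add: mult.commute[of _ "frechet_derivative ?Dw _ v"])
  qed
  let ?g = "\<lambda>t. f (x + h *\<^sub>R v + t *\<^sub>R w) - f (x + 0 *\<^sub>R v + t *\<^sub>R w)"
  have "(?g has_real_derivative (?Dw (x + h *\<^sub>R v + t *\<^sub>R w) - ?Dw (x + 0 *\<^sub>R v + t *\<^sub>R w))) (at t)"
    if "0 \<le> t" "t \<le> h" for t
    using that h by (intro DERIV_diff dt) auto
  from MVT2[OF h this] obtain t where t: "0 < t" "t < h"
    "?g h - ?g 0 = (h - 0) * (?Dw (x + h *\<^sub>R v + t *\<^sub>R w) - ?Dw (x + 0 *\<^sub>R v + t *\<^sub>R w))" by auto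
  have "((\<lambda>s. ?Dw (x + s *\<^sub>R v + t *\<^sub>R w)) has_real_derivative frechet_derivative ?Dw (at (x + s *\<^sub>R v + t *\<^sub>R w)) v) (at s)"
    if "0 \<le> s" "s \<le> h" for s
    using that t by (intro ds) auto
  from MVT2[OF h this] obtain s where s: "0 < s" "s < h"
    "?Dw (x + h *\<^sub>R v + t *\<^sub>R w) - ?Dw (x + 0 *\<^sub>R v + t *\<^sub>R w) = (h - 0) * frechet_derivative ?Dw (at (x + s *\<^sub>R v + t *\<^sub>R w)) v"
    by auto
  have "?g h - ?g 0 = h * (h * frechet_derivative ?Dw (at (x + s *\<^sub>R v + t *\<^sub>R w)) v)"
    using t(3) unfolding s(3) by simp
  then show ?thesis using s t by (intro exI[of _ s] exI[of _ t]) auto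
qed

lemma second_derivative_symmetric_real:
  fixes f :: "'a::euclidean_space \<Rightarrow> real"
  assumes S: "C_upto 2 S f" "open S" "x \<in> S"
  shows "frechet_derivative (\<lambda>y. frechet_derivative f (at y) w) (at x) v
       = frechet_derivative (\<lambda>y. frechet_derivative f (at y) v) (at x) w"
proof (rule ccontr)
  let ?A = "\<lambda>x. frechet_derivative (\<lambda>y. frechet_derivative f (at y) w) (at x) v"
  let ?B = "\<lambda>x. frechet_derivative (\<lambda>y. frechet_derivative f (at y) v) (at x) w"
  assume ne: "?A x \<noteq> ?B x"
  define e where "e = \<bar>?A x - ?B x\<bar> / 2"
  have "e > 0" using ne by (simp add: e_def)
  have "isCont ?A x" "isCont ?B x"
    using S by (auto simp: numeral_2_eq_2 continuous_on_eq_continuous_at)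
  then obtain d1 d2 where d: "d1 > 0" "d2 > 0" "\<And>y. dist y x < d1 \<Longrightarrow> dist (?A y) (?A x) < e"
    "\<And>y. dist y x < d2 \<Longrightarrow> dist (?B y) (?B x) < e"
    using \<open>e > 0\<close> unfolding continuous_at_eps_delta by metis
  obtain d3 where d3: "d3 > 0" "ball x d3 \<subseteq> S" using S open_contains_ball by blast
  define d where "d = min d1 (min d2 d3)"
  have dpos: "d > 0" using d d3 by (simp add: d_def)
  define h where "h = d / (2 * (1 + norm v + norm w))"
  have npos: "1 + norm v + norm w > 0" using norm_ge_zero[of v] norm_ge_zero[of w] by linarith
  have hpos: "h > 0" using dpos npos by (simp add: h_def)
  have near: "dist (x + s *\<^sub>R v + t *\<^sub>R w) x < d" if "0 \<le> s" "s \<le> h" "0 \<le> t" "t \<le> h" for s t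
  proof -
    have "dist (x + s *\<^sub>R v + t *\<^sub>R w) x \<le> s * norm v + t * norm w"
      using norm_triangle_ineq[of "s *\<^sub>R v" "t *\<^sub>R w"] that by (simp add: dist_norm)
    also have "\<dots> \<le> h * norm v + h * norm w" using that by (intro add_mono mult_right_mono) auto
    also have "\<dots> < 2 * h * (1 + norm v + norm w)"
    proof -
      have "0 \<le> h * norm v" "0 \<le> h * norm w" using hpos by auto
      moreover have "2 * h * (1 + norm v + norm w) = 2 * h + 2 * (h * norm v) + 2 * (h * norm w)"
        by (simp add: algebra_simps)
      ultimately show ?thesis using hpos by linarith
    qed
    also have "\<dots> = d" using npos unfolding h_def by (simp add: field_simps)
    finally show ?thesis .
  qed
  have inS: "x + s *\<^sub>R v + t *\<^sub>R w \<in> S" if "0 \<le> s" "s \<le> h" "0 \<le> t" "t \<le> h" for s t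
    using near[OF that] d3 by (auto simp: d_def dist_commute)
  obtain s t where st: "0 < s" "s < h" "0 < t" "t < h"
     "f (x + h *\<^sub>R v + h *\<^sub>R w) - f (x + h *\<^sub>R v) - f (x + h *\<^sub>R w) + f x = h * (h * ?A (x + s *\<^sub>R v + t *\<^sub>R w))"
    using second_difference_mvt[OF S(1) hpos inS] by auto
  have inS': "x + s *\<^sub>R w + t *\<^sub>R v \<in> S" if "0 \<le> s" "s \<le> h" "0 \<le> t" "t \<le> h" for s t
    using inS[of t s] that by (simp add: algebra_simps)
  obtain s' t' where st': "0 < s'" "s' < h" "0 < t'" "t' < h"
     "f (x + h *\<^sub>R w + h *\<^sub>R v) - f (x + h *\<^sub>R w) - f (x + h *\<^sub>R v) + f x = h * (h * ?B (x + s' *\<^sub>R w + t' *\<^sub>R v))"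
    using second_difference_mvt[OF S(1) hpos inS'] by auto
  have "h * (h * ?A (x + s *\<^sub>R v + t *\<^sub>R w)) = h * (h * ?B (x + s' *\<^sub>R w + t' *\<^sub>R v))"
    using st(5) st'(5) by (simp add: algebra_simps)
  then have eq: "?A (x + s *\<^sub>R v + t *\<^sub>R w) = ?B (x + t' *\<^sub>R v + s' *\<^sub>R w)"
    using hpos by (simp add: algebra_simps)
  have "dist (?A (x + s *\<^sub>R v + t *\<^sub>R w)) (?A x) < e"
    using near[of s t] st by (intro d) (auto simp: d_def)
  moreover have "dist (?B (x + t' *\<^sub>R v + s' *\<^sub>R w)) (?B x) < e"
    using near[of t' s'] st' by (intro d) (auto simp: d_def)
  ultimately have "\<bar>?A x - ?B x\<bar> < 2 * e"
    unfolding eq dist_real_def by linarith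
  then show False by (simp add: e_def)
qed

lemma second_derivative_symmetric:
  fixes f :: "'a::euclidean_space \<Rightarrow> 'b::euclidean_space"
  assumes S: "smooth_on S f" "open S" "x \<in> S"
  shows "frechet_derivative (\<lambda>y. frechet_derivative f (at y) w) (at x) v
       = frechet_derivative (\<lambda>y. frechet_derivative f (at y) v) (at x) w"
proof (rule euclidean_eqI)
  fix b :: 'b assume "b \<in> Basis"
  have comp: "frechet_derivative (\<lambda>y. g y \<bullet> b) (at y) u = frechet_derivative g (at y) u \<bullet> b"
    if "smooth_on S g" "y \<in> S" for g :: "'a \<Rightarrow> 'b" and y u
    using frechet_derivative_at[OF bounded_linear.has_derivative[OF bounded_linear_inner_left smooth_on_has_derivative[OF that]]]
    by metis
  have fb: "smooth_on S (\<lambda>y. f y \<bullet> b)"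
    by (intro smooth_on_linear_comp[OF bounded_linear_inner_left] S)
  have loc: "frechet_derivative (\<lambda>y. frechet_derivative (\<lambda>y. f y \<bullet> b) (at y) u) (at x)
      = frechet_derivative (\<lambda>y. frechet_derivative f (at y) u \<bullet> b) (at x)" for u
  proof -
    have "((\<lambda>y. frechet_derivative f (at y) u \<bullet> b) has_derivative
        frechet_derivative (\<lambda>y. frechet_derivative f (at y) u \<bullet> b) (at x)) (at x)"
      by (intro smooth_on_has_derivative[OF _ S(3)] smooth_on_linear_comp[OF bounded_linear_inner_left]
         smooth_on_frechet_derivative S)
    then have "((\<lambda>y. frechet_derivative (\<lambda>y. f y \<bullet> b) (at y) u) has_derivative
        frechet_derivative (\<lambda>y. frechet_derivative f (at y) u \<bullet> b) (at x)) (at x)"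
      by (rule has_derivative_transform_within_open[OF _ S(2,3)]) (simp add: comp[OF S(1)])
    then show ?thesis using frechet_derivative_at by metis
  qed
  have "frechet_derivative (\<lambda>y. frechet_derivative (\<lambda>y. f y \<bullet> b) (at y) w) (at x) v
      = frechet_derivative (\<lambda>y. frechet_derivative (\<lambda>y. f y \<bullet> b) (at y) v) (at x) w"
    using second_derivative_symmetric_real[OF _ S(2,3)] fb by (simp add: smooth_on_def)
  then show "frechet_derivative (\<lambda>y. frechet_derivative f (at y) w) (at x) v \<bullet> b =
     frechet_derivative (\<lambda>y. frechet_derivative f (at y) v) (at x) w \<bullet> b"
    unfolding loc comp[OF smooth_on_frechet_derivative[OF S(1)] S(3)] .
qed

section \<open>Charts, tangent vectors and forms\<close>

locale smooth_manifold =
  fixes M :: "'a::{t2_space,second_countable_topology} cr_struct"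
  assumes atlas: "smooth_atlas (charts M)"
begin

lemma chart_at_exists: obtains c where "c \<in> charts_at M p"
  using atlas unfolding smooth_atlas_def charts_at_def by blast

lemma charts_at_iff: "c \<in> charts_at M p \<longleftrightarrow> c \<in> charts M \<and> p \<in> fst c"
  by (auto simp: charts_at_def)

lemma open_dom: "c \<in> charts M \<Longrightarrow> open (fst c)"
  and open_img: "c \<in> charts M \<Longrightarrow> open (snd c ` fst c)"
  and chart_homeo: "c \<in> charts M \<Longrightarrow> homeomorphism (fst c) (snd c ` fst c) (snd c) (chart_inv c)"
  using atlas unfolding smooth_atlas_def by auto

lemma cont_chart: "c \<in> charts M \<Longrightarrow> continuous_on (fst c) (snd c)"
  and cont_chart_inv: "c \<in> charts M \<Longrightarrow> continuous_on (snd c ` fst c) (chart_inv c)"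
  and chart_inv_chart [simp]: "c \<in> charts M \<Longrightarrow> p \<in> fst c \<Longrightarrow> chart_inv c (snd c p) = p"
  and chart_chart_inv: "c \<in> charts M \<Longrightarrow> x \<in> snd c ` fst c \<Longrightarrow> snd c (chart_inv c x) = x"
  and chart_inv_in: "c \<in> charts M \<Longrightarrow> x \<in> snd c ` fst c \<Longrightarrow> chart_inv c x \<in> fst c"
  using chart_homeo[of c] unfolding homeomorphism_def by auto

lemma chart_inj: "c \<in> charts M \<Longrightarrow> inj_on (snd c) (fst c)"
  by (rule inj_on_inverseI[of _ "chart_inv c"]) simp

lemma chart_image_eq:
  assumes "c \<in> charts M" "W \<subseteq> fst c"
  shows "snd c ` W = {x \<in> snd c ` fst c. chart_inv c x \<in> W}"
  using assms by force

lemma open_chart_image: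
  assumes "c \<in> charts M" "open W"
  shows "open (snd c ` (W \<inter> fst c))"
proof -
  have "snd c ` (W \<inter> fst c) = snd c ` fst c \<inter> chart_inv c -` W"
    using assms(1) by force
  then show ?thesis
    using continuous_open_preimage[OF cont_chart_inv open_img] assms by simp
qed

lemma open_overlap: "c \<in> charts M \<Longrightarrow> c' \<in> charts M \<Longrightarrow> open (snd c ` (fst c \<inter> fst c'))"
  using open_chart_image[of c "fst c'"] open_dom[of c'] by (simp add: Int_commute)

lemma chart_change_smooth:
  "c \<in> charts M \<Longrightarrow> c' \<in> charts M \<Longrightarrow> smooth_on (snd c ` (fst c \<inter> fst c')) (snd c' \<circ> chart_inv c)"
  using atlas unfolding smooth_atlas_def by blast

lemma chart_change_has_derivative:
  assumes "c \<in> charts_at M p" "c' \<in> charts_at M p"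
  shows "((snd c' \<circ> chart_inv c) has_derivative
     (\<lambda>v. frechet_derivative (snd c' \<circ> chart_inv c) (at (snd c p)) v)) (at (snd c p))"
  using assms chart_change_smooth[of c c'] by (intro smooth_on_has_derivative[of "snd c ` (fst c \<inter> fst c')"]) (auto simp: charts_at_iff)

lemma tangent_vec_has_derivative:
  assumes "c \<in> charts_at M p" "c' \<in> charts_at M p"
  shows "((snd c' \<circ> chart_inv c) has_derivative (\<lambda>v. tangent_vec M p c v c')) (at (snd c p))"
  using chart_change_has_derivative[OF assms] assms by (simp add: tangent_vec_def)

lemma tangent_vec_outside: "c' \<notin> charts_at M p \<Longrightarrow> tangent_vec M p c v c' = 0"
  by (simp add: tangent_vec_def)

lemma tangent_vec_self [simp]:
  assumes "c \<in> charts_at M p" shows "tangent_vec M p c v c = v"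
proof -
  have c: "c \<in> charts M" "p \<in> fst c" using assms by (auto simp: charts_at_iff)
  have "((\<lambda>x. x) has_derivative (\<lambda>v. v)) (at (snd c p))" by (rule has_derivative_ident)
  then have "((snd c \<circ> chart_inv c) has_derivative (\<lambda>v. v)) (at (snd c p))"
    by (rule has_derivative_transform_within_open[OF _ open_img[OF c(1)]])
      (use c chart_chart_inv in auto)
  from has_derivative_unique[OF this tangent_vec_has_derivative[OF assms assms]]
  show ?thesis by metis
qed

text \<open>
  Chain rule for coordinate changes: it makes the coordinates of a tangent vector in one chart
  determine the vector, so that tangent vectors may be computed with in any chart.
\<close>

lemma tangent_vec_chain:
  assumes "c \<in> charts_at M p" "c' \<in> charts_at M p" "c'' \<in> charts_at M p"
  shows "tangent_vec M p c' (tangent_vec M p c v c') c'' = tangent_vec M p c v c''"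
proof -
  have c: "c \<in> charts M" "p \<in> fst c" "c' \<in> charts M" "p \<in> fst c'" using assms by (auto simp: charts_at_iff)
  have *: "(snd c' \<circ> chart_inv c) (snd c p) = snd c' p" using c by simp
  have "((snd c'' \<circ> chart_inv c') \<circ> (snd c' \<circ> chart_inv c) has_derivative
      (\<lambda>v. tangent_vec M p c' v c'') \<circ> (\<lambda>v. tangent_vec M p c v c')) (at (snd c p))"
    by (rule diff_chain_at[OF tangent_vec_has_derivative[OF assms(1,2)]])
      (unfold *, rule tangent_vec_has_derivative[OF assms(2,3)])
  then have "((snd c'' \<circ> chart_inv c) has_derivative
      (\<lambda>v. tangent_vec M p c' v c'') \<circ> (\<lambda>v. tangent_vec M p c v c')) (at (snd c p))"
    by (rule has_derivative_transform_within_open[OF _ open_overlap[OF c(1,3)]])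
      (use c in auto)
  from has_derivative_unique[OF this tangent_vec_has_derivative[OF assms(1,3)]]
  show ?thesis by (metis o_apply)
qed

lemma tangent_vec_change:
  assumes "c \<in> charts_at M p" "c' \<in> charts_at M p"
  shows "tangent_vec M p c' (tangent_vec M p c v c') = tangent_vec M p c v"
  using tangent_vec_chain[OF assms] tangent_vec_outside by (intro ext) metis

lemma tangent_vec_in: "c \<in> charts_at M p \<Longrightarrow> tangent_vec M p c v \<in> tangent_space M p"
  unfolding tangent_space_def by blast

lemma tangent_vec_coord:
  assumes "v \<in> tangent_space M p" "c \<in> charts_at M p"
  shows "tangent_vec M p c (v c) = v"
proof -
  obtain c' u where "c' \<in> charts_at M p" "v = tangent_vec M p c' u"
    using assms(1) unfolding tangent_space_def by blast
  then show ?thesis using tangent_vec_change assms(2) by simp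
qed

lemma tangent_eqI:
  "v \<in> tangent_space M p \<Longrightarrow> w \<in> tangent_space M p \<Longrightarrow> c \<in> charts_at M p \<Longrightarrow> v c = w c \<Longrightarrow> v = w"
  using tangent_vec_coord by metis

lemma tangent_vec_lin:
  assumes "c \<in> charts_at M p"
  shows "tangent_vec M p c (a *\<^sub>R v + b *\<^sub>R w) = lin_comb a (tangent_vec M p c v) b (tangent_vec M p c w)"
proof
  fix c'
  show "tangent_vec M p c (a *\<^sub>R v + b *\<^sub>R w) c' = lin_comb a (tangent_vec M p c v) b (tangent_vec M p c w) c'"
  proof (cases "c' \<in> charts_at M p")
    case True
    interpret linear "\<lambda>v. tangent_vec M p c v c'"
      using tangent_vec_has_derivative[OF assms True] by (rule has_derivative_linear)
    show ?thesis by (simp add: lin_comb_def add scale)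
  qed (simp add: tangent_vec_outside lin_comb_def)
qed

lemma zero_vec_eq: "c \<in> charts_at M p \<Longrightarrow> tangent_vec M p c 0 = zero_vec"
  using tangent_vec_lin[of c p 0 0 0 0] by (simp add: lin_comb_def zero_vec_def)

lemma lin_comb_in:
  assumes "v \<in> tangent_space M p" "w \<in> tangent_space M p"
  shows "lin_comb a v b w \<in> tangent_space M p"
proof -
  obtain c where c: "c \<in> charts_at M p" using chart_at_exists by blast
  show ?thesis
    using tangent_vec_lin[OF c, of a "v c" b "w c"] tangent_vec_coord[OF _ c] tangent_vec_in[OF c] assms
    by metis
qed

lemma tangent_vec_zeroD: "c \<in> charts_at M p \<Longrightarrow> v \<in> tangent_space M p \<Longrightarrow> v c = 0 \<Longrightarrow> v = zero_vec"
  using tangent_vec_coord zero_vec_eq by metis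

text \<open>
  The coordinate expressions of a 1-form, of its exterior derivative and of the 3-form \<open>d\<eta> \<and> \<eta>\<close>
  are computed in a chart.  What is needed later is how they transform under coordinate changes and
  under multiplication of the form by a function.
\<close>

context
  fixes \<eta> assumes eta: "smooth_one_form M \<eta>"
begin

lemma form_coord_at:
  assumes "c \<in> charts_at M p" "v \<in> tangent_space M p"
  shows "form_coord M \<eta> c (snd c p) (v c) = \<eta> p v"
  using assms by (simp add: form_coord_def tangent_vec_coord charts_at_iff)

lemma charts_at_inv: "c \<in> charts M \<Longrightarrow> x \<in> snd c ` fst c \<Longrightarrow> c \<in> charts_at M (chart_inv c x)"
  by (simp add: charts_at_iff chart_inv_in)

lemma form_coord_lin:
  assumes "c \<in> charts M" "x \<in> snd c ` fst c"
  shows "form_coord M \<eta> c x (a *\<^sub>R v + b *\<^sub>R w) = a * form_coord M \<eta> c x v + b * form_coord M \<eta> c x w"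
  using eta tangent_vec_lin[OF charts_at_inv[OF assms]] tangent_vec_in[OF charts_at_inv[OF assms]]
  unfolding form_coord_def smooth_one_form_def by simp

lemma form_coord_linear:
  assumes "c \<in> charts M" "x \<in> snd c ` fst c"
  shows "linear (form_coord M \<eta> c x)"
proof
  show "form_coord M \<eta> c x (v + w) = form_coord M \<eta> c x v + form_coord M \<eta> c x w" for v w
    using form_coord_lin[OF assms, of 1 v 1 w] by simp
  show "form_coord M \<eta> c x (r *\<^sub>R v) = r *\<^sub>R form_coord M \<eta> c x v" for r v
    using form_coord_lin[OF assms, of r v 0 0] by simp
qed

lemma form_coord_smooth: "c \<in> charts M \<Longrightarrow> smooth_on (snd c ` fst c) (\<lambda>x. form_coord M \<eta> c x v)"
  using eta unfolding smooth_one_form_def by blast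

lemma form_coord_deriv:
  "c \<in> charts M \<Longrightarrow> x \<in> snd c ` fst c \<Longrightarrow>
    ((\<lambda>y. form_coord M \<eta> c y v) has_derivative frechet_derivative (\<lambda>y. form_coord M \<eta> c y v) (at x)) (at x)"
  by (rule smooth_on_has_derivative[OF form_coord_smooth])

lemma form_coord_change:
  assumes "c \<in> charts_at M p" "c' \<in> charts_at M p"
  shows "form_coord M \<eta> c (snd c p) v = form_coord M \<eta> c' (snd c' p) (tangent_vec M p c v c')"
  using assms tangent_vec_change[OF assms] by (simp add: form_coord_def charts_at_iff)

lemma ext_deriv_antisym: "ext_deriv M \<eta> c x v w = - ext_deriv M \<eta> c x w v"
  by (simp add: ext_deriv_def)

lemma ext_deriv_self: "ext_deriv M \<eta> c x v v = 0"
  by (simp add: ext_deriv_def)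

lemma ext_deriv_lin1:
  assumes "c \<in> charts M" "x \<in> snd c ` fst c"
  shows "ext_deriv M \<eta> c x (a *\<^sub>R v + b *\<^sub>R w) u = a * ext_deriv M \<eta> c x v u + b * ext_deriv M \<eta> c x w u"
proof -
  let ?F = "\<lambda>v y. form_coord M \<eta> c y v"
  interpret linear "frechet_derivative (?F u) (at x)"
    by (rule has_derivative_linear[OF form_coord_deriv[OF assms]])
  have "((\<lambda>y. a * ?F v y + b * ?F w y) has_derivative
      (\<lambda>h. a * frechet_derivative (?F v) (at x) h + b * frechet_derivative (?F w) (at x) h)) (at x)"
    by (intro has_derivative_add has_derivative_mult_right form_coord_deriv assms)
  then have "(?F (a *\<^sub>R v + b *\<^sub>R w) has_derivative
      (\<lambda>h. a * frechet_derivative (?F v) (at x) h + b * frechet_derivative (?F w) (at x) h)) (at x)"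
    by (rule has_derivative_transform_within_open[OF _ open_img[OF assms(1)] assms(2)])
      (simp add: form_coord_lin[OF assms(1)])
  from frechet_derivative_at[OF this, symmetric]
  show ?thesis unfolding ext_deriv_def by (simp add: add scale algebra_simps)
qed

lemma ext_deriv_lin2:
  assumes "c \<in> charts M" "x \<in> snd c ` fst c"
  shows "ext_deriv M \<eta> c x u (a *\<^sub>R v + b *\<^sub>R w) = a * ext_deriv M \<eta> c x u v + b * ext_deriv M \<eta> c x u w"
  using ext_deriv_lin1[OF assms, of a v b w u] ext_deriv_antisym[of c x u] by simp

lemma ext_deriv_smooth: "c \<in> charts M \<Longrightarrow> smooth_on (snd c ` fst c) (\<lambda>x. ext_deriv M \<eta> c x v w)"
  unfolding ext_deriv_def
  by (intro smooth_on_diff open_img smooth_on_frechet_derivative form_coord_smooth)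

lemma vol_coeff_smooth: "c \<in> charts M \<Longrightarrow> smooth_on (snd c ` fst c) (vol_coeff M \<eta> c)"
  unfolding vol_coeff_def[abs_def]
  by (intro smooth_on_add smooth_on_mult open_img ext_deriv_smooth form_coord_smooth)

lemma vec3_expand: "(v::real^3) = (v$1) *\<^sub>R axis 1 1 + 1 *\<^sub>R ((v$2) *\<^sub>R axis 2 1 + (v$3) *\<^sub>R axis 3 1)"
  by (simp add: vec_eq_iff forall_3 axis_def)

lemma form_coord_expand:
  assumes "c \<in> charts M" "x \<in> snd c ` fst c"
  shows "form_coord M \<eta> c x v = v$1 * form_coord M \<eta> c x (axis 1 1)
     + v$2 * form_coord M \<eta> c x (axis 2 1) + v$3 * form_coord M \<eta> c x (axis 3 1)"
  by (subst vec3_expand[of v]) (simp only: form_coord_lin[OF assms] mult_1 add.assoc)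

lemma ext_deriv_expand1:
  assumes "c \<in> charts M" "x \<in> snd c ` fst c"
  shows "ext_deriv M \<eta> c x v w = v$1 * ext_deriv M \<eta> c x (axis 1 1) w
     + v$2 * ext_deriv M \<eta> c x (axis 2 1) w + v$3 * ext_deriv M \<eta> c x (axis 3 1) w"
  by (subst vec3_expand[of v]) (simp only: ext_deriv_lin1[OF assms] mult_1 add.assoc)

lemma ext_deriv_expand2:
  assumes "c \<in> charts M" "x \<in> snd c ` fst c"
  shows "ext_deriv M \<eta> c x v w = w$1 * ext_deriv M \<eta> c x v (axis 1 1)
     + w$2 * ext_deriv M \<eta> c x v (axis 2 1) + w$3 * ext_deriv M \<eta> c x v (axis 3 1)"
  by (subst vec3_expand[of w]) (simp only: ext_deriv_lin2[OF assms] mult_1 add.assoc)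

lemma ext_deriv_expand:
  assumes "c \<in> charts M" "x \<in> snd c ` fst c"
  shows "ext_deriv M \<eta> c x v w =
      (v$1 * w$2 - v$2 * w$1) * ext_deriv M \<eta> c x (axis 1 1) (axis 2 1)
    + (v$2 * w$3 - v$3 * w$2) * ext_deriv M \<eta> c x (axis 2 1) (axis 3 1)
    + (v$3 * w$1 - v$1 * w$3) * ext_deriv M \<eta> c x (axis 3 1) (axis 1 1)"
proof -
  have a: "ext_deriv M \<eta> c x (axis 2 1) (axis 1 1) = - ext_deriv M \<eta> c x (axis 1 1) (axis 2 1)"
    "ext_deriv M \<eta> c x (axis 3 1) (axis 2 1) = - ext_deriv M \<eta> c x (axis 2 1) (axis 3 1)"
    "ext_deriv M \<eta> c x (axis 1 1) (axis 3 1) = - ext_deriv M \<eta> c x (axis 3 1) (axis 1 1)"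
    by (rule ext_deriv_antisym)+
  show ?thesis
    unfolding ext_deriv_expand1[OF assms, of v w]
      ext_deriv_expand2[OF assms, of "axis 1 1" w] ext_deriv_expand2[OF assms, of "axis 2 1" w]
      ext_deriv_expand2[OF assms, of "axis 3 1" w] ext_deriv_self a
    by (simp add: algebra_simps)
qed

text \<open>
  An alternating trilinear form on a three-dimensional space is a multiple of the determinant, so
  the coefficient can be recovered from any basis.
\<close>

lemma vol_coeff_triple:
  assumes "c \<in> charts M" "x \<in> snd c ` fst c"
  shows "ext_deriv M \<eta> c x u v * form_coord M \<eta> c x w + ext_deriv M \<eta> c x v w * form_coord M \<eta> c x u
      + ext_deriv M \<eta> c x w u * form_coord M \<eta> c x v = vol_coeff M \<eta> c x * det (vector [u, v, w] :: real^3^3)"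
  unfolding vol_coeff_def det_3 ext_deriv_expand[OF assms, of u v] ext_deriv_expand[OF assms, of v w]
    ext_deriv_expand[OF assms, of w u] form_coord_expand[OF assms, of u] form_coord_expand[OF assms, of v]
    form_coord_expand[OF assms, of w]
  by (simp add: algebra_simps)

text \<open>
  The exterior derivative is natural under coordinate changes: differentiating the transformed
  coefficients produces second derivatives of the coordinate change, and these cancel by symmetry.
\<close>

lemma ext_deriv_change:
  assumes c: "c \<in> charts_at M p" "c' \<in> charts_at M p"
  shows "ext_deriv M \<eta> c (snd c p) v w
    = ext_deriv M \<eta> c' (snd c' p) (tangent_vec M p c v c') (tangent_vec M p c w c')"
proof -
  have cc: "c \<in> charts M" "p \<in> fst c" "c' \<in> charts M" "p \<in> fst c'" using c by (auto simp: charts_at_iff)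
  let ?x = "snd c p" and ?\<tau> = "snd c' \<circ> chart_inv c" and ?O = "snd c ` (fst c \<inter> fst c')"
  let ?F = "\<lambda>v y. form_coord M \<eta> c y v" and ?F' = "\<lambda>v y. form_coord M \<eta> c' y v"
  let ?T = "\<lambda>v. tangent_vec M p c v c'"
  have x: "?x \<in> ?O" "?x \<in> snd c ` fst c" "snd c' p \<in> snd c' ` fst c'" "?\<tau> ?x = snd c' p" using cc by auto
  note O = open_overlap[OF cc(1,3)]
  have T: "frechet_derivative ?\<tau> (at ?x) = ?T"
    using frechet_derivative_at[OF tangent_vec_has_derivative[OF c]] by simp
  have Fexp: "?F w y = (\<Sum>b\<in>Basis. (frechet_derivative ?\<tau> (at y) w \<bullet> b) * ?F' b (?\<tau> y))" if "y \<in> ?O" for w y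
  proof -
    obtain q where q: "q \<in> fst c" "q \<in> fst c'" "y = snd c q" using \<open>y \<in> ?O\<close> by auto
    have qc: "c \<in> charts_at M q" "c' \<in> charts_at M q" using q cc by (auto simp: charts_at_iff)
    interpret linear "form_coord M \<eta> c' (snd c' q)"
      by (rule form_coord_linear) (use q cc in auto)
    have *: "frechet_derivative ?\<tau> (at y) w = tangent_vec M q c w c'"
      using qc q by (simp add: tangent_vec_def)
    have "?F w y = form_coord M \<eta> c' (snd c' q) (tangent_vec M q c w c')"
      using form_coord_change[OF qc] q by simp
    also have "\<dots> = form_coord M \<eta> c' (snd c' q) (\<Sum>b\<in>Basis. (tangent_vec M q c w c' \<bullet> b) *\<^sub>R b)"
      by (simp add: euclidean_representation)
    also have "\<dots> = (\<Sum>b\<in>Basis. (tangent_vec M q c w c' \<bullet> b) * form_coord M \<eta> c' (snd c' q) b)"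
      by (simp add: sum scale)
    finally show ?thesis unfolding * using q cc by simp
  qed
  let ?DD = "\<lambda>w. frechet_derivative (\<lambda>y. frechet_derivative ?\<tau> (at y) w) (at ?x)"
  have DD: "((\<lambda>y. frechet_derivative ?\<tau> (at y) w) has_derivative ?DD w) (at ?x)" for w
    by (rule smooth_on_has_derivative[OF smooth_on_frechet_derivative[OF chart_change_smooth[OF cc(1,3)]] x(1)])
  have F': "((\<lambda>y. ?F' b (?\<tau> y)) has_derivative (\<lambda>v. frechet_derivative (?F' b) (at (snd c' p)) (?T v))) (at ?x)" for b
  proof -
    have "(?F' b has_derivative frechet_derivative (?F' b) (at (snd c' p))) (at (?\<tau> ?x))"
      using form_coord_deriv[OF cc(3) x(3)] x(4) by simp
    from diff_chain_at[OF tangent_vec_has_derivative[OF c] this] show ?thesis by (simp add: o_def)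
  qed
  have der: "frechet_derivative (?F w) (at ?x) v =
     (\<Sum>b\<in>Basis. (?T w \<bullet> b) * frechet_derivative (?F' b) (at (snd c' p)) (?T v) + (?DD w v \<bullet> b) * ?F' b (snd c' p))" for v w
  proof -
    have "((\<lambda>y. \<Sum>b\<in>Basis. (frechet_derivative ?\<tau> (at y) w \<bullet> b) * ?F' b (?\<tau> y)) has_derivative
      (\<lambda>v. \<Sum>b\<in>Basis. (frechet_derivative ?\<tau> (at ?x) w \<bullet> b) * frechet_derivative (?F' b) (at (snd c' p)) (?T v)
          + (?DD w v \<bullet> b) * ?F' b (?\<tau> ?x))) (at ?x)"
      by (intro has_derivative_sum has_derivative_mult F' bounded_linear.has_derivative[OF bounded_linear_inner_left DD])
    then have "(?F w has_derivative
      (\<lambda>v. \<Sum>b\<in>Basis. (frechet_derivative ?\<tau> (at ?x) w \<bullet> b) * frechet_derivative (?F' b) (at (snd c' p)) (?T v)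
          + (?DD w v \<bullet> b) * ?F' b (?\<tau> ?x))) (at ?x)"
      by (rule has_derivative_transform_within_open[OF _ O x(1)]) (simp only: Fexp)
    from fun_cong[OF frechet_derivative_at[OF this], of v] show ?thesis unfolding T x(4) by simp
  qed
  have der': "frechet_derivative (?F' w') (at (snd c' p)) v' = (\<Sum>b\<in>Basis. (w' \<bullet> b) * frechet_derivative (?F' b) (at (snd c' p)) v')" for v' w'
  proof -
    have "((\<lambda>y. \<Sum>b\<in>Basis. (w' \<bullet> b) * ?F' b y) has_derivative
        (\<lambda>v'. \<Sum>b\<in>Basis. (w' \<bullet> b) * frechet_derivative (?F' b) (at (snd c' p)) v')) (at (snd c' p))"
      by (intro has_derivative_sum has_derivative_mult_right form_coord_deriv cc x)
    then have "(?F' w' has_derivative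
        (\<lambda>v'. \<Sum>b\<in>Basis. (w' \<bullet> b) * frechet_derivative (?F' b) (at (snd c' p)) v')) (at (snd c' p))"
    proof (rule has_derivative_transform_within_open[OF _ open_img[OF cc(3)] x(3)])
      fix y assume y: "y \<in> snd c' ` fst c'"
      interpret linear "form_coord M \<eta> c' y" by (rule form_coord_linear[OF cc(3) y])
      have "form_coord M \<eta> c' y (\<Sum>b\<in>Basis. (w' \<bullet> b) *\<^sub>R b) = (\<Sum>b\<in>Basis. (w' \<bullet> b) * ?F' b y)"
        by (simp add: sum scale)
      then show "(\<Sum>b\<in>Basis. (w' \<bullet> b) * ?F' b y) = ?F' w' y" by (simp add: euclidean_representation)
    qed
    from fun_cong[OF frechet_derivative_at[OF this], of v'] show ?thesis by simp
  qed
  \<comment> \<open>The terms with second derivatives in the two halves of the exterior derivative agree.\<close>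
  have symm: "?DD w v = ?DD v w" for v w
    by (rule second_derivative_symmetric[OF chart_change_smooth[OF cc(1,3)] O x(1)])
  show ?thesis
    unfolding ext_deriv_def der der'[of "?T w" "?T v"] der'[of "?T v" "?T w"] symm[of w v]
    by (simp add: sum.distrib)
qed

lemma vol_coeff_change:
  assumes c: "c \<in> charts_at M p" "c' \<in> charts_at M p"
  shows "vol_coeff M \<eta> c (snd c p) = vol_coeff M \<eta> c' (snd c' p) * det (matrix (\<lambda>v. tangent_vec M p c v c'))"
proof -
  let ?T = "\<lambda>v. tangent_vec M p c v c'"
  have cc: "c' \<in> charts M" "snd c' p \<in> snd c' ` fst c'" using c by (auto simp: charts_at_iff)
  have "vol_coeff M \<eta> c (snd c p) = 
     vol_coeff M \<eta> c' (snd c' p) * det (vector [?T (axis 1 1), ?T (axis 2 1), ?T (axis 3 1)] :: real^3^3)"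
    unfolding vol_coeff_triple[OF cc, symmetric] vol_coeff_def[of M \<eta> c] ext_deriv_change[OF c] form_coord_change[OF c] ..
  also have "(vector [?T (axis 1 1), ?T (axis 2 1), ?T (axis 3 1)] :: real^3^3) = transpose (matrix ?T)"
    by (simp add: vec_eq_iff forall_3 transpose_def matrix_def)
  finally show ?thesis by (simp add: det_transpose)
qed

end

text \<open>
  This is the rule $d(k\eta) = k\,d\eta + dk\wedge\eta$.  The last term vanishes on pairs of vectors in the
  kernel of \<open>\<eta>\<close>.
\<close>

lemma ext_deriv_scale:
  assumes eta: "smooth_one_form M \<eta>" and c: "c \<in> charts M" "x \<in> snd c ` fst c" "open V" "x \<in> V"
    and sc: "\<And>y w. y \<in> V \<Longrightarrow> form_coord M \<eta>' c y w = k y * form_coord M \<eta> c y w"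
    and k: "(k has_derivative k') (at x)"
  shows "ext_deriv M \<eta>' c x v w = k x * ext_deriv M \<eta> c x v w
      + k' v * form_coord M \<eta> c x w - k' w * form_coord M \<eta> c x v"
proof -
  let ?F = "\<lambda>v y. form_coord M \<eta> c y v" and ?F' = "\<lambda>v y. form_coord M \<eta>' c y v"
  have "frechet_derivative (?F' u) (at x) = (\<lambda>h. k x * frechet_derivative (?F u) (at x) h + k' h * ?F u x)" for u
  proof -
    have "((\<lambda>y. k y * ?F u y) has_derivative (\<lambda>h. k x * frechet_derivative (?F u) (at x) h + k' h * ?F u x)) (at x)"
      by (intro has_derivative_mult k form_coord_deriv[OF eta c(1,2)])
    then have "(?F' u has_derivative (\<lambda>h. k x * frechet_derivative (?F u) (at x) h + k' h * ?F u x)) (at x)"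
      by (rule has_derivative_transform_within_open[OF _ c(3,4)]) (simp add: sc)
    from frechet_derivative_at[OF this] show ?thesis by simp
  qed
  then show ?thesis by (simp add: ext_deriv_def algebra_simps)
qed

text \<open>
  The contribution of $dk\wedge\eta$ disappears after a wedge product with $\eta$; hence the square.
\<close>

lemma vol_coeff_scale:
  assumes "smooth_one_form M \<eta>" "c \<in> charts M" "x \<in> snd c ` fst c" "open V" "x \<in> V"
    "\<And>y w. y \<in> V \<Longrightarrow> form_coord M \<eta>' c y w = k y * form_coord M \<eta> c y w"
    "(k has_derivative k') (at x)"
  shows "vol_coeff M \<eta>' c x = (k x)\<^sup>2 * vol_coeff M \<eta> c x"
proof -
  have e: "ext_deriv M \<eta>' c x v w = k x * ext_deriv M \<eta> c x v w
      + k' v * form_coord M \<eta> c x w - k' w * form_coord M \<eta> c x v" for v w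
    by (rule ext_deriv_scale[OF assms])
  show ?thesis
    unfolding vol_coeff_def e assms(6)[OF assms(5)] by (simp add: power2_eq_square algebra_simps)
qed

end

section \<open>The contact form of a Hermitian metric\<close>

locale contact_manifold = smooth_manifold M for M :: "'a::{t2_space,second_countable_topology} cr_struct" +
  assumes planes: "smooth_oriented_planes M"
    and contact_exists: "\<exists>\<theta>. contact_form M \<theta>"
begin

lemma contact_formD:
  assumes "contact_form M \<eta>"
  shows "smooth_one_form M \<eta>"
    and "c \<in> charts M \<Longrightarrow> x \<in> snd c ` fst c \<Longrightarrow> vol_coeff M \<eta> c x \<noteq> 0"
    and "v \<in> hplane M p \<longleftrightarrow> v \<in> tangent_space M p \<and> \<eta> p v = 0"
  using assms unfolding contact_form_def by auto

lemma hplane_tangent: "v \<in> hplane M p \<Longrightarrow> v \<in> tangent_space M p"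
  using contact_exists contact_formD(3) by blast

lemma hplane_lin_comb:
  assumes "v \<in> hplane M p" "w \<in> hplane M p"
  shows "lin_comb a v b w \<in> hplane M p"
proof -
  obtain \<theta> where th: "contact_form M \<theta>" using contact_exists by blast
  have "v \<in> tangent_space M p" "w \<in> tangent_space M p" using assms hplane_tangent by auto
  then have "\<theta> p (lin_comb a v b w) = a * \<theta> p v + b * \<theta> p w"
    using contact_formD(1)[OF th] unfolding smooth_one_form_def by blast
  then show ?thesis using assms contact_formD(3)[OF th] lin_comb_in by simp
qed

lemma frame:
  obtains W X Y where "open W" "p \<in> W" "horizontal_field M W X" "horizontal_field M W Y"
    "\<And>q a b. q \<in> W \<Longrightarrow> lin_comb a (X q) b (Y q) = zero_vec \<Longrightarrow> a = 0 \<and> b = 0"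
    "\<And>q v. q \<in> W \<Longrightarrow> v \<in> hplane M q \<Longrightarrow> \<exists>a b. v = lin_comb a (X q) b (Y q)"
    "\<And>q a b a' b'. q \<in> W \<Longrightarrow> pos_basis M q (lin_comb a (X q) b (Y q)) (lin_comb a' (X q) b' (Y q))
              \<longleftrightarrow> a * b' - b * a' > 0"
proof -
  obtain W X Y where W: "open W" "p \<in> W" "smooth_field M W X" "smooth_field M W Y"
    and q: "\<forall>q\<in>W. (\<forall>a b. lin_comb a (X q) b (Y q) = zero_vec \<longrightarrow> a = 0 \<and> b = 0) \<and>
           hplane M q = {lin_comb a (X q) b (Y q) | a b. True} \<and>
           (\<forall>a b a' b'. pos_basis M q (lin_comb a (X q) b (Y q)) (lin_comb a' (X q) b' (Y q))
              \<longleftrightarrow> a * b' - b * a' > 0)"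
    using planes unfolding smooth_oriented_planes_def by blast
  have e: "lin_comb 1 v 0 w = v" "lin_comb 0 v 1 w = w" for v w :: "'a tvec"
    by (auto simp: lin_comb_def)
  have "X q \<in> hplane M q" "Y q \<in> hplane M q" if "q \<in> W" for q
  proof -
    have h: "hplane M q = {lin_comb a (X q) b (Y q) | a b. True}" using q that by blast
    show "X q \<in> hplane M q" unfolding h by (rule CollectI) (metis e(1))
    show "Y q \<in> hplane M q" unfolding h by (rule CollectI) (metis e(2))
  qed
  then have "horizontal_field M W X" "horizontal_field M W Y"
    using W unfolding horizontal_field_def by auto
  then show thesis
    using W q by (intro that[of W X Y]) blast+
qed

lemma lin_comb_coord: "lin_comb a v b w c = a *\<^sub>R v c + b *\<^sub>R w c"
  by (simp add: lin_comb_def)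

lemma ext_deriv_lin_comb:
  assumes "smooth_one_form M \<eta>" "c \<in> charts M" "x \<in> snd c ` fst c"
  shows "ext_deriv M \<eta> c x (lin_comb a X b Y c) (lin_comb a' X b' Y c) = (a * b' - b * a') * ext_deriv M \<eta> c x (X c) (Y c)"
  unfolding lin_comb_coord ext_deriv_lin1[OF assms] ext_deriv_lin2[OF assms]
  using ext_deriv_antisym[OF assms(1), of c x "Y c" "X c"] ext_deriv_self[OF assms(1)]
  by (simp add: algebra_simps)

text \<open>
  Evaluated on \<open>X\<close>, \<open>Y\<close> and any third vector \<open>w\<close>, the nonvanishing volume form is $d\theta(X,Y)\,\theta(w)$
  because \<open>X\<close> and \<open>Y\<close> lie in the kernel.  So if $d\theta(X,Y)$ vanished, then all determinants with the columns
  \<open>X\<close>, \<open>Y\<close> would vanish and \<open>X\<close>, \<open>Y\<close> would be dependent.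
\<close>

lemma ext_deriv_frame_nonzero:
  assumes th: "contact_form M \<theta>" and c: "c \<in> charts_at M p"
    and XY: "X \<in> hplane M p" "Y \<in> hplane M p"
    and indep: "\<And>a b. lin_comb a X b Y = zero_vec \<Longrightarrow> a = 0 \<and> b = 0"
  shows "ext_deriv M \<theta> c (snd c p) (X c) (Y c) \<noteq> 0"
proof
  assume 0: "ext_deriv M \<theta> c (snd c p) (X c) (Y c) = 0"
  have cc: "c \<in> charts M" "snd c p \<in> snd c ` fst c" using c by (auto simp: charts_at_iff)
  have t: "X \<in> tangent_space M p" "Y \<in> tangent_space M p" using XY hplane_tangent by auto
  have f0: "form_coord M \<theta> c (snd c p) (X c) = 0" "form_coord M \<theta> c (snd c p) (Y c) = 0"
    using form_coord_at[OF contact_formD(1)[OF th] c] t XY contact_formD(3)[OF th] by auto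
  have "det (vector [X c, Y c, w] :: real^3^3) = 0" for w
    using vol_coeff_triple[OF contact_formD(1)[OF th] cc, of "X c" "Y c" w] 0 f0 contact_formD(2)[OF th cc] by simp
  \<comment> \<open>The cross product is the choice of the third column that makes the determinant a squared norm.\<close>
  from this[of "cross3 (X c) (Y c)"] have "cross3 (X c) (Y c) \<bullet> cross3 (X c) (Y c) = 0"
    unfolding det_3 by (simp add: cross3_def inner_vec_def sum_3 algebra_simps)
  then have "cross3 (X c) (Y c) = 0" by simp
  then have "collinear {0, X c, Y c}" by (simp add: cross_eq_0)
  then obtain a b where ab: "a *\<^sub>R X c + b *\<^sub>R Y c = 0" "\<not> (a = 0 \<and> b = 0)"
    unfolding collinear_lemma
    by (metis add.right_inverse add_0 scaleR_one scaleR_zero_left scaleR_zero_right scaleR_minus_left zero_neq_one add.right_neutral)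
  have "lin_comb a X b Y = zero_vec"
    by (rule tangent_vec_zeroD[OF c lin_comb_in[OF t]]) (simp add: lin_comb_coord ab)
  then show False using indep ab by blast
qed

end

locale cr_metric = contact_manifold M for M :: "'a::{t2_space,second_countable_topology} cr_struct" +
  fixes g assumes metric: "hermitian_metric M g"
begin

lemma g_sym: "v \<in> hplane M p \<Longrightarrow> w \<in> hplane M p \<Longrightarrow> g p v w = g p w v"
  and g_pos: "v \<in> hplane M p \<Longrightarrow> v \<noteq> zero_vec \<Longrightarrow> g p v v > 0"
  and g_lin: "v \<in> hplane M p \<Longrightarrow> w \<in> hplane M p \<Longrightarrow> u \<in> hplane M p \<Longrightarrow>
     g p (lin_comb a v b w) u = a * g p v u + b * g p w u"
  and g_smooth: "open W \<Longrightarrow> horizontal_field M W X \<Longrightarrow> horizontal_field M W Y \<Longrightarrow> smooth_fun M W (\<lambda>p. g p (X p) (Y p))"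
  using metric unfolding hermitian_metric_def by blast+

lemma g_lin_comb2:
  assumes "X \<in> hplane M p" "Y \<in> hplane M p"
  shows "g p (lin_comb a X b Y) (lin_comb a' X b' Y)
     = a * a' * g p X X + (a * b' + b * a') * g p X Y + b * b' * g p Y Y"
proof -
  have l: "lin_comb a' X b' Y \<in> hplane M p" using assms hplane_lin_comb by blast
  have "g p (lin_comb a X b Y) (lin_comb a' X b' Y) = a * g p (lin_comb a' X b' Y) X + b * g p (lin_comb a' X b' Y) Y"
    using g_lin[OF assms l] g_sym[OF l] assms by simp
  then show ?thesis using g_lin[OF assms] assms g_sym[OF assms] by (simp add: algebra_simps)
qed

lemma g_nonneg:
  assumes v: "v \<in> hplane M p" shows "g p v v \<ge> 0"
proof (cases "v = zero_vec")
  case True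
  have "zero_vec = lin_comb 0 v 0 v" by (simp add: lin_comb_def zero_vec_def)
  then show ?thesis using True g_lin[OF v v v, of 0 0] by simp
next
  case False
  then show ?thesis using g_pos[OF v] by simp
qed

text \<open>
  Strict Cauchy-Schwarz inequality.
\<close>

lemma gram_pos:
  assumes XY: "X \<in> hplane M p" "Y \<in> hplane M p"
    and indep: "\<And>a b. lin_comb a X b Y = zero_vec \<Longrightarrow> a = 0 \<and> b = 0"
  shows "g p X X * g p Y Y - (g p X Y)\<^sup>2 > 0" "g p X X > 0" "g p Y Y > 0"
proof -
  have "X \<noteq> zero_vec" using indep[of 1 0] by (auto simp: lin_comb_def zero_vec_def)
  then show E: "g p X X > 0" using g_pos XY by blast
  have "Y \<noteq> zero_vec" using indep[of 0 1] by (auto simp: lin_comb_def zero_vec_def)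
  then show "g p Y Y > 0" using g_pos XY by blast
  \<comment> \<open>A multiple of the component of \<open>Y\<close> that is orthogonal to \<open>X\<close>.\<close>
  let ?v = "lin_comb (- g p X Y) X (g p X X) Y"
  have "?v \<noteq> zero_vec" using indep E by force
  then have "g p ?v ?v > 0" using g_pos hplane_lin_comb XY by blast
  also have "g p ?v ?v = g p X X * (g p X X * g p Y Y - (g p X Y)\<^sup>2)"
    unfolding g_lin_comb2[OF XY] by (simp add: power2_eq_square algebra_simps)
  finally show "g p X X * g p Y Y - (g p X Y)\<^sup>2 > 0" using E by (simp add: zero_less_mult_iff)
qed

lemma area_form_lin_comb:
  assumes XY: "X \<in> hplane M p" "Y \<in> hplane M p"
    and indep: "\<And>a b. lin_comb a X b Y = zero_vec \<Longrightarrow> a = 0 \<and> b = 0"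
    and pos: "pos_basis M p (lin_comb a X b Y) (lin_comb a' X b' Y) \<longleftrightarrow> a * b' - b * a' > 0"
  shows "area_form M g p (lin_comb a X b Y) (lin_comb a' X b' Y)
     = (a * b' - b * a') * sqrt (g p X X * g p Y Y - (g p X Y)\<^sup>2)"
proof -
  have "g p (lin_comb a X b Y) (lin_comb a X b Y) * g p (lin_comb a' X b' Y) (lin_comb a' X b' Y)
     - (g p (lin_comb a X b Y) (lin_comb a' X b' Y))\<^sup>2
     = (a * b' - b * a')\<^sup>2 * (g p X X * g p Y Y - (g p X Y)\<^sup>2)"
    unfolding g_lin_comb2[OF XY] by (simp add: power2_eq_square algebra_simps)
  then show ?thesis unfolding area_form_def pos by (simp add: real_sqrt_mult)
qed

text \<open>
  On a plane all alternating bilinear forms are proportional, so $d\theta$ on the distribution is a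
  multiple \<open>u\<close> of the area form.  In a local frame \<open>u\<close> is a quotient of smooth functions, and it has
  no zeros since $d\theta$ is nondegenerate on the distribution.
\<close>

lemma ext_deriv_proportional_area_form:
  assumes th: "contact_form M \<theta>"
  shows "\<exists>u. smooth_fun M UNIV u \<and> (\<forall>p. u p \<noteq> 0) \<and>
    (\<forall>p. \<forall>c\<in>charts_at M p. \<forall>v\<in>hplane M p. \<forall>w\<in>hplane M p.
      ext_deriv M \<theta> c (snd c p) (v c) (w c) = u p * area_form M g p v w)"
proof -
  note th1 = contact_formD(1)[OF th]
  let ?S = "\<lambda>p X Y. sqrt (g p X X * g p Y Y - (g p X Y)\<^sup>2)"
  let ?prop = "\<lambda>p u. u \<noteq> 0 \<and> (\<forall>c\<in>charts_at M p. \<forall>v\<in>hplane M p. \<forall>w\<in>hplane M p.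
      ext_deriv M \<theta> c (snd c p) (v c) (w c) = u * area_form M g p v w)"
  have ex: "\<exists>u. ?prop p u" for p
  proof -
    obtain W X Y where F: "open W" "p \<in> W" "horizontal_field M W X" "horizontal_field M W Y"
      and ind: "\<And>q a b. q \<in> W \<Longrightarrow> lin_comb a (X q) b (Y q) = zero_vec \<Longrightarrow> a = 0 \<and> b = 0"
      and span: "\<And>q v. q \<in> W \<Longrightarrow> v \<in> hplane M q \<Longrightarrow> \<exists>a b. v = lin_comb a (X q) b (Y q)"
      and pos: "\<And>q a b a' b'. q \<in> W \<Longrightarrow> pos_basis M q (lin_comb a (X q) b (Y q)) (lin_comb a' (X q) b' (Y q))
              \<longleftrightarrow> a * b' - b * a' > 0"
      using frame[of p] by metis
    have XY: "X p \<in> hplane M p" "Y p \<in> hplane M p" using F unfolding horizontal_field_def by auto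
    obtain c0 where c0: "c0 \<in> charts_at M p" using chart_at_exists by blast
    let ?e = "ext_deriv M \<theta> c0 (snd c0 p) (X p c0) (Y p c0)"
    have S: "?S p (X p) (Y p) > 0" using gram_pos[OF XY ind[OF F(2)]] by simp
    have "?prop p (?e / ?S p (X p) (Y p))"
    proof (intro conjI ballI)
      show "?e / ?S p (X p) (Y p) \<noteq> 0"
        using ext_deriv_frame_nonzero[OF th c0 XY ind[OF F(2)]] S by simp
      fix c v w assume c: "c \<in> charts_at M p" and v: "v \<in> hplane M p" and w: "w \<in> hplane M p"
      obtain a b a' b' where vw: "v = lin_comb a (X p) b (Y p)" "w = lin_comb a' (X p) b' (Y p)"
        using span[OF F(2)] v w by metis
      have cc: "c \<in> charts M" "snd c p \<in> snd c ` fst c" using c by (auto simp: charts_at_iff)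
      have "ext_deriv M \<theta> c (snd c p) (v c) (w c) = (a * b' - b * a') * ext_deriv M \<theta> c (snd c p) (X p c) (Y p c)"
        unfolding vw by (rule ext_deriv_lin_comb[OF th1 cc])
      also have "ext_deriv M \<theta> c (snd c p) (X p c) (Y p c) = ?e"
        unfolding ext_deriv_change[OF th1 c c0]
        using XY hplane_tangent tangent_vec_coord[OF _ c] by simp
      finally have ext: "ext_deriv M \<theta> c (snd c p) (v c) (w c) = (a * b' - b * a') * ?e" .
      have ar: "area_form M g p v w = (a * b' - b * a') * ?S p (X p) (Y p)"
        unfolding vw by (rule area_form_lin_comb[OF XY ind[OF F(2)] pos[OF F(2)]])
      show "ext_deriv M \<theta> c (snd c p) (v c) (w c) = ?e / ?S p (X p) (Y p) * area_form M g p v w"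
        unfolding ext ar using S by simp
    qed
    then show ?thesis by blast
  qed
  then obtain u where u: "\<And>p. ?prop p (u p)" by metis
  have "smooth_on (snd c ` (UNIV \<inter> fst c)) (u \<circ> chart_inv c)" if c: "c \<in> charts M" for c
  proof (rule smooth_on_local)
    fix x assume "x \<in> snd c ` (UNIV \<inter> fst c)"
    then obtain p where p: "p \<in> fst c" "x = snd c p" by auto
    obtain W X Y where F: "open W" "p \<in> W" "horizontal_field M W X" "horizontal_field M W Y"
      and ind: "\<And>q a b. q \<in> W \<Longrightarrow> lin_comb a (X q) b (Y q) = zero_vec \<Longrightarrow> a = 0 \<and> b = 0"
      and span: "\<And>q v. q \<in> W \<Longrightarrow> v \<in> hplane M q \<Longrightarrow> \<exists>a b. v = lin_comb a (X q) b (Y q)"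
      and pos: "\<And>q a b a' b'. q \<in> W \<Longrightarrow> pos_basis M q (lin_comb a (X q) b (Y q)) (lin_comb a' (X q) b' (Y q))
              \<longleftrightarrow> a * b' - b * a' > 0"
      using frame[of p] by metis
    let ?T = "snd c ` (W \<inter> fst c)"
    have T: "open ?T" using open_chart_image[OF c F(1)] .
    have XY: "X q \<in> hplane M q" "Y q \<in> hplane M q" if "q \<in> W" for q
      using F that unfolding horizontal_field_def by auto
    have e12: "lin_comb 1 v 0 w = v" "lin_comb 0 v 1 w = w" for v w :: "'a tvec"
      by (auto simp: lin_comb_def)
    let ?E = "\<lambda>x. ext_deriv M \<theta> c x (X (chart_inv c x) c) (Y (chart_inv c x) c)"
    let ?R = "\<lambda>x. ?S (chart_inv c x) (X (chart_inv c x)) (Y (chart_inv c x))"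
    have u_eq: "?E x * inverse (?R x) = (u \<circ> chart_inv c) x" if x: "x \<in> ?T" for x
    proof -
      obtain q where q: "q \<in> W" "q \<in> fst c" "x = snd c q" using x by auto
      have qx: "chart_inv c x = q" using q c by simp
      have S: "?S q (X q) (Y q) > 0" using gram_pos[OF XY[OF q(1)] ind[OF q(1)]] by simp
      have "area_form M g q (X q) (Y q) = ?S q (X q) (Y q)"
        using area_form_lin_comb[OF XY[OF q(1)] ind[OF q(1)] pos[OF q(1)], of 1 0 0 1] by (simp add: e12)
      moreover have "ext_deriv M \<theta> c (snd c q) (X q c) (Y q c) = u q * area_form M g q (X q) (Y q)"
        using u[of q] XY[OF q(1)] q c by (auto simp: charts_at_iff)
      ultimately show ?thesis using S qx q by simp
    qed
    have sX: "smooth_on ?T (\<lambda>x. X (chart_inv c x) c $ i)" "smooth_on ?T (\<lambda>x. Y (chart_inv c x) c $ i)" for i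
      using F c unfolding horizontal_field_def smooth_field_def
      by (auto intro!: smooth_on_linear_comp[OF bounded_linear_vec_nth T])
    have sE: "smooth_on ?T ?E"
    proof (rule smooth_on_cong[OF T])
      show "smooth_on ?T (\<lambda>x.
      (X (chart_inv c x) c$1 * Y (chart_inv c x) c$2 - X (chart_inv c x) c$2 * Y (chart_inv c x) c$1) * ext_deriv M \<theta> c x (axis 1 1) (axis 2 1)
    + (X (chart_inv c x) c$2 * Y (chart_inv c x) c$3 - X (chart_inv c x) c$3 * Y (chart_inv c x) c$2) * ext_deriv M \<theta> c x (axis 2 1) (axis 3 1)
    + (X (chart_inv c x) c$3 * Y (chart_inv c x) c$1 - X (chart_inv c x) c$1 * Y (chart_inv c x) c$3) * ext_deriv M \<theta> c x (axis 3 1) (axis 1 1))"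
        by (intro smooth_on_add smooth_on_mult smooth_on_diff sX T smooth_on_subset[OF ext_deriv_smooth[OF th1 c]]) auto
    next
      fix x assume x: "x \<in> ?T"
      then have xi: "x \<in> snd c ` fst c" by auto
      show "(X (chart_inv c x) c$1 * Y (chart_inv c x) c$2 - X (chart_inv c x) c$2 * Y (chart_inv c x) c$1) * ext_deriv M \<theta> c x (axis 1 1) (axis 2 1)
    + (X (chart_inv c x) c$2 * Y (chart_inv c x) c$3 - X (chart_inv c x) c$3 * Y (chart_inv c x) c$2) * ext_deriv M \<theta> c x (axis 2 1) (axis 3 1)
    + (X (chart_inv c x) c$3 * Y (chart_inv c x) c$1 - X (chart_inv c x) c$1 * Y (chart_inv c x) c$3) * ext_deriv M \<theta> c x (axis 3 1) (axis 1 1) = ?E x"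
        by (rule ext_deriv_expand[OF th1 c xi, symmetric])
    qed
    have sg: "smooth_on ?T (\<lambda>x. g (chart_inv c x) (A (chart_inv c x)) (B (chart_inv c x)))"
      if "horizontal_field M W A" "horizontal_field M W B" for A B
      using g_smooth[OF F(1) that] c unfolding smooth_fun_def by (auto simp: o_def)
    have "smooth_on ?T ?R"
    proof (intro smooth_on_sqrt smooth_on_diff T)
      show "smooth_on ?T (\<lambda>x. g (chart_inv c x) (X (chart_inv c x)) (X (chart_inv c x)) * g (chart_inv c x) (Y (chart_inv c x)) (Y (chart_inv c x)))"
        by (intro smooth_on_mult sg F T)
      show "smooth_on ?T (\<lambda>x. (g (chart_inv c x) (X (chart_inv c x)) (Y (chart_inv c x)))\<^sup>2)"
        unfolding power2_eq_square by (intro smooth_on_mult sg F T)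
      fix x assume "x \<in> ?T"
      then have "chart_inv c x \<in> W" using c by auto
      then show "g (chart_inv c x) (X (chart_inv c x)) (X (chart_inv c x)) * g (chart_inv c x) (Y (chart_inv c x)) (Y (chart_inv c x)) -
         (g (chart_inv c x) (X (chart_inv c x)) (Y (chart_inv c x)))\<^sup>2 > 0"
        using gram_pos(1)[OF XY ind] by simp
    qed
    then have sR: "smooth_on ?T (\<lambda>x. inverse (?R x))"
    proof (rule smooth_on_inverse[OF _ T])
      fix x assume "x \<in> ?T"
      then have w: "chart_inv c x \<in> W" using c by auto
      show "?R x \<noteq> 0"
        using gram_pos(1)[OF XY[OF w] ind[OF w]] by simp
    qed
    have "smooth_on ?T (u \<circ> chart_inv c)"
      by (rule smooth_on_cong[OF T u_eq smooth_on_mult[OF T sE sR]])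
    then show "\<exists>T. open T \<and> x \<in> T \<and> smooth_on T (u \<circ> chart_inv c)"
      using T p F by (intro exI[of _ ?T]) auto
  qed
  then have "smooth_fun M UNIV u" unfolding smooth_fun_def by blast
  then show ?thesis using u by (intro exI[of _ u]) blast
qed

text \<open>
  Rescale any contact form $\theta$ by $1/u$.  On the distribution, where $\theta$ vanishes, this divides
  $d\theta$ by \<open>u\<close>.
\<close>

lemma metric_contact_form_exists:
  "\<exists>\<eta>. contact_form M \<eta> \<and> (\<forall>p. \<forall>c\<in>charts_at M p. \<forall>v\<in>hplane M p. \<forall>w\<in>hplane M p.
           ext_deriv M \<eta> c (snd c p) (v c) (w c) = area_form M g p v w)"
proof -
  obtain \<theta> where th: "contact_form M \<theta>" using contact_exists by blast
  note th1 = contact_formD(1)[OF th]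
  obtain u where u: "smooth_fun M UNIV u" "\<And>p. u p \<noteq> 0"
    "\<And>p c v w. c \<in> charts_at M p \<Longrightarrow> v \<in> hplane M p \<Longrightarrow> w \<in> hplane M p \<Longrightarrow>
      ext_deriv M \<theta> c (snd c p) (v c) (w c) = u p * area_form M g p v w"
    using ext_deriv_proportional_area_form[OF th] by blast
  define \<eta> where "\<eta> = (\<lambda>p v. inverse (u p) * \<theta> p v)"
  let ?k = "\<lambda>c x. inverse (u (chart_inv c x))"
  have fc: "form_coord M \<eta> c x v = ?k c x * form_coord M \<theta> c x v" for c x v
    by (simp add: form_coord_def \<eta>_def)
  have ks: "smooth_on (snd c ` fst c) (?k c)" if "c \<in> charts M" for c
    using u(1,2) that open_img[OF that] unfolding smooth_fun_def by (intro smooth_on_inverse) (auto simp: o_def)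
  have kd: "(?k c has_derivative frechet_derivative (?k c) (at x)) (at x)" if "c \<in> charts M" "x \<in> snd c ` fst c" for c x
    using smooth_on_has_derivative[OF ks] that by blast
  have one: "smooth_one_form M \<eta>"
    unfolding smooth_one_form_def
  proof (intro conjI allI ballI impI)
    show "\<eta> p v = 0" if "v \<notin> tangent_space M p" for p v
      using th1 that unfolding smooth_one_form_def \<eta>_def by simp
    show "\<eta> p (lin_comb a v b w) = a * \<eta> p v + b * \<eta> p w"
      if "v \<in> tangent_space M p" "w \<in> tangent_space M p" for p a b v w
      using th1 that unfolding smooth_one_form_def \<eta>_def by (simp add: algebra_simps)
    show "smooth_on (snd c ` fst c) (\<lambda>x. form_coord M \<eta> c x v)" if "c \<in> charts M" for c v
      unfolding fc by (intro smooth_on_mult open_img ks form_coord_smooth[OF th1] that)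
  qed
  have "contact_form M \<eta>"
    unfolding contact_form_def
  proof (intro conjI one ballI allI)
    fix c x assume c: "c \<in> charts M" "x \<in> snd c ` fst c"
    show "vol_coeff M \<eta> c x \<noteq> 0"
      using vol_coeff_scale[OF th1 c open_img[OF c(1)] c(2) fc kd[OF c]] contact_formD(2)[OF th c] u(2) by simp
  next
    show "hplane M p = {v \<in> tangent_space M p. \<eta> p v = 0}" for p
      using contact_formD(3)[OF th] u(2)[of p] by (auto simp: \<eta>_def)
  qed
  moreover have "ext_deriv M \<eta> c (snd c p) (v c) (w c) = area_form M g p v w"
    if c: "c \<in> charts_at M p" and v: "v \<in> hplane M p" and w: "w \<in> hplane M p" for p c v w
  proof -
    have cc: "c \<in> charts M" "snd c p \<in> snd c ` fst c" "p \<in> fst c" using c by (auto simp: charts_at_iff)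
    have 0: "form_coord M \<theta> c (snd c p) (v c) = 0" "form_coord M \<theta> c (snd c p) (w c) = 0"
      using form_coord_at[OF th1 c] v w contact_formD(3)[OF th] by auto
    show ?thesis
      using ext_deriv_scale[OF th1 cc(1,2) open_img[OF cc(1)] cc(2) fc kd[OF cc(1,2)], of "v c" "w c"] 0
        u(2)[of p] cc u(3)[OF c v w] by simp
  qed
  ultimately show ?thesis by blast
qed

text \<open>
  Two forms with the same kernel are locally multiples of each other, and the factor is the quotient
  of their exterior derivatives on the distribution, which is 1.
\<close>

lemma metric_contact_form_unique:
  assumes e1: "contact_form M \<eta>" "\<forall>p. \<forall>c\<in>charts_at M p. \<forall>v\<in>hplane M p. \<forall>w\<in>hplane M p.
           ext_deriv M \<eta> c (snd c p) (v c) (w c) = area_form M g p v w"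
    and e2: "contact_form M \<eta>'" "\<forall>p. \<forall>c\<in>charts_at M p. \<forall>v\<in>hplane M p. \<forall>w\<in>hplane M p.
           ext_deriv M \<eta>' c (snd c p) (v c) (w c) = area_form M g p v w"
  shows "\<eta>' = \<eta>"
proof (intro ext)
  fix p v
  note o1 = contact_formD(1)[OF e1(1)] and o2 = contact_formD(1)[OF e2(1)]
  show "\<eta>' p v = \<eta> p v"
  proof (cases "v \<in> tangent_space M p")
    case False
    then show ?thesis using o1 o2 unfolding smooth_one_form_def by simp
  next
    case True
    obtain c where c: "c \<in> charts_at M p" using chart_at_exists by blast
    have cc: "c \<in> charts M" "snd c p \<in> snd c ` fst c" "p \<in> fst c" using c by (auto simp: charts_at_iff)
    let ?x = "snd c p" and ?F = "form_coord M \<eta> c" and ?F' = "form_coord M \<eta>' c"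
    \<comment> \<open>A vector outside the kernel, used to write the factor as a quotient of smooth functions.\<close>
    obtain v0 where v0: "?F ?x v0 \<noteq> 0"
      using contact_formD(2)[OF e1(1) cc(1,2)] unfolding vol_coeff_def by fastforce
    define V where "V = {y \<in> snd c ` fst c. ?F y v0 \<noteq> 0}"
    have V: "open V" "?x \<in> V"
    proof -
      have "V = snd c ` fst c \<inter> (\<lambda>y. ?F y v0) -` (-{0})" by (auto simp: V_def)
      then show "open V"
        using continuous_open_preimage[OF smooth_on_continuous_on[OF form_coord_smooth[OF o1 cc(1), of v0]] open_img[OF cc(1)]]
        by (simp add: open_Compl)
      show "?x \<in> V" using v0 cc by (auto simp: V_def)
    qed
    let ?k = "\<lambda>y. ?F' y v0 / ?F y v0"
    have sc: "?F' y w = ?k y * ?F y w" if "y \<in> V" for y w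
    proof -
      have y: "y \<in> snd c ` fst c" "?F y v0 \<noteq> 0" using that by (auto simp: V_def)
      let ?w = "w - (?F y w / ?F y v0) *\<^sub>R v0"
      note cy = charts_at_inv[OF o1 cc(1) y(1)]
      interpret F: linear "?F y" by (rule form_coord_linear[OF o1 cc(1) y(1)])
      interpret F': linear "?F' y" by (rule form_coord_linear[OF o2 cc(1) y(1)])
      have "?F y ?w = 0" using y(2) by (simp add: F.diff F.scale)
      then have "tangent_vec M (chart_inv c y) c ?w \<in> hplane M (chart_inv c y)"
        using contact_formD(3)[OF e1(1)] tangent_vec_in[OF cy] by (simp add: form_coord_def)
      then have "?F' y ?w = 0"
        using contact_formD(3)[OF e2(1)] by (simp add: form_coord_def)
      then have "?F' y w = ?F y w / ?F y v0 * ?F' y v0" by (simp add: F'.diff F'.scale)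
      then show ?thesis by simp
    qed
    have "smooth_on V (\<lambda>y. ?F' y v0 * inverse (?F y v0))"
      by (intro smooth_on_mult smooth_on_inverse V smooth_on_subset[OF form_coord_smooth[OF o1 cc(1)]]
          smooth_on_subset[OF form_coord_smooth[OF o2 cc(1)]]) (auto simp: V_def)
    then have k: "(?k has_derivative frechet_derivative ?k (at ?x)) (at ?x)"
      using V smooth_on_has_derivative by (simp add: divide_inverse)
    obtain W X Y where F: "open W" "p \<in> W" "horizontal_field M W X" "horizontal_field M W Y"
      and ind: "\<And>q a b. q \<in> W \<Longrightarrow> lin_comb a (X q) b (Y q) = zero_vec \<Longrightarrow> a = 0 \<and> b = 0"
      using frame[of p] by metis
    have XY: "X p \<in> hplane M p" "Y p \<in> hplane M p" using F unfolding horizontal_field_def by auto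
    have "?F ?x (X p c) = 0" "?F ?x (Y p c) = 0"
      using form_coord_at[OF o1 c] XY contact_formD(3)[OF e1(1)] by auto
    then have "ext_deriv M \<eta>' c ?x (X p c) (Y p c) = ?k ?x * ext_deriv M \<eta> c ?x (X p c) (Y p c)"
      using ext_deriv_scale[OF o1 cc(1,2) V sc k] by simp
    moreover have "ext_deriv M \<eta>' c ?x (X p c) (Y p c) = ext_deriv M \<eta> c ?x (X p c) (Y p c)"
      using e1(2) e2(2) c XY by simp
    moreover have "ext_deriv M \<eta> c ?x (X p c) (Y p c) \<noteq> 0"
      by (rule ext_deriv_frame_nonzero[OF e1(1) c XY ind[OF F(2)]])
    ultimately have "?k ?x = 1" by (metis mult_cancel_right1)
    then have "?F' ?x (v c) = ?F ?x (v c)" using sc[OF V(2), of "v c"] by (metis mult_1)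
    then show ?thesis using form_coord_at[OF o1 c True] form_coord_at[OF o2 c True] by simp
  qed
qed

theorem metric_contact_form_well_defined: "contact_form M (metric_contact_form M g)"
proof -
  have "\<exists>!\<eta>. contact_form M \<eta> \<and> (\<forall>p. \<forall>c\<in>charts_at M p. \<forall>v\<in>hplane M p. \<forall>w\<in>hplane M p.
           ext_deriv M \<eta> c (snd c p) (v c) (w c) = area_form M g p v w)"
    by (rule ex_ex1I[OF metric_contact_form_exists]) (elim conjE, rule metric_contact_form_unique)
  from theI'[OF this] show ?thesis unfolding metric_contact_form_def by blast
qed

end

section \<open>Change of variables for nonnegative integrals\<close>

text \<open>
  The change of variables formula for vector-valued functions, applied to functions into the
  one-dimensional space; for nonnegative functions integrability is absolute.
\<close>

lemma has_integral_change_of_variables_nonneg: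
  fixes G :: "real^'m::{finite,wellorder} \<Rightarrow> real^'m::_" and u :: "real^'m::_ \<Rightarrow> real"
  assumes S: "S \<in> sets lebesgue"
    and der: "\<And>x. x \<in> S \<Longrightarrow> (G has_derivative G' x) (at x within S)"
    and inj: "inj_on G S" and u: "\<And>y. u y \<ge> 0"
  shows "((\<lambda>x. \<bar>det (matrix (G' x))\<bar> * u (G x)) has_integral b) S \<longleftrightarrow> (u has_integral b) (G ` S)"
proof -
  have "((\<lambda>x. \<bar>det (matrix (G' x))\<bar> * u (G x)) absolutely_integrable_on S \<and>
           integral S (\<lambda>x. \<bar>det (matrix (G' x))\<bar> * u(G x)) = b)
     \<longleftrightarrow> (u absolutely_integrable_on (G ` S) \<and> integral (G ` S) u = b)"
    using has_absolute_integral_change_of_variables[OF S der inj, of "\<lambda>y. vec (u y) :: real^1" "vec b"]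
    by (simp add: absolutely_integrable_on_1_iff integral_on_1_eq)
  moreover have "(\<lambda>x. \<bar>det (matrix (G' x))\<bar> * u (G x)) absolutely_integrable_on S \<longleftrightarrow>
     (\<lambda>x. \<bar>det (matrix (G' x))\<bar> * u (G x)) integrable_on S"
    by (rule absolutely_integrable_on_iff_nonneg) (simp add: u)
  moreover have "u absolutely_integrable_on (G ` S) \<longleftrightarrow> u integrable_on (G ` S)"
    by (rule absolutely_integrable_on_iff_nonneg) (simp add: u)
  ultimately show ?thesis unfolding has_integral_iff by blast
qed

text \<open>
  If either side is finite, then it is a Henstock-Kurzweil integral and the formula for these
  applies; otherwise both sides are infinite.
\<close>

lemma nn_integral_change_of_variables:
  fixes G :: "real^'m::{finite,wellorder} \<Rightarrow> real^'m::_" and u :: "real^'m::_ \<Rightarrow> real"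
  assumes S: "open S" and der: "\<And>x. x \<in> S \<Longrightarrow> (G has_derivative G' x) (at x)"
    and inj: "inj_on G S" and cont: "continuous_on S (\<lambda>x. det (matrix (G' x)))"
    and u: "u \<in> borel_measurable borel" "\<And>y. u y \<ge> 0"
  shows "(\<integral>\<^sup>+y. ennreal (indicator (G ` S) y * u y) \<partial>lborel)
    = (\<integral>\<^sup>+x. ennreal (indicator S x * (\<bar>det (matrix (G' x))\<bar> * u (G x))) \<partial>lborel)" (is "?L = ?R")
proof -
  have contG: "continuous_on S G"
    using der has_derivative_continuous continuous_at_imp_continuous_on by blast
  have oG: "open (G ` S)" by (rule invariance_of_domain[OF contG S inj])
  have derw: "(G has_derivative G' x) (at x within S)" if "x \<in> S" for x
    using der[OF that] by (rule has_derivative_at_withinI)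
  have Sl: "S \<in> sets lebesgue" using S by simp
  have iff: "((\<lambda>x. \<bar>det (matrix (G' x))\<bar> * u (G x)) has_integral b) S \<longleftrightarrow> (u has_integral b) (G ` S)" for b
    by (rule has_integral_change_of_variables_nonneg[OF Sl derw inj u(2)])
  have mL: "(\<lambda>y. indicator (G ` S) y * u y) \<in> borel_measurable borel"
    using oG u by (intro borel_measurable_times borel_measurable_indicator) auto
  have mR: "(\<lambda>x. indicator S x * (\<bar>det (matrix (G' x))\<bar> * u (G x))) \<in> borel_measurable borel"
  proof -
    have "(\<lambda>x. \<bar>det (matrix (G' x))\<bar> * u (G x)) \<in> borel_measurable (restrict_space borel S)"
    proof (intro borel_measurable_times)
      show "(\<lambda>x. \<bar>det (matrix (G' x))\<bar>) \<in> borel_measurable (restrict_space borel S)"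
        by (intro borel_measurable_continuous_on_restrict continuous_on_rabs cont)
      have "G \<in> borel_measurable (restrict_space borel S)"
        by (intro borel_measurable_continuous_on_restrict contG)
      then show "(\<lambda>x. u (G x)) \<in> borel_measurable (restrict_space borel S)"
        using u(1) by (rule measurable_compose)
    qed
    note restr = this
    have "S \<inter> space borel \<in> sets borel" using S by simp
    from borel_measurable_restrict_space_iff[OF this, THEN iffD1, OF restr]
    show ?thesis unfolding real_scaleR_def .
  qed
  have res: "((\<lambda>x. indicator A x * h x) has_integral r) UNIV \<longleftrightarrow> (h has_integral r) A" for A r and h :: "real^'m::{finite,wellorder} \<Rightarrow> real"
  proof -
    have "indicator A x * h x = (if x \<in> A then h x else 0)" for x by (cases "x \<in> A") simp_all
    then show ?thesis using has_integral_restrict_UNIV[of A h r] by presburger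
  qed
  show ?thesis
  proof (cases "?L < \<infinity>")
    case True
    then obtain r where r: "?L = ennreal r" "0 \<le> r" by (cases ?L rule: ennreal_cases) auto
    have "((\<lambda>y. indicator (G ` S) y * u y) has_integral r) UNIV"
      by (rule nn_integral_has_integral[OF mL _ r]) (simp add: u)
    then have "((\<lambda>x. indicator S x * (\<bar>det (matrix (G' x))\<bar> * u (G x))) has_integral r) UNIV"
      unfolding res by (rule iff[THEN iffD2])
    from nn_integral_has_integral_lborel[OF mR _ this] show ?thesis using r u(2) by simp
  next
    case inf: False
    show ?thesis
    proof (cases "?R < \<infinity>")
      case True
      then obtain r where r: "?R = ennreal r" "0 \<le> r" by (cases ?R rule: ennreal_cases) auto
      have "((\<lambda>x. indicator S x * (\<bar>det (matrix (G' x))\<bar> * u (G x))) has_integral r) UNIV"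
        by (rule nn_integral_has_integral[OF mR _ r]) (simp add: u)
      then have "((\<lambda>y. indicator (G ` S) y * u y) has_integral r) UNIV"
        unfolding res by (rule iff[THEN iffD1])
      from nn_integral_has_integral_lborel[OF mL _ this] show ?thesis using r u(2) by simp
    next
      case False
      have top: "x = top" if "\<not> x < (\<infinity>::ennreal)" for x
        using that unfolding infinity_ennreal_def less_top[symmetric] by simp
      show ?thesis using top[OF False] top[OF inf] by (rule trans[OF _ sym, rotated])
    qed
  qed
qed

section \<open>The volume measure\<close>

context cr_metric
begin

definition vol_density :: "'a chart \<Rightarrow> real^3 \<Rightarrow> real" where
  "vol_density c x = \<bar>vol_coeff M (metric_contact_form M g) c x\<bar>"

text \<open>
  The value outside of the chart is irrelevant because the density vanishes there.
\<close>

definition chart_meas :: "'a chart \<Rightarrow> 'a measure" where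
  "chart_meas c = distr (density lborel (\<lambda>x. ennreal (if x \<in> snd c ` fst c then vol_density c x else 0))) borel
      (\<lambda>x. if x \<in> snd c ` fst c then chart_inv c x else undefined)"

lemma vol_density_cont: "c \<in> charts M \<Longrightarrow> continuous_on (snd c ` fst c) (vol_density c)"
  unfolding vol_density_def
  by (intro continuous_on_rabs smooth_on_continuous_on[OF vol_coeff_smooth[OF contact_formD(1)[OF metric_contact_form_well_defined]]])

lemma vol_density_pos: "c \<in> charts M \<Longrightarrow> x \<in> snd c ` fst c \<Longrightarrow> vol_density c x > 0"
  unfolding vol_density_def using contact_formD(2)[OF metric_contact_form_well_defined] by simp

lemma vol_density_change:
  assumes "c \<in> charts_at M p" "c' \<in> charts_at M p"
  shows "vol_density c (snd c p) = \<bar>det (matrix (\<lambda>v. tangent_vec M p c v c'))\<bar> * vol_density c' (snd c' p)"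
  unfolding vol_density_def vol_coeff_change[OF contact_formD(1)[OF metric_contact_form_well_defined] assms]
  by (simp add: abs_mult)

lemma chart_inv_measurable:
  assumes "c \<in> charts M"
  shows "(\<lambda>x. if x \<in> snd c ` fst c then chart_inv c x else undefined) \<in> borel \<rightarrow>\<^sub>M borel"
proof -
  have "chart_inv c \<in> restrict_space borel (snd c ` fst c) \<rightarrow>\<^sub>M borel"
    by (rule borel_measurable_continuous_on_restrict[OF cont_chart_inv[OF assms]])
  then show ?thesis
    using open_img[OF assms] by (subst measurable_If_restrict_space_iff) auto
qed

lemma chart_density_measurable:
  assumes "c \<in> charts M"
  shows "(\<lambda>x. if x \<in> snd c ` fst c then vol_density c x else 0) \<in> borel_measurable borel"
proof -
  have "vol_density c \<in> restrict_space borel (snd c ` fst c) \<rightarrow>\<^sub>M borel"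
    by (rule borel_measurable_continuous_on_restrict[OF vol_density_cont[OF assms]])
  then show ?thesis
    using open_img[OF assms] by (subst measurable_If_restrict_space_iff) auto
qed

lemma sets_chart_meas [simp]: "sets (chart_meas c) = sets borel" "space (chart_meas c) = UNIV"
  by (auto simp: chart_meas_def)

lemma nn_integral_chart_meas:
  assumes c: "c \<in> charts M" and h: "h \<in> borel_measurable borel"
  shows "(\<integral>\<^sup>+p. h p \<partial>chart_meas c) = (\<integral>\<^sup>+x. ennreal (if x \<in> snd c ` fst c then vol_density c x else 0) * h (chart_inv c x) \<partial>lborel)"
proof -
  let ?e = "\<lambda>x. if x \<in> snd c ` fst c then chart_inv c x else undefined"
  have "(\<integral>\<^sup>+p. h p \<partial>chart_meas c) = (\<integral>\<^sup>+x. ennreal (if x \<in> snd c ` fst c then vol_density c x else 0) * h (?e x) \<partial>lborel)"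
    unfolding chart_meas_def using chart_inv_measurable[OF c] chart_density_measurable[OF c] h
    by (subst nn_integral_distr) (auto intro!: nn_integral_density)
  also have "\<dots> = (\<integral>\<^sup>+x. ennreal (if x \<in> snd c ` fst c then vol_density c x else 0) * h (chart_inv c x) \<partial>lborel)"
    by (intro nn_integral_cong) auto
  finally show ?thesis .
qed

lemma emeasure_chart_meas:
  assumes c: "c \<in> charts M" and B: "B \<in> sets borel" "B \<subseteq> fst c"
  shows "emeasure (chart_meas c) B = (\<integral>\<^sup>+x\<in>snd c ` B. ennreal (vol_density c x) \<partial>lborel)"
proof -
  have "emeasure (chart_meas c) B = (\<integral>\<^sup>+p. indicator B p \<partial>chart_meas c)"
    using B by simp
  also have "\<dots> = (\<integral>\<^sup>+x. ennreal (if x \<in> snd c ` fst c then vol_density c x else 0) * indicator B (chart_inv c x) \<partial>lborel)"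
    by (rule nn_integral_chart_meas[OF c]) (use B in auto)
  also have "\<dots> = (\<integral>\<^sup>+x\<in>snd c ` B. ennreal (vol_density c x) \<partial>lborel)"
    by (intro nn_integral_cong) (auto simp: indicator_def chart_image_eq[OF c B(2)])
  finally show ?thesis .
qed

lemma emeasure_chart_meas_outside:
  assumes c: "c \<in> charts M" and B: "B \<in> sets borel"
  shows "emeasure (chart_meas c) B = emeasure (chart_meas c) (B \<inter> fst c)"
proof -
  have o: "fst c \<in> sets borel" using open_dom[OF c] by simp
  have "emeasure (chart_meas c) A = (\<integral>\<^sup>+p. indicator A p \<partial>chart_meas c)" if "A \<in> sets borel" for A
    using that by simp
  moreover have "(\<integral>\<^sup>+p. indicator B p \<partial>chart_meas c) = (\<integral>\<^sup>+p. indicator (B \<inter> fst c) p \<partial>chart_meas c)"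
    using B o by (subst (1 2) nn_integral_chart_meas[OF c]) (auto intro!: nn_integral_cong simp: indicator_def c)
  ultimately show ?thesis using B o by simp
qed

lemma borel_chart_image:
  assumes c: "c \<in> charts M" and B: "B \<in> sets borel" "B \<subseteq> fst c"
  shows "snd c ` B \<in> sets borel"
proof -
  let ?e = "\<lambda>x. if x \<in> snd c ` fst c then chart_inv c x else undefined"
  have "?e -` B \<inter> space borel \<in> sets borel"
    by (rule measurable_sets[OF chart_inv_measurable[OF c] B(1)])
  moreover have "snd c ` B = (?e -` B \<inter> space borel) \<inter> snd c ` fst c"
    unfolding chart_image_eq[OF c B(2)] by auto
  ultimately show ?thesis using open_img[OF c] by auto
qed

text \<open>
  The volume coefficients of two charts differ by the Jacobian determinant of the coordinate change,
  which is the factor in the change of variables formula.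
\<close>

lemma chart_meas_change:
  assumes c: "c \<in> charts M" and c': "c' \<in> charts M" and B: "B \<in> sets borel" "B \<subseteq> fst c" "B \<subseteq> fst c'"
  shows "emeasure (chart_meas c) B = emeasure (chart_meas c') B"
proof -
  let ?S = "snd c ` (fst c \<inter> fst c')" and ?\<tau> = "snd c' \<circ> chart_inv c"
  let ?u = "\<lambda>y. indicator (snd c' ` B) y * (if y \<in> snd c' ` fst c' then vol_density c' y else 0)"
  let ?D = "\<lambda>x. frechet_derivative ?\<tau> (at x)"
  have S: "open ?S" by (rule open_overlap[OF c c'])
  have im: "?\<tau> ` ?S = snd c' ` (fst c \<inter> fst c')" using c c' by (force simp: image_image)
  have der: "(?\<tau> has_derivative ?D x) (at x)" if "x \<in> ?S" for x
    by (rule smooth_on_has_derivative[OF chart_change_smooth[OF c c'] that])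
  have inj: "inj_on ?\<tau> ?S"
    using c c' by (auto simp: inj_on_def) (metis chart_inv_chart)
  have cont: "continuous_on ?S (\<lambda>x. det (matrix (?D x)))"
  proof -
    have comp: "continuous_on ?S (\<lambda>x. ?D x v $ i)" for v i
      using smooth_on_continuous_on[OF smooth_on_frechet_derivative[OF chart_change_smooth[OF c c']], of v]
      by (intro continuous_on_component)
    show ?thesis
      unfolding det_3 matrix_def vec_lambda_beta
      by (intro continuous_on_add continuous_on_diff continuous_on_mult comp)
  qed
  have um: "?u \<in> borel_measurable borel"
    using borel_chart_image[OF c' B(1,3)] chart_density_measurable[OF c']
    by (intro borel_measurable_times borel_measurable_indicator) auto
  have un: "?u y \<ge> 0" for y using vol_density_pos[OF c', of y] by (auto simp: indicator_def)
  have "emeasure (chart_meas c') B = (\<integral>\<^sup>+y. ennreal (indicator (?\<tau> ` ?S) y * ?u y) \<partial>lborel)"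
    unfolding emeasure_chart_meas[OF c' B(1,3)] im
    using B by (intro nn_integral_cong) (auto simp: indicator_def)
  also have "\<dots> = (\<integral>\<^sup>+x. ennreal (indicator ?S x * (\<bar>det (matrix (?D x))\<bar> * ?u (?\<tau> x))) \<partial>lborel)"
    by (rule nn_integral_change_of_variables[OF S der inj cont um un])
  also have "\<dots> = emeasure (chart_meas c) B"
    unfolding emeasure_chart_meas[OF c B(1,2)]
  proof (intro nn_integral_cong)
    fix x
    show "ennreal (indicator ?S x * (\<bar>det (matrix (?D x))\<bar> * ?u (?\<tau> x))) = ennreal (vol_density c x) * indicator (snd c ` B) x"
    proof (cases "x \<in> ?S")
      case True
      then obtain p where p: "p \<in> fst c" "p \<in> fst c'" "x = snd c p" by auto
      have pc: "c \<in> charts_at M p" "c' \<in> charts_at M p" using p c c' by (auto simp: charts_at_iff)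
      have D: "?D x = (\<lambda>v. tangent_vec M p c v c')"
        using frechet_derivative_at[OF tangent_vec_has_derivative[OF pc]] p by simp
      have "snd c' p \<in> snd c' ` B \<longleftrightarrow> p \<in> B"
        by (rule inj_on_image_mem_iff[OF chart_inj[OF c'] p(2) B(3)])
      moreover have "snd c p \<in> snd c ` B \<longleftrightarrow> p \<in> B"
        by (rule inj_on_image_mem_iff[OF chart_inj[OF c] p(1) B(2)])
      ultimately show ?thesis
        unfolding D using True vol_density_change[OF pc] p c c' by (auto simp: indicator_def)
    next
      case False
      then have "x \<notin> snd c ` B" using B by blast
      then show ?thesis using False by simp
    qed
  qed
  finally show ?thesis by simp
qed

definition is_volume :: "'a measure \<Rightarrow> bool" where
  "is_volume \<mu> \<longleftrightarrow> sets \<mu> = sets borel \<and>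
     (\<forall>c\<in>charts M. \<forall>B\<in>sets borel. B \<subseteq> fst c \<longrightarrow> emeasure \<mu> B = emeasure (chart_meas c) B)"

lemma volume_alt: "volume M g = (THE \<mu>. is_volume \<mu>)"
proof -
  have "is_volume = (\<lambda>\<mu>. sets \<mu> = sets borel \<and>
        (\<forall>c\<in>charts M. \<forall>B\<in>sets borel. B \<subseteq> fst c \<longrightarrow>
           emeasure \<mu> B =
             (\<integral>\<^sup>+x\<in>snd c ` B. ennreal \<bar>vol_coeff M (metric_contact_form M g) c x\<bar> \<partial>lborel)))"
    unfolding is_volume_def
    by (intro ext conj_cong ball_cong imp_cong refl) (simp add: emeasure_chart_meas vol_density_def)
  then show ?thesis unfolding volume_def by simp
qed

text \<open>
  By second countability countably many charts suffice, and their domains can be made disjoint.  A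
  measure that is prescribed on subsets of chart domains is then determined, and it can be obtained by
  summing over the pieces.
\<close>

lemma borel_partition:
  obtains c :: "nat \<Rightarrow> 'a chart" and D where "\<And>i. c i \<in> charts M" "\<And>i. D i \<subseteq> fst (c i)"
    "\<And>i. D i \<in> sets borel" "disjoint_family D" "(\<Union>i. D i) = UNIV"
proof -
  have "(\<Union>(fst ` charts M)) = (UNIV :: 'a set)" using atlas unfolding smooth_atlas_def by blast
  moreover obtain \<F>' where F: "\<F>' \<subseteq> fst ` charts M" "countable \<F>'" "\<Union>\<F>' = \<Union>(fst ` charts M)"
    using Lindelof[of "fst ` charts M"] open_dom by blast
  ultimately have U: "\<Union>\<F>' = UNIV" by simp
  then have "\<F>' \<noteq> {}" by auto
  then have r: "range (from_nat_into \<F>') = \<F>'" using F by simp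
  have "\<forall>i. \<exists>c. c \<in> charts M \<and> fst c = from_nat_into \<F>' i"
    using F(1) r by (metis imageE rangeI subsetD)
  then obtain c where c: "\<And>i. c i \<in> charts M \<and> fst (c i) = from_nat_into \<F>' i" by metis
  then have cU: "(\<Union>i. fst (c i)) = UNIV" using U r by (metis SUP_cong)
  have cM: "c i \<in> charts M" for i using c by blast
  define D where "D = disjointed (\<lambda>i. fst (c i))"
  have Dsub: "D i \<subseteq> fst (c i)" for i unfolding D_def by (rule disjointed_subset)
  have Dborel: "D i \<in> sets borel" for i
  proof -
    have "range D \<subseteq> sets borel"
      unfolding D_def by (rule sets.range_disjointed_sets) (use open_dom[OF cM] in auto)
    then show ?thesis by blast
  qed
  have Ddis: "disjoint_family D" unfolding D_def by (rule disjoint_family_disjointed)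
  have DU: "(\<Union>i. D i) = UNIV" unfolding D_def UN_disjointed_eq cU ..
  show thesis by (rule that[OF cM Dsub Dborel Ddis DU])
qed

lemma volume_exists: "\<exists>\<mu>. is_volume \<mu>"
proof -
  obtain c D where c: "\<And>i::nat. c i \<in> charts M" and Dsub: "\<And>i. D i \<subseteq> fst (c i)"
    and Dborel: "\<And>i. D i \<in> sets borel" and Ddis: "disjoint_family D" and DU: "(\<Union>i. D i) = UNIV"
    by (rule borel_partition) (rule that)
  define F where "F = (\<lambda>B. \<integral>\<^sup>+i. emeasure (chart_meas (c i)) (B \<inter> D i) \<partial>count_space (UNIV :: nat set))"
  define \<mu> where "\<mu> = measure_of UNIV (sets borel) F"
  have sets: "sets \<mu> = sets borel" by (simp add: \<mu>_def sets_measure_of_conv sets.sigma_sets_eq[of borel, simplified])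
  have em: "emeasure \<mu> B = F B" if "B \<in> sets borel" for B
  proof (rule emeasure_measure_of[OF \<mu>_def])
    show "positive (sets \<mu>) F" by (simp add: positive_def F_def)
    show "countably_additive (sets \<mu>) F"
      unfolding countably_additive_def
    proof (intro allI impI)
      fix A :: "nat \<Rightarrow> 'a set" assume A: "range A \<subseteq> sets \<mu>" "disjoint_family A"
      have Ab: "A k \<in> sets borel" for k using A sets by auto
      have "(\<Sum>k. F (A k)) = (\<integral>\<^sup>+i. (\<Sum>k. emeasure (chart_meas (c i)) (A k \<inter> D i)) \<partial>count_space UNIV)"
        unfolding F_def by (rule nn_integral_suminf[symmetric]) simp
      also have "\<dots> = F (\<Union>k. A k)"
        unfolding F_def
      proof (intro nn_integral_cong)
        fix i
        have "(\<Sum>k. emeasure (chart_meas (c i)) (A k \<inter> D i)) = emeasure (chart_meas (c i)) (\<Union>k. A k \<inter> D i)"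
        proof (rule suminf_emeasure)
          show "disjoint_family (\<lambda>k. A k \<inter> D i)"
            using A(2) unfolding disjoint_family_on_def by blast
        qed (use Ab Dborel in auto)
        moreover have "(\<Union>k. A k \<inter> D i) = \<Union> (range A) \<inter> D i" by blast
        ultimately show "(\<Sum>k. emeasure (chart_meas (c i)) (A k \<inter> D i)) = emeasure (chart_meas (c i)) (\<Union> (range A) \<inter> D i)"
          by simp
      qed
      finally show "(\<Sum>k. F (A k)) = F (\<Union> (range A))" .
    qed
    show "B \<in> sets \<mu>" using that sets by simp
  qed auto
  have "emeasure \<mu> B = emeasure (chart_meas c') B" if c': "c' \<in> charts M" and B: "B \<in> sets borel" "B \<subseteq> fst c'" for c' B
  proof -
    have "emeasure \<mu> B = (\<integral>\<^sup>+i. emeasure (chart_meas c') (B \<inter> D i) \<partial>count_space (UNIV :: nat set))"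
      unfolding em[OF B(1)] F_def
    proof (intro nn_integral_cong chart_meas_change[OF c c'])
      show "B \<inter> D i \<in> sets borel" "B \<inter> D i \<subseteq> fst (c i)" "B \<inter> D i \<subseteq> fst c'" for i
        using B Dborel[of i] Dsub[of i] by auto
    qed
    also have "\<dots> = (\<Sum>i. emeasure (chart_meas c') (B \<inter> D i))"
      by (rule nn_integral_count_space_nat)
    also have "\<dots> = emeasure (chart_meas c') (\<Union>i. B \<inter> D i)"
    proof (rule suminf_emeasure)
      show "disjoint_family (\<lambda>i. B \<inter> D i)"
        using Ddis unfolding disjoint_family_on_def by blast
    qed (use B Dborel in auto)
    also have "(\<Union>i. B \<inter> D i) = B" using DU by auto
    finally show ?thesis .
  qed
  then show ?thesis unfolding is_volume_def using sets by blast
qed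

lemma volume_unique:
  assumes "is_volume \<mu>" "is_volume \<nu>" shows "\<mu> = \<nu>"
proof (rule measure_eqI)
  show s: "sets \<mu> = sets \<nu>" using assms unfolding is_volume_def by simp
  obtain c D where c: "\<And>i::nat. c i \<in> charts M" and Dsub: "\<And>i. D i \<subseteq> fst (c i)"
    and Dborel: "\<And>i. D i \<in> sets borel" and Ddis: "disjoint_family D" and DU: "(\<Union>i. D i) = UNIV"
    by (rule borel_partition) (rule that)
  fix B assume "B \<in> sets \<mu>"
  then have B: "B \<in> sets borel" using assms unfolding is_volume_def by simp
  have "emeasure \<kappa> B = (\<Sum>i. emeasure (chart_meas (c i)) (B \<inter> D i))" if "is_volume \<kappa>" for \<kappa>
  proof -
    have "emeasure \<kappa> (\<Union>i. B \<inter> D i) = (\<Sum>i. emeasure \<kappa> (B \<inter> D i))"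
    proof (rule suminf_emeasure[symmetric])
      show "disjoint_family (\<lambda>i. B \<inter> D i)"
        using Ddis unfolding disjoint_family_on_def by blast
    qed (use that B Dborel in \<open>auto simp: is_volume_def\<close>)
    moreover have "emeasure \<kappa> (B \<inter> D i) = emeasure (chart_meas (c i)) (B \<inter> D i)" for i
      using that B Dborel Dsub c unfolding is_volume_def by (metis inf.coboundedI2 sets.Int)
    moreover have "(\<Union>i. B \<inter> D i) = B" using DU by auto
    ultimately show ?thesis by simp
  qed
  then show "emeasure \<mu> B = emeasure \<nu> B" using assms by simp
qed

text \<open>
  Existence holds by summing over a partition into pieces of chart domains, uniqueness by countable
  additivity; so the definite description in the definition of the volume denotes this measure.
\<close>

theorem volume_well_defined: "is_volume (volume M g)"
  unfolding volume_alt by (rule theI'[OF ex_ex1I[OF volume_exists volume_unique]])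

lemma sets_volume [simp]: "sets (volume M g) = sets borel" "space (volume M g) = UNIV"
  using volume_well_defined unfolding is_volume_def by (auto dest: sets_eq_imp_space_eq)

lemma nn_integral_volume_chart:
  assumes c: "c \<in> charts M" and h: "h \<in> borel_measurable borel"
  shows "(\<integral>\<^sup>+p\<in>fst c. h p \<partial>volume M g) =
     (\<integral>\<^sup>+x. ennreal (if x \<in> snd c ` fst c then vol_density c x else 0) * h (chart_inv c x) \<partial>lborel)"
proof -
  have o: "fst c \<in> sets borel" using open_dom[OF c] by simp
  have m: "indicator (fst c) \<in> borel_measurable (volume M g)" "h \<in> borel_measurable (volume M g)"
    using o h by (auto simp: measurable_cong_sets[OF sets_volume(1) refl])
  have "density (volume M g) (indicator (fst c)) = chart_meas c"
  proof (rule measure_eqI)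
    fix B assume "B \<in> sets (density (volume M g) (indicator (fst c)))"
    then have B: "B \<in> sets borel" by simp
    then have "emeasure (density (volume M g) (indicator (fst c))) B = emeasure (volume M g) (B \<inter> fst c)"
      using m o by (subst emeasure_density) (auto simp: indicator_inter_arith[symmetric] Int_commute)
    also have "\<dots> = emeasure (chart_meas c) (B \<inter> fst c)"
      using volume_well_defined B o c unfolding is_volume_def by blast
    finally show "emeasure (density (volume M g) (indicator (fst c))) B = emeasure (chart_meas c) B"
      using emeasure_chart_meas_outside[OF c B] by simp
  qed simp
  then have "(\<integral>\<^sup>+p. h p \<partial>chart_meas c) = (\<integral>\<^sup>+p. indicator (fst c) p * h p \<partial>volume M g)"
    using nn_integral_density[OF m] by simp
  then show ?thesis using nn_integral_chart_meas[OF c h] by (simp add: mult.commute)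
qed

end

section \<open>Absolutely continuous functions\<close>

text \<open>
  The condition for one pair of bounds in the definition of absolute continuity.
\<close>

definition small_variation :: "real set \<Rightarrow> (real \<Rightarrow> 'b::metric_space) \<Rightarrow> real \<Rightarrow> real \<Rightarrow> bool" where
  "small_variation S h \<delta> \<epsilon> \<longleftrightarrow> (\<forall>(n::nat) a b.
        (\<forall>i<n. a i \<le> b i \<and> {a i..b i} \<subseteq> S) \<and>
        (\<forall>i<n. \<forall>j<n. i \<noteq> j \<longrightarrow> {a i<..<b i} \<inter> {a j<..<b j} = {}) \<and>
        (\<Sum>i<n. b i - a i) < \<delta> \<longrightarrow>
        (\<Sum>i<n. dist (h (a i)) (h (b i))) < \<epsilon>)"

lemma abs_cont_on_iff: "abs_cont_on S h \<longleftrightarrow> (\<forall>\<epsilon>>0. \<exists>\<delta>>0. small_variation S h \<delta> \<epsilon>)"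
  unfolding abs_cont_on_def small_variation_def ..

lemma small_variationD:
  fixes n :: nat and a b :: "nat \<Rightarrow> real"
  assumes "small_variation S h \<delta> \<epsilon>" "\<And>i. i < n \<Longrightarrow> a i \<le> b i \<and> {a i..b i} \<subseteq> S"
    "\<And>i j. i < n \<Longrightarrow> j < n \<Longrightarrow> i \<noteq> j \<Longrightarrow> {a i<..<b i} \<inter> {a j<..<b j} = {}"
    "(\<Sum>i<n. b i - a i) < \<delta>"
  shows "(\<Sum>i<n. dist (h (a i)) (h (b i))) < \<epsilon>"
proof -
  have "(\<forall>i<n. a i \<le> b i \<and> {a i..b i} \<subseteq> S) \<and>
        (\<forall>i<n. \<forall>j<n. i \<noteq> j \<longrightarrow> {a i<..<b i} \<inter> {a j<..<b j} = {}) \<and>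
        (\<Sum>i<n. b i - a i) < \<delta>"
    by (intro conjI allI impI assms(3,4)) (use assms(2) in blast)+
  with assms(1)[unfolded small_variation_def, THEN spec, THEN spec, THEN spec, of n a b]
  show ?thesis by (rule mp)
qed

lemma small_variationI:
  assumes "\<And>(n::nat) a b. (\<And>i. i < n \<Longrightarrow> a i \<le> b i \<and> {a i..b i} \<subseteq> S) \<Longrightarrow>
    (\<And>i j. i < n \<Longrightarrow> j < n \<Longrightarrow> i \<noteq> j \<Longrightarrow> {a i<..<b i} \<inter> {a j<..<b j} = {}) \<Longrightarrow>
    (\<Sum>i<n. b i - a i) < \<delta> \<Longrightarrow> (\<Sum>i<n. dist (h (a i)) (h (b i))) < \<epsilon>"
  shows "small_variation S h \<delta> \<epsilon>"
  unfolding small_variation_def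
proof (intro allI impI, elim conjE)
  fix n :: nat and a b :: "nat \<Rightarrow> real"
  assume A: "\<forall>i<n. a i \<le> b i \<and> {a i..b i} \<subseteq> S"
     "\<forall>i<n. \<forall>j<n. i \<noteq> j \<longrightarrow> {a i<..<b i} \<inter> {a j<..<b j} = {}" "(\<Sum>i<n. b i - a i) < \<delta>"
  show "(\<Sum>i<n. dist (h (a i)) (h (b i))) < \<epsilon>"
    by (rule assms) (use A in blast)+
qed

lemma abs_cont_on_subset:
  assumes "abs_cont_on S h" "T \<subseteq> S" shows "abs_cont_on T h"
proof -
  have "small_variation T h \<delta> \<epsilon>" if "small_variation S h \<delta> \<epsilon>" for \<delta> \<epsilon>
    by (rule small_variationI, rule small_variationD[OF that]) (use assms(2) in blast)+
  then show ?thesis using assms(1) unfolding abs_cont_on_iff by blast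
qed

lemma abs_cont_on_lipschitz_comp:
  assumes ac: "abs_cont_on S h" and L: "L > 0"
    and lip: "\<And>s t. s \<in> S \<Longrightarrow> t \<in> S \<Longrightarrow> dist (k s) (k t) \<le> L * dist (h s) (h t)"
  shows "abs_cont_on S k"
  unfolding abs_cont_on_iff
proof (intro allI impI)
  fix \<epsilon> :: real assume "\<epsilon> > 0"
  then have "\<epsilon> / L > 0" using L by simp
  then obtain \<delta> where d: "\<delta> > 0" "small_variation S h \<delta> (\<epsilon> / L)"
    using ac unfolding abs_cont_on_iff by blast
  have "small_variation S k \<delta> \<epsilon>"
  proof (rule small_variationI)
    fix n :: nat and a b :: "nat \<Rightarrow> real"
    assume A: "\<And>i. i < n \<Longrightarrow> a i \<le> b i \<and> {a i..b i} \<subseteq> S"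
      "\<And>i j. i < n \<Longrightarrow> j < n \<Longrightarrow> i \<noteq> j \<Longrightarrow> {a i<..<b i} \<inter> {a j<..<b j} = {}"
      "(\<Sum>i<n. b i - a i) < \<delta>"
    have "(\<Sum>i<n. dist (k (a i)) (k (b i))) \<le> (\<Sum>i<n. L * dist (h (a i)) (h (b i)))"
    proof (intro sum_mono lip)
      fix i assume "i \<in> {..<n}"
      then have "a i \<le> b i" "{a i..b i} \<subseteq> S" using A(1) by auto
      then show "a i \<in> S" "b i \<in> S" by auto
    qed
    also have "\<dots> = L * (\<Sum>i<n. dist (h (a i)) (h (b i)))" by (simp add: sum_distrib_left)
    also have "\<dots> < L * (\<epsilon> / L)"
      using small_variationD[OF d(2) A] L by (intro mult_strict_left_mono) auto
    finally show "(\<Sum>i<n. dist (k (a i)) (k (b i))) < \<epsilon>" using L by simp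
  qed
  then show "\<exists>\<delta>>0. small_variation S k \<delta> \<epsilon>" using d(1) by blast
qed

lemma abs_cont_on_lipschitz:
  fixes h :: "real \<Rightarrow> 'b::metric_space"
  assumes L: "L > 0" and lip: "\<And>s t. s \<in> S \<Longrightarrow> t \<in> S \<Longrightarrow> dist (h s) (h t) \<le> L * dist s t"
  shows "abs_cont_on S h"
proof (rule abs_cont_on_lipschitz_comp[OF _ L lip])
  have "small_variation S (\<lambda>t. t) \<epsilon> \<epsilon>" for \<epsilon>
  proof (rule small_variationI)
    fix n :: nat and a b :: "nat \<Rightarrow> real"
    assume A: "\<And>i. i < n \<Longrightarrow> a i \<le> b i \<and> {a i..b i} \<subseteq> S" "(\<Sum>i<n. b i - a i) < \<epsilon>"
    have "(\<Sum>i<n. dist (a i) (b i)) = (\<Sum>i<n. b i - a i)"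
      using A(1) by (intro sum.cong) (auto simp: dist_real_def)
    then show "(\<Sum>i<n. dist (a i) (b i)) < \<epsilon>" using A(2) by simp
  qed
  then show "abs_cont_on S (\<lambda>t. t)" unfolding abs_cont_on_iff by blast
qed auto

text \<open>
  A monotone Lipschitz change of parameter maps disjoint intervals to disjoint intervals whose total
  length is at most multiplied by the Lipschitz constant.
\<close>

lemma abs_cont_on_mono_comp:
  fixes l :: "real \<Rightarrow> real"
  assumes ac: "abs_cont_on T h" and T: "is_interval T" and lT: "l ` S \<subseteq> T"
    and L: "L > 0" and lip: "\<And>s t. s \<in> S \<Longrightarrow> t \<in> S \<Longrightarrow> \<bar>l s - l t\<bar> \<le> L * \<bar>s - t\<bar>"
    and mono: "mono_on S l \<or> antimono_on S l"
  shows "abs_cont_on S (h \<circ> l)"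
  unfolding abs_cont_on_iff
proof (intro allI impI)
  fix \<epsilon> :: real assume "\<epsilon> > 0"
  then obtain \<delta> where d: "\<delta> > 0" "small_variation T h \<delta> \<epsilon>"
    using ac unfolding abs_cont_on_iff by blast
  have "\<delta> / L > 0" using d L by simp
  moreover have "small_variation S (h \<circ> l) (\<delta> / L) \<epsilon>"
  proof (rule small_variationI)
    fix n :: nat and a b :: "nat \<Rightarrow> real"
    assume A: "\<And>i. i < n \<Longrightarrow> a i \<le> b i \<and> {a i..b i} \<subseteq> S"
      "\<And>i j. i < n \<Longrightarrow> j < n \<Longrightarrow> i \<noteq> j \<Longrightarrow> {a i<..<b i} \<inter> {a j<..<b j} = {}"
      "(\<Sum>i<n. b i - a i) < \<delta> / L"
    have ab: "a i \<in> S" "b i \<in> S" "a i \<le> b i" if "i < n" for i using A(1)[OF that] by auto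
    have ord: "b i \<le> a j \<or> b j \<le> a i \<or> a i = b i \<or> a j = b j" if "i < n" "j < n" "i \<noteq> j" for i j
    proof (rule ccontr)
      assume "\<not> ?thesis"
      then have "max (a i) (a j) < min (b i) (b j)" using ab[OF that(1)] ab[OF that(2)] by auto
      then obtain x where "max (a i) (a j) < x" "x < min (b i) (b j)" using dense by blast
      then have "x \<in> {a i<..<b i} \<inter> {a j<..<b j}" by auto
      then show False using A(2)[OF that] by blast
    qed
    \<comment> \<open>The image intervals, written so that both kinds of monotonicity are covered.\<close>
    define a' where "a' i = min (l (a i)) (l (b i))" for i
    define b' where "b' i = max (l (a i)) (l (b i))" for i
    have le: "a' i \<le> b' i" for i by (simp add: a'_def b'_def)
    have "(\<Sum>i<n. dist (h (a' i)) (h (b' i))) < \<epsilon>"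
    proof (rule small_variationD[OF d(2)])
      fix i assume i: "i < n"
      have "l (a i) \<in> T" "l (b i) \<in> T" using ab[OF i] lT by auto
      then have "a' i \<in> T" "b' i \<in> T" by (auto simp: a'_def b'_def min_def max_def)
      then have "x \<in> T" if "a' i \<le> x" "x \<le> b' i" for x
        using T that unfolding is_interval_1 by blast
      then have "{a' i..b' i} \<subseteq> T" by auto
      then show "a' i \<le> b' i \<and> {a' i..b' i} \<subseteq> T" using le by simp
    next
      fix i j assume ij: "i < n" "j < n" "i \<noteq> j"
      note ai = ab[OF ij(1)] and aj = ab[OF ij(2)]
      from mono show "{a' i<..<b' i} \<inter> {a' j<..<b' j} = {}"
      proof
        assume m: "mono_on S l"
        have "a' i = l (a i)" "b' i = l (b i)" "a' j = l (a j)" "b' j = l (b j)"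
          using monotone_onD[OF m ai] monotone_onD[OF m aj] by (auto simp: a'_def b'_def)
        moreover have "b i \<le> a j \<Longrightarrow> l (b i) \<le> l (a j)" "b j \<le> a i \<Longrightarrow> l (b j) \<le> l (a i)"
          using monotone_onD[OF m ai(2) aj(1)] monotone_onD[OF m aj(2) ai(1)] by auto
        ultimately show ?thesis using ord[OF ij] by auto
      next
        assume m: "antimono_on S l"
        have "b' i = l (a i)" "a' i = l (b i)" "b' j = l (a j)" "a' j = l (b j)"
          using monotone_onD[OF m ai] monotone_onD[OF m aj] by (auto simp: a'_def b'_def)
        moreover have "b i \<le> a j \<Longrightarrow> l (b i) \<ge> l (a j)" "b j \<le> a i \<Longrightarrow> l (b j) \<ge> l (a i)"
          using monotone_onD[OF m ai(2) aj(1)] monotone_onD[OF m aj(2) ai(1)] by auto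
        ultimately show ?thesis using ord[OF ij] by auto
      qed
    next
      have "(\<Sum>i<n. b' i - a' i) \<le> (\<Sum>i<n. L * (b i - a i))"
      proof (rule sum_mono)
        fix i assume "i \<in> {..<n}"
        then have i: "i < n" by simp
        have "b' i - a' i = \<bar>l (b i) - l (a i)\<bar>" by (simp add: a'_def b'_def)
        also have "\<dots> \<le> L * \<bar>b i - a i\<bar>" using ab[OF i] lip by blast
        finally show "b' i - a' i \<le> L * (b i - a i)" using ab[OF i] by simp
      qed
      also have "\<dots> = L * (\<Sum>i<n. b i - a i)" by (simp add: sum_distrib_left)
      also have "\<dots> < L * (\<delta> / L)" using A(3) L by (intro mult_strict_left_mono) auto
      finally show "(\<Sum>i<n. b' i - a' i) < \<delta>" using L by simp
    qed
    moreover have "dist (h (a' i)) (h (b' i)) = dist ((h \<circ> l) (a i)) ((h \<circ> l) (b i))" for i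
      by (simp add: a'_def b'_def min_def max_def dist_commute)
    ultimately show "(\<Sum>i<n. dist ((h \<circ> l) (a i)) ((h \<circ> l) (b i))) < \<epsilon>" by simp
  qed
  ultimately show "\<exists>\<delta>>0. small_variation S (h \<circ> l) \<delta> \<epsilon>" by blast
qed

text \<open>
  The intervals of a part of a tagged division are disjoint, so their total length is bounded by the
  measure of any set that contains them.
\<close>

lemma abs_cont_tagged_sum:
  fixes h :: "real \<Rightarrow> 'b::real_normed_vector"
  assumes p: "p tagged_division_of {a..b}" and r: "r \<subseteq> p"
    and ac: "small_variation {a..b} h \<delta> \<epsilon>"
    and O: "O' \<in> lmeasurable" "measure lebesgue O' < \<delta>" "\<And>x K. (x, K) \<in> r \<Longrightarrow> K \<subseteq> O'"
  shows "(\<Sum>(x,K)\<in>r. norm (h (Sup K) - h (Inf K))) < \<epsilon>"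
proof -
  have fin: "finite r" using p r finite_subset by blast
  have K: "\<exists>u v. u \<le> v \<and> snd z = {u..v}" if "z \<in> r" for z
  proof -
    obtain x K where z: "z = (x, K)" by fastforce
    then have xk: "(x, K) \<in> p" using that r by auto
    obtain u v where "K = cbox u v" using tagged_division_ofD(4)[OF p xk] by blast
    moreover have "x \<in> K" using tagged_division_ofD(2)[OF p xk] .
    ultimately show ?thesis using z by (auto intro!: exI[of _ u] exI[of _ v])
  qed
  then have K': "Inf (snd z) \<le> Sup (snd z) \<and> snd z = {Inf (snd z)..Sup (snd z)}" if "z \<in> r" for z
    using that by fastforce
  have sub: "snd z \<subseteq> {a..b}" if "z \<in> r" for z
    using tagged_division_ofD(3)[OF p, of "fst z" "snd z"] that r by auto
  have dis: "{Inf (snd z)<..<Sup (snd z)} \<inter> {Inf (snd w)<..<Sup (snd w)} = {}" if "z \<in> r" "w \<in> r" "z \<noteq> w" for z w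
  proof -
    have "interior (snd z) \<inter> interior (snd w) = {}"
      using tagged_division_ofD(5)[OF p, of "fst z" "snd z" "fst w" "snd w"] that r by auto
    then show ?thesis using K'[OF that(1)] K'[OF that(2)] by (metis interior_atLeastAtMost_real)
  qed
  have "(\<Sum>z\<in>r. Sup (snd z) - Inf (snd z)) = (\<Sum>z\<in>r. measure lebesgue {Inf (snd z)<..<Sup (snd z)})"
    using K' by (intro sum.cong refl) simp
  also have "\<dots> = measure lebesgue (\<Union>z\<in>r. {Inf (snd z)<..<Sup (snd z)})"
  proof (rule measure_finite_Union[symmetric, OF fin])
    show "disjoint_family_on (\<lambda>z. {Inf (snd z)<..<Sup (snd z)}) r"
      using dis unfolding disjoint_family_on_def by blast
    show "emeasure lebesgue {Inf (snd z)<..<Sup (snd z)} \<noteq> \<infinity>" if "z \<in> r" for z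
      using K'[OF that] by simp
  qed auto
  also have "\<dots> \<le> measure lebesgue O'"
  proof (rule measure_mono_fmeasurable[OF _ _ O(1)])
    show "(\<Union>z\<in>r. {Inf (snd z)<..<Sup (snd z)}) \<subseteq> O'"
    proof (rule UN_least)
      fix z assume z: "z \<in> r"
      then have "snd z \<subseteq> O'" using O(3)[of "fst z" "snd z"] by simp
      moreover have "{Inf (snd z)<..<Sup (snd z)} \<subseteq> snd z" using K'[OF z] by (metis greaterThanLessThan_subseteq_atLeastAtMost_iff order_refl)
      ultimately show "{Inf (snd z)<..<Sup (snd z)} \<subseteq> O'" by blast
    qed
  qed (use fin in auto)
  finally have tot: "(\<Sum>z\<in>r. Sup (snd z) - Inf (snd z)) < \<delta>" using O(2) by simp
  obtain e where e: "bij_betw e {..<card r} r"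
    using ex_bij_betw_nat_finite[OF fin] by (auto simp: atLeast0LessThan)
  then have er: "e i \<in> r" if "i < card r" for i using that bij_betwE by blast
  have einj: "e i \<noteq> e j" if "i < card r" "j < card r" "i \<noteq> j" for i j
    using e that unfolding bij_betw_def inj_on_def by auto
  have "(\<Sum>i<card r. dist (h (Inf (snd (e i)))) (h (Sup (snd (e i))))) < \<epsilon>"
  proof (rule small_variationD[OF ac])
    show "Inf (snd (e i)) \<le> Sup (snd (e i)) \<and> {Inf (snd (e i))..Sup (snd (e i))} \<subseteq> {a..b}" if "i < card r" for i
      using K'[OF er[OF that]] sub[OF er[OF that]] by metis
    show "{Inf (snd (e i))<..<Sup (snd (e i))} \<inter> {Inf (snd (e j))<..<Sup (snd (e j))} = {}"
      if "i < card r" "j < card r" "i \<noteq> j" for i j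
      using dis[OF er[OF that(1)] er[OF that(2)] einj[OF that]] .
    show "(\<Sum>i<card r. Sup (snd (e i)) - Inf (snd (e i))) < \<delta>"
      using tot sum.reindex_bij_betw[OF e, of "\<lambda>z. Sup (snd z) - Inf (snd z)"] by simp
  qed
  also have "(\<Sum>i<card r. dist (h (Inf (snd (e i)))) (h (Sup (snd (e i))))) = (\<Sum>z\<in>r. dist (h (Inf (snd z))) (h (Sup (snd z))))"
    by (rule sum.reindex_bij_betw[OF e])
  also have "\<dots> = (\<Sum>(x,K)\<in>r. norm (h (Sup K) - h (Inf K)))"
    by (intro sum.cong refl) (auto simp: dist_norm norm_minus_commute)
  finally show ?thesis .
qed

text \<open>
  The fundamental theorem for absolutely continuous functions.  The gauge is chosen in two ways: at
  tags outside the null set \<open>N\<close> by differentiability, at tags in \<open>N\<close> such that the intervals lie in an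
  open set of small measure, where absolute continuity bounds the increments of \<open>h\<close>.
\<close>

lemma abs_cont_has_integral:
  fixes h :: "real \<Rightarrow> 'b::euclidean_space"
  assumes ab: "a \<le> b" and ac: "abs_cont_on {a..b} h" and N: "negligible N"
    and der: "\<And>t. t \<in> {a..b} - N \<Longrightarrow> (h has_vector_derivative h' t) (at t within {a..b})"
  shows "((\<lambda>t. if t \<in> N then 0 else h' t) has_integral (h b - h a)) {a..b}"
proof -
  let ?k = "\<lambda>t. if t \<in> N then 0 else h' t"
  have "\<exists>\<gamma>. gauge \<gamma> \<and> (\<forall>p. p tagged_division_of cbox a b \<and> \<gamma> fine p \<longrightarrow>
           norm ((\<Sum>(x,K)\<in>p. measure lborel K *\<^sub>R ?k x) - (h b - h a)) < e)" if e: "e > 0" for e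
  proof -
    \<comment> \<open>The summand 1 covers the case \<open>a = b\<close>.\<close>
    define e1 where "e1 = e / (2 * (b - a + 1))"
    have e1: "e1 > 0" "e1 * (b - a) < e / 2" using e ab by (auto simp: e1_def field_simps)
    have e2: "e / 2 > 0" using e by simp
    obtain \<delta> where d: "\<delta> > 0" and D: "small_variation {a..b} h \<delta> (e / 2)"
      using ac e2 unfolding abs_cont_on_iff by blast
    have Nl: "N \<in> lmeasurable" "measure lebesgue N = 0"
      using N negligible_iff_measure by auto
    obtain O' where O: "open O'" "N \<subseteq> O'" "O' - N \<in> lmeasurable" "emeasure lebesgue (O' - N) < ennreal \<delta>"
      by (rule sets_lebesgue_outer_open[OF fmeasurableD[OF Nl(1)] d])
    have ON: "O' = (O' - N) \<union> N" using O(2) by blast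
    have Om: "O' \<in> lmeasurable" by (subst ON) (intro fmeasurable.Un O(3) Nl(1))
    have "measure lebesgue O' \<le> measure lebesgue (O' - N) + measure lebesgue N"
      using measure_Un_le[OF fmeasurableD[OF O(3)] fmeasurableD[OF Nl(1)]] ON by simp
    moreover have "measure lebesgue (O' - N) < \<delta>"
      using O(4) unfolding emeasure_eq_measure2[OF O(3)] by (simp add: ennreal_less_iff)
    ultimately have Od: "measure lebesgue O' < \<delta>" using Nl(2) by simp
    have "\<exists>r>0. ball t r \<subseteq> O'" if "t \<in> N" for t
      using O that open_contains_ball by blast
    moreover have "\<exists>r>0. \<forall>y\<in>{a..b}. norm (y - t) < r \<longrightarrow> norm (h y - h t - (y - t) *\<^sub>R h' t) \<le> e1 * norm (y - t)"
      if "t \<in> {a..b} - N" for t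
      using der[OF that] e1 unfolding has_vector_derivative_def has_derivative_within_alt by blast
    ultimately have "\<exists>r>0. (t \<in> N \<longrightarrow> ball t r \<subseteq> O') \<and> (t \<in> {a..b} - N \<longrightarrow>
        (\<forall>y\<in>{a..b}. norm (y - t) < r \<longrightarrow> norm (h y - h t - (y - t) *\<^sub>R h' t) \<le> e1 * norm (y - t)))" for t
      by (cases "t \<in> N"; cases "t \<in> {a..b}") (auto intro: exI[of _ "1::real"])
    then obtain r where rr: "\<And>t. r t > 0 \<and> (t \<in> N \<longrightarrow> ball t (r t) \<subseteq> O') \<and> (t \<in> {a..b} - N \<longrightarrow>
        (\<forall>y\<in>{a..b}. norm (y - t) < r t \<longrightarrow> norm (h y - h t - (y - t) *\<^sub>R h' t) \<le> e1 * norm (y - t)))"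
      by metis
    then have r: "\<And>t. t \<in> N \<Longrightarrow> r t > 0 \<and> ball t (r t) \<subseteq> O'"
      "\<And>t. t \<in> {a..b} - N \<Longrightarrow> r t > 0 \<and> (\<forall>y\<in>{a..b}. norm (y - t) < r t \<longrightarrow> norm (h y - h t - (y - t) *\<^sub>R h' t) \<le> e1 * norm (y - t))"
      by blast+
    define \<gamma> where "\<gamma> t = ball t (if t \<in> N \<or> t \<in> {a..b} then r t else 1)" for t
    have gauge: "gauge \<gamma>"
      unfolding \<gamma>_def gauge_def using r by auto
    have "norm ((\<Sum>(x,K)\<in>p. measure lborel K *\<^sub>R ?k x) - (h b - h a)) < e"
      if p: "p tagged_division_of cbox a b" and fine: "\<gamma> fine p" for p
    proof -
      have p': "p tagged_division_of {a..b}" using p by simp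
      have fin: "finite p" using p by blast
      let ?T = "\<lambda>(x::real,K). measure lborel K *\<^sub>R ?k x - (h (Sup K) - h (Inf K))"
      define r1 where "r1 = {z\<in>p. fst z \<in> N}"
      define r2 where "r2 = {z\<in>p. fst z \<notin> N}"
      have "(\<Sum>(x,K)\<in>p. measure lborel K *\<^sub>R ?k x) - (h b - h a) = (\<Sum>z\<in>p. ?T z)"
        using additive_tagged_division_1[OF ab p', of h]
        by (simp add: sum_subtractf split_def)
      moreover have "(\<Sum>z\<in>r1 \<union> r2. ?T z) = (\<Sum>z\<in>r1. ?T z) + (\<Sum>z\<in>r2. ?T z)"
        using fin by (intro sum.union_disjoint) (auto simp: r1_def r2_def)
      moreover have "p = r1 \<union> r2" by (auto simp: r1_def r2_def)
      ultimately have eq: "(\<Sum>(x,K)\<in>p. measure lborel K *\<^sub>R ?k x) - (h b - h a) = (\<Sum>z\<in>r1. ?T z) + (\<Sum>z\<in>r2. ?T z)"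
        by metis
      have "norm (\<Sum>z\<in>r1. ?T z) \<le> (\<Sum>(x,K)\<in>r1. norm (h (Sup K) - h (Inf K)))"
        by (rule sum_norm_le) (auto simp: r1_def norm_minus_commute)
      also have "\<dots> < e / 2"
      proof (rule abs_cont_tagged_sum[OF p' _ D Om Od])
        show "r1 \<subseteq> p" by (auto simp: r1_def)
        show "K \<subseteq> O'" if "(x, K) \<in> r1" for x K
        proof -
          have "x \<in> N" and xp: "(x, K) \<in> p" using that by (auto simp: r1_def)
          then have "K \<subseteq> ball x (r x)" using fineD[OF fine xp] by (simp add: \<gamma>_def)
          then show ?thesis using r(1)[OF \<open>x \<in> N\<close>] by blast
        qed
      qed
      finally have 1: "norm (\<Sum>z\<in>r1. ?T z) < e / 2" .
      have "norm (?T z) \<le> e1 * measure lborel (snd z)" if z: "z \<in> r2" for z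
      proof -
        obtain x K where xK: "z = (x, K)" by fastforce
        have xp: "(x, K) \<in> p" and xN: "x \<notin> N" using z xK by (auto simp: r2_def)
        obtain u v where uv: "K = {u..v}" using tagged_division_ofD(4)[OF p xp] by auto
        have xKin: "x \<in> {u..v}" using tagged_division_ofD(2)[OF p xp] uv by simp
        have Kab: "{u..v} \<subseteq> {a..b}" using tagged_division_ofD(3)[OF p xp] uv by simp
        have xab: "x \<in> {a..b} - N" using xKin Kab xN by blast
        have Kb: "K \<subseteq> ball x (r x)" using fineD[OF fine xp] xab by (simp add: \<gamma>_def)
        have "u \<in> K" "v \<in> K" using uv xKin by auto
        then have "u \<in> ball x (r x)" "v \<in> ball x (r x)" using Kb by blast+
        then have near: "norm (u - x) < r x" "norm (v - x) < r x"
          by (auto simp: dist_real_def)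
        have uvab: "u \<in> {a..b}" "v \<in> {a..b}" using xKin Kab by auto
        have A: "norm (h v - h x - (v - x) *\<^sub>R h' x) \<le> e1 * (v - x)"
          "norm (h u - h x - (u - x) *\<^sub>R h' x) \<le> e1 * (x - u)"
        proof -
          have nv: "norm (v - x) = v - x" "norm (u - x) = x - u" using xKin by auto
          show "norm (h v - h x - (v - x) *\<^sub>R h' x) \<le> e1 * (v - x)"
            using r(2)[OF xab] near(2) uvab(2) nv(1) by metis
          show "norm (h u - h x - (u - x) *\<^sub>R h' x) \<le> e1 * (x - u)"
            using r(2)[OF xab] near(1) uvab(1) nv(2) by metis
        qed
        have "?T z = - (h v - h x - (v - x) *\<^sub>R h' x) + (h u - h x - (u - x) *\<^sub>R h' x)"
          using xK uv xKin xN by (simp add: algebra_simps)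
        also have "norm \<dots> \<le> e1 * (v - x) + e1 * (x - u)"
          using A by (intro norm_triangle_le add_mono) (auto simp: norm_minus_commute)
        also have "\<dots> = e1 * measure lborel (snd z)" using xK uv xKin by (simp add: algebra_simps)
        finally show ?thesis .
      qed
      then have "norm (\<Sum>z\<in>r2. ?T z) \<le> (\<Sum>z\<in>r2. e1 * measure lborel (snd z))"
        by (rule sum_norm_le)
      also have "\<dots> \<le> (\<Sum>z\<in>p. e1 * measure lborel (snd z))"
        using fin e1 by (intro sum_mono2) (auto simp: r2_def)
      also have "\<dots> = e1 * (\<Sum>(x,K)\<in>p. measure lborel K)" by (simp add: sum_distrib_left split_def)
      also have "(\<Sum>(x,K)\<in>p. measure lborel K) = measure lborel (cbox a b)"
        by (rule additive_content_tagged_division[OF p])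
      also have "e1 * measure lborel (cbox a b) < e / 2" using e1 ab by simp
      finally have 2: "norm (\<Sum>z\<in>r2. ?T z) < e / 2" .
      show ?thesis unfolding eq using norm_triangle_ineq[of "\<Sum>z\<in>r1. ?T z" "\<Sum>z\<in>r2. ?T z"] 1 2 by linarith
    qed
    then show ?thesis using gauge by blast
  qed
  then have "(?k has_integral (h b - h a)) (cbox a b)" unfolding has_integral by blast
  then show ?thesis by simp
qed

lemma has_integral_norm_le_nn_integral:
  fixes k :: "real \<Rightarrow> 'b::euclidean_space"
  assumes k: "(k has_integral I) S"
  shows "ennreal (norm I) \<le> (\<integral>\<^sup>+t\<in>S. ennreal (norm (k t)) \<partial>lebesgue)"
proof (cases "(\<integral>\<^sup>+t\<in>S. ennreal (norm (k t)) \<partial>lebesgue) < \<infinity>")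
  case True
  let ?f = "\<lambda>x. indicator S x *\<^sub>R k x"
  have eq: "(\<integral>\<^sup>+t\<in>S. ennreal (norm (k t)) \<partial>lebesgue) = (\<integral>\<^sup>+t. ennreal (norm (?f t)) \<partial>lebesgue)"
    by (intro nn_integral_cong) (auto simp: indicator_def)
  have "integrable lebesgue ?f"
    by (rule integrableI_bounded[OF has_integral_implies_lebesgue_measurable[OF k]]) (use True eq in simp)
  then have si: "set_integrable lebesgue S k" unfolding set_integrable_def .
  have "I = integral\<^sup>L lebesgue ?f"
    using set_lebesgue_integral_eq_integral(2)[OF si] k unfolding set_lebesgue_integral_def
    by (simp add: integral_unique)
  then show ?thesis
    using integral_norm_bound_ennreal[OF \<open>integrable lebesgue ?f\<close>] eq by simp
next
  case False
  then show ?thesis by (simp add: less_top[symmetric])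
qed

section \<open>Upper densities of finite measures\<close>

text \<open>
  The set \<open>En n\<close> of points with some ball of density larger than \<open>n + 1\<close> is covered by the fivefold
  enlargements of disjoint such balls.  Comparing with the total mass, its outer measure is at most
  a constant divided by \<open>n + 1\<close>, and the intersection of all these sets is negligible.
\<close>

lemma density_bounded_ae:
  fixes \<nu> :: "'a::euclidean_space measure"
  assumes nu: "sets \<nu> = sets borel" "finite_measure \<nu>"
  shows "\<exists>E. negligible E \<and> (\<forall>z. z \<notin> E \<longrightarrow> (\<exists>\<Lambda>>0. \<forall>r. 0 < r \<longrightarrow> r \<le> 1 \<longrightarrow> measure \<nu> (cball z r) \<le> \<Lambda> * r ^ DIM('a)))"
proof -
  interpret finite_measure \<nu> by fact
  let ?d = "DIM('a)"
  define En where "En n = {z. \<exists>r>0. r \<le> 1 \<and> measure \<nu> (cball z r) > real (Suc n) * r ^ ?d}" for n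
  define E where "E = (\<Inter>n. En n)"
  define \<omega> where "\<omega> = unit_ball_vol (real ?d)"
  define B where "B = 5 ^ ?d * \<omega> * measure \<nu> (space \<nu>)"
  have om: "\<omega> \<ge> 0" by (simp add: \<omega>_def)
  have cov: "\<exists>T. En n \<subseteq> T \<and> T \<in> lmeasurable \<and> measure lebesgue T \<le> B / real (Suc n)" for n
  proof -
    have "\<forall>z\<in>En n. \<exists>r>0. r \<le> 1 \<and> measure \<nu> (cball z r) > real (Suc n) * r ^ ?d" by (auto simp: En_def)
    then obtain r where r: "\<And>z. z \<in> En n \<Longrightarrow> 0 < r z \<and> r z \<le> 1 \<and> measure \<nu> (cball z (r z)) > real (Suc n) * r z ^ ?d"
      by metis
    have "En n \<subseteq> (\<Union>i\<in>En n. cball i (r i))" using r by (force intro: less_imp_le)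
    then obtain C where C: "countable C" "C \<subseteq> En n"
      "pairwise (\<lambda>i j. disjnt (cball i (r i)) (cball j (r j))) C" "En n \<subseteq> (\<Union>i\<in>C. cball i (5 * r i))"
      using Vitali_covering_lemma_cballs[where S="En n" and K="En n" and a="\<lambda>i. i" and r=r and B=1] r by auto
    have bound: "measure lebesgue (\<Union>i\<in>I. cball i (5 * r i)) \<le> B / real (Suc n)" if I: "I \<subseteq> C" "finite I" for I
    proof -
      have "measure lebesgue (\<Union>i\<in>I. cball i (5 * r i)) \<le> (\<Sum>i\<in>I. measure lebesgue (cball i (5 * r i)))"
        using I by (intro measure_UNION_le) auto
      also have "\<dots> \<le> (\<Sum>i\<in>I. 5 ^ ?d * \<omega> / real (Suc n) * measure \<nu> (cball i (r i)))"
      proof (rule sum_mono)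
        fix i assume "i \<in> I"
        then have ri: "0 < r i" "real (Suc n) * r i ^ ?d \<le> measure \<nu> (cball i (r i))"
          using I C r by (meson in_mono less_imp_le)+
        have "measure lebesgue (cball i (5 * r i)) = \<omega> * (5 * r i) ^ ?d"
          using ri by (simp add: \<omega>_def content_cball)
        also have "\<dots> = 5 ^ ?d * \<omega> / real (Suc n) * (real (Suc n) * r i ^ ?d)"
          by (simp add: power_mult_distrib del: of_nat_Suc)
        also have "\<dots> \<le> 5 ^ ?d * \<omega> / real (Suc n) * measure \<nu> (cball i (r i))"
          by (rule mult_left_mono[OF ri(2)]) (use om in simp)
        finally show "measure lebesgue (cball i (5 * r i)) \<le> 5 ^ ?d * \<omega> / real (Suc n) * measure \<nu> (cball i (r i))" .
      qed
      also have "\<dots> = 5 ^ ?d * \<omega> / real (Suc n) * (\<Sum>i\<in>I. measure \<nu> (cball i (r i)))"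
        by (simp add: sum_distrib_left)
      also have "(\<Sum>i\<in>I. measure \<nu> (cball i (r i))) = measure \<nu> (\<Union>i\<in>I. cball i (r i))"
      proof (rule measure_finite_Union[symmetric])
        show "disjoint_family_on (\<lambda>i. cball i (r i)) I"
          using C(3) I unfolding disjoint_family_on_def pairwise_def disjnt_def by blast
      qed (use I nu in auto)
      also have "5 ^ ?d * \<omega> / real (Suc n) * measure \<nu> (\<Union>i\<in>I. cball i (r i)) \<le> 5 ^ ?d * \<omega> / real (Suc n) * measure \<nu> (space \<nu>)"
        by (rule mult_left_mono[OF bounded_measure]) (use om in simp)
      finally show ?thesis by (simp add: B_def)
    qed
    have m: "cball i (5 * r i) \<in> lmeasurable" for i by simp
    show ?thesis
      using C(4) fmeasurable_UN_bound[OF C(1) m bound] measure_UN_bound[OF C(1) m bound] by blast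
  qed
  have "negligible E"
    unfolding negligible_outer_le
  proof (intro allI impI)
    fix e :: real assume e: "e > 0"
    obtain n where n: "B / e < real n" using reals_Archimedean2 by blast
    then have "B / real (Suc n) \<le> e" using e by (simp add: field_simps) 
    then show "\<exists>T. E \<subseteq> T \<and> T \<in> lmeasurable \<and> measure lebesgue T \<le> e"
      using cov[of n] unfolding E_def by (meson INF_lower UNIV_I order_trans)
  qed
  moreover have "\<exists>\<Lambda>>0. \<forall>r. 0 < r \<longrightarrow> r \<le> 1 \<longrightarrow> measure \<nu> (cball z r) \<le> \<Lambda> * r ^ ?d" if z: "z \<notin> E" for z
  proof -
    obtain n where "z \<notin> En n" using z unfolding E_def by blast
    then have "\<forall>r. 0 < r \<longrightarrow> r \<le> 1 \<longrightarrow> measure \<nu> (cball z r) \<le> real (Suc n) * r ^ ?d"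
      unfolding En_def by (metis (mono_tags, lifting) mem_Collect_eq not_le)
    then show ?thesis by (intro exI[of _ "real (Suc n)"]) simp
  qed
  ultimately show ?thesis by blast
qed

section \<open>Smooth maps into a manifold\<close>

text \<open>
  The image of the vector \<open>u\<close> under the differential of \<open>F\<close> at \<open>z\<close>.
\<close>

definition push :: "'a cr_struct \<Rightarrow> ('e::euclidean_space \<Rightarrow> 'a) \<Rightarrow> 'e \<Rightarrow> 'e \<Rightarrow> 'a tvec" where
  "push M F z u = (\<lambda>c. if c \<in> charts_at M (F z) then frechet_derivative (snd c \<circ> F) (at z) u else 0)"

lemma interval_at_within_nonbot:
  fixes I :: "real set"
  assumes "is_interval I" "interior I \<noteq> {}" "t \<in> I"
  shows "at t within I \<noteq> bot"
proof -
  have "convex I" using assms(1) by (simp add: is_interval_convex_1)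
  obtain y where y: "y \<in> interior I" using assms(2) by blast
  have "t islimpt I"
  proof (cases "y = t")
    case True
    then show ?thesis using y interior_limit_point by blast
  next
    case False
    have "connected I" using \<open>convex I\<close> by (rule convex_connected)
    moreover have "y \<in> I" using y interior_subset by blast
    ultimately show ?thesis using connected_imp_perfect[of I] assms(3) False by blast
  qed
  then show ?thesis by (simp add: trivial_limit_within)
qed

lemma real_has_vector_derivative_frechet:
  fixes f :: "real \<Rightarrow> 'b::real_normed_vector"
  assumes "(f has_derivative frechet_derivative f (at t)) (at t)"
  shows "(f has_vector_derivative frechet_derivative f (at t) 1) (at t within S)"
proof -
  have "linear (frechet_derivative f (at t))" using assms by (rule has_derivative_linear)
  then have "frechet_derivative f (at t) r = r *\<^sub>R frechet_derivative f (at t) 1" for r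
    using linear_scale[of "frechet_derivative f (at t)" r 1] by simp
  then have "frechet_derivative f (at t) = (\<lambda>r. r *\<^sub>R frechet_derivative f (at t) 1)"
    by (rule ext)
  then have "(f has_vector_derivative frechet_derivative f (at t) 1) (at t)"
    unfolding has_vector_derivative_def using assms by simp
  then show ?thesis by (rule has_vector_derivative_at_within)
qed

lemma isCont_eventually_dist:
  fixes f :: "'c::metric_space \<Rightarrow> 'd::metric_space"
  assumes "isCont f x" "e > 0"
  shows "\<forall>\<^sub>F y in nhds x. dist (f y) (f x) < e"
  using assms unfolding continuous_at_eps_delta eventually_nhds_metric by blast

lemma linear_inv_of_bij:
  assumes f: "linear f" and b: "bij f" shows "linear (inv f)"
proof (rule linearI)
  have s: "f (inv f x) = x" for x using b by (simp add: bij_is_surj surj_f_inv_f)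
  have i: "inv f (f x) = x" for x using b by (simp add: bij_is_inj)
  show "inv f (x + y) = inv f x + inv f y" for x y
    using i[of "inv f x + inv f y"] linear_add[OF f, of "inv f x" "inv f y"] s by simp
  show "inv f (r *\<^sub>R x) = r *\<^sub>R inv f x" for r x
    using i[of "r *\<^sub>R inv f x"] linear_scale[OF f, of r "inv f x"] s by simp
qed

context smooth_manifold
begin

lemma smooth_map_open_preimage:
  assumes F: "smooth_map M D F" and D: "open D" and W: "open W"
  shows "open (D \<inter> F -` W)"
  using F D W unfolding smooth_map_def by (auto intro: continuous_open_preimage)

lemma smooth_map_coord:
  "smooth_map M D F \<Longrightarrow> c \<in> charts M \<Longrightarrow> smooth_on (D \<inter> F -` fst c) (snd c \<circ> F)"
  unfolding smooth_map_def by blast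

lemma smooth_map_subset: "smooth_map M D F \<Longrightarrow> D' \<subseteq> D \<Longrightarrow> smooth_map M D' F"
  unfolding smooth_map_def by (auto intro: continuous_on_subset smooth_on_subset)

lemma smooth_map_has_derivative:
  assumes F: "smooth_map M D F" and z: "z \<in> D" and c: "c \<in> charts_at M (F z)"
  shows "((snd c \<circ> F) has_derivative frechet_derivative (snd c \<circ> F) (at z)) (at z)"
  by (rule smooth_on_has_derivative[OF smooth_map_coord[OF F]]) (use z c in \<open>auto simp: charts_at_iff\<close>)

lemma smooth_map_comp:
  fixes m :: "'e::euclidean_space \<Rightarrow> 'd::euclidean_space"
  assumes F: "smooth_map M D F" and D: "open D" and m: "smooth_on S m" and S: "open S" "m ` S \<subseteq> D"
  shows "smooth_map M S (F \<circ> m)"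
  unfolding smooth_map_def
proof (intro conjI ballI)
  have contF: "continuous_on D F" using F unfolding smooth_map_def by blast
  have contm: "continuous_on S m" by (rule smooth_on_continuous_on[OF m])
  show "continuous_on S (F \<circ> m)"
    by (rule continuous_on_compose[OF contm continuous_on_subset[OF contF S(2)]])
  fix c assume c: "c \<in> charts M"
  have o: "open (D \<inter> F -` fst c)" by (rule smooth_map_open_preimage[OF F D open_dom[OF c]])
  have "S \<inter> (F \<circ> m) -` fst c = S \<inter> m -` (D \<inter> F -` fst c)" using S(2) by auto
  then have o': "open (S \<inter> (F \<circ> m) -` fst c)"
    using continuous_open_preimage[OF contm S(1) o] by simp
  have "smooth_on (S \<inter> (F \<circ> m) -` fst c) ((snd c \<circ> F) \<circ> m)"
  proof (rule smooth_on_comp[OF _ smooth_map_coord[OF F c] o' o])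
    show "smooth_on (S \<inter> (F \<circ> m) -` fst c) m" by (rule smooth_on_subset[OF m]) auto
    show "m ` (S \<inter> (F \<circ> m) -` fst c) \<subseteq> D \<inter> F -` fst c" using S(2) by auto
  qed
  then show "smooth_on (S \<inter> (F \<circ> m) -` fst c) (snd c \<circ> (F \<circ> m))" by (simp add: o_assoc)
qed

lemma push_eq_tangent_vec:
  assumes F: "smooth_map M D F" and D: "open D" and z: "z \<in> D" and c: "c \<in> charts_at M (F z)"
  shows "push M F z u = tangent_vec M (F z) c (frechet_derivative (snd c \<circ> F) (at z) u)"
proof
  fix c'
  show "push M F z u c' = tangent_vec M (F z) c (frechet_derivative (snd c \<circ> F) (at z) u) c'"
  proof (cases "c' \<in> charts_at M (F z)")
    case True
    have cc: "c \<in> charts M" "F z \<in> fst c" "c' \<in> charts M" "F z \<in> fst c'" using c True by (auto simp: charts_at_iff)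
    have "((snd c' \<circ> chart_inv c) \<circ> (snd c \<circ> F) has_derivative
       (\<lambda>v. tangent_vec M (F z) c v c') \<circ> frechet_derivative (snd c \<circ> F) (at z)) (at z)"
      by (rule diff_chain_at[OF smooth_map_has_derivative[OF F z c]])
         (use tangent_vec_has_derivative[OF c True] in simp)
    then have "((snd c' \<circ> F) has_derivative
       (\<lambda>v. tangent_vec M (F z) c v c') \<circ> frechet_derivative (snd c \<circ> F) (at z)) (at z)"
      by (rule has_derivative_transform_within_open[OF _ smooth_map_open_preimage[OF F D open_dom[OF cc(1)]]])
         (use z cc in auto)
    from frechet_derivative_at[OF this] True show ?thesis by (simp add: push_def fun_eq_iff)
  qed (simp add: push_def tangent_vec_outside)
qed

lemma push_in_tangent:
  assumes F: "smooth_map M D F" and D: "open D" and z: "z \<in> D"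
  shows "push M F z u \<in> tangent_space M (F z)"
proof -
  obtain c where c: "c \<in> charts_at M (F z)" using chart_at_exists by blast
  show ?thesis unfolding push_eq_tangent_vec[OF F D z c] by (rule tangent_vec_in[OF c])
qed

text \<open>
  The velocity of a curve is defined by one-sided derivatives at end points of the parameter interval.
  A nondegenerate interval has no isolated points, so these agree with the derivative of any smooth
  extension.
\<close>

lemma velocity_eq_push:
  assumes F: "smooth_map M S F" and S: "open S" "I \<subseteq> S" and eq: "\<And>t. t \<in> I \<Longrightarrow> F t = \<gamma> t"
    and I: "is_interval I" "interior I \<noteq> {}" and t: "t \<in> I"
  shows "velocity M (I, \<gamma>) t = push M F t 1"
    and "c \<in> charts_at M (\<gamma> t) \<Longrightarrow> (snd c \<circ> \<gamma> has_vector_derivative push M F t 1 c) (at t within I)"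
proof -
  have nb: "at t within I \<noteq> bot" by (rule interval_at_within_nonbot[OF I t])
  have d: "(snd c \<circ> \<gamma> has_vector_derivative push M F t 1 c) (at t within I)" if c: "c \<in> charts_at M (\<gamma> t)" for c
  proof -
    have "(snd c \<circ> F has_vector_derivative frechet_derivative (snd c \<circ> F) (at t) 1) (at t within I)"
      by (rule real_has_vector_derivative_frechet[OF smooth_map_has_derivative[OF F]])
         (use S t c eq in auto)
    then have "(snd c \<circ> \<gamma> has_vector_derivative frechet_derivative (snd c \<circ> F) (at t) 1) (at t within I)"
      by (rule has_vector_derivative_transform[OF t, rotated]) (simp add: eq)
    then show ?thesis using c eq[OF t] by (simp add: push_def)
  qed
  then show "c \<in> charts_at M (\<gamma> t) \<Longrightarrow> (snd c \<circ> \<gamma> has_vector_derivative push M F t 1 c) (at t within I)" .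
  show "velocity M (I, \<gamma>) t = push M F t 1"
  proof
    fix c show "velocity M (I, \<gamma>) t c = push M F t 1 c"
    proof (cases "c \<in> charts_at M (\<gamma> t)")
      case True
      then show ?thesis using vector_derivative_within[OF nb d[OF True]] by (simp add: velocity_def)
    next
      case False
      then show ?thesis using eq[OF t] by (simp add: velocity_def push_def)
    qed
  qed
qed

end

section \<open>Local trivialisations of fibrations by curves\<close>

text \<open>
  The local data in the definition of a smooth fibration.  The model fibre is the line or the circle
  of length 1; in both cases \<open>\<Psi>\<close> is injective on \<open>D\<close> times an open interval of length at most 1.
\<close>

locale trivialisation = smooth_manifold M for M :: "'a::{t2_space,second_countable_topology} cr_struct" +
  fixes D :: "(real^2) set" and \<Psi> :: "(real^2) \<times> real \<Rightarrow> 'a" and P :: "real set"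
  assumes openD: "open D" and P: "P = {0} \<or> P = \<int>"
    and smooth: "smooth_map M (D \<times> UNIV) \<Psi>"
    and bij: "\<And>z c. z \<in> D \<times> UNIV \<Longrightarrow> c \<in> charts_at M (\<Psi> z) \<Longrightarrow> bij (frechet_derivative (snd c \<circ> \<Psi>) (at z))"
    and fib: "\<And>z z'. z \<in> D \<times> UNIV \<Longrightarrow> z' \<in> D \<times> UNIV \<Longrightarrow>
        \<Psi> z = \<Psi> z' \<longleftrightarrow> fst z = fst z' \<and> snd z - snd z' \<in> P"
begin

lemma open_cyl: "open (D \<times> (UNIV :: real set))" using openD by (simp add: open_Times)

lemma cont_Psi: "continuous_on (D \<times> UNIV) \<Psi>" using smooth unfolding smooth_map_def by blast

lemma P_small: "x \<in> P \<Longrightarrow> \<bar>x\<bar> < 1 \<Longrightarrow> x = 0"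
  using P Ints_nonzero_abs_less1 by fastforce

lemma inj_slab:
  assumes "t - s \<le> 1" shows "inj_on \<Psi> (D \<times> {s<..<t})"
proof (rule inj_onI)
  fix z z' assume z: "z \<in> D \<times> {s<..<t}" "z' \<in> D \<times> {s<..<t}" "\<Psi> z = \<Psi> z'"
  then have "fst z = fst z'" "snd z - snd z' \<in> P" using fib[of z z'] by auto
  moreover have "\<bar>snd z - snd z'\<bar> < 1" using z assms by auto
  ultimately show "z = z'" using P_small[of "snd z - snd z'"] by (simp add: prod_eq_iff)
qed

definition slab :: "'a chart \<Rightarrow> real \<Rightarrow> real \<Rightarrow> ((real^2) \<times> real) set" where
  "slab c s t = (D \<times> {s<..<t}) \<inter> \<Psi> -` fst c"

lemma slab_sub: "slab c s t \<subseteq> D \<times> UNIV" by (auto simp: slab_def)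

lemma open_slab: "c \<in> charts M \<Longrightarrow> open (slab c s t)"
  unfolding slab_def
  by (rule smooth_map_open_preimage[OF smooth_map_subset[OF smooth] _ open_dom]) (auto simp: openD open_Times)

lemma slab_homeo:
  assumes c: "c \<in> charts M" and st: "t - s \<le> 1" and Z: "open Z" "Z \<subseteq> slab c s t"
  obtains g where "homeomorphism Z ((snd c \<circ> \<Psi>) ` Z) (snd c \<circ> \<Psi>) g" "open ((snd c \<circ> \<Psi>) ` Z)"
proof -
  have cont: "continuous_on Z (snd c \<circ> \<Psi>)"
    by (rule continuous_on_subset[OF smooth_on_continuous_on[OF smooth_map_coord[OF smooth c]]])
       (use Z in \<open>auto simp: slab_def\<close>)
  have inj: "inj_on (snd c \<circ> \<Psi>) Z"
  proof (rule comp_inj_on)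
    show "inj_on \<Psi> Z" by (rule inj_on_subset[OF inj_slab[OF st]]) (use Z in \<open>auto simp: slab_def\<close>)
    show "inj_on (snd c) (\<Psi> ` Z)" by (rule inj_on_subset[OF chart_inj[OF c]]) (use Z in \<open>auto simp: slab_def\<close>)
  qed
  have dim: "DIM(real^3) \<le> DIM((real^2) \<times> real)" by simp
  obtain g where "homeomorphism Z ((snd c \<circ> \<Psi>) ` Z) (snd c \<circ> \<Psi>) g"
    using invariance_of_domain_homeomorphism[OF Z(1) cont dim inj] by blast
  moreover have "open ((snd c \<circ> \<Psi>) ` Z)" by (rule invariance_of_domain_gen[OF Z(1) cont inj dim])
  ultimately show thesis using that by blast
qed

text \<open>
  Invariance of domain, applied in charts: source and target have dimension 3.
\<close>

lemma open_image:
  assumes st: "t - s \<le> 1" and Z: "open Z" "Z \<subseteq> D \<times> {s<..<t}"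
  shows "open (\<Psi> ` Z)"
proof -
  have eq: "\<Psi> ` Z = (\<Union>c\<in>charts M. fst c \<inter> snd c -` ((snd c \<circ> \<Psi>) ` (Z \<inter> slab c s t)))"
  proof (intro equalityI subsetI)
    fix p assume "p \<in> \<Psi> ` Z"
    then obtain z where z: "z \<in> Z" "p = \<Psi> z" by blast
    obtain c where "c \<in> charts_at M p" using chart_at_exists by blast
    then show "p \<in> (\<Union>c\<in>charts M. fst c \<inter> snd c -` ((snd c \<circ> \<Psi>) ` (Z \<inter> slab c s t)))"
      using z Z by (auto simp: charts_at_iff slab_def)
  next
    fix p assume "p \<in> (\<Union>c\<in>charts M. fst c \<inter> snd c -` ((snd c \<circ> \<Psi>) ` (Z \<inter> slab c s t)))"
    then obtain c z where c: "c \<in> charts M" "p \<in> fst c" "z \<in> Z" "z \<in> slab c s t" "snd c p = snd c (\<Psi> z)" by auto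
    then have "p = \<Psi> z" using inj_onD[OF chart_inj[OF c(1)], of p "\<Psi> z"] by (auto simp: slab_def)
    then show "p \<in> \<Psi> ` Z" using c by blast
  qed
  have "open (fst c \<inter> snd c -` ((snd c \<circ> \<Psi>) ` (Z \<inter> slab c s t)))" if c: "c \<in> charts M" for c
  proof -
    have "open (Z \<inter> slab c s t)" using Z(1) open_slab[OF c] by blast
    then have "open ((snd c \<circ> \<Psi>) ` (Z \<inter> slab c s t))"
      using slab_homeo[OF c st, of "Z \<inter> slab c s t"] by blast
    then show ?thesis by (rule continuous_open_preimage[OF cont_chart[OF c] open_dom[OF c]])
  qed
  then show ?thesis unfolding eq by blast
qed

text \<open>
  The local inverse of \<open>\<Psi>\<close>, read in a chart.  It is differentiable because the differentials of \<open>\<Psi>\<close>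
  are bijective.
\<close>

definition slab_inv :: "'a chart \<Rightarrow> real \<Rightarrow> real \<Rightarrow> real^3 \<Rightarrow> (real^2) \<times> real" where
  "slab_inv c s t = inv_into (slab c s t) (snd c \<circ> \<Psi>)"

definition coord_slab :: "'a chart \<Rightarrow> real \<Rightarrow> real \<Rightarrow> (real^3) set" where
  "coord_slab c s t = (snd c \<circ> \<Psi>) ` slab c s t"

context
  fixes c s t assumes c: "c \<in> charts M" and st: "t - s \<le> (1::real)"
begin

lemma open_coord_slab: "open (coord_slab c s t)"
  unfolding coord_slab_def using slab_homeo[OF c st open_slab[OF c] order_refl] by blast

lemma inj_coord: "inj_on (snd c \<circ> \<Psi>) (slab c s t)"
proof -
  obtain g where "homeomorphism (slab c s t) ((snd c \<circ> \<Psi>) ` slab c s t) (snd c \<circ> \<Psi>) g"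
    using slab_homeo[OF c st open_slab[OF c] order_refl] by blast
  then show ?thesis by (intro inj_on_inverseI[of _ g] homeomorphism_apply1)
qed

lemma slab_inv_coord: "z \<in> slab c s t \<Longrightarrow> slab_inv c s t (snd c (\<Psi> z)) = z"
  using inv_into_f_f[OF inj_coord] by (simp add: slab_inv_def)

lemma slab_inv_in: "y \<in> coord_slab c s t \<Longrightarrow> slab_inv c s t y \<in> slab c s t"
  and coord_slab_inv: "y \<in> coord_slab c s t \<Longrightarrow> snd c (\<Psi> (slab_inv c s t y)) = y"
  using slab_inv_coord by (auto simp: coord_slab_def)

lemma cont_slab_inv: "continuous_on (coord_slab c s t) (slab_inv c s t)"
proof -
  obtain g where g: "homeomorphism (slab c s t) (coord_slab c s t) (snd c \<circ> \<Psi>) g"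
    using slab_homeo[OF c st open_slab[OF c] order_refl] unfolding coord_slab_def by blast
  then have "g y = slab_inv c s t y" if "y \<in> coord_slab c s t" for y
    using that slab_inv_coord unfolding homeomorphism_def by (metis coord_slab_inv slab_inv_in o_apply)
  moreover have "continuous_on (coord_slab c s t) g" using g unfolding homeomorphism_def by blast
  ultimately show ?thesis using continuous_on_cong by metis
qed

lemma slab_inv_has_derivative:
  assumes z: "z \<in> slab c s t"
  shows "(slab_inv c s t has_derivative inv (frechet_derivative (snd c \<circ> \<Psi>) (at z))) (at (snd c (\<Psi> z)))"
proof -
  let ?G = "snd c \<circ> \<Psi>" and ?f' = "frechet_derivative (snd c \<circ> \<Psi>) (at z)"
  have zc: "z \<in> D \<times> UNIV" "c \<in> charts_at M (\<Psi> z)" using z c by (auto simp: slab_def charts_at_iff)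
  have y: "snd c (\<Psi> z) \<in> coord_slab c s t" using z by (auto simp: coord_slab_def)
  have d: "(?G has_derivative ?f') (at z)" by (rule smooth_map_has_derivative[OF smooth zc])
  have b: "bij ?f'" by (rule bij[OF zc])
  have lin: "linear ?f'" using d by (rule has_derivative_linear)
  have "linear (inv ?f')" using lin b by (rule linear_inv_of_bij)
  show ?thesis
  proof (rule has_derivative_inverse_basic[where f = ?G and f' = ?f' and T = "coord_slab c s t"])
    show "(?G has_derivative ?f') (at (slab_inv c s t (snd c (\<Psi> z))))" using d slab_inv_coord[OF z] by simp
    show "bounded_linear (inv ?f')"
      using \<open>linear (inv ?f')\<close> by (rule linear_conv_bounded_linear[THEN iffD1])
    show "inv ?f' \<circ> ?f' = id" using b by (simp add: bij_is_inj)
    show "continuous (at (snd c (\<Psi> z))) (slab_inv c s t)"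
      using cont_slab_inv open_coord_slab y by (simp add: continuous_on_eq_continuous_at)
  qed (use y open_coord_slab coord_slab_inv in auto)
qed

end

text \<open>
  The velocity of the vertical curve \<open>\<tau> \<mapsto> \<Psi> (d, \<tau>)\<close>.
\<close>

definition vert :: "(real^2) \<times> real \<Rightarrow> 'a tvec" where
  "vert z = push M \<Psi> z (0, 1)"

lemma vert_tangent: "z \<in> D \<times> UNIV \<Longrightarrow> vert z \<in> tangent_space M (\<Psi> z)"
  unfolding vert_def by (rule push_in_tangent[OF smooth open_cyl])

lemma vert_coord: "c \<in> charts_at M (\<Psi> z) \<Longrightarrow> vert z c = frechet_derivative (snd c \<circ> \<Psi>) (at z) (0, 1)"
  by (simp add: vert_def push_def)

lemma deriv_linear: "z \<in> D \<times> UNIV \<Longrightarrow> c \<in> charts_at M (\<Psi> z) \<Longrightarrow> linear (frechet_derivative (snd c \<circ> \<Psi>) (at z))"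
  by (rule has_derivative_linear[OF smooth_map_has_derivative[OF smooth]])

lemma vert_coord_nonzero:
  assumes "z \<in> D \<times> UNIV" "c \<in> charts_at M (\<Psi> z)"
  shows "vert z c \<noteq> 0"
proof
  assume "vert z c = 0"
  then have "frechet_derivative (snd c \<circ> \<Psi>) (at z) (0, 1) = frechet_derivative (snd c \<circ> \<Psi>) (at z) 0"
    using linear_0[OF deriv_linear[OF assms]] vert_coord[OF assms(2)] by simp
  from injD[OF bij_is_inj[OF bij[OF assms]] this] show False by (simp add: zero_prod_def)
qed

lemma vert_nonzero: "z \<in> D \<times> UNIV \<Longrightarrow> vert z \<noteq> zero_vec"
  using vert_coord_nonzero chart_at_exists[of "\<Psi> z"] unfolding zero_vec_def by metis

text \<open>
  A regular curve in a fibre is, near each parameter, a reparametrisation of the vertical curve by a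
  function \<open>l\<close> whose derivative does not vanish.  This transfers absolute continuity from vertical
  curves to all parametrisations of a fibre, and it shows that vertical curves are Legendrian.
  The function \<open>l\<close> is the second component of the local inverse of \<open>\<Psi>\<close>, applied to a smooth
  extension \<open>\<gamma>'\<close> of the curve beyond end points of \<open>I\<close>; only at points of \<open>I\<close> is the first component
  known to be constant.
\<close>

lemma fibre_lift:
  assumes reg: "regular_legendrian M (I, \<gamma>)" and tr: "\<gamma> ` I \<subseteq> \<Psi> ` ({d} \<times> UNIV)" and d: "d \<in> D"
    and t0: "t0 \<in> I" and \<tau>0: "\<Psi> (d, \<tau>0) = \<gamma> t0" and eps: "\<epsilon> > 0"
  obtains r l L k where "r > 0" "L > (0::real)" "k \<noteq> 0"
    "\<And>t. t \<in> I \<inter> {t0-r..t0+r} \<Longrightarrow> \<gamma> t = \<Psi> (d, l t) \<and> \<bar>l t - \<tau>0\<bar> < \<epsilon>"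
    "mono_on (I \<inter> {t0-r..t0+r}) l \<or> antimono_on (I \<inter> {t0-r..t0+r}) l"
    "\<And>x y. x \<in> I \<inter> {t0-r..t0+r} \<Longrightarrow> y \<in> I \<inter> {t0-r..t0+r} \<Longrightarrow> \<bar>l x - l y\<bar> \<le> L * \<bar>x - y\<bar>"
    "velocity M (I, \<gamma>) t0 = lin_comb k (vert (d, \<tau>0)) 0 (vert (d, \<tau>0))"
proof -
  have I: "is_interval I" "interior I \<noteq> {}"
    and vne: "\<And>t. t \<in> I \<Longrightarrow> velocity M (I, \<gamma>) t \<noteq> zero_vec"
    and "\<exists>S \<gamma>'. open S \<and> I \<subseteq> S \<and> smooth_map M S \<gamma>' \<and> (\<forall>t\<in>I. \<gamma>' t = \<gamma> t)"
    using reg unfolding regular_legendrian_def by blast+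
  then obtain S \<gamma>' where S: "open S" "I \<subseteq> S" "smooth_map M S \<gamma>'" "\<And>t. t \<in> I \<Longrightarrow> \<gamma>' t = \<gamma> t"
    by blast
  obtain c where ct: "c \<in> charts_at M (\<gamma> t0)" using chart_at_exists by blast
  then have c: "c \<in> charts M" and ct0: "\<gamma> t0 \<in> fst c" by (auto simp: charts_at_iff)
  let ?s = "\<tau>0 - 1/2" and ?t = "\<tau>0 + 1/2"
  have st: "?t - ?s \<le> 1" by simp
  have z0: "(d, \<tau>0) \<in> slab c ?s ?t" using d \<tau>0 ct0 by (simp add: slab_def)
  let ?q = "snd c \<circ> \<gamma>'" and ?g = "slab_inv c ?s ?t" and ?G = "snd c \<circ> \<Psi>"
  let ?q' = "\<lambda>t. frechet_derivative ?q (at t) 1"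
  define T1 where "T1 = S \<inter> \<gamma>' -` fst c"
  have T1: "open T1" unfolding T1_def by (rule smooth_map_open_preimage[OF S(3,1) open_dom[OF c]])
  have qs: "smooth_on T1 ?q" unfolding T1_def by (rule smooth_map_coord[OF S(3) c])
  define S1 where "S1 = T1 \<inter> ?q -` coord_slab c ?s ?t"
  have S1: "open S1"
    unfolding S1_def by (rule continuous_open_preimage[OF smooth_on_continuous_on[OF qs] T1 open_coord_slab[OF c st]])
  have t0S1: "t0 \<in> S1"
  proof -
    have "snd c (\<gamma> t0) \<in> coord_slab c ?s ?t" unfolding coord_slab_def \<tau>0[symmetric] using z0 by auto
    then show ?thesis using t0 S ct0 by (auto simp: S1_def T1_def)
  qed
  define w where "w t = ?g (?q t)" for t
  have w: "w t \<in> slab c ?s ?t" "\<Psi> (w t) = \<gamma>' t" "w t \<in> D \<times> UNIV" "c \<in> charts_at M (\<Psi> (w t))" "snd c (\<Psi> (w t)) = ?q t" if t: "t \<in> S1" for t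
  proof -
    have qt: "?q t \<in> coord_slab c ?s ?t" "\<gamma>' t \<in> fst c" using t by (auto simp: S1_def T1_def)
    show ws: "w t \<in> slab c ?s ?t" unfolding w_def by (rule slab_inv_in[OF c st qt(1)])
    show cw: "snd c (\<Psi> (w t)) = ?q t" unfolding w_def by (rule coord_slab_inv[OF c st qt(1)])
    have "\<Psi> (w t) \<in> fst c" using ws by (simp add: slab_def)
    then show e: "\<Psi> (w t) = \<gamma>' t" using inj_onD[OF chart_inj[OF c]] cw qt(2) by auto
    show "w t \<in> D \<times> UNIV" using ws slab_sub by blast
    show "c \<in> charts_at M (\<Psi> (w t))" using e qt c by (simp add: charts_at_iff)
  qed
  have fstw: "fst (w t) = d" "\<gamma> t = \<Psi> (d, snd (w t))" if t: "t \<in> I" "t \<in> S1" for t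
  proof -
    obtain \<sigma> where "\<gamma> t = \<Psi> (d, \<sigma>)" using tr t by auto
    then have "\<Psi> (w t) = \<Psi> (d, \<sigma>)" using w(2)[OF t(2)] S(4)[OF t(1)] by simp
    then show "fst (w t) = d" using fib[OF w(3)[OF t(2)], of "(d, \<sigma>)"] d by simp
    then show "\<gamma> t = \<Psi> (d, snd (w t))" using w(2)[OF t(2)] S(4)[OF t(1)] by (metis prod.collapse)
  qed
  have wt0: "w t0 = (d, \<tau>0)"
    using slab_inv_coord[OF c st z0] \<tau>0 S(4)[OF t0] by (simp add: w_def)
  let ?w' = "\<lambda>t. inv (frechet_derivative ?G (at (w t))) (?q' t)"
  define l where "l t = snd (w t)" for t
  define l' where "l' t = snd (?w' t)" for t
  have qder: "(?q has_derivative frechet_derivative ?q (at t)) (at t)" if "t \<in> S1" for t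
    using that by (intro smooth_on_has_derivative[OF qs]) (simp add: S1_def)
  have wder: "(w has_vector_derivative ?w' t) (at t)" if t: "t \<in> S1" for t
  proof -
    have qv: "(?q has_vector_derivative ?q' t) (at t)"
      using real_has_vector_derivative_frechet[OF qder[OF t], of UNIV] .
    have gd: "(?g has_derivative inv (frechet_derivative ?G (at (w t)))) (at (?q t))"
      using slab_inv_has_derivative[OF c st w(1)[OF t]] w(5)[OF t] by simp
    have "(?g \<circ> ?q has_derivative inv (frechet_derivative ?G (at (w t))) \<circ> (\<lambda>h. h *\<^sub>R ?q' t)) (at t)"
      by (rule diff_chain_at[OF qv[unfolded has_vector_derivative_def] gd])
    moreover have "inv (frechet_derivative ?G (at (w t))) \<circ> (\<lambda>h. h *\<^sub>R ?q' t) = (\<lambda>h. h *\<^sub>R ?w' t)"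
      using linear_scale[OF has_derivative_linear[OF gd]] by auto
    moreover have "?g \<circ> ?q = w" by (auto simp: w_def)
    ultimately show ?thesis unfolding has_vector_derivative_def by simp
  qed
  have lder: "(l has_real_derivative l' t) (at t)" if t: "t \<in> S1" for t
  proof -
    have "((\<lambda>t. snd (w t)) has_vector_derivative snd (?w' t)) (at t)"
      using bounded_linear.has_vector_derivative[OF bounded_linear_snd wder[OF t]] .
    then show ?thesis unfolding l_def l'_def by (simp add: has_real_derivative_iff_has_vector_derivative)
  qed
  \<comment> \<open>The first component of the lift is constant on \<open>I\<close>, so the velocity is vertical.\<close>
  have q'eq: "?q' t = l' t *\<^sub>R vert (w t) c" if t: "t \<in> I" "t \<in> S1" for t
  proof -
    have nb: "at t within I \<noteq> bot" by (rule interval_at_within_nonbot[OF I t(1)])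
    have "((\<lambda>t. fst (w t)) has_vector_derivative fst (?w' t)) (at t within I)"
      by (rule has_vector_derivative_at_within[OF bounded_linear.has_vector_derivative[OF bounded_linear_fst wder[OF t(2)]]])
    moreover have "((\<lambda>t. fst (w t)) has_vector_derivative 0) (at t within I)"
    proof -
      obtain e where e: "e > 0" "ball t e \<subseteq> S1" using S1 t(2) open_contains_ball by blast
      have c0: "((\<lambda>t. d) has_vector_derivative 0) (at t within I)" by simp
      show ?thesis
      proof (rule has_vector_derivative_transform_within[OF c0 e(1) t(1)])
        fix x assume "x \<in> I" "dist x t < e"
        then show "d = fst (w x)" using fstw(1)[of x] e(2) by (auto simp: dist_commute)
      qed
    qed
    ultimately have "fst (?w' t) = 0" using vector_derivative_unique_within[OF nb] by blast
    then have "?w' t = l' t *\<^sub>R (0, 1)" by (simp add: prod_eq_iff l'_def)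
    moreover have "frechet_derivative ?G (at (w t)) (?w' t) = ?q' t"
      using bij[OF w(3,4)[OF t(2)]] by (simp add: bij_is_surj surj_f_inv_f)
    ultimately have "?q' t = frechet_derivative ?G (at (w t)) (l' t *\<^sub>R (0, 1))" by simp
    also have "\<dots> = l' t *\<^sub>R vert (w t) c"
      unfolding vert_coord[OF w(4)[OF t(2)]] by (rule linear_scale[OF deriv_linear[OF w(3,4)[OF t(2)]]])
    finally show ?thesis .
  qed
  have vel: "velocity M (I, \<gamma>) t0 = push M \<gamma>' t0 1"
    by (rule velocity_eq_push(1)[OF S(3,1,2,4) I t0])
  have velT: "push M \<gamma>' t0 1 \<in> tangent_space M (\<gamma> t0)"
    using push_in_tangent[OF S(3,1), of t0 1] t0 S by auto
  have velc: "push M \<gamma>' t0 1 c = ?q' t0" using ct S(4)[OF t0] by (simp add: push_def)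
  have q0: "?q' t0 \<noteq> 0"
    using tangent_vec_zeroD[OF ct velT] velc vne[OF t0] vel by auto
  define v where "v = ?q' t0"
  have vv: "v \<bullet> v > 0" using q0 by (simp add: v_def)
  \<comment> \<open>Both the velocity and \<open>vert\<close> are compared with the fixed vector \<open>v\<close>.  Their inner products with
      \<open>v\<close> stay away from 0 near \<open>t0\<close>, and \<open>l'\<close> is their quotient.\<close>
  define m where "m = vert (d, \<tau>0) c \<bullet> v"
  have lm: "v \<bullet> v = l' t0 * m"
    using q'eq[OF t0 t0S1] wt0 by (simp add: v_def m_def)
  then have k0: "l' t0 \<noteq> 0" and m0: "m \<noteq> 0" using vv by auto
  have A: "isCont (\<lambda>t. ?q' t \<bullet> v) t0"
  proof -
    have "continuous_on T1 (\<lambda>t. ?q' t \<bullet> v)"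
      by (intro continuous_on_inner smooth_on_continuous_on[OF smooth_on_frechet_derivative[OF qs]] continuous_on_const)
    then show ?thesis using T1 t0S1 by (simp add: continuous_on_eq_continuous_at S1_def)
  qed
  have wcont: "isCont w t0" using wder[OF t0S1] has_vector_derivative_continuous by blast
  have Bc: "isCont (\<lambda>t. frechet_derivative ?G (at (w t)) (0, 1) \<bullet> v) t0"
  proof -
    have "smooth_on ((D \<times> UNIV) \<inter> \<Psi> -` fst c) (\<lambda>z. frechet_derivative ?G (at z) (0, 1))"
      by (rule smooth_on_frechet_derivative[OF smooth_map_coord[OF smooth c]])
    then have "continuous_on ((D \<times> UNIV) \<inter> \<Psi> -` fst c) (\<lambda>z. frechet_derivative ?G (at z) (0, 1))"
      by (rule smooth_on_continuous_on)
    moreover have "open ((D \<times> UNIV) \<inter> \<Psi> -` fst c)"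
      by (rule smooth_map_open_preimage[OF smooth open_cyl open_dom[OF c]])
    moreover have "w t0 \<in> (D \<times> UNIV) \<inter> \<Psi> -` fst c" using w(1)[OF t0S1] by (auto simp: slab_def)
    ultimately have "isCont (\<lambda>z. frechet_derivative ?G (at z) (0, 1)) (w t0)"
      by (simp add: continuous_on_eq_continuous_at)
    then show ?thesis using isCont_o2[OF wcont] by (intro continuous_inner continuous_const) blast
  qed
  have lc: "isCont l t0" using lder[OF t0S1] by (rule DERIV_isCont)
  have "\<forall>\<^sub>F t in nhds t0. t \<in> S1" using S1 t0S1 by (rule eventually_nhds_in_open)
  moreover have "\<forall>\<^sub>F t in nhds t0. dist (?q' t \<bullet> v) (?q' t0 \<bullet> v) < v \<bullet> v"
    by (rule isCont_eventually_dist[OF A vv])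
  moreover have "\<forall>\<^sub>F t in nhds t0. dist (frechet_derivative ?G (at (w t)) (0, 1) \<bullet> v) (frechet_derivative ?G (at (w t0)) (0, 1) \<bullet> v) < \<bar>m\<bar> / 2"
    by (rule isCont_eventually_dist[OF Bc]) (use m0 in simp)
  moreover have "\<forall>\<^sub>F t in nhds t0. dist (l t) (l t0) < \<epsilon>"
    by (rule isCont_eventually_dist[OF lc eps])
  ultimately have "\<forall>\<^sub>F t in nhds t0. t \<in> S1 \<and> dist (?q' t \<bullet> v) (?q' t0 \<bullet> v) < v \<bullet> v \<and>
     dist (frechet_derivative ?G (at (w t)) (0, 1) \<bullet> v) (frechet_derivative ?G (at (w t0)) (0, 1) \<bullet> v) < \<bar>m\<bar> / 2 \<and> dist (l t) (l t0) < \<epsilon>"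
    by eventually_elim blast
  then obtain r0 where r0: "r0 > 0" and near: "\<And>t. dist t t0 < r0 \<Longrightarrow> t \<in> S1 \<and> dist (?q' t \<bullet> v) (?q' t0 \<bullet> v) < v \<bullet> v \<and>
     dist (frechet_derivative ?G (at (w t)) (0, 1) \<bullet> v) (frechet_derivative ?G (at (w t0)) (0, 1) \<bullet> v) < \<bar>m\<bar> / 2 \<and> dist (l t) (l t0) < \<epsilon>"
    unfolding eventually_nhds_metric by blast
  \<comment> \<open>Halved, because the closed interval around \<open>t0\<close> must lie in the open one of radius \<open>r0\<close>.\<close>
  define r where "r = r0 / 2"
  define J where "J = I \<inter> {t0-r..t0+r}"
  define L where "L = 2 * (v \<bullet> v) / (\<bar>m\<bar> / 2)"
  have Jn: "dist t t0 < r0" if "t \<in> J" for t using that r0 by (auto simp: J_def r_def dist_real_def)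
  have JS: "t \<in> S1" "t \<in> I" if "t \<in> J" for t using near[OF Jn[OF that]] that by (auto simp: J_def)
  have l'b: "m * l' t > 0 \<and> \<bar>l' t\<bar> \<le> L" if t: "t \<in> J" for t
  proof -
    note n = near[OF Jn[OF t]]
    define a where "a = ?q' t \<bullet> v"
    define b where "b = vert (w t) c \<bullet> v"
    have "\<bar>a - v \<bullet> v\<bar> < v \<bullet> v" using n by (simp add: a_def dist_real_def v_def)
    then have a: "a > 0" "a < 2 * (v \<bullet> v)" by auto
    have "\<bar>b - m\<bar> < \<bar>m\<bar> / 2"
      using n wt0 vert_coord[OF w(4)[OF JS(1)[OF t]]] vert_coord[OF w(4)[OF t0S1]] by (simp add: b_def m_def dist_real_def)
    then have b: "\<bar>b\<bar> > \<bar>m\<bar> / 2" "m * b > 0" using m0 by (auto simp: abs_if zero_less_mult_iff split: if_splits)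
    have ab: "a = l' t * b" using q'eq[OF JS(2,1)[OF t]] by (simp add: a_def b_def)
    have e: "(m * l' t) * (b * b) = (m * b) * a" unfolding ab by (simp add: algebra_simps)
    have "(m * l' t) * (b * b) > 0" unfolding e by (rule mult_pos_pos[OF b(2) a(1)])
    moreover have "b * b \<ge> 0" by simp
    ultimately have 1: "m * l' t > 0" by (metis not_less zero_less_mult_iff)
    have "\<bar>l' t\<bar> * (\<bar>m\<bar> / 2) \<le> \<bar>l' t\<bar> * \<bar>b\<bar>" using b by (intro mult_left_mono) auto
    also have "\<dots> = a" using ab a by (simp add: abs_mult[symmetric])
    finally have "\<bar>l' t\<bar> * (\<bar>m\<bar> / 2) \<le> 2 * (v \<bullet> v)" using a by simp
    then have "\<bar>l' t\<bar> \<le> L" unfolding L_def using m0 by (simp add: pos_le_divide_eq)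
    then show ?thesis using 1 by blast
  qed
  have Jint: "x \<in> J" if "a \<in> J" "b \<in> J" "a \<le> x" "x \<le> b" for a b x
    using that I(1) unfolding is_interval_1 J_def by auto
  have mvt: "\<exists>\<xi>\<in>J. l y - l x = (y - x) * l' \<xi>" if xy: "x \<in> J" "y \<in> J" "x < y" for x y
  proof -
    have "(l has_real_derivative l' t) (at t)" if "x \<le> t" "t \<le> y" for t
      using lder JS Jint[OF xy(1,2) that] by blast
    from MVT2[OF xy(3) this] obtain \<xi> where "x < \<xi>" "\<xi> < y" "l y - l x = (y - x) * l' \<xi>" by auto
    then show ?thesis using Jint[OF xy(1,2), of \<xi>] by auto
  qed
  have Lpos: "L > 0" using vv m0 by (simp add: L_def)
  show thesis
  proof (rule that[of r L "l' t0" l])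
    show "r > 0" using r0 by (simp add: r_def)
    show "L > 0" "l' t0 \<noteq> 0" by fact+
    show "\<gamma> t = \<Psi> (d, l t) \<and> \<bar>l t - \<tau>0\<bar> < \<epsilon>" if "t \<in> I \<inter> {t0-r..t0+r}" for t
    proof -
      have t: "t \<in> J" using that by (simp add: J_def)
      show ?thesis using fstw(2)[OF JS(2,1)[OF t]] near[OF Jn[OF t]] wt0 by (simp add: l_def dist_real_def)
    qed
    show "mono_on (I \<inter> {t0-r..t0+r}) l \<or> antimono_on (I \<inter> {t0-r..t0+r}) l"
    proof (cases "m > 0")
      case True
      have "mono_on J l"
      proof (rule mono_onI)
        fix x y assume xy: "x \<in> J" "y \<in> J" "x \<le> y"
        show "l x \<le> l y"
        proof (cases "x = y")
          case False
          then obtain \<xi> where x: "\<xi> \<in> J" "l y - l x = (y - x) * l' \<xi>" using mvt[OF xy(1,2)] xy by auto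
          have "l' \<xi> > 0" using l'b[OF x(1)] True by (simp add: zero_less_mult_iff)
          then have "(y - x) * l' \<xi> \<ge> 0" using xy by simp
          then show ?thesis using x by simp
        qed simp
      qed
      then show ?thesis by (simp add: J_def)
    next
      case False
      have "antimono_on J l"
      proof (rule monotone_onI)
        fix x y assume xy: "x \<in> J" "y \<in> J" "x \<le> y"
        show "l y \<le> l x"
        proof (cases "x = y")
          case F: False
          then obtain \<xi> where x: "\<xi> \<in> J" "l y - l x = (y - x) * l' \<xi>" using mvt[OF xy(1,2)] xy by auto
          have "l' \<xi> < 0" using l'b[OF x(1)] False by (simp add: zero_less_mult_iff)
          then have "(y - x) * l' \<xi> \<le> 0" using xy by (intro mult_nonneg_nonpos) auto
          then show ?thesis using x by simp
        qed simp
      qed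
      then show ?thesis by (simp add: J_def)
    qed
    show "\<bar>l x - l y\<bar> \<le> L * \<bar>x - y\<bar>" if "x \<in> I \<inter> {t0-r..t0+r}" "y \<in> I \<inter> {t0-r..t0+r}" for x y
    proof -
      have lip: "\<bar>l x - l y\<bar> \<le> L * \<bar>x - y\<bar>" if xy: "x \<in> J" "y \<in> J" "x < y" for x y
      proof -
        obtain \<xi> where x: "\<xi> \<in> J" "l y - l x = (y - x) * l' \<xi>" using mvt[OF xy] by auto
        have "\<bar>l x - l y\<bar> = \<bar>y - x\<bar> * \<bar>l' \<xi>\<bar>" using x(2) abs_mult[of "y - x" "l' \<xi>"] abs_minus_commute[of "l x" "l y"] by simp
        also have "\<dots> \<le> \<bar>y - x\<bar> * L" using l'b[OF x(1)] by (intro mult_left_mono) auto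
        finally show ?thesis by (simp add: mult.commute abs_minus_commute)
      qed
      consider "x < y" | "y < x" | "x = y" by linarith
      then show ?thesis
      proof cases
        case 1 then show ?thesis using lip[of x y] that by (simp add: J_def)
      next
        case 2 then show ?thesis using lip[of y x] that by (simp add: J_def abs_minus_commute)
      qed simp
    qed
    have T: "vert (d, \<tau>0) \<in> tangent_space M (\<gamma> t0)" using vert_tangent[of "(d, \<tau>0)"] d \<tau>0 by simp
    show "velocity M (I, \<gamma>) t0 = lin_comb (l' t0) (vert (d, \<tau>0)) 0 (vert (d, \<tau>0))"
      unfolding vel
    proof (rule tangent_eqI[OF velT lin_comb_in[OF T T] ct])
      show "push M \<gamma>' t0 1 c = lin_comb (l' t0) (vert (d, \<tau>0)) 0 (vert (d, \<tau>0)) c"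
        unfolding velc using q'eq[OF t0 t0S1] wt0 by (simp add: lin_comb_def)
    qed
  qed
qed

end

section \<open>Lengths of rectifiable curves in charts\<close>

lemma smooth_on_locally_lipschitz:
  fixes f :: "'e::euclidean_space \<Rightarrow> 'f::euclidean_space"
  assumes f: "smooth_on S f" and S: "open S" and x: "x \<in> S"
  obtains \<rho> L where "\<rho> > 0" "L > (0::real)" "cball x \<rho> \<subseteq> S"
    "\<And>y z. y \<in> cball x \<rho> \<Longrightarrow> z \<in> cball x \<rho> \<Longrightarrow> dist (f y) (f z) \<le> L * dist y z"
proof -
  obtain \<rho> where r: "\<rho> > 0" "cball x \<rho> \<subseteq> S" using S x open_contains_cball by blast
  let ?N = "\<lambda>y. \<Sum>b\<in>Basis. norm (frechet_derivative f (at y) b)"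
  have contb: "continuous_on (cball x \<rho>) (\<lambda>y. frechet_derivative f (at y) b)" for b
    by (rule continuous_on_subset[OF smooth_on_continuous_on[OF smooth_on_frechet_derivative[OF f]] r(2)])
  have "continuous_on (cball x \<rho>) ?N"
    by (intro continuous_on_sum continuous_on_norm contb)
  then have "compact (?N ` cball x \<rho>)" by (rule compact_continuous_image[OF _ compact_cball])
  then have "bounded (?N ` cball x \<rho>)" by (rule compact_imp_bounded)
  then obtain B where "\<forall>r\<in>?N ` cball x \<rho>. norm r \<le> B" unfolding bounded_iff by blast
  then have B: "norm (?N y) \<le> B" if "y \<in> cball x \<rho>" for y using that by (rule bspec[OF _ imageI])
  define L where "L = max B 1"
  have der: "(f has_derivative frechet_derivative f (at y)) (at y)" if "y \<in> cball x \<rho>" for y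
    using smooth_on_has_derivative[OF f] that r by blast
  have on: "onorm (frechet_derivative f (at y)) \<le> L" if y: "y \<in> cball x \<rho>" for y
  proof (rule onorm_le)
    fix v
    interpret linear "frechet_derivative f (at y)" by (rule has_derivative_linear[OF der[OF y]])
    have "norm (frechet_derivative f (at y) v) = norm (\<Sum>b\<in>Basis. (v \<bullet> b) *\<^sub>R frechet_derivative f (at y) b)"
      by (subst euclidean_representation[of v, symmetric]) (simp only: sum scale)
    also have "\<dots> \<le> (\<Sum>b\<in>Basis. norm v * norm (frechet_derivative f (at y) b))"
      by (intro sum_norm_le) (simp add: mult_right_mono Basis_le_norm)
    also have "\<dots> = norm v * ?N y" by (simp add: sum_distrib_left)
    also have "\<dots> \<le> norm v * L" using B[OF y] by (intro mult_left_mono) (auto simp: L_def)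
    finally show "norm (frechet_derivative f (at y) v) \<le> L * norm v" by (simp add: mult.commute)
  qed
  have "dist (f y) (f z) \<le> L * dist y z" if "y \<in> cball x \<rho>" "z \<in> cball x \<rho>" for y z
  proof -
    have "norm (f y - f z) \<le> L * norm (y - z)"
      by (rule differentiable_bound[OF convex_cball _ on that]) (use der in \<open>blast intro: has_derivative_at_withinI\<close>)
    then show ?thesis by (simp add: dist_norm)
  qed
  then show thesis using r that[of \<rho> L] by (auto simp: L_def)
qed

lemma abs_cont_on_continuous:
  fixes h :: "real \<Rightarrow> 'b::metric_space"
  assumes h: "abs_cont_on S h" and S: "is_interval S" and x: "x \<in> S" and e: "\<epsilon> > 0"
  shows "\<exists>\<delta>>0. \<forall>y\<in>S. \<bar>y - x\<bar> < \<delta> \<longrightarrow> dist (h x) (h y) < \<epsilon>"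
proof -
  obtain \<delta> where d: "\<delta> > 0" "small_variation S h \<delta> \<epsilon>" using h e unfolding abs_cont_on_iff by blast
  have "dist (h x) (h y) < \<epsilon>" if y: "y \<in> S" "\<bar>y - x\<bar> < \<delta>" for y
  proof -
    let ?a = "min x y" and ?b = "max x y"
    have ab: "?a \<in> S" "?b \<in> S" using x y by (auto simp: min_def max_def)
    have sub: "{?a..?b} \<subseteq> S"
    proof
      fix z assume "z \<in> {?a..?b}"
      then show "z \<in> S" using S ab unfolding is_interval_1 by (metis atLeastAtMost_iff)
    qed
    have "(\<Sum>i<Suc 0. dist (h ?a) (h ?b)) < \<epsilon>"
      by (rule small_variationD[OF d(2)]) (use sub y in auto)
    then show ?thesis by (simp add: min_def max_def dist_commute split: if_splits)
  qed
  then show ?thesis using d(1) by blast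
qed

context smooth_manifold
begin

lemma smooth_curve_abs_cont:
  assumes F: "smooth_map M S F" and S: "open S" "I \<subseteq> S" and eq: "\<And>t. t \<in> I \<Longrightarrow> F t = \<gamma> t"
  shows "abs_cont_curve M (I, \<gamma>)"
  unfolding abs_cont_curve_def
proof (clarify)
  fix t assume t: "t \<in> I"
  obtain c where "c \<in> charts_at M (F t)" using chart_at_exists by blast
  then have c: "c \<in> charts M" "F t \<in> fst c" by (auto simp: charts_at_iff)
  let ?T = "S \<inter> F -` fst c"
  have T: "open ?T" "t \<in> ?T" using smooth_map_open_preimage[OF F S(1) open_dom[OF c(1)]] t S c by auto
  obtain \<rho> L where r: "\<rho> > 0" "L > (0::real)" "cball t \<rho> \<subseteq> ?T"
    and lip: "\<And>y z. y \<in> cball t \<rho> \<Longrightarrow> z \<in> cball t \<rho> \<Longrightarrow> dist ((snd c \<circ> F) y) ((snd c \<circ> F) z) \<le> L * dist y z"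
    using smooth_on_locally_lipschitz[OF smooth_map_coord[OF F c(1)] T] by blast
  have cb: "{t-\<rho>..t+\<rho>} = cball t \<rho>" by (simp add: cball_eq_atLeastAtMost)
  have "abs_cont_on (I \<inter> {t-\<rho>..t+\<rho>}) (snd c \<circ> \<gamma>)"
  proof (rule abs_cont_on_lipschitz[OF r(2)])
    fix x y assume "x \<in> I \<inter> {t-\<rho>..t+\<rho>}" "y \<in> I \<inter> {t-\<rho>..t+\<rho>}"
    then show "dist ((snd c \<circ> \<gamma>) x) ((snd c \<circ> \<gamma>) y) \<le> L * dist x y"
      using lip[of x y] eq unfolding cb by simp
  qed
  moreover have "\<gamma> ` (I \<inter> {t-\<rho>..t+\<rho>}) \<subseteq> fst c"
    using r(3) eq unfolding cb by force
  ultimately show "\<exists>c\<in>charts M. \<exists>r>0. \<gamma> ` (I \<inter> {t-r..t+r}) \<subseteq> fst c \<and> abs_cont_on (I \<inter> {t-r..t+r}) (snd c \<circ> \<gamma>)"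
    using c(1) r(1) by blast
qed

text \<open>
  The definition provides some chart around each parameter; since coordinate changes are locally
  Lipschitz, every other chart does as well.
\<close>

lemma abs_cont_change_chart:
  assumes ac: "abs_cont_curve M (I, q)" and I: "is_interval I" and t: "t \<in> I"
    and c: "c \<in> charts M" and qc: "q t \<in> fst c"
  shows "\<exists>r>0. abs_cont_on (I \<inter> {t-r..t+r}) (snd c \<circ> q)"
proof -
  obtain c' r where c': "c' \<in> charts M" "r > 0" "q ` (I \<inter> {t-r..t+r}) \<subseteq> fst c'"
    and acc: "abs_cont_on (I \<inter> {t-r..t+r}) (snd c' \<circ> q)"
    using ac t unfolding abs_cont_curve_def by auto
  let ?J = "I \<inter> {t-r..t+r}" and ?\<tau> = "snd c \<circ> chart_inv c'" and ?O = "snd c' ` (fst c' \<inter> fst c)"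
  have tJ: "t \<in> ?J" using t c' by auto
  have Jint: "is_interval ?J" using I by (intro is_interval_Int) (auto simp: is_interval_cc)
  have "q t \<in> fst c'" using c'(3) tJ by blast
  then have x: "snd c' (q t) \<in> ?O" using qc by blast
  obtain \<rho> L where r: "\<rho> > 0" "L > (0::real)" "cball (snd c' (q t)) \<rho> \<subseteq> ?O"
    and lip: "\<And>y z. y \<in> cball (snd c' (q t)) \<rho> \<Longrightarrow> z \<in> cball (snd c' (q t)) \<rho> \<Longrightarrow> dist (?\<tau> y) (?\<tau> z) \<le> L * dist y z"
    using smooth_on_locally_lipschitz[OF chart_change_smooth[OF c'(1) c] open_overlap[OF c'(1) c] x] by blast
  obtain \<delta> where d: "\<delta> > 0" "\<forall>y\<in>?J. \<bar>y - t\<bar> < \<delta> \<longrightarrow> dist ((snd c' \<circ> q) t) ((snd c' \<circ> q) y) < \<rho>"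
    using abs_cont_on_continuous[OF acc Jint tJ r(1)] by blast
  define r' where "r' = min r (\<delta> / 2)"
  have r': "r' > 0" "r' \<le> r" "r' < \<delta>" using d c' by (auto simp: r'_def)
  let ?J' = "I \<inter> {t-r'..t+r'}"
  have sub: "?J' \<subseteq> ?J" using r' by auto
  have "abs_cont_on ?J' (snd c \<circ> q)"
  proof (rule abs_cont_on_lipschitz_comp[OF abs_cont_on_subset[OF acc sub] r(2)])
    have in_ball: "(snd c' \<circ> q) y \<in> cball (snd c' (q t)) \<rho>" "?\<tau> ((snd c' \<circ> q) y) = (snd c \<circ> q) y" if y: "y \<in> ?J'" for y
    proof -
      have "y \<in> ?J" "\<bar>y - t\<bar> < \<delta>" using y sub r' by auto
      then show "(snd c' \<circ> q) y \<in> cball (snd c' (q t)) \<rho>" using d(2) by (simp add: less_imp_le)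
      have "q y \<in> fst c'" using c'(3) \<open>y \<in> ?J\<close> by blast
      then show "?\<tau> ((snd c' \<circ> q) y) = (snd c \<circ> q) y" using c'(1) by simp
    qed
    fix y z assume yz: "y \<in> ?J'" "z \<in> ?J'"
    show "dist ((snd c \<circ> q) y) ((snd c \<circ> q) z) \<le> L * dist ((snd c' \<circ> q) y) ((snd c' \<circ> q) z)"
      using lip[OF in_ball(1)[OF yz(1)] in_ball(1)[OF yz(2)]] unfolding in_ball(2)[OF yz(1)] in_ball(2)[OF yz(2)] .
  qed
  then show ?thesis using r'(1) by blast
qed

text \<open>
  A curve in the domain of a chart is absolutely continuous near each parameter, hence an indefinite
  integral of its velocity locally.  By subdivision this extends to any compact subinterval.
\<close>

lemma rectifiable_length:
  assumes rect: "locally_rectifiable M ({s<..<t}, q)" and c: "c \<in> charts M" and qc: "q ` {s<..<t} \<subseteq> fst c"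
    and uv: "s < u" "u \<le> v" "v < t" and a: "a \<ge> 0"
  shows "ennreal (a * norm (snd c (q v) - snd c (q u)))
     \<le> (\<integral>\<^sup>+\<tau>\<in>{s<..<t}. ennreal (a * norm (velocity M ({s<..<t}, q) \<tau> c)) \<partial>lebesgue)"
proof -
  let ?I = "{s<..<t}" and ?h = "snd c \<circ> q"
  let ?v = "\<lambda>\<tau>. velocity M (?I, q) \<tau> c"
  have ac: "abs_cont_curve M (?I, q)" and "AE \<tau> in lebesgue. \<tau> \<in> ?I \<longrightarrow>
        (\<forall>c\<in>charts_at M (q \<tau>). (snd c \<circ> q) differentiable (at \<tau> within ?I))"
    using rect unfolding locally_rectifiable_def by auto
  then have ae: "AE \<tau> in lebesgue. \<tau> \<in> ?I \<longrightarrow>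
        (\<forall>c\<in>charts_at M (q \<tau>). (snd c \<circ> q) differentiable (at \<tau> within ?I))" by simp
  obtain N where N0: "N \<in> null_sets lebesgue" and N: "{\<tau>. \<not> (\<tau> \<in> ?I \<longrightarrow>
        (\<forall>c\<in>charts_at M (q \<tau>). (snd c \<circ> q) differentiable (at \<tau> within ?I)))} \<subseteq> N"
    using AE_E[OF ae] null_setsI by (metis (mono_tags, lifting) Collect_cong UNIV_I space_completion space_lborel space_borel)
  have neg: "negligible N" using N0 by (simp add: negligible_iff_null_sets)
  have vd: "(?h has_vector_derivative ?v \<tau>) (at \<tau> within {x..y})"
    if "\<tau> \<in> {x..y} - N" "{x..y} \<subseteq> ?I" for \<tau> x y
  proof -
    have \<tau>: "\<tau> \<in> ?I" "\<tau> \<notin> N" using that by auto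
    have cq: "c \<in> charts_at M (q \<tau>)" using c qc \<tau> by (auto simp: charts_at_iff)
    have "?h differentiable (at \<tau> within ?I)" using N \<tau> cq by blast
    then have "(?h has_vector_derivative vector_derivative ?h (at \<tau> within ?I)) (at \<tau> within ?I)"
      by (simp add: vector_derivative_works)
    then have "(?h has_vector_derivative ?v \<tau>) (at \<tau> within ?I)" using cq by (simp add: velocity_def)
    then show ?thesis by (rule has_vector_derivative_within_subset) (use that in auto)
  qed
  let ?k = "\<lambda>\<tau>. if \<tau> \<in> N then 0 else ?v \<tau>"
  \<comment> \<open>Bolzano's bisection principle glues the local integral representations.\<close>
  define P where "P x y \<longleftrightarrow> (u \<le> x \<and> x \<le> y \<and> y \<le> v \<longrightarrow> (?k has_integral (?h y - ?h x)) {x..y})" for x y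
  have "P u v"
    using uv(2)
  proof (induction rule: Bolzano)
    case (trans x y z)
    show ?case
      unfolding P_def
    proof
      assume A: "u \<le> x \<and> x \<le> z \<and> z \<le> v"
      then have "(?k has_integral (?h y - ?h x)) {x..y}" "(?k has_integral (?h z - ?h y)) {y..z}"
        using trans unfolding P_def by auto
      from has_integral_combine[OF trans(3,4) this] show "(?k has_integral (?h z - ?h x)) {x..z}" by simp
    qed
  next
    case (local x)
    then have x: "x \<in> ?I" using uv by auto
    have Iint: "is_interval ?I" by (simp add: is_interval_oo)
    have "q x \<in> fst c" using qc x by blast
    from abs_cont_change_chart[OF ac Iint x c this]
    obtain r where r: "r > 0" "abs_cont_on (?I \<inter> {x-r..x+r}) ?h" by blast
    show ?case
    proof (intro exI[of _ r] conjI allI impI r(1))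
      fix y z assume yz: "y \<le> x \<and> x \<le> z \<and> z - y < r"
      show "P y z"
        unfolding P_def
      proof
        assume A: "u \<le> y \<and> y \<le> z \<and> z \<le> v"
        have sub: "{y..z} \<subseteq> ?I \<inter> {x-r..x+r}" using A yz uv by auto
        show "(?k has_integral (?h z - ?h y)) {y..z}"
          by (rule abs_cont_has_integral[OF _ abs_cont_on_subset[OF r(2) sub] neg vd]) (use A sub in auto)
      qed
    qed
  qed
  then have "(?k has_integral (?h v - ?h u)) {u..v}" using uv(2) unfolding P_def by simp
  from has_integral_norm_le_nn_integral[OF has_integral_cmul[OF this, of a]]
  have "ennreal (norm (a *\<^sub>R (?h v - ?h u))) \<le> (\<integral>\<^sup>+\<tau>\<in>{u..v}. ennreal (norm (a *\<^sub>R ?k \<tau>)) \<partial>lebesgue)" .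
  also have "\<dots> \<le> (\<integral>\<^sup>+\<tau>\<in>?I. ennreal (a * norm (?v \<tau>)) \<partial>lebesgue)"
    using uv a by (intro nn_integral_mono) (auto simp: indicator_def)
  finally show ?thesis using a by simp
qed

end

section \<open>Local comparison of metric and coordinates\<close>

text \<open>
  A semidefinite quadratic form with coefficients \<open>E\<close>, \<open>F\<close>, \<open>G\<close> is at most twice its diagonal part, and
  the diagonal part is controlled by any positive definite form via completion of squares.  The
  constant depends continuously on the coefficients of both forms.
\<close>

lemma quad_form_compare:
  fixes E F G :: real
  assumes pos: "E \<ge> 0" "G \<ge> 0" "F\<^sup>2 \<le> E * G" and pos': "E' \<ge> 0" "G' \<ge> 0" "E' * G' - F'\<^sup>2 > 0"
  shows "a * a * E + 2 * (a * b) * F + b * b * G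
    \<le> 2 * (E * G' + G * E') / (E' * G' - F'\<^sup>2) * (a * a * E' + 2 * (a * b) * F' + b * b * G')"
proof -
  let ?q = "a * a * E' + 2 * (a * b) * F' + b * b * G'" and ?d = "E' * G' - F'\<^sup>2"
  have "(2 * (a * b) * F)\<^sup>2 = 4 * (a * b)\<^sup>2 * F\<^sup>2" by (simp add: power2_eq_square)
  also have "\<dots> \<le> 4 * (a * b)\<^sup>2 * (E * G)" using pos by (intro mult_left_mono) auto
  also have "\<dots> = 4 * (a * a * E) * (b * b * G)" by (simp add: power2_eq_square)
  also have "\<dots> \<le> (a * a * E + b * b * G)\<^sup>2"
    using zero_le_power2[of "a * a * E - b * b * G"] by (simp add: power2_eq_square algebra_simps)
  finally have "2 * (a * b) * F \<le> a * a * E + b * b * G"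
    by (rule power2_le_imp_le) (use pos in simp)
  moreover have "y + x + z \<le> 2 * (y + z)" if "x \<le> y + z" for x y z :: real using that by simp
  ultimately have 1: "a * a * E + 2 * (a * b) * F + b * b * G \<le> 2 * (a * a * E + b * b * G)" by blast
  have "G' * ?q - a * a * ?d = (a * F' + b * G')\<^sup>2" by (simp add: power2_eq_square algebra_simps)
  then have A: "a * a * ?d \<le> G' * ?q" using zero_le_power2[of "a * F' + b * G'"] by linarith
  have "E' * ?q - b * b * ?d = (a * E' + b * F')\<^sup>2" by (simp add: power2_eq_square algebra_simps)
  then have B: "b * b * ?d \<le> E' * ?q" using zero_le_power2[of "a * E' + b * F'"] by linarith
  have "E * (a * a * ?d) + G * (b * b * ?d) \<le> E * (G' * ?q) + G * (E' * ?q)"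
    using A B pos by (intro add_mono mult_left_mono) auto
  then have "2 * (a * a * E + b * b * G) * ?d \<le> 2 * (E * G' + G * E') * ?q"
    by (simp add: algebra_simps)
  then have "2 * (a * a * E + b * b * G) \<le> 2 * (E * G' + G * E') * ?q / ?d"
    using pos'(3) by (simp add: pos_le_divide_eq)
  from order_trans[OF 1 this] show ?thesis by (simp only: times_divide_eq_left)
qed

context cr_metric
begin

text \<open>
  In a local frame both the metric norm and the coordinate norm on the plane of the distribution are
  given by quadratic forms with continuous coefficients.
\<close>

lemma metric_compare:
  assumes c: "c \<in> charts_at M p"
  obtains W K where "open W" "p \<in> W" "W \<subseteq> fst c" "K > 0"
    "\<And>q v. q \<in> W \<Longrightarrow> v \<in> hplane M q \<Longrightarrow> hnorm g q v \<le> K * norm (v c) \<and> norm (v c) \<le> K * hnorm g q v"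
proof -
  have cc: "c \<in> charts M" "p \<in> fst c" using c by (auto simp: charts_at_iff)
  obtain W X Y where F: "open W" "p \<in> W" "horizontal_field M W X" "horizontal_field M W Y"
    and ind: "\<And>q a b. q \<in> W \<Longrightarrow> lin_comb a (X q) b (Y q) = zero_vec \<Longrightarrow> a = 0 \<and> b = 0"
    and span: "\<And>q v. q \<in> W \<Longrightarrow> v \<in> hplane M q \<Longrightarrow> \<exists>a b. v = lin_comb a (X q) b (Y q)"
    using frame[of p] by metis
  let ?T = "snd c ` (W \<inter> fst c)"
  have T: "open ?T" by (rule open_chart_image[OF cc(1) F(1)])
  have XY: "X q \<in> hplane M q" "Y q \<in> hplane M q" if "q \<in> W" for q
    using F that unfolding horizontal_field_def by auto
  define E where "E x = g (chart_inv c x) (X (chart_inv c x)) (X (chart_inv c x))" for x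
  define F1 where "F1 x = g (chart_inv c x) (X (chart_inv c x)) (Y (chart_inv c x))" for x
  define G where "G x = g (chart_inv c x) (Y (chart_inv c x)) (Y (chart_inv c x))" for x
  define E' where "E' x = X (chart_inv c x) c \<bullet> X (chart_inv c x) c" for x
  define F' where "F' x = X (chart_inv c x) c \<bullet> Y (chart_inv c x) c" for x
  define G' where "G' x = Y (chart_inv c x) c \<bullet> Y (chart_inv c x) c" for x
  have gs: "continuous_on ?T (\<lambda>x. g (chart_inv c x) (A (chart_inv c x)) (B (chart_inv c x)))"
    if "horizontal_field M W A" "horizontal_field M W B" for A B
    using g_smooth[OF F(1) that] cc(1) smooth_on_continuous_on unfolding smooth_fun_def by (auto simp: o_def)
  have Xs: "continuous_on ?T (\<lambda>x. A (chart_inv c x) c)" if "horizontal_field M W A" for A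
    using that cc(1) smooth_on_continuous_on unfolding horizontal_field_def smooth_field_def by auto
  have cont: "continuous_on ?T E" "continuous_on ?T F1" "continuous_on ?T G"
    "continuous_on ?T E'" "continuous_on ?T F'" "continuous_on ?T G'"
    unfolding E_def[abs_def] F1_def[abs_def] G_def[abs_def] E'_def[abs_def] F'_def[abs_def] G'_def[abs_def]
    by (intro gs continuous_on_inner Xs F)+
  have gram: "E x * G x - (F1 x)\<^sup>2 > 0" "E x > 0" "G x > 0" "E' x * G' x - (F' x)\<^sup>2 > 0" "E' x \<ge> 0" "G' x \<ge> 0"
    if x: "x \<in> ?T" for x
  proof -
    let ?q = "chart_inv c x"
    have q: "?q \<in> W" "?q \<in> fst c" using x cc(1) by auto
    show "E x * G x - (F1 x)\<^sup>2 > 0" "E x > 0" "G x > 0"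
      unfolding E_def F1_def G_def using gram_pos[OF XY[OF q(1)] ind[OF q(1)]] by auto
    show "E' x \<ge> 0" "G' x \<ge> 0" by (auto simp: E'_def G'_def)
    have qc: "c \<in> charts_at M ?q" using q cc by (simp add: charts_at_iff)
    have ind': "a = 0 \<and> b = 0" if "a *\<^sub>R X ?q c + b *\<^sub>R Y ?q c = 0" for a b
    proof -
      have t: "lin_comb a (X ?q) b (Y ?q) \<in> tangent_space M ?q"
        using XY[OF q(1)] hplane_tangent by (intro lin_comb_in) auto
      show ?thesis
        using ind[OF q(1)] tangent_vec_zeroD[OF qc t] that by (simp add: lin_comb_def)
    qed
    have X0: "X ?q c \<noteq> 0" using ind'[of 1 0] by auto
    then have E0: "E' x > 0" by (simp add: E'_def)
    have "- F' x *\<^sub>R X ?q c + E' x *\<^sub>R Y ?q c \<noteq> 0" using ind'[of "- F' x" "E' x"] E0 by auto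
    then have "(- F' x *\<^sub>R X ?q c + E' x *\<^sub>R Y ?q c) \<bullet> (- F' x *\<^sub>R X ?q c + E' x *\<^sub>R Y ?q c) > 0" by simp
    also have "(- F' x *\<^sub>R X ?q c + E' x *\<^sub>R Y ?q c) \<bullet> (- F' x *\<^sub>R X ?q c + E' x *\<^sub>R Y ?q c)
       = F' x * F' x * E' x - 2 * F' x * E' x * F' x + E' x * E' x * G' x"
      by (simp add: inner_add_left inner_add_right inner_commute[of "Y ?q c" "X ?q c"]
           E'_def[symmetric] F'_def[symmetric] G'_def[symmetric] inner_diff_left inner_diff_right algebra_simps)
    also have "\<dots> = E' x * (E' x * G' x - (F' x)\<^sup>2)" by (simp add: power2_eq_square algebra_simps)
    finally show "E' x * G' x - (F' x)\<^sup>2 > 0" using E0 by (simp add: zero_less_mult_iff)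
  qed
  \<comment> \<open>The constants of the previous lemma in both directions; they are bounded near \<open>p\<close> by continuity.\<close>
  define K1 where "K1 x = 2 * (E x * G' x + G x * E' x) / (E' x * G' x - (F' x)\<^sup>2)" for x
  define K2 where "K2 x = 2 * (E' x * G x + G' x * E x) / (E x * G x - (F1 x)\<^sup>2)" for x
  have K1c: "continuous_on ?T K1"
    unfolding K1_def[abs_def] using gram(4) by (intro continuous_intros cont) (metis less_irrefl)
  have K2c: "continuous_on ?T K2"
    unfolding K2_def[abs_def] using gram(1) by (intro continuous_intros cont) (metis less_irrefl)
  let ?xp = "snd c p"
  have x0: "?xp \<in> ?T" using F cc by auto
  define V where "V = (?T \<inter> K1 -` {..<K1 ?xp + 1}) \<inter> (?T \<inter> K2 -` {..<K2 ?xp + 1})"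
  have V: "open V" unfolding V_def
    by (intro open_Int continuous_open_preimage K1c K2c T) auto
  define W' where "W' = fst c \<inter> snd c -` V"
  define K where "K = 1 + \<bar>K1 ?xp + 1\<bar> + \<bar>K2 ?xp + 1\<bar>"
  have W': "open W'" unfolding W'_def
    by (rule continuous_open_preimage[OF cont_chart[OF cc(1)] open_dom[OF cc(1)] V])
  have pW: "p \<in> W'" using cc x0 by (auto simp: W'_def V_def)
  have K1: "K \<ge> 1" by (simp add: K_def)
  have sq: "x \<le> K * y" if "x\<^sup>2 \<le> k * y\<^sup>2" "k \<le> K" "y \<ge> 0" for x y k :: real
  proof (rule power2_le_imp_le)
    have "x\<^sup>2 \<le> K * y\<^sup>2" using that mult_right_mono[of k K "y\<^sup>2"] by simp
    also have "\<dots> \<le> (K * K) * y\<^sup>2" using K1 by (intro mult_right_mono) auto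
    finally show "x\<^sup>2 \<le> (K * y)\<^sup>2" by (simp add: power2_eq_square algebra_simps)
    show "K * y \<ge> 0" using K1 that by simp
  qed
  have "hnorm g q v \<le> K * norm (v c) \<and> norm (v c) \<le> K * hnorm g q v" if q: "q \<in> W'" and v: "v \<in> hplane M q" for q v
  proof -
    let ?x = "snd c q"
    have qf: "q \<in> fst c" "?x \<in> V" using q by (auto simp: W'_def)
    then have x: "?x \<in> ?T" "K1 ?x < K1 ?xp + 1" "K2 ?x < K2 ?xp + 1" by (auto simp: V_def)
    have cq: "chart_inv c ?x = q" using qf cc by simp
    have qW: "q \<in> W" using x(1) cq cc by auto
    obtain a b where ab: "v = lin_comb a (X q) b (Y q)" using span[OF qW v] by blast
    have gv: "(hnorm g q v)\<^sup>2 = a * a * E ?x + 2 * (a * b) * F1 ?x + b * b * G ?x"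
    proof -
      have "(hnorm g q v)\<^sup>2 = g q v v" using g_nonneg[OF v] by (simp add: hnorm_def)
      then show ?thesis unfolding ab g_lin_comb2[OF XY[OF qW]] E_def F1_def G_def cq by simp
    qed
    have nv: "(norm (v c))\<^sup>2 = a * a * E' ?x + 2 * (a * b) * F' ?x + b * b * G' ?x"
      unfolding ab lin_comb_coord power2_norm_eq_inner E'_def F'_def G'_def cq
      by (simp add: inner_add_left inner_add_right inner_commute[of "Y q c" "X q c"] algebra_simps)
    note gx = gram[OF x(1)]
    have le: "(F1 ?x)\<^sup>2 \<le> E ?x * G ?x" "(F' ?x)\<^sup>2 \<le> E' ?x * G' ?x" using gx(1,4) by auto
    have "(hnorm g q v)\<^sup>2 \<le> K1 ?x * (norm (v c))\<^sup>2"
      unfolding gv nv K1_def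
      by (rule quad_form_compare[OF less_imp_le[OF gx(2)] less_imp_le[OF gx(3)] le(1) gx(5,6,4)])
    moreover have "(norm (v c))\<^sup>2 \<le> K2 ?x * (hnorm g q v)\<^sup>2"
      unfolding gv nv K2_def
      by (rule quad_form_compare[OF gx(5,6) le(2) less_imp_le[OF gx(2)] less_imp_le[OF gx(3)] gx(1)])
    moreover have "K1 ?x \<le> K" "K2 ?x \<le> K"
    proof -
      have bd: "y \<le> 1 + \<bar>a\<bar> + \<bar>b\<bar>" "y \<le> 1 + \<bar>b\<bar> + \<bar>a\<bar>" if "y < a" for y a b :: real
        using that by linarith+
      show "K1 ?x \<le> K" unfolding K_def by (rule bd(1)[OF x(2)])
      show "K2 ?x \<le> K" unfolding K_def by (rule bd(2)[OF x(3)])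
    qed
    moreover have "hnorm g q v \<ge> 0" using g_nonneg[OF v] by (simp add: hnorm_def)
    ultimately show ?thesis using sq by (meson norm_ge_zero)
  qed
  then show thesis using W' pW K1 by (intro that[of W' K]) (auto simp: W'_def)
qed

lemma finite_volume_nbhd:
  assumes c: "c \<in> charts_at M p"
  obtains W where "open W" "p \<in> W" "W \<subseteq> fst c" "emeasure (volume M g) W < \<infinity>"
proof -
  have cc: "c \<in> charts M" "p \<in> fst c" using c by (auto simp: charts_at_iff)
  let ?x = "snd c p"
  obtain r where r: "r > 0" "cball ?x r \<subseteq> snd c ` fst c"
    using open_img[OF cc(1)] cc(2) open_contains_cball by blast
  have "compact (vol_density c ` cball ?x r)"
    by (intro compact_continuous_image continuous_on_subset[OF vol_density_cont[OF cc(1)] r(2)]) auto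
  then have "bounded (vol_density c ` cball ?x r)" by (rule compact_imp_bounded)
  then obtain B where "\<forall>b\<in>vol_density c ` cball ?x r. norm b \<le> B" unfolding bounded_iff by blast
  then have B: "norm (vol_density c y) \<le> B" if "y \<in> cball ?x r" for y using that by (rule bspec[OF _ imageI])
  define W where "W = fst c \<inter> snd c -` ball ?x r"
  have W: "open W" unfolding W_def
    by (rule continuous_open_preimage[OF cont_chart[OF cc(1)] open_dom[OF cc(1)]]) simp
  have im: "snd c ` W \<subseteq> ball ?x r" by (auto simp: W_def)
  have "emeasure (volume M g) W = (\<integral>\<^sup>+x\<in>snd c ` W. ennreal (vol_density c x) \<partial>lborel)"
  proof -
    have Wb: "W \<in> sets borel" "W \<subseteq> fst c" using W by (auto simp: W_def)
    then have "emeasure (volume M g) W = emeasure (chart_meas c) W"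
      using volume_well_defined cc(1) unfolding is_volume_def by blast
    then show ?thesis using emeasure_chart_meas[OF cc(1) Wb] by simp
  qed
  also have "\<dots> \<le> (\<integral>\<^sup>+x. ennreal B * indicator (ball ?x r) x \<partial>lborel)"
  proof (rule nn_integral_mono)
    fix y
    show "ennreal (vol_density c y) * indicator (snd c ` W) y \<le> ennreal B * indicator (ball ?x r) y"
    proof (cases "y \<in> snd c ` W")
      case True
      then have y: "y \<in> ball ?x r" using im by blast
      then have "vol_density c y \<le> B" using B[of y] by (simp add: abs_le_iff)
      then show ?thesis using True y by (simp add: ennreal_leI)
    qed simp
  qed
  also have "\<dots> = ennreal B * emeasure lborel (ball ?x r)" by (rule nn_integral_cmult_indicator) simp
  also have "\<dots> < \<infinity>" using emeasure_lborel_ball_finite[of ?x r]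
    unfolding infinity_ennreal_def by (simp only: ennreal_mult_less_top ennreal_less_top simp_thms)
  finally show thesis using W cc r by (intro that[of W]) (auto simp: W_def)
qed

end

section \<open>Families of fibre segments\<close>

text \<open>
  A diffeomorphism of the line onto an open interval.  It turns fibre segments into fibres with the
  line as model fibre.
\<close>

definition stretch :: "real \<Rightarrow> real \<Rightarrow> real \<Rightarrow> real" where
  "stretch s t x = (s + t) / 2 + (t - s) / pi * arctan x"

lemma stretch_deriv: "(stretch s t has_real_derivative (t - s) / pi * inverse (1 + x\<^sup>2)) (at x)"
  unfolding stretch_def[abs_def] by (auto intro!: derivative_eq_intros)

lemma stretch_in:
  assumes "s < t" shows "stretch s t x \<in> {s<..<t}"
proof -
  define A where "A = (t - s) / pi * arctan x"
  have c: "(t - s) / pi > 0" using assms by (intro divide_pos_pos pi_gt_zero) simp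
  have e: "(t - s) / pi * (pi / 2) = (t - s) / 2" by simp
  have 1: "A < (t - s) / 2"
    using mult_strict_left_mono[OF arctan_ubound[of x] c] unfolding e A_def .
  have 2: "- ((t - s) / 2) < A"
    using mult_strict_left_mono[OF arctan_lbound[of x] c] unfolding mult_minus_right e A_def .
  have "stretch s t x = (s + t) / 2 + A" by (simp only: stretch_def A_def)
  moreover have "s < (s + t) / 2 + a \<and> (s + t) / 2 + a < t" if "a < (t - s) / 2" "- ((t - s) / 2) < a" for a :: real
    using that by (simp add: field_simps)
  ultimately show ?thesis using 1 2 by auto
qed

lemma stretch_inj: "s < t \<Longrightarrow> stretch s t x = stretch s t y \<longleftrightarrow> x = y"
  by (simp add: stretch_def arctan_eq_iff)

lemma stretch_surj:
  assumes st: "s < t" and y: "y \<in> {s<..<t}"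
  shows "\<exists>x. stretch s t x = y"
proof -
  define a where "a = pi / (t - s) * (y - (s + t) / 2)"
  have c: "pi / (t - s) > 0" using st by simp
  have "y - (s + t) / 2 < (t - s) / 2" "- ((t - s) / 2) < y - (s + t) / 2" using y by (auto simp: field_simps)
  from mult_strict_left_mono[OF this(1) c] mult_strict_left_mono[OF this(2) c]
  have "a < pi / 2" "- (pi / 2) < a" using st by (simp_all add: a_def)
  then have "arctan (tan a) = a" by (simp add: arctan_tan)
  then have "stretch s t (tan a) = y" using st by (simp add: stretch_def a_def)
  then show ?thesis by blast
qed

lemma stretch_smooth: "smooth_on UNIV (stretch s t)"
  unfolding stretch_def[abs_def]
  by (intro smooth_on_add smooth_on_const smooth_on_linear_comp[OF bounded_linear_mult_right] smooth_on_arctan open_UNIV)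

lemma bounded_linear_of_linear: "linear (f :: 'c::euclidean_space \<Rightarrow> 'd::real_normed_vector) \<Longrightarrow> bounded_linear f"
  by (simp add: linear_conv_bounded_linear)

context smooth_manifold
begin

lemma frechet_derivative_smooth_map_comp:
  fixes m :: "'e::euclidean_space \<Rightarrow> 'd::euclidean_space"
  assumes F: "smooth_map M D F" and D: "open D" and m: "(m has_derivative m') (at x)" and x: "m x \<in> D"
    and c: "c \<in> charts_at M (F (m x))"
  shows "((snd c \<circ> (F \<circ> m)) has_derivative (frechet_derivative (snd c \<circ> F) (at (m x)) \<circ> m')) (at x)"
    and "frechet_derivative (snd c \<circ> (F \<circ> m)) (at x) = frechet_derivative (snd c \<circ> F) (at (m x)) \<circ> m'"
proof -
  show "((snd c \<circ> (F \<circ> m)) has_derivative (frechet_derivative (snd c \<circ> F) (at (m x)) \<circ> m')) (at x)"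
    using diff_chain_at[OF m smooth_map_has_derivative[OF F x c]] by (simp only: o_assoc)
  from frechet_derivative_at[OF this] show "frechet_derivative (snd c \<circ> (F \<circ> m)) (at x) = frechet_derivative (snd c \<circ> F) (at (m x)) \<circ> m'"
    by simp
qed

end

lemma Union_image_fibres: "\<Union>((\<lambda>d. f ` ({d} \<times> S)) ` A) = f ` (A \<times> S)"
  by blast

context trivialisation
begin

definition fibre_segments :: "(real^2) set \<Rightarrow> real \<Rightarrow> real \<Rightarrow> 'a curve set" where
  "fibre_segments B s t = (\<lambda>d. ({s<..<t}, \<lambda>\<tau>. \<Psi> (d, \<tau>))) ` B"

lemma smooth_vertical: "d \<in> D \<Longrightarrow> smooth_map M UNIV (\<Psi> \<circ> (\<lambda>\<tau>. (d, \<tau>)))"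
  by (rule smooth_map_comp[OF smooth open_cyl
        smooth_on_Pair[OF open_UNIV smooth_on_const smooth_on_bounded_linear[OF bounded_linear_ident]] open_UNIV]) auto

lemma push_vertical:
  assumes d: "d \<in> D" shows "push M (\<Psi> \<circ> (\<lambda>\<tau>. (d, \<tau>))) \<tau> 1 = vert (d, \<tau>)"
proof
  fix c
  have m: "((\<lambda>\<tau>. (d, \<tau>)) has_derivative (\<lambda>h. (0, h))) (at \<tau>)"
    by (intro has_derivative_Pair has_derivative_const has_derivative_ident)
  have dm: "(d, \<tau>) \<in> D \<times> UNIV" using d by simp
  show "push M (\<Psi> \<circ> (\<lambda>\<tau>. (d, \<tau>))) \<tau> 1 c = vert (d, \<tau>) c"
    using frechet_derivative_smooth_map_comp(2)[OF smooth open_cyl m dm] by (simp add: push_def vert_def)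
qed

lemma vertical_curve:
  assumes d: "d \<in> D" and st: "s < t" and \<tau>: "\<tau> \<in> {s<..<t}"
  shows "velocity M ({s<..<t}, \<lambda>\<tau>. \<Psi> (d, \<tau>)) \<tau> = vert (d, \<tau>)"
    and "c \<in> charts_at M (\<Psi> (d, \<tau>)) \<Longrightarrow>
      (snd c \<circ> (\<lambda>\<tau>. \<Psi> (d, \<tau>)) has_vector_derivative vert (d, \<tau>) c) (at \<tau> within {s<..<t})"
proof -
  have I: "is_interval {s<..<t}" "interior {s<..<t} \<noteq> {}" using st by (auto simp: is_interval_oo)
  have eq: "(\<Psi> \<circ> (\<lambda>\<tau>. (d, \<tau>))) x = (\<lambda>\<tau>. \<Psi> (d, \<tau>)) x" for x by simp
  note vel = velocity_eq_push[OF smooth_vertical[OF d] open_UNIV subset_UNIV eq I \<tau>, unfolded push_vertical[OF d]]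
  show "velocity M ({s<..<t}, \<lambda>\<tau>. \<Psi> (d, \<tau>)) \<tau> = vert (d, \<tau>)"
    by (rule vel(1))
  show "c \<in> charts_at M (\<Psi> (d, \<tau>)) \<Longrightarrow>
      (snd c \<circ> (\<lambda>\<tau>. \<Psi> (d, \<tau>)) has_vector_derivative vert (d, \<tau>) c) (at \<tau> within {s<..<t})"
    by (rule vel(2))
qed

end

locale legendrian_trivialisation = trivialisation +
  assumes leg: "\<And>z. z \<in> D \<times> UNIV \<Longrightarrow> vert z \<in> hplane M (\<Psi> z)"
begin

lemma vertical_regular_legendrian:
  assumes d: "d \<in> D" and st: "s < t"
  shows "regular_legendrian M ({s<..<t}, \<lambda>\<tau>. \<Psi> (d, \<tau>))"
proof -
  have I: "is_interval {s<..<t}" "interior {s<..<t} \<noteq> {}" using st by (auto simp: is_interval_oo)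
  have S: "\<exists>S \<gamma>'. open S \<and> {s<..<t} \<subseteq> S \<and> smooth_map M S \<gamma>' \<and> (\<forall>\<tau>\<in>{s<..<t}. \<gamma>' \<tau> = \<Psi> (d, \<tau>))"
    using smooth_vertical[OF d] by (intro exI[of _ UNIV] exI[of _ "\<Psi> \<circ> (\<lambda>\<tau>. (d, \<tau>))"]) auto
  have V: "velocity M ({s<..<t}, \<lambda>\<tau>. \<Psi> (d, \<tau>)) \<tau> \<noteq> zero_vec \<and>
      velocity M ({s<..<t}, \<lambda>\<tau>. \<Psi> (d, \<tau>)) \<tau> \<in> hplane M (\<Psi> (d, \<tau>))" if "\<tau> \<in> {s<..<t}" for \<tau>
    unfolding vertical_curve(1)[OF d st that] using vert_nonzero[of "(d, \<tau>)"] leg[of "(d, \<tau>)"] d by simp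
  show ?thesis unfolding regular_legendrian_def using I S V by blast
qed

text \<open>
  Over an open set \<open>B\<close> the segments over \<open>{s<..<t}\<close> are the fibres of a fibration of an open set: one
  trivialisation suffices, namely \<open>\<Psi>\<close> with the interval stretched to the line.  The bound on the
  length of the interval prevents the segments from closing up to circles.
\<close>

lemma fibre_segments_contact_fibration:
  assumes B: "open B" "B \<subseteq> D" and st: "s < t" "t - s \<le> 1"
  shows "contact_fibration M (\<Psi> ` (B \<times> {s<..<t})) (fibre_segments B s t)"
proof -
  have inj: "inj_on \<Psi> (D \<times> {s<..<t})" by (rule inj_slab[OF st(2)])
  have injB: "\<Psi> (d, x) = \<Psi> (d', x') \<longleftrightarrow> d = d' \<and> x = x'"
    if "d \<in> B" "d' \<in> B" "x \<in> {s<..<t}" "x' \<in> {s<..<t}" for d d' x x'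
    using inj_on_eq_iff[OF inj, of "(d, x)" "(d', x')"] that B by auto
  have tr: "curve_trace ({s<..<t}, \<lambda>\<tau>. \<Psi> (d, \<tau>)) = \<Psi> ` ({d} \<times> {s<..<t})" for d
    by (auto simp: curve_trace_def)
  define \<F> where "\<F> = (\<lambda>d. \<Psi> ` ({d} \<times> {s<..<t})) ` B"
  have F: "curve_trace ` fibre_segments B s t = \<F>"
    unfolding fibre_segments_def \<F>_def image_image tr ..
  obtain x0 where x0: "x0 \<in> {s<..<t}" using st(1) dense by auto
  have same: "d = d'" if "d \<in> B" "d' \<in> B" "p \<in> \<Psi> ` ({d} \<times> {s<..<t})" "p \<in> \<Psi> ` ({d'} \<times> {s<..<t})" for d d' p
    using that injB[of d d'] by force
  have o: "open (\<Psi> ` (N \<times> {s<..<t}))" if "open N" "N \<subseteq> D" for N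
    by (rule open_image[OF st(2)]) (use that in \<open>auto intro: open_Times\<close>)
  have fibration: "smooth_fibration M (\<Psi> ` (B \<times> {s<..<t})) \<F>"
    unfolding smooth_fibration_def
  proof (intro conjI)
    show "open (\<Psi> ` (B \<times> {s<..<t}))" by (rule o[OF B])
    show "\<Union>\<F> = \<Psi> ` (B \<times> {s<..<t})" unfolding \<F>_def by (rule Union_image_fibres)
    show "{} \<notin> \<F>" unfolding \<F>_def using x0 by auto
    show "disjoint \<F>"
      unfolding disjoint_def \<F>_def using same by blast
    show "\<forall>L1\<in>\<F>. \<forall>L2\<in>\<F>. L1 \<noteq> L2 \<longrightarrow>
        (\<exists>\<F>1 \<F>2. \<F>1 \<subseteq> \<F> \<and> \<F>2 \<subseteq> \<F> \<and> L1 \<in> \<F>1 \<and> L2 \<in> \<F>2 \<and> \<F>1 \<inter> \<F>2 = {} \<and>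
           open (\<Union>\<F>1) \<and> open (\<Union>\<F>2))"
    proof (intro ballI impI)
      fix L1 L2 assume L: "L1 \<in> \<F>" "L2 \<in> \<F>" "L1 \<noteq> L2"
      obtain d1 where d1: "d1 \<in> B" "L1 = \<Psi> ` ({d1} \<times> {s<..<t})" using L(1) unfolding \<F>_def by blast
      obtain d2 where d2: "d2 \<in> B" "L2 = \<Psi> ` ({d2} \<times> {s<..<t})" using L(2) unfolding \<F>_def by blast
      have "d1 \<noteq> d2" using d1 d2 L(3) by blast
      from hausdorff[OF this] obtain N1 N2
        where N: "open N1" "open N2" "d1 \<in> N1" "d2 \<in> N2" "N1 \<inter> N2 = {}" by blast
      let ?F = "\<lambda>N. (\<lambda>d. \<Psi> ` ({d} \<times> {s<..<t})) ` (B \<inter> N)"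
      have U: "\<Union>(?F N) = \<Psi> ` ((B \<inter> N) \<times> {s<..<t})" for N by (rule Union_image_fibres)
      have ou: "open (\<Union>(?F N))" if "open N" for N
        unfolding U by (rule o) (use that B in auto)
      show "\<exists>\<F>1 \<F>2. \<F>1 \<subseteq> \<F> \<and> \<F>2 \<subseteq> \<F> \<and> L1 \<in> \<F>1 \<and> L2 \<in> \<F>2 \<and> \<F>1 \<inter> \<F>2 = {} \<and>
           open (\<Union>\<F>1) \<and> open (\<Union>\<F>2)"
      proof (rule exI[of _ "?F N1"], rule exI[of _ "?F N2"], intro conjI ou N)
        show "?F N1 \<subseteq> \<F>" "?F N2 \<subseteq> \<F>" unfolding \<F>_def by blast+
        show "L1 \<in> ?F N1" "L2 \<in> ?F N2" using d1 d2 N by blast+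
        show "?F N1 \<inter> ?F N2 = {}"
        proof (rule ccontr)
          assume "?F N1 \<inter> ?F N2 \<noteq> {}"
          then obtain a b where ab: "a \<in> B" "a \<in> N1" "b \<in> B" "b \<in> N2" "\<Psi> ` ({a} \<times> {s<..<t}) = \<Psi> ` ({b} \<times> {s<..<t})" by blast
          moreover have "\<Psi> (a, x0) \<in> \<Psi> ` ({a} \<times> {s<..<t})" using x0 by blast
          ultimately have "a = b" using same[of a b "\<Psi> (a, x0)"] by blast
          then show False using ab N by blast
        qed
      qed
    qed
    show "\<forall>L\<in>\<F>. \<exists>(D' :: (real^2) set) (\<Psi>' :: (real^2) \<times> real \<Rightarrow> 'a) (P :: real set).
        open D' \<and> (P = {0} \<or> P = \<int>) \<and>
        smooth_map M (D' \<times> UNIV) \<Psi>' \<and>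
        (\<forall>z\<in>D' \<times> UNIV. \<forall>c\<in>charts_at M (\<Psi>' z). bij (frechet_derivative (snd c \<circ> \<Psi>') (at z))) \<and>
        (\<forall>z\<in>D' \<times> UNIV. \<forall>z'\<in>D' \<times> UNIV.
           \<Psi>' z = \<Psi>' z' \<longleftrightarrow> fst z = fst z' \<and> snd z - snd z' \<in> P) \<and>
        (\<forall>d\<in>D'. \<Psi>' ` ({d} \<times> UNIV) \<in> \<F>) \<and>
        (\<exists>d\<in>D'. \<Psi>' ` ({d} \<times> UNIV) = L)"
    proof
      fix L assume L: "L \<in> \<F>"
      let ?m = "\<lambda>z::(real^2) \<times> real. (fst z, stretch s t (snd z))"
      let ?\<Psi>' = "\<Psi> \<circ> ?m"
      have mim: "?m ` (B \<times> UNIV) \<subseteq> D \<times> UNIV" using B by auto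
      have oB: "open (B \<times> (UNIV :: real set))" using B by (simp add: open_Times)
      have msm: "smooth_on (B \<times> UNIV) ?m"
      proof (rule smooth_on_Pair[OF oB smooth_on_bounded_linear[OF bounded_linear_fst]])
        have "smooth_on (B \<times> UNIV) (stretch s t \<circ> snd)"
          by (rule smooth_on_comp[OF smooth_on_bounded_linear[OF bounded_linear_snd] stretch_smooth oB open_UNIV]) simp
        then show "smooth_on (B \<times> UNIV) (\<lambda>z. stretch s t (snd z))" by (simp add: o_def)
      qed
      have im: "?\<Psi>' ` ({d} \<times> UNIV) = \<Psi> ` ({d} \<times> {s<..<t})" for d
      proof (intro equalityI subsetI)
        fix p assume "p \<in> ?\<Psi>' ` ({d} \<times> UNIV)"
        then obtain x where "p = \<Psi> (d, stretch s t x)" by auto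
        then show "p \<in> \<Psi> ` ({d} \<times> {s<..<t})" using stretch_in[OF st(1), of x] by blast
      next
        fix p assume "p \<in> \<Psi> ` ({d} \<times> {s<..<t})"
        then obtain y where y: "y \<in> {s<..<t}" "p = \<Psi> (d, y)" by auto
        obtain x where "stretch s t x = y" using stretch_surj[OF st(1) y(1)] by blast
        then have "p = ?\<Psi>' (d, x)" using y by simp
        then show "p \<in> ?\<Psi>' ` ({d} \<times> UNIV)" by blast
      qed
      show "\<exists>(D' :: (real^2) set) (\<Psi>' :: (real^2) \<times> real \<Rightarrow> 'a) (P :: real set).
        open D' \<and> (P = {0} \<or> P = \<int>) \<and>
        smooth_map M (D' \<times> UNIV) \<Psi>' \<and>
        (\<forall>z\<in>D' \<times> UNIV. \<forall>c\<in>charts_at M (\<Psi>' z). bij (frechet_derivative (snd c \<circ> \<Psi>') (at z))) \<and>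
        (\<forall>z\<in>D' \<times> UNIV. \<forall>z'\<in>D' \<times> UNIV.
           \<Psi>' z = \<Psi>' z' \<longleftrightarrow> fst z = fst z' \<and> snd z - snd z' \<in> P) \<and>
        (\<forall>d\<in>D'. \<Psi>' ` ({d} \<times> UNIV) \<in> \<F>) \<and>
        (\<exists>d\<in>D'. \<Psi>' ` ({d} \<times> UNIV) = L)"
      proof (intro exI[of _ B] exI[of _ ?\<Psi>'] exI[of _ "{0}"] conjI ballI B(1))
        show "{0} = {0} \<or> {0} = (\<int> :: real set)" by simp
        show "smooth_map M (B \<times> UNIV) ?\<Psi>'" by (rule smooth_map_comp[OF smooth open_cyl msm oB mim])
        show "?\<Psi>' ` ({d} \<times> UNIV) \<in> \<F>" if "d \<in> B" for d unfolding im \<F>_def using that by blast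
        show "\<exists>d\<in>B. ?\<Psi>' ` ({d} \<times> UNIV) = L" unfolding im using L unfolding \<F>_def by blast
        show "?\<Psi>' z = ?\<Psi>' z' \<longleftrightarrow> fst z = fst z' \<and> snd z - snd z' \<in> {0}"
          if "z \<in> B \<times> UNIV" "z' \<in> B \<times> UNIV" for z z'
          using injB[of "fst z" "fst z'" "stretch s t (snd z)" "stretch s t (snd z')"] that
            stretch_in[OF st(1)] stretch_inj[OF st(1)] by auto
        fix z c assume z: "z \<in> B \<times> UNIV" and c: "c \<in> charts_at M (?\<Psi>' z)"
        let ?k = "(t - s) / pi * inverse (1 + (snd z)\<^sup>2)"
        have k: "?k \<noteq> 0" using st(1) by (simp add: add_nonneg_eq_0_iff)
        have d1: "((\<lambda>z::(real^2) \<times> real. stretch s t (snd z)) has_derivative (\<lambda>h. ?k * snd h)) (at z)"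
          using diff_chain_at[OF has_derivative_snd[OF has_derivative_ident] stretch_deriv[of s t "snd z", unfolded has_field_derivative_def]]
          by (simp add: o_def)
        have md: "(?m has_derivative (\<lambda>h. (fst h, ?k * snd h))) (at z)"
          by (intro has_derivative_Pair has_derivative_fst has_derivative_ident d1)
        have mz: "?m z \<in> D \<times> UNIV" using z B by auto
        have cz: "c \<in> charts_at M (\<Psi> (?m z))" using c by simp
        have "bij (\<lambda>h::(real^2) \<times> real. (fst h, ?k * snd h))"
        proof (rule o_bij)
          show "(\<lambda>h. (fst h, snd h / ?k)) \<circ> (\<lambda>h::(real^2) \<times> real. (fst h, ?k * snd h)) = id" using k by auto
          show "(\<lambda>h::(real^2) \<times> real. (fst h, ?k * snd h)) \<circ> (\<lambda>h. (fst h, snd h / ?k)) = id" using k by auto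
        qed
        then show "bij (frechet_derivative (snd c \<circ> ?\<Psi>') (at z))"
          unfolding frechet_derivative_smooth_map_comp(2)[OF smooth open_cyl md mz cz] using bij[OF mz cz] by (rule bij_comp)
      qed
    qed
  qed
  show ?thesis
    unfolding contact_fibration_def F
  proof (intro conjI fibration)
    show "\<forall>(I, \<gamma>)\<in>fibre_segments B s t. regular_legendrian M (I, \<gamma>) \<and> inj_on \<gamma> (interior I)"
    proof (clarify)
      fix I \<gamma> assume "(I, \<gamma>) \<in> fibre_segments B s t"
      then obtain d where d: "d \<in> B" "I = {s<..<t}" "\<gamma> = (\<lambda>\<tau>. \<Psi> (d, \<tau>))" unfolding fibre_segments_def by auto
      have "inj_on \<gamma> (interior I)"
        unfolding d(2,3) by (rule inj_onI) (use injB[OF d(1) d(1)] in auto)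
      then show "regular_legendrian M (I, \<gamma>) \<and> inj_on \<gamma> (interior I)"
        using vertical_regular_legendrian[of d s t] d B st by auto
    qed
    show "inj_on curve_trace (fibre_segments B s t)"
    proof (rule inj_onI)
      fix u v assume uv: "u \<in> fibre_segments B s t" "v \<in> fibre_segments B s t" "curve_trace u = curve_trace v"
      obtain a where a: "a \<in> B" "u = ({s<..<t}, \<lambda>\<tau>. \<Psi> (a, \<tau>))" using uv(1) unfolding fibre_segments_def by blast
      obtain b where b: "b \<in> B" "v = ({s<..<t}, \<lambda>\<tau>. \<Psi> (b, \<tau>))" using uv(2) unfolding fibre_segments_def by blast
      have "\<Psi> (a, x0) \<in> \<Psi> ` ({a} \<times> {s<..<t})" using x0 by blast
      then have "a = b" using same[OF a(1) b(1)] uv(3) unfolding a(2) b(2) tr by blast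
      then show "u = v" using a b by simp
    qed
  qed
qed

lemma vertical_locally_rectifiable:
  assumes d: "d \<in> D" and st: "s < t"
  shows "locally_rectifiable M ({s<..<t}, \<lambda>\<tau>. \<Psi> (d, \<tau>))"
proof -
  have I: "is_interval {s<..<t}" "interior {s<..<t} \<noteq> {}" using st by (auto simp: is_interval_oo)
  have ac: "abs_cont_curve M ({s<..<t}, \<lambda>\<tau>. \<Psi> (d, \<tau>))"
    by (rule smooth_curve_abs_cont[OF smooth_vertical[OF d] open_UNIV]) auto
  have dv: "\<forall>c\<in>charts_at M (\<Psi> (d, \<tau>)). (snd c \<circ> (\<lambda>\<tau>. \<Psi> (d, \<tau>))) differentiable (at \<tau> within {s<..<t})" if "\<tau> \<in> {s<..<t}" for \<tau>
    using vertical_curve(2)[OF d st that] by (blast intro: differentiableI_vector)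
  have v: "velocity M ({s<..<t}, \<lambda>\<tau>. \<Psi> (d, \<tau>)) \<tau> \<in> hplane M (\<Psi> (d, \<tau>))" if "\<tau> \<in> {s<..<t}" for \<tau>
    unfolding vertical_curve(1)[OF d st that] using leg[of "(d, \<tau>)"] d by simp
  show ?thesis
    unfolding locally_rectifiable_def using I ac dv v by (auto intro!: AE_I2)
qed

end

section \<open>Fubini coordinates\<close>

text \<open>
  The change of variables formula holds on Cartesian spaces \<open>real^n\<close>, while Fubini's theorem needs a
  product.  The isometry between \<open>real^3\<close> and \<open>real^2 \<times> real\<close> links them.
\<close>

definition join3 :: "(real^2) \<times> real \<Rightarrow> real^3" where
  "join3 z = vector [fst z $ 1, fst z $ 2, snd z]"

definition split3 :: "real^3 \<Rightarrow> (real^2) \<times> real" where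
  "split3 x = (vector [x $ 1, x $ 2], x $ 3)"

lemma split3_join3 [simp]: "split3 (join3 z) = z"
  by (simp add: split3_def join3_def prod_eq_iff vec_eq_iff forall_2)

lemma join3_split3 [simp]: "join3 (split3 x) = x"
  by (simp add: split3_def join3_def vec_eq_iff forall_3)

lemma linear_split3: "linear split3"
  by (rule linearI) (auto simp: split3_def prod_eq_iff vec_eq_iff forall_2)

lemma bij_split3: "bij split3"
  by (rule o_bij[of join3]) (auto simp: fun_eq_iff)

lemma prod_Basis_cart: "(\<Prod>b\<in>(Basis :: (real^'n) set). f \<bullet> b) = (\<Prod>i\<in>UNIV. f $ i)"
proof -
  have B: "(Basis :: (real^'n) set) = range (\<lambda>i. axis i 1)" by (auto simp: Basis_vec_def)
  have "inj (\<lambda>i. axis i 1 :: real^'n)" by (auto simp: inj_on_def axis_eq_axis)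
  then show ?thesis unfolding B by (subst prod.reindex) (auto simp: inner_axis)
qed

lemma prod_Basis_pair:
  fixes f :: "'c::euclidean_space \<times> 'd::euclidean_space"
  shows "(\<Prod>b\<in>Basis. f \<bullet> b) = (\<Prod>b\<in>Basis. fst f \<bullet> b) * (\<Prod>b\<in>Basis. snd f \<bullet> b)"
proof -
  have "(\<Prod>b\<in>Basis. f \<bullet> b) = (\<Prod>b\<in>(\<lambda>u. (u, 0)) ` Basis. f \<bullet> b) * (\<Prod>b\<in>(\<lambda>u. (0, u)) ` Basis. f \<bullet> b)"
    unfolding Basis_prod_def by (rule prod.union_disjoint) auto
  also have "(\<Prod>b\<in>(\<lambda>u. (u, 0)) ` Basis. f \<bullet> b) = (\<Prod>b\<in>Basis. fst f \<bullet> b)"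
    by (subst prod.reindex) (auto simp: inj_on_def inner_prod_def)
  also have "(\<Prod>b\<in>(\<lambda>u. (0, u)) ` Basis. f \<bullet> b) = (\<Prod>b\<in>Basis. snd f \<bullet> b)"
    by (subst prod.reindex) (auto simp: inj_on_def inner_prod_def)
  finally show ?thesis .
qed

lemma box_le_iff_cart: "(\<forall>b\<in>Basis. l \<bullet> b \<le> u \<bullet> b) \<longleftrightarrow> (\<forall>i. (l::real^'n) $ i \<le> u $ i)"
  by (auto simp: Basis_vec_def inner_axis)

lemma mem_box_pair: "z \<in> box l u \<longleftrightarrow> fst z \<in> box (fst l) (fst u) \<and> snd z \<in> box (snd l) (snd u)"
  by (auto simp: mem_box Basis_prod_def inner_prod_def ball_Un)

lemma distr_split3: "distr lborel borel split3 = (lborel :: ((real^2) \<times> real) measure)"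
proof (rule lborel_eqI[symmetric])
  have meas: "split3 \<in> borel_measurable borel"
    using bounded_linear_of_linear[OF linear_split3] by (intro borel_measurable_continuous_onI linear_continuous_on)
  fix l u :: "(real^2) \<times> real"
  assume le: "\<And>b. b \<in> Basis \<Longrightarrow> l \<bullet> b \<le> u \<bullet> b"
  have vim: "split3 -` box l u = box (join3 l) (join3 u)"
  proof (rule set_eqI)
    fix x
    show "x \<in> split3 -` box l u \<longleftrightarrow> x \<in> box (join3 l) (join3 u)"
      by (auto simp: mem_box_pair split3_def join3_def mem_box_cart forall_2 forall_3)
  qed
  have leJ: "join3 l \<bullet> b \<le> join3 u \<bullet> b" if "b \<in> Basis" for b
  proof -
    have "fst l $ i \<le> fst u $ i" for i
    proof -
      have "(axis i 1, 0) \<in> (Basis :: ((real^2) \<times> real) set)" by (simp add: Basis_prod_def)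
      from le[OF this] show ?thesis by (simp add: inner_prod_def inner_axis)
    qed
    moreover have "snd l \<le> snd u"
    proof -
      have "(0, 1) \<in> (Basis :: ((real^2) \<times> real) set)" by (simp add: Basis_prod_def)
      from le[OF this] show ?thesis by (simp add: inner_prod_def)
    qed
    ultimately have "\<forall>i. join3 l $ i \<le> join3 u $ i" by (simp add: forall_3 join3_def)
    then show ?thesis using box_le_iff_cart[of "join3 l" "join3 u"] that by blast
  qed
  have "emeasure (distr lborel borel split3) (box l u) = emeasure lborel (box (join3 l) (join3 u))"
    by (subst emeasure_distr) (use meas vim in simp_all)
  also have "\<dots> = ennreal (\<Prod>b\<in>Basis. (join3 u - join3 l) \<bullet> b)"
    by (rule emeasure_lborel_box[OF leJ])
  also have "(\<Prod>b\<in>Basis. (join3 u - join3 l) \<bullet> b) = (\<Prod>b\<in>Basis. (u - l) \<bullet> b)"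
  proof -
    have p3: "(\<Prod>i\<in>(UNIV::3 set). f i) = f 1 * (f 2 * f 3)" for f :: "3 \<Rightarrow> real"
      unfolding UNIV_3 by (simp add: ac_simps)
    have p2: "(\<Prod>i\<in>(UNIV::2 set). f i) = f 1 * f 2" for f :: "2 \<Rightarrow> real"
      unfolding UNIV_2 by (simp add: ac_simps)
    show ?thesis unfolding prod_Basis_cart prod_Basis_pair p3 p2 by (simp add: join3_def)
  qed
  finally show "emeasure (distr lborel borel split3) (box l u) = ennreal (\<Prod>b\<in>Basis. (u - l) \<bullet> b)" .
qed simp

section \<open>The modulus of a family of fibre segments\<close>

lemma indicator_comp_measurable:
  fixes h :: "'c::topological_space \<Rightarrow> real" and F :: "'d::topological_space \<Rightarrow> 'c"
  assumes A: "open A" and F: "continuous_on A F" and h: "h \<in> borel_measurable borel"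
  shows "(\<lambda>z. indicator A z * h (F z)) \<in> borel_measurable borel"
proof -
  have "F \<in> measurable (restrict_space borel A) borel" by (rule borel_measurable_continuous_on_restrict[OF F])
  from measurable_compose[OF this h] have m: "(\<lambda>z. h (F z)) \<in> borel_measurable (restrict_space borel A)" .
  have "A \<inter> space borel \<in> sets borel" using A by simp
  from borel_measurable_restrict_space_iff[OF this, THEN iffD1, OF m]
  show ?thesis unfolding real_scaleR_def .
qed

text \<open>
  Young's inequality with exponents 4 and 4/3, normalised such that equality holds at 1.
\<close>

lemma young4: "4 * (y::real) \<le> y ^ 4 + 3"
proof -
  have "y ^ 4 + 3 - 4 * y = (y - 1)\<^sup>2 * ((y + 1)\<^sup>2 + 2)"
    by (simp add: power2_eq_square power4_eq_xxxx algebra_simps)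
  moreover have "(y - 1)\<^sup>2 * ((y + 1)\<^sup>2 + 2) \<ge> 0" by (intro mult_nonneg_nonneg) auto
  ultimately show ?thesis by linarith
qed

locale cr_trivialisation = cr_metric M g + legendrian_trivialisation M D \<Psi> P
  for M :: "'a::{t2_space,second_countable_topology} cr_struct" and g D \<Psi> P
begin

text \<open>
  The density of the volume of \<open>M\<close> with respect to Lebesgue measure in the coordinates given by \<open>\<Psi>\<close>.
\<close>

definition jac :: "'a chart \<Rightarrow> (real^2) \<times> real \<Rightarrow> real" where
  "jac c z = \<bar>det (matrix (frechet_derivative (snd c \<circ> \<Psi>) (at z) \<circ> split3))\<bar> * vol_density c (snd c (\<Psi> z))"

lemma jac_det_cont:
  assumes c: "c \<in> charts M"
  shows "continuous_on ((D \<times> UNIV) \<inter> \<Psi> -` fst c) (\<lambda>z. det (matrix (frechet_derivative (snd c \<circ> \<Psi>) (at z) \<circ> split3)))"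
proof -
  have comp: "continuous_on ((D \<times> UNIV) \<inter> \<Psi> -` fst c) (\<lambda>z. frechet_derivative (snd c \<circ> \<Psi>) (at z) v $ i)" for v i
    by (intro continuous_on_component smooth_on_continuous_on[OF smooth_on_frechet_derivative[OF smooth_map_coord[OF smooth c]]])
  show ?thesis
    unfolding det_3 matrix_def vec_lambda_beta o_def
    by (intro continuous_on_add continuous_on_diff continuous_on_mult comp[unfolded o_def])
qed

lemma jac_cont:
  assumes c: "c \<in> charts M"
  shows "continuous_on ((D \<times> UNIV) \<inter> \<Psi> -` fst c) (jac c)"
proof -
  have "continuous_on ((D \<times> UNIV) \<inter> \<Psi> -` fst c) (\<lambda>z. vol_density c ((snd c \<circ> \<Psi>) z))"
    by (rule continuous_on_compose2[OF vol_density_cont[OF c] smooth_on_continuous_on[OF smooth_map_coord[OF smooth c]]]) auto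
  then have "continuous_on ((D \<times> UNIV) \<inter> \<Psi> -` fst c)
     (\<lambda>z. \<bar>det (matrix (frechet_derivative (snd c \<circ> \<Psi>) (at z) \<circ> split3))\<bar> * vol_density c ((snd c \<circ> \<Psi>) z))"
    by (intro continuous_on_mult continuous_on_rabs jac_det_cont[OF c])
  then show ?thesis unfolding jac_def[abs_def] o_apply .
qed

lemma jac_pos:
  assumes z: "z \<in> D \<times> UNIV" and c: "c \<in> charts_at M (\<Psi> z)"
  shows "jac c z > 0"
proof -
  have cc: "c \<in> charts M" "\<Psi> z \<in> fst c" using c by (auto simp: charts_at_iff)
  let ?f = "frechet_derivative (snd c \<circ> \<Psi>) (at z) \<circ> split3"
  have lin: "linear ?f" by (rule linear_compose[OF linear_split3 deriv_linear[OF z c]])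
  have "bij ?f" by (rule bij_comp[OF bij_split3 bij[OF z c]])
  then have "inj ?f" by (rule bij_is_inj)
  then have "det (matrix ?f) \<noteq> 0" using det_nz_iff_inj[OF lin] by simp
  moreover have "vol_density c (snd c (\<Psi> z)) > 0" using vol_density_pos[OF cc(1)] cc(2) by blast
  ultimately show ?thesis unfolding jac_def by simp
qed

text \<open>
  Integrals over a flow box are compared by a change of variables; \<open>c0\<close> bounds its Jacobian from below.
\<close>

lemma flow_volume:
  assumes c: "c \<in> charts M" and st: "t - s \<le> 1" and A: "open A" "A \<subseteq> slab c s t"
    and c0: "c0 \<ge> 0" "\<And>z. z \<in> A \<Longrightarrow> c0 \<le> jac c z"
    and h: "h \<in> borel_measurable borel" "\<And>p. h p \<ge> 0"
  shows "(\<integral>\<^sup>+z. ennreal (indicator A z * (c0 * h (\<Psi> z))) \<partial>lborel) \<le> (\<integral>\<^sup>+p. ennreal (h p) \<partial>volume M g)"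
proof -
  let ?G = "snd c \<circ> \<Psi>"
  let ?H = "?G \<circ> split3" and ?S = "split3 -` A"
  let ?H' = "\<lambda>x. frechet_derivative ?G (at (split3 x)) \<circ> split3"
  have contsplit: "continuous_on UNIV split3"
    by (rule linear_continuous_on[OF bounded_linear_of_linear[OF linear_split3]])
  have S: "open ?S" using continuous_open_vimage[OF A(1), of split3] contsplit
    by (simp add: continuous_on_eq_continuous_at)
  have Asub: "A \<subseteq> (D \<times> UNIV) \<inter> \<Psi> -` fst c" using A(2) by (auto simp: slab_def)
  have zc: "z \<in> D \<times> UNIV" "c \<in> charts_at M (\<Psi> z)" "\<Psi> z \<in> fst c" if "z \<in> A" for z
    using Asub that c by (auto simp: charts_at_iff)
  have der: "(?H has_derivative ?H' x) (at x)" if "x \<in> ?S" for x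
  proof (rule diff_chain_at)
    show "(split3 has_derivative split3) (at x)"
      by (rule bounded_linear_imp_has_derivative[OF bounded_linear_of_linear[OF linear_split3]])
    show "(?G has_derivative frechet_derivative ?G (at (split3 x))) (at (split3 x))"
      by (rule smooth_map_has_derivative[OF smooth]) (use zc that in auto)
  qed
  have inj: "inj_on ?H ?S"
  proof (rule comp_inj_on)
    show "inj_on split3 ?S" by (rule inj_on_subset[OF bij_is_inj[OF bij_split3]]) simp
    show "inj_on ?G (split3 ` ?S)" by (rule inj_on_subset[OF inj_coord[OF c st]]) (use A in auto)
  qed
  have cont: "continuous_on ?S (\<lambda>x. det (matrix (?H' x)))"
    by (rule continuous_on_compose2[OF jac_det_cont[OF c] continuous_on_subset[OF contsplit]]) (use Asub in auto)
  let ?e = "\<lambda>y. if y \<in> snd c ` fst c then chart_inv c y else undefined"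
  let ?vd = "\<lambda>y. if y \<in> snd c ` fst c then vol_density c y else 0"
  let ?u = "\<lambda>y. ?vd y * h (?e y)"
  have vd0: "?vd y \<ge> 0" for y using vol_density_pos[OF c, of y] by auto
  have um: "?u \<in> borel_measurable borel"
    by (intro borel_measurable_times chart_density_measurable[OF c] measurable_compose[OF chart_inv_measurable[OF c] h(1)])
  have un: "?u y \<ge> 0" for y using vd0[of y] h(2) by (intro mult_nonneg_nonneg) auto
  let ?F = "\<lambda>z. ennreal (indicator A z * (c0 * h (\<Psi> z)))"
  have Fm: "?F \<in> borel_measurable borel"
  proof -
    have "(\<lambda>z. indicator A z * (\<lambda>p. c0 * h p) (\<Psi> z)) \<in> borel_measurable borel"
      by (rule indicator_comp_measurable[OF A(1) continuous_on_subset[OF cont_Psi]]) (use Asub h in auto)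
    then show ?thesis by simp
  qed
  have sm: "split3 \<in> borel_measurable lborel"
    using contsplit by (simp add: borel_measurable_continuous_onI)
  have "(\<integral>\<^sup>+z. ?F z \<partial>lborel) = (\<integral>\<^sup>+z. ?F z \<partial>distr lborel borel split3)" unfolding distr_split3 ..
  also have "\<dots> = (\<integral>\<^sup>+x. ?F (split3 x) \<partial>lborel)"
    by (rule nn_integral_distr[OF sm]) (use Fm in simp)
  also have "\<dots> \<le> (\<integral>\<^sup>+x. ennreal (indicator ?S x * (\<bar>det (matrix (?H' x))\<bar> * ?u (?H x))) \<partial>lborel)"
  proof (rule nn_integral_mono)
    fix x
    show "?F (split3 x) \<le> ennreal (indicator ?S x * (\<bar>det (matrix (?H' x))\<bar> * ?u (?H x)))"
    proof (cases "split3 x \<in> A")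
      case True
      let ?z = "split3 x"
      have uH: "?u (?H x) = vol_density c (snd c (\<Psi> ?z)) * h (\<Psi> ?z)" using zc(3)[OF True] c by simp
      have "c0 * h (\<Psi> ?z) \<le> jac c ?z * h (\<Psi> ?z)" by (rule mult_right_mono[OF c0(2)[OF True] h(2)])
      also have "\<dots> = \<bar>det (matrix (?H' x))\<bar> * ?u (?H x)" unfolding uH jac_def by (simp only: mult.assoc)
      finally show ?thesis using True by (simp add: ennreal_leI)
    qed simp
  qed
  also have "\<dots> = (\<integral>\<^sup>+y. ennreal (indicator (?H ` ?S) y * ?u y) \<partial>lborel)"
    by (rule nn_integral_change_of_variables[OF S der inj cont um un, symmetric])
  also have "\<dots> \<le> (\<integral>\<^sup>+y. ennreal (?vd y) * ennreal (h (chart_inv c y)) \<partial>lborel)"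
  proof (rule nn_integral_mono)
    fix y
    have "indicator (?H ` ?S) y * ?u y \<le> ?vd y * h (chart_inv c y)"
      using vd0[of y] h(2)[of "chart_inv c y"] by (auto simp: indicator_def)
    then show "ennreal (indicator (?H ` ?S) y * ?u y) \<le> ennreal (?vd y) * ennreal (h (chart_inv c y))"
      using vd0[of y] h(2)[of "chart_inv c y"] by (simp only: ennreal_mult[symmetric] ennreal_leI)
  qed
  also have "\<dots> = (\<integral>\<^sup>+p\<in>fst c. ennreal (h p) \<partial>volume M g)"
    by (rule nn_integral_volume_chart[OF c, symmetric]) (use h in simp)
  also have "\<dots> \<le> (\<integral>\<^sup>+p. ennreal (h p) \<partial>volume M g)"
    by (rule nn_integral_mono) (auto simp: indicator_def)
  finally show ?thesis .
qed

text \<open>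
  With \<open>L = t - s\<close>, Young's inequality for $y = \sigma C_1 L$ bounds the integrand $\sigma C_1$ by
  $a\,\sigma^4 + b$, where the integral of \<open>b\<close> over the segment is 3/4.  At least 1/4 is left for the first
  term.
\<close>

lemma fibre_lower_bound:
  assumes d: "d \<in> D" and st: "s < t" and C1: "C1 > 0"
    and hC: "\<And>\<tau>. \<tau> \<in> {s<..<t} \<Longrightarrow> hnorm g (\<Psi> (d, \<tau>)) (vert (d, \<tau>)) \<le> C1"
    and \<sigma>: "\<sigma> \<in> borel_measurable borel" "\<And>p. \<sigma> p \<ge> 0"
    and adm: "line_integral M g ({s<..<t}, \<lambda>\<tau>. \<Psi> (d, \<tau>)) \<sigma> \<ge> 1"
  shows "ennreal (1 / (C1 ^ 4 * (t - s) ^ 3)) \<le> (\<integral>\<^sup>+\<tau>. ennreal (indicator {s<..<t} \<tau> * \<sigma> (\<Psi> (d, \<tau>)) ^ 4) \<partial>lborel)"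
    (is "_ \<le> ?X")
proof -
  define L where "L = t - s"
  have L: "L > 0" using st by (simp add: L_def)
  define a where "a = C1 ^ 4 * L ^ 3 / 4"
  define b where "b = 3 / (4 * L)"
  have a: "a > 0" and b: "b > 0" using L C1 by (simp_all add: a_def b_def)
  have cv: "continuous_on UNIV (\<lambda>\<tau>. \<Psi> (d, \<tau>))"
    using smooth_vertical[OF d] unfolding smooth_map_def o_def by blast
  have m: "(\<lambda>\<tau>. indicator {s<..<t} \<tau> * \<sigma> (\<Psi> (d, \<tau>)) ^ 4) \<in> borel_measurable borel"
    using indicator_comp_measurable[OF _ continuous_on_subset[OF cv], of "{s<..<t}" "\<lambda>p. \<sigma> p ^ 4"] \<sigma>(1) by simp
  have bd: "\<sigma> (\<Psi> (d, \<tau>)) * hnorm g (\<Psi> (d, \<tau>)) (vert (d, \<tau>)) \<le> a * \<sigma> (\<Psi> (d, \<tau>)) ^ 4 + b" if "\<tau> \<in> {s<..<t}" for \<tau>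
  proof -
    let ?x = "\<sigma> (\<Psi> (d, \<tau>))"
    have "?x * hnorm g (\<Psi> (d, \<tau>)) (vert (d, \<tau>)) \<le> ?x * C1" by (rule mult_left_mono[OF hC[OF that] \<sigma>(2)])
    also have "?x * C1 = (4 * (?x * C1 * L)) / (4 * L)" using L by simp
    also have "\<dots> \<le> ((?x * C1 * L) ^ 4 + 3) / (4 * L)" using young4 L by (intro divide_right_mono) auto
    also have "\<dots> = a * ?x ^ 4 + b"
      using L by (simp add: a_def b_def power_mult_distrib power3_eq_cube power4_eq_xxxx field_simps)
    finally show ?thesis .
  qed
  have "1 \<le> line_integral M g ({s<..<t}, \<lambda>\<tau>. \<Psi> (d, \<tau>)) \<sigma>" by (rule adm)
  also have "\<dots> = (\<integral>\<^sup>+\<tau>\<in>{s<..<t}. ennreal (\<sigma> (\<Psi> (d, \<tau>)) * hnorm g (\<Psi> (d, \<tau>))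
      (velocity M ({s<..<t}, \<lambda>\<tau>. \<Psi> (d, \<tau>)) \<tau>)) \<partial>lebesgue)"
    by (simp add: line_integral_def)
  also have "\<dots> \<le> (\<integral>\<^sup>+\<tau>. ennreal a * ennreal (indicator {s<..<t} \<tau> * \<sigma> (\<Psi> (d, \<tau>)) ^ 4) + ennreal b * indicator {s<..<t} \<tau> \<partial>lebesgue)"
  proof (rule nn_integral_mono)
    fix \<tau>
    show "ennreal (\<sigma> (\<Psi> (d, \<tau>)) * hnorm g (\<Psi> (d, \<tau>)) (velocity M ({s<..<t}, \<lambda>\<tau>. \<Psi> (d, \<tau>)) \<tau>)) * indicator {s<..<t} \<tau>
       \<le> ennreal a * ennreal (indicator {s<..<t} \<tau> * \<sigma> (\<Psi> (d, \<tau>)) ^ 4) + ennreal b * indicator {s<..<t} \<tau>"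
    proof (cases "\<tau> \<in> {s<..<t}")
      case True
      have "ennreal (\<sigma> (\<Psi> (d, \<tau>)) * hnorm g (\<Psi> (d, \<tau>)) (velocity M ({s<..<t}, \<lambda>\<tau>. \<Psi> (d, \<tau>)) \<tau>)) \<le> ennreal (a * \<sigma> (\<Psi> (d, \<tau>)) ^ 4 + b)"
        unfolding vertical_curve(1)[OF d st True] by (rule ennreal_leI[OF bd[OF True]])
      also have "\<dots> = ennreal a * ennreal (\<sigma> (\<Psi> (d, \<tau>)) ^ 4) + ennreal b"
        using a b \<sigma>(2) by (simp add: ennreal_plus ennreal_mult)
      finally show ?thesis using True by simp
    qed simp
  qed
  also have "\<dots> = (\<integral>\<^sup>+\<tau>. ennreal a * ennreal (indicator {s<..<t} \<tau> * \<sigma> (\<Psi> (d, \<tau>)) ^ 4) + ennreal b * indicator {s<..<t} \<tau> \<partial>lborel)"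
    by (rule nn_integral_completion)
  also have "\<dots> = ennreal a * ?X + ennreal b * emeasure lborel {s<..<t}"
  proof -
    have "(\<integral>\<^sup>+\<tau>. ennreal a * ennreal (indicator {s<..<t} \<tau> * \<sigma> (\<Psi> (d, \<tau>)) ^ 4) \<partial>lborel) = ennreal a * ?X"
      by (rule nn_integral_cmult) (use m in simp)
    moreover have "(\<integral>\<^sup>+\<tau>. ennreal b * indicator {s<..<t} \<tau> \<partial>lborel) = ennreal b * emeasure lborel {s<..<t}"
      by (rule nn_integral_cmult_indicator) simp
    moreover have "(\<integral>\<^sup>+\<tau>. ennreal a * ennreal (indicator {s<..<t} \<tau> * \<sigma> (\<Psi> (d, \<tau>)) ^ 4) + ennreal b * indicator {s<..<t} \<tau> \<partial>lborel)
      = (\<integral>\<^sup>+\<tau>. ennreal a * ennreal (indicator {s<..<t} \<tau> * \<sigma> (\<Psi> (d, \<tau>)) ^ 4) \<partial>lborel) + (\<integral>\<^sup>+\<tau>. ennreal b * indicator {s<..<t} \<tau> \<partial>lborel)"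
      by (rule nn_integral_add) (use m in simp_all)
    ultimately show ?thesis by simp
  qed
  also have "ennreal b * emeasure lborel {s<..<t} = ennreal (3 / 4)"
  proof -
    have "ennreal b * emeasure lborel {s<..<t} = ennreal b * ennreal L" using st by (simp add: L_def)
    also have "\<dots> = ennreal (b * L)" using b L by (simp add: ennreal_mult)
    also have "b * L = 3 / 4" using L by (simp add: b_def)
    finally show ?thesis .
  qed
  finally have main: "1 \<le> ennreal a * ?X + ennreal (3 / 4)" .
  show ?thesis
  proof (cases ?X rule: ennreal_cases)
    case (real x)
    have Xx: "?X = ennreal x" "x \<ge> 0" using real by auto
    have e: "ennreal (a * x + 3 / 4) = ennreal a * ennreal x + ennreal (3 / 4)"
      using a Xx(2) by (simp add: ennreal_plus ennreal_mult)
    have "ennreal 1 \<le> ennreal (a * x + 3 / 4)"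
      using main unfolding e Xx(1) ennreal_1 .
    then have "1 \<le> a * x + 3 / 4" using a real by (subst (asm) ennreal_le_iff) auto
    then have "1 \<le> C1 ^ 4 * L ^ 3 * x" by (simp add: a_def)
    then have "1 / (C1 ^ 4 * L ^ 3) \<le> x" using C1 L by (simp add: pos_divide_le_eq mult.commute)
    then show ?thesis using real by (simp add: L_def ennreal_leI)
  qed simp
qed

text \<open>
  Integrate the estimate on each segment over \<open>B\<close>, then compare Lebesgue measure in the flow box with
  the volume.
\<close>

lemma modulus_lower_bound:
  assumes c: "c \<in> charts M" and st: "s < t" "t - s \<le> 1" and B: "open B" "B \<subseteq> D"
    and sub: "B \<times> {s<..<t} \<subseteq> slab c s t" and C1: "C1 > 0" and c0: "c0 > 0"
    and hC: "\<And>z. z \<in> B \<times> {s<..<t} \<Longrightarrow> hnorm g (\<Psi> z) (vert z) \<le> C1"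
    and jc: "\<And>z. z \<in> B \<times> {s<..<t} \<Longrightarrow> c0 \<le> jac c z"
  shows "ennreal (c0 / (C1 ^ 4 * (t - s) ^ 3)) * emeasure lborel B \<le> modulus M g (fibre_segments B s t)"
  unfolding modulus_def
proof (rule INF_greatest)
  fix \<sigma> assume "\<sigma> \<in> admissible M g (fibre_segments B s t)"
  then have \<sigma>: "\<sigma> \<in> borel_measurable borel" "\<And>p. \<sigma> p \<ge> 0"
    and adm: "\<And>\<gamma>. \<gamma> \<in> fibre_segments B s t \<Longrightarrow> locally_rectifiable M \<gamma> \<Longrightarrow> line_integral M g \<gamma> \<sigma> \<ge> 1"
    unfolding admissible_def by auto
  let ?A = "B \<times> {s<..<t}" and ?q = "1 / (C1 ^ 4 * (t - s) ^ 3)"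
  have A: "open ?A" using B by (intro open_Times) auto
  have q0: "?q \<ge> 0" using C1 st by simp
  let ?F = "\<lambda>z. ennreal (indicator ?A z * (c0 * \<sigma> (\<Psi> z) ^ 4))"
  have s4: "(\<lambda>p. \<sigma> p ^ 4) \<in> borel_measurable borel" using \<sigma>(1) by simp
  have Fm: "?F \<in> borel_measurable (lborel \<Otimes>\<^sub>M lborel)"
  proof -
    have "(\<lambda>z. indicator ?A z * (\<lambda>p. c0 * \<sigma> p ^ 4) (\<Psi> z)) \<in> borel_measurable borel"
      by (rule indicator_comp_measurable[OF A continuous_on_subset[OF cont_Psi]]) (use B s4 in auto)
    then show ?thesis by (simp add: lborel_prod)
  qed
  have fibre: "ennreal c0 * ennreal ?q * indicator B d \<le> (\<integral>\<^sup>+\<tau>. ?F (d, \<tau>) \<partial>lborel)" for d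
  proof (cases "d \<in> B")
    case True
    then have d: "d \<in> D" using B by blast
    have "({s<..<t}, \<lambda>\<tau>. \<Psi> (d, \<tau>)) \<in> fibre_segments B s t" using True by (auto simp: fibre_segments_def)
    then have li: "line_integral M g ({s<..<t}, \<lambda>\<tau>. \<Psi> (d, \<tau>)) \<sigma> \<ge> 1"
      using adm vertical_locally_rectifiable[OF d st(1)] by blast
    have lb: "ennreal ?q \<le> (\<integral>\<^sup>+\<tau>. ennreal (indicator {s<..<t} \<tau> * \<sigma> (\<Psi> (d, \<tau>)) ^ 4) \<partial>lborel)"
      by (rule fibre_lower_bound[OF d st(1) C1 _ \<sigma> li]) (use hC True in auto)
    have cv: "continuous_on UNIV (\<lambda>\<tau>. \<Psi> (d, \<tau>))"
      using smooth_vertical[OF d] unfolding smooth_map_def o_def by blast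
    have m: "(\<lambda>\<tau>. indicator {s<..<t} \<tau> * \<sigma> (\<Psi> (d, \<tau>)) ^ 4) \<in> borel_measurable borel"
      using indicator_comp_measurable[OF _ continuous_on_subset[OF cv], of "{s<..<t}" "\<lambda>p. \<sigma> p ^ 4"] s4 by simp
    have "ennreal c0 * ennreal ?q * indicator B d = ennreal c0 * ennreal ?q" using True by simp
    also have "\<dots> \<le> ennreal c0 * (\<integral>\<^sup>+\<tau>. ennreal (indicator {s<..<t} \<tau> * \<sigma> (\<Psi> (d, \<tau>)) ^ 4) \<partial>lborel)"
      by (rule mult_left_mono[OF lb]) simp
    also have "\<dots> = (\<integral>\<^sup>+\<tau>. ennreal c0 * ennreal (indicator {s<..<t} \<tau> * \<sigma> (\<Psi> (d, \<tau>)) ^ 4) \<partial>lborel)"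
      by (rule nn_integral_cmult[symmetric]) (use m in simp)
    also have "\<dots> = (\<integral>\<^sup>+\<tau>. ?F (d, \<tau>) \<partial>lborel)"
      using True c0 by (intro nn_integral_cong) (auto simp: indicator_def ennreal_mult[symmetric])
    finally show ?thesis .
  qed simp
  have "ennreal (c0 / (C1 ^ 4 * (t - s) ^ 3)) = ennreal c0 * ennreal ?q"
    using c0 q0 by (subst ennreal_mult[symmetric]) auto
  then have "ennreal (c0 / (C1 ^ 4 * (t - s) ^ 3)) * emeasure lborel B = (\<integral>\<^sup>+d. ennreal c0 * ennreal ?q * indicator B d \<partial>lborel)"
    using B by (simp add: nn_integral_cmult_indicator)
  also have "\<dots> \<le> (\<integral>\<^sup>+d. (\<integral>\<^sup>+\<tau>. ?F (d, \<tau>) \<partial>lborel) \<partial>lborel)"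
    by (rule nn_integral_mono) (rule fibre)
  also have "\<dots> = (\<integral>\<^sup>+z. ?F z \<partial>(lborel \<Otimes>\<^sub>M lborel))"
    by (rule lborel.nn_integral_fst[OF Fm])
  also have "\<dots> = (\<integral>\<^sup>+z. ?F z \<partial>lborel)" by (simp only: lborel_prod)
  also have "\<dots> \<le> (\<integral>\<^sup>+p. ennreal (\<sigma> p ^ 4) \<partial>volume M g)"
    by (rule flow_volume[OF c st(2) A sub less_imp_le[OF c0] jc s4]) (use \<sigma>(2) in auto)
  finally show "ennreal (c0 / (C1 ^ 4 * (t - s) ^ 3)) * emeasure lborel B \<le> (\<integral>\<^sup>+p. ennreal (\<sigma> p ^ 4) \<partial>volume M g)" .
qed

end

section \<open>The modulus of a family of long curves\<close>

context cr_metric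
begin

text \<open>
  The coordinate length of the curve is at least $\delta$, and on the horizontal vectors that occur as
  velocities the metric norm times \<open>K\<close> is at least the coordinate norm.  Since the curve is only rectifiable on the open
  interval, the length estimate is applied to smaller intervals and passes to the ends by continuity.
\<close>

lemma line_integral_ge_one:
  assumes c: "c \<in> charts M" and V: "V \<subseteq> fst c" and K: "K > 0" and \<delta>: "\<delta> > 0" and st: "s < t"
    and cmp: "\<And>p v. p \<in> V \<Longrightarrow> v \<in> hplane M p \<Longrightarrow> norm (v c) \<le> K * hnorm g p v"
    and q: "q ` {s<..<t} \<subseteq> V" "continuous_on {s..t} (snd c \<circ> q)" "\<delta> \<le> norm (snd c (q t) - snd c (q s))"
    and rect: "locally_rectifiable M ({s<..<t}, q)"
  shows "1 \<le> line_integral M g ({s<..<t}, q) (\<lambda>p. K / \<delta> * indicator V p)"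
proof (rule ccontr)
  let ?I = "{s<..<t}" and ?h = "snd c \<circ> q" and ?\<sigma> = "\<lambda>p. K / \<delta> * indicator V p"
  let ?v = "\<lambda>\<tau>. velocity M ({s<..<t}, q) \<tau>"
  assume "\<not> 1 \<le> line_integral M g ({s<..<t}, q) ?\<sigma>"
  then have lt: "line_integral M g ({s<..<t}, q) ?\<sigma> < 1" by simp
  then obtain x where x: "line_integral M g ({s<..<t}, q) ?\<sigma> = ennreal x" "x \<ge> 0"
    by (cases "line_integral M g ({s<..<t}, q) ?\<sigma>" rule: ennreal_cases) auto
  have x1: "x < 1" using lt x by (simp add: ennreal_less_one_iff)
  have ae: "AE \<tau> in lebesgue. \<tau> \<in> ?I \<longrightarrow> ?v \<tau> \<in> hplane M (q \<tau>)"
    using rect unfolding locally_rectifiable_def by auto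
  have le: "norm (?h v - ?h u) \<le> \<delta> * x" if uv: "s < u" "u \<le> v" "v < t" for u v
  proof -
    have "ennreal (1 / \<delta> * norm (snd c (q v) - snd c (q u)))
       \<le> (\<integral>\<^sup>+\<tau>\<in>?I. ennreal (1 / \<delta> * norm (?v \<tau> c)) \<partial>lebesgue)"
      by (rule rectifiable_length[OF rect c _ uv]) (use q V \<delta> in auto)
    also have "\<dots> \<le> (\<integral>\<^sup>+\<tau>\<in>?I. ennreal (?\<sigma> (q \<tau>) * hnorm g (q \<tau>) (?v \<tau>)) \<partial>lebesgue)"
    proof (rule nn_integral_mono_AE, rule AE_mp[OF ae], rule AE_I2, rule impI)
      fix \<tau> assume H: "\<tau> \<in> ?I \<longrightarrow> ?v \<tau> \<in> hplane M (q \<tau>)"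
      show "ennreal (1 / \<delta> * norm (?v \<tau> c)) * indicator ?I \<tau> \<le> ennreal (?\<sigma> (q \<tau>) * hnorm g (q \<tau>) (?v \<tau>)) * indicator ?I \<tau>"
      proof (cases "\<tau> \<in> ?I")
        case True
        then have qV: "q \<tau> \<in> V" using q by blast
        have "norm (?v \<tau> c) \<le> K * hnorm g (q \<tau>) (?v \<tau>)" using cmp[OF qV] H True by blast
        from mult_left_mono[OF this, of "1 / \<delta>"]
        have "1 / \<delta> * norm (?v \<tau> c) \<le> ?\<sigma> (q \<tau>) * hnorm g (q \<tau>) (?v \<tau>)" using \<delta> qV by simp
        then show ?thesis using True by (simp add: ennreal_leI)
      qed simp
    qed
    also have "\<dots> = ennreal x" using x(1) by (simp add: line_integral_def)
    finally have "1 / \<delta> * norm (snd c (q v) - snd c (q u)) \<le> x" using x(2) by (simp only: ennreal_le_iff)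
    then show ?thesis using \<delta> by (simp add: divide_le_eq mult.commute)
  qed
  \<comment> \<open>If the line integral were \<open>x < 1\<close>, inner subintervals would leave the gap \<open>\<delta> * (1 - x)\<close>, to be shared by both ends.\<close>
  define \<eta> where "\<eta> = \<delta> * (1 - x) / 2"
  have \<eta>: "\<eta> > 0" using \<delta> x1 by (simp add: \<eta>_def)
  obtain e1 where e1: "e1 > 0" "\<And>u. u \<in> {s..t} \<Longrightarrow> dist u s < e1 \<Longrightarrow> dist (?h u) (?h s) < \<eta>"
    using q(2) st \<eta> unfolding continuous_on_iff by (metis atLeastAtMost_iff less_imp_le order_refl)
  obtain e2 where e2: "e2 > 0" "\<And>u. u \<in> {s..t} \<Longrightarrow> dist u t < e2 \<Longrightarrow> dist (?h u) (?h t) < \<eta>"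
    using q(2) st \<eta> unfolding continuous_on_iff by (metis atLeastAtMost_iff less_imp_le order_refl)
  define e where "e = min (min e1 e2) (t - s) / 3"
  have e: "e > 0" "e < e1" "e < e2" "3 * e \<le> t - s" using e1 e2 st by (auto simp: e_def)
  have 1: "dist (?h (s + e)) (?h s) < \<eta>" by (rule e1(2)) (use e in \<open>auto simp: dist_real_def\<close>)
  have 2: "dist (?h (t - e)) (?h t) < \<eta>" by (rule e2(2)) (use e in \<open>auto simp: dist_real_def\<close>)
  have 3: "norm (?h (t - e) - ?h (s + e)) \<le> \<delta> * x" by (rule le) (use e in auto)
  have "norm (?h t - ?h s) \<le> norm (?h t - ?h (t - e)) + norm (?h (t - e) - ?h (s + e)) + norm (?h (s + e) - ?h s)"
    using norm_triangle_ineq[of "?h t - ?h (t - e)" "?h (t - e) - ?h (s + e)"]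
      norm_triangle_ineq[of "?h t - ?h (t - e) + (?h (t - e) - ?h (s + e))" "?h (s + e) - ?h s"] by simp
  also have "\<dots> < \<eta> + \<delta> * x + \<eta>" using 1 2 3 by (simp add: dist_norm norm_minus_commute)
  also have "\<dots> = \<delta>" by (simp add: \<eta>_def field_simps)
  finally show False using q(3) by simp
qed

lemma modulus_upper_bound:
  assumes c: "c \<in> charts M" and V: "open V" "V \<subseteq> fst c" and K: "K > 0" and \<delta>: "\<delta> > 0" and st: "s < t"
    and cmp: "\<And>p v. p \<in> V \<Longrightarrow> v \<in> hplane M p \<Longrightarrow> norm (v c) \<le> K * hnorm g p v"
    and \<Gamma>: "\<And>\<gamma>. \<gamma> \<in> \<Gamma> \<Longrightarrow> \<exists>q. \<gamma> = ({s<..<t}, q) \<and> q ` {s<..<t} \<subseteq> V \<and> continuous_on {s..t} (snd c \<circ> q) \<and>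
       \<delta> \<le> norm (snd c (q t) - snd c (q s))"
  shows "modulus M g \<Gamma> \<le> ennreal ((K / \<delta>) ^ 4) * emeasure (volume M g) V"
proof -
  let ?\<sigma> = "\<lambda>p. K / \<delta> * indicator V p"
  have "?\<sigma> \<in> admissible M g \<Gamma>"
    unfolding admissible_def
  proof (intro CollectI conjI allI ballI impI)
    show "?\<sigma> \<in> borel_measurable borel" using V by (intro borel_measurable_times borel_measurable_indicator) auto
    show "0 \<le> ?\<sigma> p" for p using K \<delta> by (simp add: indicator_def)
    fix \<gamma> assume "\<gamma> \<in> \<Gamma>" "locally_rectifiable M \<gamma>"
    then show "1 \<le> line_integral M g \<gamma> ?\<sigma>"
      using \<Gamma>[of \<gamma>] line_integral_ge_one[OF c V(2) K \<delta> st cmp] by auto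
  qed
  then have "modulus M g \<Gamma> \<le> (\<integral>\<^sup>+p. ennreal (?\<sigma> p ^ 4) \<partial>volume M g)"
    unfolding modulus_def by (rule INF_lower)
  also have "\<dots> = (\<integral>\<^sup>+p. ennreal ((K / \<delta>) ^ 4) * indicator V p \<partial>volume M g)"
    by (intro nn_integral_cong) (auto simp: indicator_def)
  also have "\<dots> = ennreal ((K / \<delta>) ^ 4) * emeasure (volume M g) V"
    using V by (intro nn_integral_cmult_indicator) simp
  finally show ?thesis .
qed

end

section \<open>From a length-volume estimate to absolute continuity\<close>

text \<open>
  Weighted form of the inequality between geometric and arithmetic means.  The large factor \<open>A\<close> is put
  on the term that can be made small.
\<close>

lemma linear_bound_of_quartic:
  fixes D l w A Q :: real
  assumes nn: "D \<ge> 0" "l \<ge> 0" "w \<ge> 0" "Q \<ge> 0" and A: "A > 0" and le: "D ^ 4 \<le> Q * l ^ 3 * w"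
  shows "D \<le> A * l + Q / A ^ 3 * w"
proof (cases "D \<le> A * l")
  case True
  moreover have "Q / A ^ 3 * w \<ge> 0" using nn A by simp
  ultimately show ?thesis by linarith
next
  case False
  then have D: "D > 0" using nn A by (meson le_less_trans mult_nonneg_nonneg less_imp_le not_le)
  have "A ^ 3 * D ^ 4 \<le> A ^ 3 * (Q * l ^ 3 * w)" using le A by (intro mult_left_mono) auto
  also have "\<dots> = Q * w * (A * l) ^ 3" by (simp add: power_mult_distrib)
  also have "\<dots> \<le> Q * w * D ^ 3" using False nn A by (intro mult_left_mono power_mono) auto
  finally have "(A ^ 3 * D) * D ^ 3 \<le> (Q * w) * D ^ 3" by (simp add: power4_eq_xxxx power3_eq_cube mult.assoc)
  then have "A ^ 3 * D \<le> Q * w" using D by (simp add: mult_le_cancel_right)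
  then have "D \<le> Q / A ^ 3 * w" using A by (simp add: pos_le_divide_eq mult.commute)
  moreover have "A * l \<ge> 0" using nn A by simp
  ultimately show ?thesis by linarith
qed

text \<open>
  Hoelder's inequality in linearised form: with a factor \<open>A\<close> that is large in terms of $\epsilon$, the
  sum of the displacements is at most $A\sum l_i + (Q/A^3)\,\Lambda$, where the second term is smaller than $\epsilon/2$,
  and the first one is small for small total length.
\<close>

lemma abs_cont_of_quartic_bound:
  fixes h :: "real \<Rightarrow> 'b::metric_space"
  assumes Q: "Q \<ge> 0" and L: "\<Lambda> \<ge> 0"
    and est: "\<And>F l u. finite (F :: nat set) \<Longrightarrow>
      (\<And>i. i \<in> F \<Longrightarrow> l i < u i \<and> {l i..u i} \<subseteq> S \<and> h (l i) \<noteq> h (u i)) \<Longrightarrow>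
      (\<And>i j. i \<in> F \<Longrightarrow> j \<in> F \<Longrightarrow> i \<noteq> j \<Longrightarrow> {l i<..<u i} \<inter> {l j<..<u j} = {}) \<Longrightarrow>
      \<exists>w. (\<forall>i\<in>F. 0 \<le> w i \<and> dist (h (l i)) (h (u i)) ^ 4 \<le> Q * (u i - l i) ^ 3 * w i) \<and> sum w F \<le> \<Lambda>"
  shows "abs_cont_on S h"
  unfolding abs_cont_on_iff
proof (intro allI impI)
  fix \<epsilon> :: real assume e: "\<epsilon> > 0"
  define A where "A = 1 + 2 * Q * \<Lambda> / \<epsilon>"
  have "2 * Q * \<Lambda> / \<epsilon> \<ge> 0" using Q L e by simp
  then have A: "A \<ge> 1" by (simp add: A_def)
  have AQ: "Q * \<Lambda> / A ^ 3 < \<epsilon> / 2"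
  proof -
    have "Q * \<Lambda> < A * (\<epsilon> / 2)" using e by (simp add: A_def field_simps)
    also have "\<dots> \<le> A ^ 3 * (\<epsilon> / 2)" using A e power_increasing[of 1 3 A] by (intro mult_right_mono) auto
    finally show ?thesis using A by (simp add: pos_divide_less_eq mult.commute)
  qed
  have "small_variation S h (\<epsilon> / (2 * A)) \<epsilon>"
  proof (rule small_variationI)
    fix n :: nat and l u :: "nat \<Rightarrow> real"
    assume lu: "\<And>i. i < n \<Longrightarrow> l i \<le> u i \<and> {l i..u i} \<subseteq> S"
      and disj: "\<And>i j. i < n \<Longrightarrow> j < n \<Longrightarrow> i \<noteq> j \<Longrightarrow> {l i<..<u i} \<inter> {l j<..<u j} = {}"
      and small: "(\<Sum>i<n. u i - l i) < \<epsilon> / (2 * A)"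
    \<comment> \<open>Intervals without displacement contribute nothing; dropping them allows strict inequalities.\<close>
    define F where "F = {i. i < n \<and> h (l i) \<noteq> h (u i)}"
    have F: "finite F" "F \<subseteq> {..<n}" by (auto simp: F_def)
    have strict: "l i < u i \<and> {l i..u i} \<subseteq> S \<and> h (l i) \<noteq> h (u i)" if "i \<in> F" for i
    proof -
      have i: "i < n" "h (l i) \<noteq> h (u i)" using that by (auto simp: F_def)
      then have "l i \<noteq> u i" by auto
      then show ?thesis using lu[OF i(1)] i(2) by auto
    qed
    have disjF: "{l i<..<u i} \<inter> {l j<..<u j} = {}" if "i \<in> F" "j \<in> F" "i \<noteq> j" for i j
      by (rule disj) (use that F(2) in auto)
    from est[of F l u, OF F(1) strict disjF] obtain w where w: "\<And>i. i \<in> F \<Longrightarrow> 0 \<le> w i"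
      "\<And>i. i \<in> F \<Longrightarrow> dist (h (l i)) (h (u i)) ^ 4 \<le> Q * (u i - l i) ^ 3 * w i" "sum w F \<le> \<Lambda>"
      by auto
    have "(\<Sum>i<n. dist (h (l i)) (h (u i))) = (\<Sum>i\<in>F. dist (h (l i)) (h (u i)))"
      by (rule sum.mono_neutral_right) (auto simp: F_def)
    also have "\<dots> \<le> (\<Sum>i\<in>F. A * (u i - l i) + Q / A ^ 3 * w i)"
    proof (rule sum_mono)
      fix i assume i: "i \<in> F"
      show "dist (h (l i)) (h (u i)) \<le> A * (u i - l i) + Q / A ^ 3 * w i"
        by (rule linear_bound_of_quartic[OF zero_le_dist _ w(1)[OF i] Q _ w(2)[OF i]]) (use strict[OF i] A in auto)
    qed
    also have "\<dots> = A * (\<Sum>i\<in>F. u i - l i) + Q / A ^ 3 * sum w F"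
      by (simp add: sum.distrib sum_distrib_left)
    also have "\<dots> \<le> A * (\<Sum>i<n. u i - l i) + Q / A ^ 3 * \<Lambda>"
    proof (rule add_mono)
      have "(\<Sum>i\<in>F. u i - l i) \<le> (\<Sum>i<n. u i - l i)" by (rule sum_mono2) (use F(2) lu in auto)
      then show "A * (\<Sum>i\<in>F. u i - l i) \<le> A * (\<Sum>i<n. u i - l i)" using A by (intro mult_left_mono) auto
      show "Q / A ^ 3 * sum w F \<le> Q / A ^ 3 * \<Lambda>" using w(3) Q A by (intro mult_left_mono) auto
    qed
    also have "\<dots> < \<epsilon> / 2 + \<epsilon> / 2"
    proof (rule add_strict_mono)
      show "A * (\<Sum>i<n. u i - l i) < \<epsilon> / 2" using small A by (simp add: field_simps)
      show "Q / A ^ 3 * \<Lambda> < \<epsilon> / 2" using AQ by simp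
    qed
    finally show "(\<Sum>i<n. dist (h (l i)) (h (u i))) < \<epsilon>" by simp
  qed
  then show "\<exists>\<delta>>0. small_variation S h \<delta> \<epsilon>" using e A by (intro exI[of _ "\<epsilon> / (2 * A)"]) auto
qed

section \<open>Null sets of fibres\<close>

context trivialisation
begin

text \<open>
  Locally on the patch, the label in \<open>D\<close> of the fibre through \<open>\<phi> x\<close> is a function of \<open>x\<close> with injective
  differentials: a vector in the kernel would be tangent to the surface and to the fibre, contrary to
  transversality.  Preimages of null sets under such functions are null sets.  Since \<open>\<Psi>\<close> is injective
  only on short slabs, the line is covered by countably many unit intervals with half-integral spacing.
\<close>

lemma null_on_patch:
  assumes fibres: "\<And>d. d \<in> D \<Longrightarrow> \<exists>I \<gamma>. (I, \<gamma>) \<in> \<Gamma> \<and> regular_legendrian M (I, \<gamma>) \<and> \<gamma> ` I = \<Psi> ` ({d} \<times> UNIV)"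
    and patch: "transversal_patch M U \<Gamma> D' \<phi>" and E: "negligible E"
  shows "negligible {x \<in> D'. \<phi> x \<in> \<Psi> ` ((E \<inter> D) \<times> UNIV)}"
proof -
  have D': "open D'" "smooth_map M D' \<phi>"
    and tv: "\<And>x c. x \<in> D' \<Longrightarrow> c \<in> charts_at M (\<phi> x) \<Longrightarrow> inj (frechet_derivative (snd c \<circ> \<phi>) (at x)) \<and>
        (\<forall>(I, \<gamma>)\<in>\<Gamma>. \<forall>t\<in>I. \<gamma> t = \<phi> x \<longrightarrow>
           velocity M (I, \<gamma>) t c \<notin> range (frechet_derivative (snd c \<circ> \<phi>) (at x)))"
    using patch unfolding transversal_patch_def by auto
  let ?J = "\<lambda>k::int. {real_of_int k / 2 - 1/2 <..< real_of_int k / 2 + 1/2}"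
  let ?S = "\<lambda>k. {x \<in> D'. \<phi> x \<in> \<Psi> ` (D \<times> ?J k)}"
  let ?h = "\<lambda>k x. fst (inv_into (D \<times> ?J k) \<Psi> (\<phi> x))"
  have injk: "inj_on \<Psi> (D \<times> ?J k)" for k by (rule inj_slab) simp
  have "negligible {x \<in> ?S k. ?h k x \<in> E}" for k
  proof -
    let ?s = "real_of_int k / 2 - 1/2" and ?t = "real_of_int k / 2 + 1/2"
    have st: "?t - ?s \<le> 1" by simp
    have "\<exists>h'. (?h k has_derivative h') (at x within ?S k) \<and> inj h'" if x: "x \<in> ?S k" for x
    proof -
      obtain d \<tau> where z: "d \<in> D" "\<tau> \<in> ?J k" "\<phi> x = \<Psi> (d, \<tau>)" and xD: "x \<in> D'" using x by auto
      obtain c where cx: "c \<in> charts_at M (\<phi> x)" using chart_at_exists by blast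
      then have c: "c \<in> charts M" "\<phi> x \<in> fst c" by (auto simp: charts_at_iff)
      let ?g = "slab_inv c ?s ?t" and ?q = "snd c \<circ> \<phi>"
      have zs: "(d, \<tau>) \<in> slab c ?s ?t" using z c by (simp add: slab_def)
      define T where "T = D' \<inter> \<phi> -` fst c"
      have T: "open T" unfolding T_def by (rule smooth_map_open_preimage[OF D'(2,1) open_dom[OF c(1)]])
      have qs: "smooth_on T ?q" unfolding T_def by (rule smooth_map_coord[OF D'(2) c(1)])
      define N where "N = T \<inter> ?q -` coord_slab c ?s ?t"
      have N: "open N"
        unfolding N_def by (rule continuous_open_preimage[OF smooth_on_continuous_on[OF qs] T open_coord_slab[OF c(1) st]])
      have xN: "x \<in> N" using xD c z zs by (auto simp: N_def T_def coord_slab_def)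
      have hN: "fst (?g (?q y)) = ?h k y" if y: "y \<in> N" for y
      proof -
        have yq: "?q y \<in> coord_slab c ?s ?t" "\<phi> y \<in> fst c" using y by (auto simp: N_def T_def)
        have w: "?g (?q y) \<in> slab c ?s ?t" by (rule slab_inv_in[OF c(1) st yq(1)])
        have "snd c (\<Psi> (?g (?q y))) = snd c (\<phi> y)" using coord_slab_inv[OF c(1) st yq(1)] by simp
        then have "\<Psi> (?g (?q y)) = \<phi> y"
          using inj_onD[OF chart_inj[OF c(1)]] w yq(2) by (auto simp: slab_def)
        moreover have "?g (?q y) \<in> D \<times> ?J k" using w by (simp add: slab_def)
        ultimately have "inv_into (D \<times> ?J k) \<Psi> (\<phi> y) = ?g (?q y)" using inv_into_f_f[OF injk] by metis
        then show ?thesis by simp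
      qed
      let ?q' = "frechet_derivative ?q (at x)" and ?G' = "frechet_derivative (snd c \<circ> \<Psi>) (at (d, \<tau>))"
      have zD: "(d, \<tau>) \<in> D \<times> UNIV" "c \<in> charts_at M (\<Psi> (d, \<tau>))" using z cx by auto
      have qd: "(?q has_derivative ?q') (at x)"
        by (rule smooth_map_has_derivative[OF D'(2) xD cx])
      have gd: "(?g has_derivative inv ?G') (at (?q x))"
        using slab_inv_has_derivative[OF c(1) st zs] z(3) by simp
      have "((\<lambda>y. fst (?g (?q y))) has_derivative (\<lambda>v. fst (inv ?G' (?q' v)))) (at x)"
        using has_derivative_fst[OF diff_chain_at[OF qd gd]] by (simp add: o_def)
      then have hd: "(?h k has_derivative (\<lambda>v. fst (inv ?G' (?q' v)))) (at x)"
        by (rule has_derivative_transform_within_open[OF _ N xN]) (rule hN)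
      have linG: "linear (inv ?G')" using gd by (rule has_derivative_linear)
      have linq: "linear ?q'" using qd by (rule has_derivative_linear)
      have injq: "inj ?q'" using tv[OF xD cx] by blast
      have "linear (\<lambda>v. fst (inv ?G' (?q' v)))" using hd by (rule has_derivative_linear)
      moreover have "v = 0" if v: "fst (inv ?G' (?q' v)) = 0" for v
      proof -
        \<comment> \<open>The image of \<open>v\<close> in the surface is the vertical vector times \<open>\<mu>\<close>.\<close>
        define \<mu> where "\<mu> = snd (inv ?G' (?q' v))"
        have "inv ?G' (?q' v) = \<mu> *\<^sub>R (0, 1)" using v by (simp add: \<mu>_def prod_eq_iff)
        then have "?G' (inv ?G' (?q' v)) = \<mu> *\<^sub>R vert (d, \<tau>) c"
          using linear_scale[OF deriv_linear[OF zD], of \<mu> "(0, 1)"] vert_coord[OF zD(2)] by simp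
        then have qv: "?q' v = \<mu> *\<^sub>R vert (d, \<tau>) c"
          using bij[OF zD] by (simp add: bij_is_surj surj_f_inv_f)
        have "\<mu> = 0"
        proof (rule ccontr)
          assume \<mu>: "\<mu> \<noteq> 0"
          obtain I \<gamma> where g: "(I, \<gamma>) \<in> \<Gamma>" "regular_legendrian M (I, \<gamma>)" "\<gamma> ` I = \<Psi> ` ({d} \<times> UNIV)"
            using fibres[OF z(1)] by blast
          have "\<Psi> (d, \<tau>) \<in> \<gamma> ` I" unfolding g(3) by blast
          then obtain t0 where t0: "t0 \<in> I" "\<Psi> (d, \<tau>) = \<gamma> t0" by auto
          obtain kk where kk: "velocity M (I, \<gamma>) t0 = lin_comb kk (vert (d, \<tau>)) 0 (vert (d, \<tau>))"
            using fibre_lift[OF g(2) equalityD1[OF g(3)] z(1) t0 zero_less_one] by metis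
          have "velocity M (I, \<gamma>) t0 c = kk *\<^sub>R vert (d, \<tau>) c" unfolding kk by (simp add: lin_comb_def)
          also have "\<dots> = (kk / \<mu>) *\<^sub>R ?q' v" using qv \<mu> by simp
          also have "\<dots> = ?q' ((kk / \<mu>) *\<^sub>R v)" using linear_scale[OF linq] by simp
          finally have "velocity M (I, \<gamma>) t0 c \<in> range ?q'" by blast
          moreover have "velocity M (I, \<gamma>) t0 c \<notin> range ?q'"
          proof -
            have e: "\<gamma> t0 = \<phi> x" using t0(2) z(3) by (rule trans[OF sym sym])
            have "\<forall>t\<in>I. \<gamma> t = \<phi> x \<longrightarrow> velocity M (I, \<gamma>) t c \<notin> range ?q'"
              using bspec[OF conjunct2[OF tv[OF xD cx]] g(1)] by (simp only: prod.case)
            then show ?thesis using t0(1) e by blast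
          qed
          ultimately show False by blast
        qed
        then have "?q' v = ?q' 0" using qv linear_0[OF linq] by simp
        then show ?thesis using injD[OF injq] by blast
      qed
      ultimately have "inj (\<lambda>v. fst (inv ?G' (?q' v)))" by (simp add: linear_injective_0)
      then show ?thesis
        by (intro exI[of _ "\<lambda>v. fst (inv ?G' (?q' v))"] conjI has_derivative_at_withinI[OF hd])
    qed
    then have "\<forall>x\<in>?S k. \<exists>h'. (?h k has_derivative h') (at x within ?S k) \<and> inj h'" by (rule ballI)
    from bchoice[OF this] obtain h' where "\<And>x. x \<in> ?S k \<Longrightarrow> (?h k has_derivative h' x) (at x within ?S k)"
      "\<And>x. x \<in> ?S k \<Longrightarrow> inj (h' x)" by blast
    then show ?thesis using negligible_differentiable_vimage[OF E] by blast
  qed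
  then have "negligible (\<Union>k. {x \<in> ?S k. ?h k x \<in> E})"
    by (intro negligible_countable_Union) auto
  moreover have "{x \<in> D'. \<phi> x \<in> \<Psi> ` ((E \<inter> D) \<times> UNIV)} \<subseteq> (\<Union>k. {x \<in> ?S k. ?h k x \<in> E})"
  proof
    fix x assume "x \<in> {x \<in> D'. \<phi> x \<in> \<Psi> ` ((E \<inter> D) \<times> UNIV)}"
    then obtain d \<tau> where x: "x \<in> D'" "d \<in> E" "d \<in> D" "\<phi> x = \<Psi> (d, \<tau>)" by auto
    \<comment> \<open>The interval number \<open>k\<close> contains \<open>\<tau>\<close>, as \<open>k / 2 \<le> \<tau> < k / 2 + 1 / 2\<close>.\<close>
    define k where "k = \<lfloor>2 * \<tau>\<rfloor>"
    have "real_of_int k \<le> 2 * \<tau>" "2 * \<tau> < real_of_int k + 1" unfolding k_def by linarith+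
    then have z: "(d, \<tau>) \<in> D \<times> ?J k" using x by simp
    then have "?h k x = d" using inv_into_f_f[OF injk z] x(4) by simp
    then have "x \<in> {x \<in> ?S k. ?h k x \<in> E}" using x z by blast
    then show "x \<in> (\<Union>k. {x \<in> ?S k. ?h k x \<in> E})" by blast
  qed
  ultimately show ?thesis by (rule negligible_subset)
qed

end

section \<open>Absolute continuity in a flow box\<close>

locale acl_setting = M1: cr_metric M1 g1 + M2: cr_metric M2 g2
  for M1 :: "'a::{t2_space,second_countable_topology} cr_struct" and g1
    and M2 :: "'b::{t2_space,second_countable_topology} cr_struct" and g2 +
  fixes f :: "'a \<Rightarrow> 'b" and finv :: "'b \<Rightarrow> 'a" and K :: real
  assumes hom: "homeomorphism UNIV UNIV f finv" and K: "K \<ge> 1"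
    and mod: "\<And>U \<Gamma>. contact_fibration M1 U \<Gamma> \<Longrightarrow>
           modulus M1 g1 \<Gamma> \<le> ennreal (K\<^sup>2) * modulus M2 g2 (image_family f \<Gamma>)"
begin

lemma f_homeo: "continuous_on UNIV f" "inj f" "open A \<Longrightarrow> open (f ` A)"
proof -
  show "continuous_on UNIV f" using hom unfolding homeomorphism_def by blast
  have fi: "finv (f x) = x" "f (finv y) = y" for x y using hom unfolding homeomorphism_def by auto
  show "inj f" using fi(1) by (rule inj_on_inverseI)
  assume A: "open A"
  have "f ` A = finv -` A"
  proof (intro equalityI subsetI)
    show "y \<in> finv -` A" if "y \<in> f ` A" for y using that fi(1) by auto
    show "y \<in> f ` A" if "y \<in> finv -` A" for y
    proof -
      have "f (finv y) \<in> f ` A" using that by (intro imageI) simp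
      then show ?thesis by (simp only: fi(2))
    qed
  qed
  moreover have "open (finv -` A)"
    by (rule open_vimage[OF A]) (use hom in \<open>simp add: homeomorphism_def\<close>)
  ultimately show "open (f ` A)" by simp
qed

text \<open>
  The hypothesis on moduli, between the lower bound in the source and the upper bound in the target,
  solved for the displacement.
\<close>

lemma box_estimate:
  assumes T: "cr_trivialisation M1 g1 D \<Psi> P"
    and c1: "c1 \<in> charts M1" and c2: "c2 \<in> charts M2"
    and box: "b - a \<le> 1" "B0 \<subseteq> D" "B0 \<times> {a<..<b} \<subseteq> trivialisation.slab D \<Psi> c1 a b"
    and C: "C1 > 0" "c0 > 0" "C2 > 0"
    and hC: "\<And>z. z \<in> B0 \<times> {a<..<b} \<Longrightarrow> hnorm g1 (\<Psi> z) (trivialisation.vert M1 \<Psi> z) \<le> C1"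
    and jc: "\<And>z. z \<in> B0 \<times> {a<..<b} \<Longrightarrow> c0 \<le> cr_trivialisation.jac M1 g1 \<Psi> c1 z"
    and V0: "f ` \<Psi> ` (B0 \<times> {a<..<b}) \<subseteq> fst c2"
    and cmp: "\<And>p v. p \<in> f ` \<Psi> ` (B0 \<times> {a<..<b}) \<Longrightarrow> v \<in> hplane M2 p \<Longrightarrow> norm (v c2) \<le> C2 * hnorm g2 p v"
    and fin: "emeasure (volume M2 g2) (f ` \<Psi> ` (B0 \<times> {a<..<b})) < \<infinity>"
    and B0: "open B0" and B: "ball z r \<subseteq> B0" "r > 0" and uv: "a < u" "u < v" "v < b" and \<delta>: "\<delta> > 0"
    and sep: "\<And>d. d \<in> ball z r \<Longrightarrow> \<delta> \<le> norm (snd c2 (f (\<Psi> (d, v))) - snd c2 (f (\<Psi> (d, u))))"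
  shows "\<delta> ^ 4 \<le> K\<^sup>2 * C2 ^ 4 * C1 ^ 4 / (c0 * unit_ball_vol 2) * (v - u) ^ 3
     * (measure (volume M2 g2) (f ` \<Psi> ` (ball z r \<times> {u<..<v})) / r\<^sup>2)"
proof -
  interpret T: cr_trivialisation M1 g1 D \<Psi> P by (rule T)
  let ?B = "ball z r" and ?V = "f ` \<Psi> ` (ball z r \<times> {u<..<v})"
  define m where "m = measure (volume M2 g2) ?V"
  have sub: "?B \<times> {u<..<v} \<subseteq> B0 \<times> {a<..<b}" using B uv by auto
  have slab: "?B \<times> {u<..<v} \<subseteq> T.slab c1 u v"
    using sub box(3) unfolding T.slab_def by auto
  have vu: "v - u \<le> 1" using box uv by linarith
  have BD: "?B \<subseteq> D" using B box by blast
  have oV: "open ?V"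
    by (rule f_homeo(3)[OF T.open_image[OF vu]]) (use BD in \<open>auto intro: open_Times\<close>)
  have Vsub: "?V \<subseteq> f ` \<Psi> ` (B0 \<times> {a<..<b})" using sub by blast
  have finV: "emeasure (volume M2 g2) ?V \<noteq> \<infinity> \<Longrightarrow> emeasure (volume M2 g2) ?V = ennreal m"
    unfolding m_def by (simp add: emeasure_eq_ennreal_measure)
  have low: "ennreal (c0 / (C1 ^ 4 * (v - u) ^ 3)) * emeasure lborel ?B \<le> modulus M1 g1 (T.fibre_segments ?B u v)"
    by (rule T.modulus_lower_bound[OF c1 uv(2) vu open_ball BD slab C(1,2)])
       (use hC jc sub in blast)+
  have upp: "modulus M2 g2 (image_family f (T.fibre_segments ?B u v)) \<le> ennreal ((C2 / \<delta>) ^ 4) * emeasure (volume M2 g2) ?V"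
  proof (rule M2.modulus_upper_bound[OF c2 oV _ C(3) \<delta> uv(2)])
    show "?V \<subseteq> fst c2" using Vsub V0 by blast
    show "norm (w c2) \<le> C2 * hnorm g2 p w" if "p \<in> ?V" "w \<in> hplane M2 p" for p w
      using cmp that Vsub by blast
    fix \<gamma> assume "\<gamma> \<in> image_family f (T.fibre_segments ?B u v)"
    then obtain d where d: "d \<in> ?B" "\<gamma> = ({u<..<v}, f \<circ> (\<lambda>\<tau>. \<Psi> (d, \<tau>)))"
      unfolding image_family_def T.fibre_segments_def by auto
    let ?q = "f \<circ> (\<lambda>\<tau>. \<Psi> (d, \<tau>))"
    have dD: "d \<in> D" using d BD by blast
    have "continuous_on {u..v} (snd c2 \<circ> ?q)"
    proof (rule continuous_on_compose)
      have "continuous_on {u..v} (\<lambda>\<tau>. \<Psi> (d, \<tau>))"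
        using T.smooth_vertical[OF dD] unfolding smooth_map_def o_def by (blast intro: continuous_on_subset)
      then show "continuous_on {u..v} ?q"
        by (rule continuous_on_compose) (rule continuous_on_subset[OF f_homeo(1)], simp)
      show "continuous_on (?q ` {u..v}) (snd c2)"
      proof (rule continuous_on_subset[OF M2.cont_chart[OF c2]])
        have "(d, \<tau>) \<in> B0 \<times> {a<..<b}" if "\<tau> \<in> {u..v}" for \<tau> using that d B uv by auto
        then show "?q ` {u..v} \<subseteq> fst c2" using V0 by auto
      qed
    qed
    moreover have "?q ` {u<..<v} \<subseteq> ?V" using d by auto
    ultimately show "\<exists>q. \<gamma> = ({u<..<v}, q) \<and> q ` {u<..<v} \<subseteq> ?V \<and> continuous_on {u..v} (snd c2 \<circ> q) \<and>
       \<delta> \<le> norm (snd c2 (q v) - snd c2 (q u))"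
      using d(2) sep[OF d(1)] by (intro exI[of _ ?q]) simp
  qed
  have fV: "emeasure (volume M2 g2) ?V < \<infinity>"
  proof (rule le_less_trans[OF emeasure_mono[OF Vsub] fin])
    have "open (f ` \<Psi> ` (B0 \<times> {a<..<b}))"
      by (rule f_homeo(3)[OF T.open_image[OF box(1)]]) (use B0 box in \<open>auto intro: open_Times\<close>)
    then show "f ` \<Psi> ` (B0 \<times> {a<..<b}) \<in> sets (volume M2 g2)" by simp
  qed
  have "ennreal (c0 / (C1 ^ 4 * (v - u) ^ 3)) * emeasure lborel ?B
     \<le> ennreal (K\<^sup>2) * modulus M2 g2 (image_family f (T.fibre_segments ?B u v))"
    using low mod[OF T.fibre_segments_contact_fibration[OF open_ball BD uv(2) vu]] by (rule order_trans)
  also have "\<dots> \<le> ennreal (K\<^sup>2) * (ennreal ((C2 / \<delta>) ^ 4) * emeasure (volume M2 g2) ?V)"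
    by (rule mult_left_mono[OF upp]) simp
  finally have main: "ennreal (c0 / (C1 ^ 4 * (v - u) ^ 3)) * emeasure lborel ?B
     \<le> ennreal (K\<^sup>2) * (ennreal ((C2 / \<delta>) ^ 4) * ennreal m)" using finV fV by simp
  have "emeasure lborel ?B = ennreal (unit_ball_vol 2 * r\<^sup>2)"
    using emeasure_ball[of r z] B(2) by simp
  then have "ennreal (c0 / (C1 ^ 4 * (v - u) ^ 3)) * ennreal (unit_ball_vol 2 * r\<^sup>2)
     \<le> ennreal (K\<^sup>2) * (ennreal ((C2 / \<delta>) ^ 4) * ennreal m)"
    using main by (simp only:)
  moreover have "ennreal (c0 / (C1 ^ 4 * (v - u) ^ 3) * (unit_ball_vol 2 * r\<^sup>2))
     = ennreal (c0 / (C1 ^ 4 * (v - u) ^ 3)) * ennreal (unit_ball_vol 2 * r\<^sup>2)"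
    by (rule ennreal_mult) (use C uv in auto)
  moreover have "ennreal (K\<^sup>2 * ((C2 / \<delta>) ^ 4 * m)) = ennreal (K\<^sup>2) * (ennreal ((C2 / \<delta>) ^ 4) * ennreal m)"
    by (simp add: ennreal_mult m_def)
  ultimately have "ennreal (c0 / (C1 ^ 4 * (v - u) ^ 3) * (unit_ball_vol 2 * r\<^sup>2)) \<le> ennreal (K\<^sup>2 * ((C2 / \<delta>) ^ 4 * m))"
    by (simp only:)
  then have real: "c0 / (C1 ^ 4 * (v - u) ^ 3) * (unit_ball_vol 2 * r\<^sup>2) \<le> K\<^sup>2 * ((C2 / \<delta>) ^ 4 * m)"
    by (subst (asm) ennreal_le_iff) (auto simp: m_def)
  have om: "unit_ball_vol 2 > 0" by simp
  define X where "X = c0 * unit_ball_vol 2 * r\<^sup>2"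
  define Y where "Y = C1 ^ 4 * (v - u) ^ 3"
  have X: "X > 0" "Y > 0" using C B om uv by (simp_all add: X_def Y_def)
  have "X / Y \<le> K\<^sup>2 * C2 ^ 4 * m / \<delta> ^ 4"
    using real by (simp add: X_def Y_def power_divide mult.assoc)
  then have "X * \<delta> ^ 4 \<le> K\<^sup>2 * C2 ^ 4 * m * Y" using X \<delta> by (simp add: field_simps)
  then have "\<delta> ^ 4 \<le> K\<^sup>2 * C2 ^ 4 * m * Y / X" using X by (simp add: pos_le_divide_eq mult.commute)
  also have "\<dots> = K\<^sup>2 * C2 ^ 4 * C1 ^ 4 / (c0 * unit_ball_vol 2) * (v - u) ^ 3 * (m / r\<^sup>2)"
    by (simp add: X_def Y_def)
  finally show ?thesis by (simp add: m_def)
qed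

text \<open>
  Each image point of the box determines the label \<open>d\<close> of its fibre.  The image of the volume under this
  projection is a finite measure on the plane, and the volumes of tubes are its values on discs.
\<close>

lemma tube_volume_density:
  assumes T: "cr_trivialisation M1 g1 D \<Psi> P" and ab: "b - a \<le> 1" and B0: "open B0" "B0 \<subseteq> D"
    and fin: "emeasure (volume M2 g2) (f ` \<Psi> ` (B0 \<times> {a<..<b})) < \<infinity>"
  shows "\<exists>E. negligible E \<and> (\<forall>d. d \<notin> E \<longrightarrow> (\<exists>\<Lambda>>0. \<forall>r. 0 < r \<longrightarrow> r \<le> 1 \<longrightarrow> ball d r \<subseteq> B0 \<longrightarrow>
     measure (volume M2 g2) (f ` \<Psi> ` (ball d r \<times> {a<..<b})) \<le> \<Lambda> * r\<^sup>2))"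
proof -
  interpret T: cr_trivialisation M1 g1 D \<Psi> P by (rule T)
  let ?X = "B0 \<times> {a<..<b}" and ?H = "\<lambda>z. f (\<Psi> z)" and ?vol = "volume M2 g2"
  let ?tube = "\<lambda>B. f ` \<Psi> ` (B \<times> {a<..<b})"
  let ?\<pi> = "\<lambda>y. fst (inv_into ?X ?H y)"
  have injH: "inj_on ?H ?X"
  proof (rule inj_onI)
    fix x y assume xy: "x \<in> ?X" "y \<in> ?X" "f (\<Psi> x) = f (\<Psi> y)"
    have "\<Psi> x = \<Psi> y" using xy(3) f_homeo(2) by (simp add: inj_eq)
    moreover have "x \<in> D \<times> {a<..<b}" "y \<in> D \<times> {a<..<b}" using xy B0 by auto
    ultimately show "x = y" using inj_onD[OF T.inj_slab[OF ab]] by blast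
  qed
  have open_tube: "open (?tube B)" if "open B" "B \<subseteq> B0" for B
    by (rule f_homeo(3)[OF T.open_image[OF ab]]) (use that B0 in \<open>auto intro: open_Times\<close>)
  have space: "space ?vol = UNIV" using sets_eq_imp_space_eq[of ?vol borel] by simp
  have V0: "?tube B0 \<in> sets ?vol" using open_tube[OF B0(1)] by simp
  have pi: "?\<pi> (f (\<Psi> z)) = fst z" if "z \<in> ?X" for z using inv_into_f_f[OF injH that] by simp
  have vim: "?\<pi> -` N \<inter> ?tube B0 = ?tube (B0 \<inter> N)" for N
  proof (intro equalityI subsetI)
    fix y assume y: "y \<in> ?\<pi> -` N \<inter> ?tube B0"
    then obtain z where z: "z \<in> ?X" "y = f (\<Psi> z)" by blast
    then have "fst z \<in> N" using y pi[OF z(1)] by simp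
    then show "y \<in> ?tube (B0 \<inter> N)" using z by (intro image_eqI[of _ f "\<Psi> z"] image_eqI[of _ \<Psi> z]) auto
  next
    fix y assume "y \<in> ?tube (B0 \<inter> N)"
    then obtain z where z: "z \<in> (B0 \<inter> N) \<times> {a<..<b}" "y = f (\<Psi> z)" by blast
    then have zX: "z \<in> ?X" by auto
    show "y \<in> ?\<pi> -` N \<inter> ?tube B0" using pi[OF zX] z zX by auto
  qed
  define \<mu> where "\<mu> = restrict_space ?vol (?tube B0)"
  have smu: "space \<mu> = ?tube B0" by (simp add: \<mu>_def space_restrict_space space)
  have emu: "emeasure \<mu> A = emeasure ?vol A" if "A \<subseteq> ?tube B0" for A
    unfolding \<mu>_def by (rule emeasure_restrict_space) (use V0 space that in auto)
  have meas: "?\<pi> \<in> measurable \<mu> borel"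
  proof (rule borel_measurableI)
    fix N :: "(real^2) set" assume "open N"
    then have "open (?tube (B0 \<inter> N))" using B0 by (intro open_tube) auto
    then have "?tube (B0 \<inter> N) \<in> sets ?vol" by simp
    then show "?\<pi> -` N \<inter> space \<mu> \<in> sets \<mu>"
      unfolding smu vim unfolding \<mu>_def using V0 space by (subst sets_restrict_space_iff) auto
  qed
  define \<nu> where "\<nu> = distr \<mu> borel ?\<pi>"
  have sn: "sets \<nu> = sets borel" by (simp add: \<nu>_def)
  have fmu: "finite_measure \<mu>" by (rule finite_measureI) (use fin emu[OF subset_refl] smu in auto)
  have "finite_measure \<nu>" unfolding \<nu>_def by (rule finite_measure.finite_measure_distr[OF fmu meas])
  from density_bounded_ae[OF sn this] obtain E where E: "negligible E"
    "\<And>d. d \<notin> E \<Longrightarrow> \<exists>\<Lambda>>0. \<forall>r. 0 < r \<longrightarrow> r \<le> 1 \<longrightarrow> measure \<nu> (cball d r) \<le> \<Lambda> * r ^ DIM(real^2)" by blast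
  have "measure ?vol (?tube (ball d r)) \<le> measure \<nu> (cball d r)" if sub: "ball d r \<subseteq> B0" for d r
  proof -
    have s: "?tube (ball d r) \<subseteq> ?tube B0" using sub by blast
    have "measure ?vol (?tube (ball d r)) = measure \<mu> (?tube (ball d r))"
      unfolding measure_def using emu[OF s] by simp
    also have "\<dots> \<le> measure \<mu> (?\<pi> -` cball d r \<inter> space \<mu>)"
    proof (rule finite_measure.finite_measure_mono[OF fmu])
      have "ball d r \<subseteq> B0 \<inter> cball d r" using sub ball_subset_cball by blast
      then show "?tube (ball d r) \<subseteq> ?\<pi> -` cball d r \<inter> space \<mu>"
        unfolding smu vim by (intro image_mono Sigma_mono) auto
      show "?\<pi> -` cball d r \<inter> space \<mu> \<in> sets \<mu>" by (rule measurable_sets[OF meas]) simp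
    qed
    also have "\<dots> = measure \<nu> (cball d r)" unfolding \<nu>_def by (rule measure_distr[symmetric, OF meas]) simp
    finally show ?thesis .
  qed
  then have "\<exists>\<Lambda>>0. \<forall>r. 0 < r \<longrightarrow> r \<le> 1 \<longrightarrow> ball d r \<subseteq> B0 \<longrightarrow> measure ?vol (?tube (ball d r)) \<le> \<Lambda> * r\<^sup>2"
    if "d \<notin> E" for d
  proof -
    from E(2)[OF that] obtain \<Lambda> where "\<Lambda> > 0" "\<And>r. 0 < r \<Longrightarrow> r \<le> 1 \<Longrightarrow> measure \<nu> (cball d r) \<le> \<Lambda> * r\<^sup>2" by auto
    then show ?thesis using \<open>\<And>r d. ball d r \<subseteq> B0 \<Longrightarrow> measure ?vol (?tube (ball d r)) \<le> measure \<nu> (cball d r)\<close>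
      by (intro exI[of _ \<Lambda>]) (auto intro: order_trans)
  qed
  then show ?thesis using E(1) by blast
qed

text \<open>
  For finitely many disjoint intervals, the discs around \<open>d\<close> may be taken so small that by continuity all nearby
  fibres have at least half of the displacements on the fibre over \<open>d\<close>.  Then the estimate for boxes
  holds with the factor 16, and the tubes over the intervals are disjoint subsets of a tube whose
  volume is bounded by the density at \<open>d\<close>.
\<close>

lemma fibre_abs_cont:
  assumes T: "cr_trivialisation M1 g1 D \<Psi> P"
    and c1: "c1 \<in> charts M1" and c2: "c2 \<in> charts M2"
    and box: "b - a \<le> 1" "B0 \<subseteq> D" "B0 \<times> {a<..<b} \<subseteq> trivialisation.slab D \<Psi> c1 a b"
    and C: "C1 > 0" "c0 > 0" "C2 > 0"
    and hC: "\<And>z. z \<in> B0 \<times> {a<..<b} \<Longrightarrow> hnorm g1 (\<Psi> z) (trivialisation.vert M1 \<Psi> z) \<le> C1"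
    and jc: "\<And>z. z \<in> B0 \<times> {a<..<b} \<Longrightarrow> c0 \<le> cr_trivialisation.jac M1 g1 \<Psi> c1 z"
    and V0: "f ` \<Psi> ` (B0 \<times> {a<..<b}) \<subseteq> fst c2"
    and cmp: "\<And>p v. p \<in> f ` \<Psi> ` (B0 \<times> {a<..<b}) \<Longrightarrow> v \<in> hplane M2 p \<Longrightarrow> norm (v c2) \<le> C2 * hnorm g2 p v"
    and fin: "emeasure (volume M2 g2) (f ` \<Psi> ` (B0 \<times> {a<..<b})) < \<infinity>"
    and B0: "open B0" and d: "d \<in> B0" and st: "a < s" "t < b" and L: "\<Lambda> > 0"
    and dens: "\<And>r. 0 < r \<Longrightarrow> r \<le> 1 \<Longrightarrow> ball d r \<subseteq> B0 \<Longrightarrow>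
        measure (volume M2 g2) (f ` \<Psi> ` (ball d r \<times> {a<..<b})) \<le> \<Lambda> * r\<^sup>2"
  shows "abs_cont_on {s..t} (\<lambda>\<tau>. snd c2 (f (\<Psi> (d, \<tau>))))"
proof -
  interpret T: cr_trivialisation M1 g1 D \<Psi> P by (rule T)
  define q where "q = K\<^sup>2 * C2 ^ 4 * C1 ^ 4 / (c0 * unit_ball_vol 2)"
  have q: "q \<ge> 0" using C by (simp add: q_def)
  let ?h = "\<lambda>\<tau> d'. snd c2 (f (\<Psi> (d', \<tau>)))" and ?vol = "volume M2 g2"
  let ?tube = "\<lambda>B l u. f ` \<Psi> ` (B \<times> {l<..<u})"
  have cont: "isCont (?h \<tau>) d" if \<tau>: "\<tau> \<in> {a<..<b}" for \<tau>
  proof -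
    have "continuous_on B0 (\<lambda>d'. \<Psi> (d', \<tau>))"
      by (rule continuous_on_compose2[OF T.cont_Psi]) (use box in \<open>auto intro!: continuous_intros\<close>)
    then have "continuous_on B0 (\<lambda>d'. f (\<Psi> (d', \<tau>)))"
      by (rule continuous_on_compose2[OF f_homeo(1)]) simp
    then have "continuous_on B0 (?h \<tau>)"
      by (rule continuous_on_compose2[OF M2.cont_chart[OF c2]]) (use V0 \<tau> in auto)
    then show ?thesis using continuous_on_eq_continuous_at[OF B0] d by blast
  qed
  have "abs_cont_on {s..t} (\<lambda>\<tau>. ?h \<tau> d)"
  proof (rule abs_cont_of_quartic_bound)
    show "16 * q \<ge> 0" "\<Lambda> \<ge> 0" using q L by auto
    fix F :: "nat set" and l u :: "nat \<Rightarrow> real"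
    assume F: "finite F" and lu: "\<And>i. i \<in> F \<Longrightarrow> l i < u i \<and> {l i..u i} \<subseteq> {s..t} \<and> ?h (l i) d \<noteq> ?h (u i) d"
      and disj: "\<And>i j. i \<in> F \<Longrightarrow> j \<in> F \<Longrightarrow> i \<noteq> j \<Longrightarrow> {l i<..<u i} \<inter> {l j<..<u j} = {}"
    have in_ab: "a < l i" "l i < u i" "u i < b" if "i \<in> F" for i
    proof -
      have "l i < u i" "l i \<in> {s..t}" "u i \<in> {s..t}" using lu[OF that] by auto
      then show "a < l i" "l i < u i" "u i < b" using st by auto
    qed
    define \<delta> where "\<delta> i = norm (?h (u i) d - ?h (l i) d) / 2" for i
    have \<delta>: "\<delta> i > 0" if "i \<in> F" for i using not_sym[OF conjunct2[OF conjunct2[OF lu[OF that]]]] by (simp add: \<delta>_def)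
    have "\<forall>\<^sub>F d' in nhds d. \<delta> i \<le> norm (?h (u i) d' - ?h (l i) d')" if i: "i \<in> F" for i
    proof -
      have "isCont (\<lambda>d'. ?h (u i) d' - ?h (l i) d') d"
        by (intro continuous_diff cont) (use in_ab[OF i] in auto)
      from isCont_eventually_dist[OF this \<delta>[OF i]] show ?thesis
      proof eventually_elim
        case (elim d')
        have "norm (?h (u i) d - ?h (l i) d) \<le> norm (?h (u i) d' - ?h (l i) d') + dist (?h (u i) d' - ?h (l i) d') (?h (u i) d - ?h (l i) d)"
          unfolding dist_norm by (metis norm_minus_commute norm_triangle_sub)
        then show ?case using elim unfolding \<delta>_def by linarith
      qed
    qed
    then have "\<forall>\<^sub>F d' in nhds d. \<forall>i\<in>F. \<delta> i \<le> norm (?h (u i) d' - ?h (l i) d')"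
      using F by (simp add: eventually_ball_finite)
    moreover have "\<forall>\<^sub>F d' in nhds d. d' \<in> B0" by (rule eventually_nhds_in_open[OF B0 d])
    ultimately have "\<forall>\<^sub>F d' in nhds d. d' \<in> B0 \<and> (\<forall>i\<in>F. \<delta> i \<le> norm (?h (u i) d' - ?h (l i) d'))"
      by eventually_elim blast
    then obtain e where e: "e > 0" "\<And>d'. dist d' d < e \<Longrightarrow> d' \<in> B0 \<and> (\<forall>i\<in>F. \<delta> i \<le> norm (?h (u i) d' - ?h (l i) d'))"
      unfolding eventually_nhds_metric by blast
    define r where "r = min e 1"
    have r: "r > 0" "r \<le> 1" "ball d r \<subseteq> B0"
      and sep: "\<And>i d'. i \<in> F \<Longrightarrow> d' \<in> ball d r \<Longrightarrow> \<delta> i \<le> norm (?h (u i) d' - ?h (l i) d')"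
      using e by (auto simp: r_def dist_commute)
    define w where "w i = measure ?vol (?tube (ball d r) (l i) (u i)) / r\<^sup>2" for i
    have est: "\<delta> i ^ 4 \<le> q * (u i - l i) ^ 3 * w i" if i: "i \<in> F" for i
      unfolding q_def w_def
      by (rule box_estimate[OF T c1 c2 box C hC jc V0 cmp fin B0 r(3,1) in_ab[OF i] \<delta>[OF i] sep[OF i]])
    have ot: "open (?tube (ball d r) l' u')" if "a \<le> l'" "u' \<le> b" for l' u'
      by (rule f_homeo(3)[OF T.open_image[OF box(1)]]) (use that r box in \<open>auto intro: open_Times\<close>)
    have fm: "?tube (ball d r) l' u' \<in> fmeasurable ?vol" if "a \<le> l'" "u' \<le> b" for l' u'
    proof (rule fmeasurableI)
      show "?tube (ball d r) l' u' \<in> sets ?vol" using ot[OF that] by simp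
      have "open (f ` \<Psi> ` (B0 \<times> {a<..<b}))"
        by (rule f_homeo(3)[OF T.open_image[OF box(1)]]) (use B0 box in \<open>auto intro: open_Times\<close>)
      then have "emeasure ?vol (?tube (ball d r) l' u') \<le> emeasure ?vol (f ` \<Psi> ` (B0 \<times> {a<..<b}))"
        by (intro emeasure_mono image_mono) (use that r in auto)
      then show "emeasure ?vol (?tube (ball d r) l' u') < \<infinity>" using fin by (rule le_less_trans)
    qed
    have dfam: "disjoint_family_on (\<lambda>i. ?tube (ball d r) (l i) (u i)) F"
    unfolding disjoint_family_on_def
    proof (intro ballI impI, rule ccontr)
      fix i j assume ij: "i \<in> F" "j \<in> F" "i \<noteq> j" "?tube (ball d r) (l i) (u i) \<inter> ?tube (ball d r) (l j) (u j) \<noteq> {}"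
      then obtain z z' where z: "z \<in> ball d r \<times> {l i<..<u i}" "z' \<in> ball d r \<times> {l j<..<u j}" "f (\<Psi> z) = f (\<Psi> z')" by blast
      have "\<Psi> z = \<Psi> z'" using z(3) f_homeo(2) by (simp add: inj_eq)
      moreover have "z \<in> D \<times> {a<..<b}" "z' \<in> D \<times> {a<..<b}"
        using z(1,2) r(3) box(2) in_ab[OF ij(1)] in_ab[OF ij(2)] by auto
      ultimately have "z = z'" using inj_onD[OF T.inj_slab[OF box(1)]] by blast
      then have "snd z \<in> {l i<..<u i} \<inter> {l j<..<u j}" using z by auto
      then show False using disj[OF ij(1-3)] by blast
    qed
    have "sum w F = measure ?vol (\<Union>i\<in>F. ?tube (ball d r) (l i) (u i)) / r\<^sup>2"
    proof -
      have "measure ?vol (\<Union>i\<in>F. ?tube (ball d r) (l i) (u i)) = (\<Sum>i\<in>F. measure ?vol (?tube (ball d r) (l i) (u i)))"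
      proof (rule measure_finite_Union[OF F _ dfam])
        have fmi: "?tube (ball d r) (l i) (u i) \<in> fmeasurable ?vol" if "i \<in> F" for i
          by (rule fm) (use in_ab[OF that] in auto)
        then show "(\<lambda>i. ?tube (ball d r) (l i) (u i)) ` F \<subseteq> sets ?vol" using fmeasurableD by blast
        show "emeasure ?vol (?tube (ball d r) (l i) (u i)) \<noteq> \<infinity>" if "i \<in> F" for i
          using fmeasurableD2[OF fmi[OF that]] by simp
      qed
      then show ?thesis unfolding w_def by (simp only: sum_divide_distrib)
    qed
    also have "\<dots> \<le> measure ?vol (?tube (ball d r) a b) / r\<^sup>2"
    proof (rule divide_right_mono[OF measure_mono_fmeasurable])
      have sub: "{l i<..<u i} \<subseteq> {a<..<b}" if "i \<in> F" for i using in_ab[OF that] by auto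
      show "(\<Union>i\<in>F. ?tube (ball d r) (l i) (u i)) \<subseteq> ?tube (ball d r) a b"
        by (intro UN_least image_mono Sigma_mono subset_refl sub)
      show "(\<Union>i\<in>F. ?tube (ball d r) (l i) (u i)) \<in> sets ?vol"
      proof (rule sets.finite_UN[OF F])
        fix i assume i: "i \<in> F"
        show "?tube (ball d r) (l i) (u i) \<in> sets ?vol"
          by (rule fmeasurableD[OF fm]) (use in_ab[OF i] in auto)
      qed
      show "?tube (ball d r) a b \<in> fmeasurable ?vol" by (rule fm) auto
    qed simp
    also have "\<dots> \<le> \<Lambda>" using dens[OF r] r by (simp add: pos_divide_le_eq)
    finally have sumw: "sum w F \<le> \<Lambda>" .
    have "0 \<le> w i \<and> dist (?h (l i) d) (?h (u i) d) ^ 4 \<le> 16 * q * (u i - l i) ^ 3 * w i" if i: "i \<in> F" for i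
    proof -
      have "dist (?h (l i) d) (?h (u i) d) = 2 * \<delta> i" by (simp add: \<delta>_def dist_norm norm_minus_commute)
      then have "dist (?h (l i) d) (?h (u i) d) ^ 4 = 16 * \<delta> i ^ 4" by (simp add: power_mult_distrib)
      then show ?thesis using est[OF i] by (simp add: w_def)
    qed
    then show "\<exists>w. (\<forall>i\<in>F. 0 \<le> w i \<and> dist (?h (l i) d) (?h (u i) d) ^ 4 \<le> 16 * q * (u i - l i) ^ 3 * w i) \<and> sum w F \<le> \<Lambda>"
      using sumw by (intro exI[of _ w]) blast
  qed
  then show ?thesis .
qed

text \<open>
  All constants in the estimate are bounded near a point by continuity.  The estimate is used on an
  open interval of twice the length, which contains the closed one.
\<close>

lemma box_exists:
  assumes T: "cr_trivialisation M1 g1 D \<Psi> P" and d0: "d0 \<in> D"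
  shows "\<exists>\<rho> E c2. \<rho> > 0 \<and> \<rho> \<le> 1/4 \<and> ball d0 \<rho> \<subseteq> D \<and> c2 \<in> charts M2 \<and> negligible E \<and>
    f ` \<Psi> ` (ball d0 \<rho> \<times> {\<tau>0 - \<rho>..\<tau>0 + \<rho>}) \<subseteq> fst c2 \<and>
    (\<forall>d \<in> ball d0 \<rho> - E. abs_cont_on {\<tau>0 - \<rho>..\<tau>0 + \<rho>} (\<lambda>\<tau>. snd c2 (f (\<Psi> (d, \<tau>)))))"
proof -
  interpret T: cr_trivialisation M1 g1 D \<Psi> P by (rule T)
  let ?z0 = "(d0, \<tau>0)"
  have z0: "?z0 \<in> D \<times> UNIV" using d0 by simp
  obtain c1 where c1: "c1 \<in> charts_at M1 (\<Psi> ?z0)" using M1.chart_at_exists by blast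
  obtain c2 where c2: "c2 \<in> charts_at M2 (f (\<Psi> ?z0))" using M2.chart_at_exists by blast
  have c12: "c1 \<in> charts M1" "c2 \<in> charts M2" using c1 c2 by (auto simp: charts_at_def)
  obtain W1 K1 where W1: "open W1" "\<Psi> ?z0 \<in> W1" "W1 \<subseteq> fst c1" "K1 > 0"
    "\<And>q v. q \<in> W1 \<Longrightarrow> v \<in> hplane M1 q \<Longrightarrow> hnorm g1 q v \<le> K1 * norm (v c1) \<and> norm (v c1) \<le> K1 * hnorm g1 q v"
    using M1.metric_compare[OF c1] by blast
  obtain W2 K2 where W2: "open W2" "f (\<Psi> ?z0) \<in> W2" "W2 \<subseteq> fst c2" "K2 > 0"
    "\<And>q v. q \<in> W2 \<Longrightarrow> v \<in> hplane M2 q \<Longrightarrow> hnorm g2 q v \<le> K2 * norm (v c2) \<and> norm (v c2) \<le> K2 * hnorm g2 q v"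
    using M2.metric_compare[OF c2] by blast
  obtain W3 where W3: "open W3" "f (\<Psi> ?z0) \<in> W3" "W3 \<subseteq> fst c2" "emeasure (volume M2 g2) W3 < \<infinity>"
    by (rule M2.finite_volume_nbhd[OF c2]) (rule that)
  let ?S = "(D \<times> UNIV) \<inter> \<Psi> -` fst c1"
  let ?w = "\<lambda>z. frechet_derivative (snd c1 \<circ> \<Psi>) (at z) (0, 1)"
  have S: "open ?S" by (rule continuous_open_preimage[OF T.cont_Psi T.open_cyl M1.open_dom[OF c12(1)]])
  have wc: "continuous_on ?S (\<lambda>z. norm (?w z))"
    by (intro continuous_on_norm smooth_on_continuous_on[OF smooth_on_frechet_derivative[OF M1.smooth_map_coord[OF T.smooth c12(1)]]])
  define N1 where "N1 = ?S \<inter> (\<lambda>z. norm (?w z)) -` {..< norm (?w ?z0) + 1}"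
  define N2 where "N2 = ?S \<inter> T.jac c1 -` {T.jac c1 ?z0 / 2 <..}"
  define N3 where "N3 = (D \<times> UNIV) \<inter> \<Psi> -` (W1 \<inter> f -` (W2 \<inter> W3))"
  have "open (f -` (W2 \<inter> W3))" by (intro open_vimage open_Int W2 W3 f_homeo)
  then have "open N3"
    unfolding N3_def by (intro continuous_open_preimage[OF T.cont_Psi T.open_cyl] open_Int W1(1))
  moreover have "open N1" unfolding N1_def by (rule continuous_open_preimage[OF wc S open_lessThan])
  moreover have "open N2" unfolding N2_def by (rule continuous_open_preimage[OF T.jac_cont[OF c12(1)] S open_greaterThan])
  ultimately have N: "open (N1 \<inter> N2 \<inter> N3)" by (intro open_Int)
  have jp: "T.jac c1 ?z0 > 0" by (rule T.jac_pos[OF z0 c1])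
  have "?z0 \<in> ?S" using z0 c1 by (simp add: charts_at_def)
  then have "?z0 \<in> N1 \<inter> N2 \<inter> N3" using jp z0 W1(2) W2(2) W3(2) by (simp add: N1_def N2_def N3_def)
  then obtain A B where AB: "open A" "open B" "?z0 \<in> A \<times> B" "A \<times> B \<subseteq> N1 \<inter> N2 \<inter> N3"
    using open_prod_elim[OF N] by metis
  obtain e1 where e1: "e1 > 0" "ball d0 e1 \<subseteq> A" using AB(1,3) open_contains_ball by blast
  obtain e2 where e2: "e2 > 0" "ball \<tau>0 e2 \<subseteq> B" using AB(2,3) open_contains_ball by blast
  define \<rho> where "\<rho> = min e1 (min (e2 / 2) (1/4))"
  have \<rho>: "\<rho> > 0" "\<rho> \<le> 1/4" "\<rho> \<le> e1" "2 * \<rho> \<le> e2" using e1 e2 by (auto simp: \<rho>_def)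
  define a where "a = \<tau>0 - 2 * \<rho>"
  define b where "b = \<tau>0 + 2 * \<rho>"
  have ab: "b - a \<le> 1" "a < \<tau>0 - \<rho>" "\<tau>0 + \<rho> < b" using \<rho> by (auto simp: a_def b_def)
  let ?B0 = "ball d0 \<rho>"
  have "?B0 \<subseteq> A" using e1(2) subset_ball[OF \<rho>(3)] by blast
  moreover have "{a<..<b} \<subseteq> B"
    using e2(2) \<rho>(4) by (auto simp: a_def b_def dist_real_def subset_iff abs_real_def)
  ultimately have sub: "?B0 \<times> {a<..<b} \<subseteq> N1 \<inter> N2 \<inter> N3" using AB(4) by blast
  have B0: "?B0 \<subseteq> D"
  proof
    fix d assume "d \<in> ?B0"
    then have "(d, \<tau>0) \<in> ?B0 \<times> {a<..<b}" using ab \<rho> by simp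
    then have "(d, \<tau>0) \<in> N3" using sub by blast
    then show "d \<in> D" by (simp add: N3_def)
  qed
  have slab: "?B0 \<times> {a<..<b} \<subseteq> T.slab c1 a b"
  proof
    fix z assume z: "z \<in> ?B0 \<times> {a<..<b}"
    then have "z \<in> N1" using sub by blast
    then show "z \<in> T.slab c1 a b" using z by (auto simp: N1_def T.slab_def)
  qed
  define C1 where "C1 = K1 * (norm (?w ?z0) + 1)"
  define c0 where "c0 = T.jac c1 ?z0 / 2"
  have "norm (?w ?z0) + 1 > 0" using norm_ge_zero[of "?w ?z0"] by linarith
  then have C: "C1 > 0" "c0 > 0" "K2 > 0" using W1(4) W2(4) jp by (auto simp: C1_def c0_def)
  have hC: "hnorm g1 (\<Psi> z) (T.vert z) \<le> C1" if z: "z \<in> ?B0 \<times> {a<..<b}" for z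
  proof -
    have z1: "z \<in> N1" and z3: "z \<in> N3" using z sub by auto
    have zD: "z \<in> D \<times> UNIV" "\<Psi> z \<in> W1" using z3 by (auto simp: N3_def)
    have "hnorm g1 (\<Psi> z) (T.vert z) \<le> K1 * norm (T.vert z c1)" using W1(5)[OF zD(2) T.leg[OF zD(1)]] by blast
    also have "T.vert z c1 = ?w z" by (rule T.vert_coord) (use zD W1(3) c12 in \<open>auto simp: charts_at_def\<close>)
    also have "K1 * norm (?w z) \<le> C1"
      unfolding C1_def using z1 W1(4) by (intro mult_left_mono) (auto simp: N1_def)
    finally show ?thesis .
  qed
  have jc: "c0 \<le> T.jac c1 z" if z: "z \<in> ?B0 \<times> {a<..<b}" for z
  proof -
    have "z \<in> N2" using z sub by blast
    then show ?thesis by (simp add: N2_def c0_def)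
  qed
  have fW: "f ` \<Psi> ` (?B0 \<times> {a<..<b}) \<subseteq> W2 \<inter> W3"
  proof
    fix y assume "y \<in> f ` \<Psi> ` (?B0 \<times> {a<..<b})"
    then obtain z where z: "z \<in> ?B0 \<times> {a<..<b}" "y = f (\<Psi> z)" by blast
    then have "z \<in> N3" using sub by blast
    then show "y \<in> W2 \<inter> W3" using z(2) by (simp add: N3_def)
  qed
  then have V0: "f ` \<Psi> ` (?B0 \<times> {a<..<b}) \<subseteq> fst c2" using W2(3) by blast
  have cmp: "norm (v c2) \<le> K2 * hnorm g2 p v" if "p \<in> f ` \<Psi> ` (?B0 \<times> {a<..<b})" "v \<in> hplane M2 p" for p v
    using W2(5)[OF _ that(2)] that(1) fW by blast
  have fin: "emeasure (volume M2 g2) (f ` \<Psi> ` (?B0 \<times> {a<..<b})) < \<infinity>"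
  proof (rule le_less_trans[OF emeasure_mono W3(4)])
    show "f ` \<Psi> ` (?B0 \<times> {a<..<b}) \<subseteq> W3" using fW by blast
    show "W3 \<in> sets (volume M2 g2)" using W3(1) by simp
  qed
  obtain E where E: "negligible E" "\<And>d. d \<notin> E \<Longrightarrow> \<exists>\<Lambda>>0. \<forall>r. 0 < r \<longrightarrow> r \<le> 1 \<longrightarrow> ball d r \<subseteq> ?B0 \<longrightarrow>
     measure (volume M2 g2) (f ` \<Psi> ` (ball d r \<times> {a<..<b})) \<le> \<Lambda> * r\<^sup>2"
    using tube_volume_density[OF T ab(1) open_ball B0 fin] by blast
  have ac: "abs_cont_on {\<tau>0 - \<rho>..\<tau>0 + \<rho>} (\<lambda>\<tau>. snd c2 (f (\<Psi> (d, \<tau>))))" if d: "d \<in> ?B0 - E" for d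
  proof -
    have dB: "d \<in> ?B0" and dE: "d \<notin> E" using d by auto
    obtain \<Lambda> where L: "\<Lambda> > 0" "\<And>r. 0 < r \<Longrightarrow> r \<le> 1 \<Longrightarrow> ball d r \<subseteq> ?B0 \<Longrightarrow>
        measure (volume M2 g2) (f ` \<Psi> ` (ball d r \<times> {a<..<b})) \<le> \<Lambda> * r\<^sup>2"
      using E(2)[OF dE] by blast
    show ?thesis
      by (rule fibre_abs_cont[OF T c12 ab(1) B0 slab C hC jc V0 cmp fin open_ball dB ab(2,3) L])
  qed
  have "{\<tau>0 - \<rho>..\<tau>0 + \<rho>} \<subseteq> {a<..<b}" using ab by auto
  then have "f ` \<Psi> ` (?B0 \<times> {\<tau>0 - \<rho>..\<tau>0 + \<rho>}) \<subseteq> f ` \<Psi> ` (?B0 \<times> {a<..<b})"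
    by (intro image_mono Sigma_mono subset_refl)
  with V0 have "f ` \<Psi> ` (?B0 \<times> {\<tau>0 - \<rho>..\<tau>0 + \<rho>}) \<subseteq> fst c2" by blast
  then show ?thesis using \<rho>(1,2) B0 c12(2) E(1) ac
    by (intro exI[of _ \<rho>] exI[of _ E] exI[of _ c2]) blast
qed

end

section \<open>Absolute continuity on almost every fibre\<close>

context acl_setting
begin

text \<open>
  The curves of a contact fibration parametrise the fibres and are Legendrian; so the vertical curves,
  which are reparametrisations of them, are Legendrian.
\<close>

lemma adapted_trivialisation:
  assumes cf: "contact_fibration M1 U \<Gamma>" and p: "p \<in> U"
  shows "\<exists>D \<Psi> P d0 \<tau>0. cr_trivialisation M1 g1 D \<Psi> P \<and> (\<forall>d\<in>D. \<Psi> ` ({d} \<times> UNIV) \<in> curve_trace ` \<Gamma>) \<and>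
    d0 \<in> D \<and> \<Psi> (d0, \<tau>0) = p"
proof -
  have sf: "smooth_fibration M1 U (curve_trace ` \<Gamma>)" using cf unfolding contact_fibration_def by blast
  have reg: "regular_legendrian M1 (I, \<gamma>)" if "(I, \<gamma>) \<in> \<Gamma>" for I \<gamma>
    using cf that unfolding contact_fibration_def by blast
  have "\<Union>(curve_trace ` \<Gamma>) = U" using sf unfolding smooth_fibration_def by blast
  then obtain L where L: "L \<in> curve_trace ` \<Gamma>" "p \<in> L" using p by blast
  have "\<exists>(D :: (real^2) set) (\<Psi> :: (real^2) \<times> real \<Rightarrow> 'a) (P :: real set).
        open D \<and> (P = {0} \<or> P = \<int>) \<and>
        smooth_map M1 (D \<times> UNIV) \<Psi> \<and>
        (\<forall>z\<in>D \<times> UNIV. \<forall>c\<in>charts_at M1 (\<Psi> z). bij (frechet_derivative (snd c \<circ> \<Psi>) (at z))) \<and>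
        (\<forall>z\<in>D \<times> UNIV. \<forall>z'\<in>D \<times> UNIV.
           \<Psi> z = \<Psi> z' \<longleftrightarrow> fst z = fst z' \<and> snd z - snd z' \<in> P) \<and>
        (\<forall>d\<in>D. \<Psi> ` ({d} \<times> UNIV) \<in> curve_trace ` \<Gamma>) \<and>
        (\<exists>d\<in>D. \<Psi> ` ({d} \<times> UNIV) = L)"
    using sf L(1) unfolding smooth_fibration_def by (elim conjE) (erule bspec)
  then obtain D :: "(real^2) set" and \<Psi> :: "(real^2) \<times> real \<Rightarrow> 'a" and P :: "real set" where
    T: "open D" "P = {0} \<or> P = \<int>" "smooth_map M1 (D \<times> UNIV) \<Psi>"
      "\<forall>z\<in>D \<times> UNIV. \<forall>c\<in>charts_at M1 (\<Psi> z). bij (frechet_derivative (snd c \<circ> \<Psi>) (at z))"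
      "\<forall>z\<in>D \<times> UNIV. \<forall>z'\<in>D \<times> UNIV. \<Psi> z = \<Psi> z' \<longleftrightarrow> fst z = fst z' \<and> snd z - snd z' \<in> P"
      and fibres: "\<forall>d\<in>D. \<Psi> ` ({d} \<times> UNIV) \<in> curve_trace ` \<Gamma>" and Ld: "\<exists>d\<in>D. \<Psi> ` ({d} \<times> UNIV) = L"
    by (elim exE conjE) (rule that)
  interpret T: trivialisation M1 D \<Psi> P
  proof
    show "open D" by (rule T(1))
    show "P = {0} \<or> P = \<int>" by (rule T(2))
    show "smooth_map M1 (D \<times> UNIV) \<Psi>" by (rule T(3))
    show "bij (frechet_derivative (snd c \<circ> \<Psi>) (at z))" if "z \<in> D \<times> UNIV" "c \<in> charts_at M1 (\<Psi> z)" for z c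
      using T(4) that by blast
    show "\<Psi> z = \<Psi> z' \<longleftrightarrow> fst z = fst z' \<and> snd z - snd z' \<in> P" if "z \<in> D \<times> UNIV" "z' \<in> D \<times> UNIV" for z z'
      using T(5)[rule_format, OF that] .
  qed
  have leg: "T.vert z \<in> hplane M1 (\<Psi> z)" if z: "z \<in> D \<times> UNIV" for z
  proof -
    obtain d \<tau> where zz: "z = (d, \<tau>)" by (cases z) blast
    have d: "d \<in> D" using z zz by simp
    obtain \<gamma>' where g': "\<gamma>' \<in> \<Gamma>" "\<Psi> ` ({d} \<times> UNIV) = curve_trace \<gamma>'" using fibres d by blast
    obtain I \<gamma> where Ig: "\<gamma>' = (I, \<gamma>)" by (cases \<gamma>') blast
    have g: "(I, \<gamma>) \<in> \<Gamma>" "\<gamma> ` I = \<Psi> ` ({d} \<times> UNIV)" using g' Ig by (auto simp: curve_trace_def)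
    have "\<Psi> (d, \<tau>) \<in> \<gamma> ` I" unfolding g(2) by blast
    then obtain t0 where t0: "t0 \<in> I" "\<Psi> (d, \<tau>) = \<gamma> t0" by blast
    obtain r l L' k where k: "k \<noteq> 0" "velocity M1 (I, \<gamma>) t0 = lin_comb k (T.vert (d, \<tau>)) 0 (T.vert (d, \<tau>))"
      by (rule T.fibre_lift[OF reg[OF g(1)] equalityD1[OF g(2)] d t0 zero_less_one]) blast
    let ?v = "velocity M1 (I, \<gamma>) t0"
    have "\<forall>t\<in>I. velocity M1 (I, \<gamma>) t \<in> hplane M1 (\<gamma> t)"
      using reg[OF g(1)] unfolding regular_legendrian_def prod.case by blast
    then have "?v \<in> hplane M1 (\<Psi> z)" using t0 zz by simp
    then have "lin_comb (1 / k) ?v 0 ?v \<in> hplane M1 (\<Psi> z)" by (intro M1.hplane_lin_comb)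
    moreover have "lin_comb (1 / k) ?v 0 ?v = T.vert z"
      unfolding k(2) zz by (rule ext) (simp add: lin_comb_def k(1))
    ultimately show ?thesis by simp
  qed
  have CT: "cr_trivialisation M1 g1 D \<Psi> P"
    by (intro cr_trivialisation.intro M1.cr_metric_axioms legendrian_trivialisation.intro T.trivialisation_axioms
        legendrian_trivialisation_axioms.intro leg)
  from Ld obtain d0 where d0: "d0 \<in> D" "\<Psi> ` ({d0} \<times> UNIV) = L" by blast
  then obtain \<tau>0 where "\<Psi> (d0, \<tau>0) = p" using L(2) by blast
  then show ?thesis using CT fibres d0(1)
    by (intro exI[of _ D] exI[of _ \<Psi>] exI[of _ P] exI[of _ d0] exI[of _ \<tau>0] conjI)
qed

text \<open>
  The condition at one parameter in the absolute continuity of the image curve.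
\<close>

definition abs_cont_at :: "'a curve \<Rightarrow> real \<Rightarrow> bool" where
  "abs_cont_at = (\<lambda>(I, \<gamma>) t. \<exists>c\<in>charts M2. \<exists>r>0.
     (f \<circ> \<gamma>) ` (I \<inter> {t-r..t+r}) \<subseteq> fst c \<and> abs_cont_on (I \<inter> {t-r..t+r}) (snd c \<circ> (f \<circ> \<gamma>)))"

text \<open>
  Near a point the exceptional fibres are those over the null set of a flow box.  The fibres outside
  of it are parametrised by monotone Lipschitz changes of the vertical parameter.
\<close>

lemma local_ACL:
  assumes cf: "contact_fibration M1 U \<Gamma>" and p: "p \<in> U"
  shows "\<exists>W N. open W \<and> p \<in> W \<and> null_subfamily M1 U \<Gamma> N \<and>
    (\<forall>(I, \<gamma>)\<in>\<Gamma> - N. \<forall>t\<in>I. \<gamma> t \<in> W \<longrightarrow> abs_cont_at (I, \<gamma>) t)"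
proof -
  have reg: "regular_legendrian M1 (I, \<gamma>)" if "(I, \<gamma>) \<in> \<Gamma>" for I \<gamma>
    using cf that unfolding contact_fibration_def by blast
  have dis: "disjoint (curve_trace ` \<Gamma>)" using cf unfolding contact_fibration_def smooth_fibration_def by blast
  obtain D \<Psi> P d0 \<tau>0 where T: "cr_trivialisation M1 g1 D \<Psi> P"
    and fibres: "\<forall>d\<in>D. \<Psi> ` ({d} \<times> UNIV) \<in> curve_trace ` \<Gamma>" and d0: "d0 \<in> D" "\<Psi> (d0, \<tau>0) = p"
    using adapted_trivialisation[OF cf p] by (elim exE conjE) (rule that)
  interpret T: cr_trivialisation M1 g1 D \<Psi> P by (rule T)
  obtain \<rho> E c2 where \<rho>: "\<rho> > 0" "\<rho> \<le> 1/4" "ball d0 \<rho> \<subseteq> D" and c2: "c2 \<in> charts M2" and E: "negligible E"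
    and dom: "f ` \<Psi> ` (ball d0 \<rho> \<times> {\<tau>0 - \<rho>..\<tau>0 + \<rho>}) \<subseteq> fst c2"
    and ac: "\<forall>d \<in> ball d0 \<rho> - E. abs_cont_on {\<tau>0 - \<rho>..\<tau>0 + \<rho>} (\<lambda>\<tau>. snd c2 (f (\<Psi> (d, \<tau>))))"
    using box_exists[OF T d0(1), of \<tau>0] by (elim exE conjE) (rule that)
  let ?fib = "\<lambda>d. \<Psi> ` ({d} \<times> UNIV)"
  define W where "W = \<Psi> ` (ball d0 \<rho> \<times> {\<tau>0 - \<rho><..<\<tau>0 + \<rho>})"
  define N where "N = {\<gamma> \<in> \<Gamma>. curve_trace \<gamma> \<in> ?fib ` (E \<inter> D)}"
  have "open W" unfolding W_def
    by (rule T.open_image[of "\<tau>0 + \<rho>" "\<tau>0 - \<rho>"]) (use \<rho> in \<open>auto intro: open_Times\<close>)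
  moreover have "p \<in> W" unfolding W_def by (rule image_eqI[of _ _ "(d0, \<tau>0)"]) (use d0 \<rho> in auto)
  moreover have "null_subfamily M1 U \<Gamma> N"
    unfolding null_subfamily_def
  proof (intro conjI allI impI)
    show "N \<subseteq> \<Gamma>" by (auto simp: N_def)
    fix D' s assume patch: "transversal_patch M1 U \<Gamma> D' s"
    have "negligible {x \<in> D'. s x \<in> \<Psi> ` ((E \<inter> D) \<times> UNIV)}"
    proof (rule T.null_on_patch[OF _ patch E])
      fix d assume "d \<in> D"
      then obtain \<gamma>' where g': "\<gamma>' \<in> \<Gamma>" "?fib d = curve_trace \<gamma>'" using fibres by blast
      obtain I \<gamma> where Ig: "\<gamma>' = (I, \<gamma>)" by (cases \<gamma>') blast
      have "(I, \<gamma>) \<in> \<Gamma>" "\<gamma> ` I = ?fib d" using g' Ig by (auto simp: curve_trace_def)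
      moreover from this(1) have "regular_legendrian M1 (I, \<gamma>)" by (rule reg)
      ultimately show "\<exists>I \<gamma>. (I, \<gamma>) \<in> \<Gamma> \<and> regular_legendrian M1 (I, \<gamma>) \<and> \<gamma> ` I = ?fib d"
        by blast
    qed
    moreover have "\<Union>(curve_trace ` N) \<subseteq> \<Psi> ` ((E \<inter> D) \<times> UNIV)"
    proof (rule Union_least)
      fix L assume "L \<in> curve_trace ` N"
      then obtain d where "d \<in> E \<inter> D" "L = ?fib d" unfolding N_def by blast
      then show "L \<subseteq> \<Psi> ` ((E \<inter> D) \<times> UNIV)" by blast
    qed
    ultimately show "negligible {x \<in> D'. s x \<in> \<Union>(curve_trace ` N)}"
      by (elim negligible_subset) blast
  qed
  moreover have "abs_cont_at (I, \<gamma>) t" if g: "(I, \<gamma>) \<in> \<Gamma>" "(I, \<gamma>) \<notin> N" and t: "t \<in> I" "\<gamma> t \<in> W" for I \<gamma> t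
  proof -
    obtain d \<tau> where d: "d \<in> ball d0 \<rho>" "\<tau> \<in> {\<tau>0 - \<rho><..<\<tau>0 + \<rho>}" "\<Psi> (d, \<tau>) = \<gamma> t"
      using t(2) unfolding W_def by auto
    have dD: "d \<in> D" using d \<rho> by blast
    have tr: "curve_trace (I, \<gamma>) = ?fib d"
    proof (rule ccontr)
      assume "curve_trace (I, \<gamma>) \<noteq> ?fib d"
      then have "curve_trace (I, \<gamma>) \<inter> ?fib d = {}"
        using disjointD[OF dis imageI[OF g(1)] bspec[OF fibres dD]] by blast
      moreover have "\<gamma> t \<in> curve_trace (I, \<gamma>)" using t(1) by (simp add: curve_trace_def)
      moreover have "\<gamma> t \<in> ?fib d" unfolding d(3)[symmetric] by blast
      ultimately show False by blast
    qed
    have dE: "d \<notin> E"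
    proof
      assume "d \<in> E"
      then have "curve_trace (I, \<gamma>) \<in> ?fib ` (E \<inter> D)" unfolding tr using dD by blast
      then show False using g unfolding N_def by blast
    qed
    have tr': "\<gamma> ` I \<subseteq> ?fib d" using tr by (simp add: curve_trace_def)
    have eps: "\<rho> - \<bar>\<tau> - \<tau>0\<bar> > 0" using d(2) by (auto simp: abs_less_iff)
    obtain r l L k where r: "r > 0" "L > (0::real)"
      "\<And>s. s \<in> I \<inter> {t-r..t+r} \<Longrightarrow> \<gamma> s = \<Psi> (d, l s) \<and> \<bar>l s - \<tau>\<bar> < \<rho> - \<bar>\<tau> - \<tau>0\<bar>"
      "mono_on (I \<inter> {t-r..t+r}) l \<or> antimono_on (I \<inter> {t-r..t+r}) l"
      "\<And>x y. x \<in> I \<inter> {t-r..t+r} \<Longrightarrow> y \<in> I \<inter> {t-r..t+r} \<Longrightarrow> \<bar>l x - l y\<bar> \<le> L * \<bar>x - y\<bar>"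
      by (rule T.fibre_lift[OF reg[OF g(1)] tr' dD t(1) d(3) eps]) blast
    let ?S = "I \<inter> {t-r..t+r}"
    have lS: "l s \<in> {\<tau>0 - \<rho>..\<tau>0 + \<rho>}" if "s \<in> ?S" for s
    proof -
      have "\<bar>l s - \<tau>\<bar> < \<rho> - \<bar>\<tau> - \<tau>0\<bar>" using r(3)[OF that] by blast
      moreover have "\<bar>l s - \<tau>0\<bar> \<le> \<bar>l s - \<tau>\<bar> + \<bar>\<tau> - \<tau>0\<bar>" by linarith
      ultimately have "\<bar>l s - \<tau>0\<bar> < \<rho>" by linarith
      then show ?thesis by (simp add: abs_less_iff)
    qed
    have acd: "abs_cont_on {\<tau>0 - \<rho>..\<tau>0 + \<rho>} (\<lambda>\<tau>. snd c2 (f (\<Psi> (d, \<tau>))))"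
      using ac d(1) dE by blast
    have "abs_cont_on ?S ((\<lambda>\<tau>. snd c2 (f (\<Psi> (d, \<tau>)))) \<circ> l)"
      by (rule abs_cont_on_mono_comp[OF acd _ _ r(2) r(5) r(4)]) (use lS in \<open>auto simp: is_interval_cc\<close>)
    then have "abs_cont_on ?S (snd c2 \<circ> (f \<circ> \<gamma>))"
      by (rule abs_cont_on_lipschitz_comp[OF _ zero_less_one]) (use r(3) in simp)
    moreover have "(f \<circ> \<gamma>) ` ?S \<subseteq> fst c2"
    proof (rule image_subsetI)
      fix s assume s: "s \<in> ?S"
      have "f (\<Psi> (d, l s)) \<in> fst c2" using dom lS[OF s] d(1) by blast
      then show "(f \<circ> \<gamma>) s \<in> fst c2" using r(3)[OF s] by simp
    qed
    ultimately show ?thesis unfolding abs_cont_at_def prod.case using c2 r(1) by blast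
  qed
  ultimately show ?thesis by (intro exI[of _ W] exI[of _ N]) blast
qed

text \<open>
  Absolute continuity is local on a curve, countably many boxes cover \<open>U\<close> by Lindelof's theorem, and
  countable unions of null families are null families.
\<close>

lemma image_ACL: "ACL M1 M2 f"
  unfolding ACL_def
proof (intro allI impI)
  fix U \<Gamma> assume cf: "contact_fibration M1 U \<Gamma>"
  have U: "\<Union>(curve_trace ` \<Gamma>) = U" using cf unfolding contact_fibration_def smooth_fibration_def by blast
  define good where "good W N \<longleftrightarrow> null_subfamily M1 U \<Gamma> N \<and>
    (\<forall>(I, \<gamma>)\<in>\<Gamma> - N. \<forall>t\<in>I. \<gamma> t \<in> W \<longrightarrow> abs_cont_at (I, \<gamma>) t)" for W N
  define \<W> where "\<W> = {W. open W \<and> (\<exists>N. good W N)}"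
  have "open W" if "W \<in> \<W>" for W using that unfolding \<W>_def by blast
  from Lindelof[OF this] obtain \<W>' where W': "\<W>' \<subseteq> \<W>" "countable \<W>'" "\<Union>\<W>' = \<Union>\<W>"
    by metis
  have "\<forall>W\<in>\<W>'. \<exists>N. good W N" using W'(1) unfolding \<W>_def by blast
  from bchoice[OF this] obtain N where good: "\<forall>W\<in>\<W>'. good W (N W)" by (rule exE)
  have N: "null_subfamily M1 U \<Gamma> (N W)"
    "(I, \<gamma>) \<in> \<Gamma> - N W \<Longrightarrow> t \<in> I \<Longrightarrow> \<gamma> t \<in> W \<Longrightarrow> abs_cont_at (I, \<gamma>) t" if "W \<in> \<W>'" for W I \<gamma> t
    using bspec[OF good that] unfolding good_def by (blast, fast)
  let ?N = "\<Union>W\<in>\<W>'. N W"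
  have "null_subfamily M1 U \<Gamma> ?N"
    unfolding null_subfamily_def
  proof (intro conjI allI impI)
    show "?N \<subseteq> \<Gamma>" using N(1) unfolding null_subfamily_def by blast
    fix D s assume patch: "transversal_patch M1 U \<Gamma> D s"
    have "negligible (\<Union>W\<in>\<W>'. {x \<in> D. s x \<in> \<Union>(curve_trace ` N W)})"
    proof (rule negligible_countable_Union)
      show "countable ((\<lambda>W. {x \<in> D. s x \<in> \<Union>(curve_trace ` N W)}) ` \<W>')" using W'(2) by (rule countable_image)
      fix S assume "S \<in> (\<lambda>W. {x \<in> D. s x \<in> \<Union>(curve_trace ` N W)}) ` \<W>'"
      then show "negligible S" using N(1) patch unfolding null_subfamily_def by blast
    qed
    moreover have "{x \<in> D. s x \<in> \<Union>(curve_trace ` ?N)} = (\<Union>W\<in>\<W>'. {x \<in> D. s x \<in> \<Union>(curve_trace ` N W)})" by blast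
    ultimately show "negligible {x \<in> D. s x \<in> \<Union>(curve_trace ` ?N)}" by simp
  qed
  moreover have "abs_cont_curve M2 (I, f \<circ> \<gamma>)" if g: "(I, \<gamma>) \<in> \<Gamma> - ?N" for I \<gamma>
  proof -
    have "abs_cont_at (I, \<gamma>) t" if t: "t \<in> I" for t
    proof -
      have "\<gamma> t \<in> curve_trace (I, \<gamma>)" using t by (simp add: curve_trace_def)
      then have "\<gamma> t \<in> U" using g U by blast
      from local_ACL[OF cf this] obtain W N' where "open W" "\<gamma> t \<in> W" "good W N'"
        unfolding good_def[symmetric] by (elim exE conjE) (rule that)
      then have "\<gamma> t \<in> \<Union>\<W>" unfolding \<W>_def by blast
      then obtain V where V: "V \<in> \<W>'" "\<gamma> t \<in> V" using W'(3) by blast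
      moreover have "(I, \<gamma>) \<in> \<Gamma> - N V" using g V(1) by blast
      ultimately show ?thesis using N(2) t by blast
    qed
    then show ?thesis unfolding abs_cont_curve_def abs_cont_at_def prod.case by blast
  qed
  ultimately show "\<exists>N. null_subfamily M1 U \<Gamma> N \<and> (\<forall>(I, \<gamma>)\<in>\<Gamma> - N. abs_cont_curve M2 (I, f \<circ> \<gamma>))"
    by (intro exI[of _ ?N]) blast
qed

end

theorem theorem3p4:
  fixes M1 :: "'a::{t2_space,second_countable_topology} cr_struct"
    and M2 :: "'b::{t2_space,second_countable_topology} cr_struct"
    and g1 :: "'a \<Rightarrow> 'a tvec \<Rightarrow> 'a tvec \<Rightarrow> real"
    and g2 :: "'b \<Rightarrow> 'b tvec \<Rightarrow> 'b tvec \<Rightarrow> real"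
    and f :: "'a \<Rightarrow> 'b"
    and K :: real
  assumes "cr_manifold M1" and "strongly_pseudoconvex M1" and "compact (UNIV :: 'a set)"
    and "cr_manifold M2" and "strongly_pseudoconvex M2" and "compact (UNIV :: 'b set)"
    and "hermitian_metric M1 g1" and "hermitian_metric M2 g2"
    and "\<exists>h. homeomorphism UNIV UNIV f h"
    and "K \<ge> 1"
    and "\<And>U \<Gamma>. contact_fibration M1 U \<Gamma> \<Longrightarrow>
           modulus M1 g1 \<Gamma> \<le> ennreal (K\<^sup>2) * modulus M2 g2 (image_family f \<Gamma>)"
  shows "ACL M1 M2 f"
proof -
  obtain finv where h: "homeomorphism UNIV UNIV f finv" using assms(9) by blast
  interpret acl_setting M1 g1 M2 g2 f finv K
    using assms(1,4,7,8,10,11) h by unfold_locales (auto simp: cr_manifold_def)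
  show ?thesis by (rule image_ACL)
qed

end
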